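(* For each $n\ge 2$, let the edges of the complete graph $K_n$ be given a total ordering chosen uniformly at random among all $\binom{n}{2}!$ orderings, and let $X_n$ be the number of increasing Hamiltonian paths of $K_n$ with respect to this ordering. Then $\mathbb{P}(X_n>0)\to 1$ as $n\to\infty$; that is, a uniformly chosen edge-ordering of $K_n$ contains an increasing Hamiltonian path with high probability.
   Context: A Hamiltonian path in $K_n$ is a directed path visiting every vertex exactly once, i.e. a sequence $(v_1,\dots,v_n)$ listing all the vertices without repetition; so there are $n!$ Hamiltonian paths, and a path and its reversal are regarded as different. Given a total ordering of the edges, the path is increasing if the edges $v_1v_2, v_2v_3,\dots,v_{n-1}v_n$ appear in ascending order. *)

theory Defs
  imports "HOL-Probability.Probability"
begin

definition K_edges :: "nat \<Rightarrow> nat set set" where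
  "K_edges n = {e. e \<subseteq> {..<n} \<and> card e = 2}"

definition edge_orderings :: "nat \<Rightarrow> nat set rel set" where
  "edge_orderings n = {r. linear_order_on (K_edges n) r}"

definition hamiltonian_paths :: "nat \<Rightarrow> nat list set" where
  "hamiltonian_paths n = {vs. distinct vs \<and> set vs = {..<n}}"

definition path_edges :: "nat list \<Rightarrow> nat set list" where
  "path_edges vs = map (\<lambda>i. {vs ! i, vs ! Suc i}) [0..<length vs - 1]"

text \<open>Edge orderings are reflexive relations; removing the diagonal gives the strict order.\<close>

definition increasing_path :: "nat set rel \<Rightarrow> nat list \<Rightarrow> bool" where
  "increasing_path r vs \<longleftrightarrow> sorted_wrt (\<lambda>e f. (e, f) \<in> r - Id) (path_edges vs)"

definition num_increasing_paths :: "nat \<Rightarrow> nat set rel \<Rightarrow> nat" where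
  "num_increasing_paths n r = card {vs \<in> hamiltonian_paths n. increasing_path r vs}"

text \<open>The uniform distribution \<^const>\<open>pmf_of_set\<close> is only meaningful on finite nonempty sets.\<close>

definition random_edge_ordering :: "nat \<Rightarrow> nat set rel pmf" where
  "random_edge_ordering n = pmf_of_set (edge_orderings n)"

lemma finite_K_edges: "finite (K_edges n)"
  by (rule finite_subset[of _ "Pow {..<n}"]) (auto simp: K_edges_def)

lemma card_K_edges: "card (K_edges n) = n choose 2"
  using n_subsets[of "{..<n}" 2] by (simp add: K_edges_def)

lemma finite_edge_orderings: "finite (edge_orderings n)"
  by (rule finite_subset[of _ "Pow (K_edges n \<times> K_edges n)"])
     (auto simp: edge_orderings_def order_on_defs finite_K_edges)

lemma edge_orderings_nonempty: "edge_orderings n \<noteq> {}"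
  using well_order_on[of "K_edges n"] by (auto simp: edge_orderings_def well_order_on_def)

lemma card_hamiltonian_paths: "card (hamiltonian_paths n) = fact n"
  using card_permutations_of_set[of "{..<n}"]
  by (simp add: hamiltonian_paths_def permutations_of_set_def conj_commute)

lemma finite_hamiltonian_paths: "finite (hamiltonian_paths n)"
  using card_hamiltonian_paths[of n] by (intro card_ge_0_finite) simp

end

theory Submission
  imports Defs "HOL-Real_Asymp.Real_Asymp"
begin

text \<open>
  Replace the ordering by independent uniform labels in \<open>{..<n ^ 6}\<close>. The number of increasing
  Hamiltonian paths has mean about \<open>n\<close>, but its second moment exceeds the square of the mean by a
  constant factor, because two paths typically share boundedly many edges; Chebyshev's
  inequality alone gives only a probability bounded away from \<open>0\<close>. To boost it to \<open>1\<close>, let \<open>q\<close> be the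
  probability that there is no increasing path. The labels on a path \<open>a\<close> are independent
  of all other labels, so with expectation at least about \<open>q n\<close> there are increasing paths \<open>a\<close> that are
  isolated: no increasing path is edge-disjoint from \<open>a\<close>. If there are at least \<open>2 \<delta> n\<close>
  increasing paths in total, an isolated \<open>a\<close> shares edges with all of them. Either \<open>\<delta> n\<close> of them share more
  than \<open>K\<close> edges with \<open>a\<close>, which is rare for large \<open>K\<close>, or the sum over increasing paths \<open>b\<close> of
  a weight depending on the size of the overlap of \<open>a\<close> and \<open>b\<close> is at least \<open>\<delta> n\<close>: the weight is \<open>1\<close> for overlaps
  \<open>1, \<dots>, K\<close>, vanishes above \<open>K\<close>, and for disjoint paths takes the value that makes its mean over \<open>a\<close> zero
  given the labels on \<open>b\<close>. For typical pairs \<open>b\<close>, \<open>c\<close> the overlaps of \<open>a\<close> with \<open>b\<close> and with \<open>c\<close>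
  are asymptotically independent, so the weighted sum has second moment \<open>o(n ^ 2)\<close>, and hence \<open>q\<close> tends to \<open>0\<close>.
\<close>

section \<open>Random labellings of the edges\<close>

text \<open>The argument rests on a product formula. Fix the labels of an increasing path
  \<open>b\<close>. A path that meets \<open>b\<close> in several runs of consecutive edges pays a
  factor about 1/n per run, gains a factor 2 for every run that is a single edge, since only such an
  edge can be reversed, and pays exp(- n s / Q), where s is the total spread of the labels inside
  the runs, because its other labels must stay out of these intervals. What remains is n times the
  probability \<open>free_prob\<close> that a random vertex order avoids the other edges. This
  probability is never evaluated: it is a common factor of a main term that the weights annihilate.
  For two paths the formula is applied to their concatenation; it factors unless the two patterns
  interfere through a vertex, an edge or nearby labels, and interference is rare only if the labels
  are not bunched. Overlaps comparable to n are bounded by separate sums, with an extra estimate for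
  nearly coinciding paths, where geometric decay in the overlap fails. Integer labels make every
  probability a finite count and every increasing sequence a subset of
  \<open>{..<Q}\<close>.\<close>

definition edge :: "(nat \<Rightarrow> nat) \<Rightarrow> nat \<Rightarrow> nat set" where
  "edge a i = {a i, a (Suc i)}"

locale labelling =
  fixes n Q :: nat
  assumes n2: "2 \<le> n" and Q1: "1 \<le> Q"
begin

definition m :: nat where "m = n - 1"

lemma Suc_m: "Suc m = n" and m_pos: "0 < m"
  using n2 by (auto simp: m_def)

text \<open>Vertex orders are permutations that fix everything from \<open>n\<close> on, so two of
  them are equal as soon as they agree below \<open>n\<close>, and exchanging two vertices is
  composition with a transposition.\<close>

definition paths :: "(nat \<Rightarrow> nat) set" where "paths = {a. a permutes {..<n}}"

definition path_set :: "(nat \<Rightarrow> nat) \<Rightarrow> nat set set" where "path_set a = edge a ` {..<m}"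

definition labels :: "(nat set \<Rightarrow> nat) set" where "labels = K_edges n \<rightarrow>\<^sub>E {..<Q}"

definition lab :: "(nat set \<Rightarrow> nat) \<Rightarrow> (nat \<Rightarrow> nat) \<Rightarrow> nat \<Rightarrow> nat" where
  "lab l a = restrict (\<lambda>i. l (edge a i)) {..<m}"

definition seqs :: "(nat \<Rightarrow> nat) set" where "seqs = {..<m} \<rightarrow>\<^sub>E {..<Q}"

definition hits :: "nat set set \<Rightarrow> (nat \<Rightarrow> nat) \<Rightarrow> nat" where
  "hits E a = card {i\<in>{..<m}. edge a i \<in> E}"

text \<open>The label sequences still possible for \<open>a\<close> once the labels on
  \<open>E\<close> are known; the conditional law of the labels of \<open>a\<close> is uniform on
  this set.\<close>

definition match :: "nat set set \<Rightarrow> (nat set \<Rightarrow> nat) \<Rightarrow> (nat \<Rightarrow> nat) \<Rightarrow> (nat \<Rightarrow> nat) set" where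
  "match E l a = {t\<in>seqs. \<forall>i<m. edge a i \<in> E \<longrightarrow> t i = l (edge a i)}"

definition inc :: "(nat \<Rightarrow> nat) \<Rightarrow> bool" where
  "inc t \<longleftrightarrow> (\<forall>i j. i < j \<longrightarrow> j < m \<longrightarrow> t i < t j)"

lemma lt_m: "i < m \<Longrightarrow> i < n" "i < m \<Longrightarrow> Suc i < n"
  using Suc_m by auto

lemma finite_paths: "finite paths" and card_paths: "card paths = fact n"
  unfolding paths_def by (auto simp: finite_permutations card_permutations)

lemma finite_labels: "finite labels" and card_labels: "card labels = Q ^ card (K_edges n)"
  unfolding labels_def by (auto simp: finite_K_edges card_funcsetE intro!: finite_PiE)

lemma finite_seqs: "finite seqs"
  unfolding seqs_def by (auto intro!: finite_PiE)

lemma path_lt: "a \<in> paths \<Longrightarrow> i < n \<Longrightarrow> a i < n"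
  using permutes_in_image[of a "{..<n}" i] by (simp add: paths_def)

lemma path_inj: "a \<in> paths \<Longrightarrow> a i = a j \<longleftrightarrow> i = j"
  by (auto simp: paths_def inj_eq[OF permutes_inj])

lemma path_surj: "a \<in> paths \<Longrightarrow> v < n \<Longrightarrow> \<exists>i<n. a i = v"
proof -
  assume "a \<in> paths" "v < n"
  then have "v \<in> a ` {..<n}" by (simp add: paths_def permutes_image)
  then show ?thesis by auto
qed

lemma edge_in_K: "a \<in> paths \<Longrightarrow> i < m \<Longrightarrow> edge a i \<in> K_edges n"
  using path_lt[of a i] path_lt[of a "Suc i"] path_inj[of a i "Suc i"] Suc_m
  by (auto simp: K_edges_def edge_def card_insert_if)

lemma path_set_K: "a \<in> paths \<Longrightarrow> path_set a \<subseteq> K_edges n"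
  using edge_in_K by (auto simp: path_set_def)

lemma edge_eq_iff: "a \<in> paths \<Longrightarrow> edge a i = edge a j \<longleftrightarrow> i = j"
  unfolding edge_def doubleton_eq_iff by (auto simp: path_inj)

lemma edge_meet_iff: "a \<in> paths \<Longrightarrow> edge a i \<inter> edge a j \<noteq> {} \<longleftrightarrow> i = j \<or> i = Suc j \<or> j = Suc i"
  unfolding edge_def by (auto simp: path_inj)

lemma inj_edge: "a \<in> paths \<Longrightarrow> inj_on (edge a) A"
  by (auto simp: inj_on_def edge_eq_iff)

lemma finite_path_set: "finite (path_set a)"
  unfolding path_set_def by simp

lemma card_path_set: "a \<in> paths \<Longrightarrow> card (path_set a) = m"
  unfolding path_set_def by (simp add: card_image inj_edge)

lemma hits_eq_card: "a \<in> paths \<Longrightarrow> hits E a = card (path_set a \<inter> E)"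
proof -
  assume a: "a \<in> paths"
  have "path_set a \<inter> E = edge a ` {i\<in>{..<m}. edge a i \<in> E}" by (auto simp: path_set_def)
  then show ?thesis by (simp add: hits_def card_image inj_edge[OF a])
qed

lemma hits_le: "hits E a \<le> m"
  unfolding hits_def by (rule order.trans[OF card_mono[of "{..<m}"]]) auto

lemma degree_path: "a \<in> paths \<Longrightarrow> card {e \<in> path_set a. v \<in> e} \<le> 2"
proof (cases "v < n")
  case True
  assume a: "a \<in> paths"
  obtain i where i: "i < n" "a i = v" using path_surj[OF a True] by blast
  have "{e \<in> path_set a. v \<in> e} \<subseteq> {edge a i, edge a (i - 1)}"
  proof
    fix e assume "e \<in> {e \<in> path_set a. v \<in> e}"
    then obtain j where j: "e = edge a j" "a i \<in> edge a j" using i by (auto simp: path_set_def)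
    then have "i = j \<or> i = Suc j" by (simp add: edge_def path_inj[OF a])
    then show "e \<in> {edge a i, edge a (i - 1)}" using j by auto
  qed
  then have "card {e \<in> path_set a. v \<in> e} \<le> card {edge a i, edge a (i - 1)}"
    by (intro card_mono) auto
  also have "\<dots> \<le> 2" by (simp add: card_insert_if)
  finally show ?thesis .
next
  case False
  assume a: "a \<in> paths"
  have "{e \<in> path_set a. v \<in> e} = {}"
    using False path_lt[OF a] lt_m by (auto simp: path_set_def edge_def)
  then show ?thesis by (metis card.empty zero_le)
qed

lemma lab_in_seqs: "a \<in> paths \<Longrightarrow> l \<in> labels \<Longrightarrow> lab l a \<in> seqs"
  unfolding lab_def labels_def seqs_def using edge_in_K by auto

text \<open>Exchanging the block of labels on \<open>B\<close> with an independent copy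
  \<open>u\<close> is an involution on pairs \<open>(l, u)\<close>. This is the finite form of
  resampling the labels on \<open>B\<close>.\<close>

lemma sum_labels_override:
  fixes f :: "(nat set \<Rightarrow> nat) \<Rightarrow> real"
  assumes B: "B \<subseteq> K_edges n"
  shows "(\<Sum>l\<in>labels. \<Sum>u\<in>B \<rightarrow>\<^sub>E {..<Q}. f (override_on l u B)) = real Q ^ card B * (\<Sum>l\<in>labels. f l)"
proof -
  let ?W = "B \<rightarrow>\<^sub>E {..<Q}"
  let ?h = "\<lambda>(l,u). (override_on l u B, restrict l B)"
  have finB: "finite B" using B finite_K_edges finite_subset by blast
  have "(\<Sum>l\<in>labels. \<Sum>u\<in>?W. f (override_on l u B)) = (\<Sum>(l,u)\<in>labels \<times> ?W. f (override_on l u B))"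
    by (simp add: sum.cartesian_product)
  also have "\<dots> = (\<Sum>(l,u)\<in>labels \<times> ?W. f l)"
  proof (rule sum.reindex_bij_witness[of _ ?h ?h])
    fix z assume z: "z \<in> labels \<times> ?W"
    obtain l u where lu: "z = (l, u)" "l \<in> labels" "u \<in> ?W" using z by auto
    have "override_on (override_on l u B) (restrict l B) B = l"
      by (rule ext) (simp add: override_on_def)
    moreover have "restrict (override_on l u B) B = u"
      using lu(3) by (intro ext) (auto simp: override_on_def PiE_iff extensional_def)
    ultimately show "?h (?h z) = z" "?h (?h z) = z" by (simp_all add: lu(1))
    have "override_on l u B \<in> labels" using lu B by (auto simp: labels_def override_on_def PiE_iff extensional_def)
    moreover have "restrict l B \<in> ?W" using lu B by (auto simp: labels_def)
    ultimately show "?h z \<in> labels \<times> ?W" "?h z \<in> labels \<times> ?W" by (simp_all add: lu(1))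
    show "(case ?h z of (l, u) \<Rightarrow> f l) = (case z of (l, u) \<Rightarrow> f (override_on l u B))" by (simp add: lu(1))
  qed
  also have "\<dots> = (\<Sum>l\<in>labels. \<Sum>u\<in>?W. f l)"
    by (simp only: sum.cartesian_product)
  also have "\<dots> = real Q ^ card B * (\<Sum>l\<in>labels. f l)"
    using finB by (simp add: card_funcsetE sum_distrib_left)
  finally show ?thesis .
qed

text \<open>Conditioning on the labels in \<open>E\<close>: resampling the edges of \<open>a\<close>
  outside \<open>E\<close> does not change \<open>F\<close> and makes the labels of \<open>a\<close>
  uniform on \<open>match E l a\<close>, a set of \<open>Q ^ (m - hits E a)\<close> sequences. The
  quotient of powers is the normalisation.\<close>

lemma sum_labels_path:
  fixes F :: "(nat set \<Rightarrow> nat) \<Rightarrow> real" and \<phi> :: "(nat \<Rightarrow> nat) \<Rightarrow> real"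
  assumes a: "a \<in> paths" and E: "E \<subseteq> K_edges n"
    and F: "\<And>l l'. l \<in> labels \<Longrightarrow> l' \<in> labels \<Longrightarrow> (\<And>e. e \<in> E \<Longrightarrow> l e = l' e) \<Longrightarrow> F l = F l'"
  shows "(\<Sum>l\<in>labels. F l * \<phi> (lab l a)) =
    (\<Sum>l\<in>labels. F l * (real Q ^ hits E a / real Q ^ m * (\<Sum>t\<in>match E l a. \<phi> t)))"
proof -
  define B where "B = path_set a - E"
  let ?W = "B \<rightarrow>\<^sub>E {..<Q}"
  have B: "B \<subseteq> K_edges n" using path_set_K[OF a] by (auto simp: B_def)
  have cB: "card B + hits E a = m"
    unfolding B_def hits_eq_card[OF a]
    using card_Diff_subset_Int[of "path_set a" E] card_mono[of "path_set a" "path_set a \<inter> E"]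
    by (simp add: finite_path_set card_path_set[OF a])
  have ov: "override_on l u B \<in> labels" if "l \<in> labels" "u \<in> ?W" for l u
    using that B by (auto simp: labels_def override_on_def PiE_iff extensional_def)
  have key: "(\<Sum>u\<in>?W. \<phi> (lab (override_on l u B) a)) = (\<Sum>t\<in>match E l a. \<phi> t)"
    if l: "l \<in> labels" for l
  proof (rule sum.reindex_bij_witness[of _ "\<lambda>t. restrict (\<lambda>e. t (inv_into {..<m} (edge a) e)) B"
           "\<lambda>u. lab (override_on l u B) a"])
    fix u assume u: "u \<in> ?W"
    show "restrict (\<lambda>e. lab (override_on l u B) a (inv_into {..<m} (edge a) e)) B = u"
    proof
      fix e
      show "restrict (\<lambda>e. lab (override_on l u B) a (inv_into {..<m} (edge a) e)) B e = u e"
      proof (cases "e \<in> B")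
        case True
        then obtain i where i: "i < m" "e = edge a i" by (auto simp: B_def path_set_def)
        have "inv_into {..<m} (edge a) e = i" using i inj_edge[OF a] by simp
        then show ?thesis using True i by (simp add: lab_def)
      next
        case False then show ?thesis using u by (auto simp: PiE_iff extensional_def)
      qed
    qed
    show "lab (override_on l u B) a \<in> match E l a"
      using lab_in_seqs[OF a ov[OF l u]] by (auto simp: match_def lab_def B_def override_on_def)
  next
    fix t assume t: "t \<in> match E l a"
    have ts: "t \<in> seqs" using t by (simp add: match_def)
    show "restrict (\<lambda>e. t (inv_into {..<m} (edge a) e)) B \<in> ?W"
    proof (unfold restrict_PiE_iff, intro ballI)
      fix e assume "e \<in> B"
      then obtain i where i: "i < m" "e = edge a i" by (auto simp: B_def path_set_def)
      then have "inv_into {..<m} (edge a) e = i" using inj_edge[OF a] by simp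
      then show "t (inv_into {..<m} (edge a) e) \<in> {..<Q}" using ts i(1) by (auto simp: seqs_def)
    qed
    show "lab (override_on l (restrict (\<lambda>e. t (inv_into {..<m} (edge a) e)) B) B) a = t"
    proof
      fix i
      show "lab (override_on l (restrict (\<lambda>e. t (inv_into {..<m} (edge a) e)) B) B) a i = t i"
      proof (cases "i < m")
        case False
        then show ?thesis using ts by (auto simp: lab_def seqs_def PiE_iff extensional_def)
      next
        case True
        show ?thesis
        proof (cases "edge a i \<in> E")
          case True' : True
          then show ?thesis using True t by (simp add: lab_def match_def B_def override_on_def)
        next
          case False
          then have "edge a i \<in> B" using True by (simp add: B_def path_set_def)
          then show ?thesis using True inv_into_f_f[OF inj_edge[OF a, of "{..<m}"], of i]
            by (simp add: lab_def override_on_def)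
        qed
      qed
    qed
  qed simp
  have "real Q ^ card B * (\<Sum>l\<in>labels. F l * \<phi> (lab l a))
      = (\<Sum>l\<in>labels. \<Sum>u\<in>?W. F (override_on l u B) * \<phi> (lab (override_on l u B) a))"
    by (rule sum_labels_override[OF B, symmetric])
  also have "\<dots> = (\<Sum>l\<in>labels. \<Sum>u\<in>?W. F l * \<phi> (lab (override_on l u B) a))"
  proof (intro sum.cong refl)
    fix l u assume lu: "l \<in> labels" "u \<in> ?W"
    have "F (override_on l u B) = F l"
      by (rule F[OF ov[OF lu] lu(1)]) (auto simp: B_def override_on_def)
    then show "F (override_on l u B) * \<phi> (lab (override_on l u B) a) = F l * \<phi> (lab (override_on l u B) a)" by simp
  qed
  also have "\<dots> = (\<Sum>l\<in>labels. F l * (\<Sum>t\<in>match E l a. \<phi> t))"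
    by (intro sum.cong refl) (simp add: key sum_distrib_left[symmetric])
  finally have *: "real Q ^ card B * (\<Sum>l\<in>labels. F l * \<phi> (lab l a)) = (\<Sum>l\<in>labels. F l * (\<Sum>t\<in>match E l a. \<phi> t))" .
  have Qm: "real Q ^ m = real Q ^ card B * real Q ^ hits E a"
    by (metis cB power_add)
  have "(\<Sum>l\<in>labels. F l * (real Q ^ hits E a / real Q ^ m * (\<Sum>t\<in>match E l a. \<phi> t)))
     = real Q ^ hits E a / real Q ^ m * (\<Sum>l\<in>labels. F l * (\<Sum>t\<in>match E l a. \<phi> t))"
    by (simp add: sum_distrib_left mult_ac)
  also have "\<dots> = (\<Sum>l\<in>labels. F l * \<phi> (lab l a))"
    unfolding *[symmetric] Qm using Q1 by simp
  finally show ?thesis by simp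
qed

end

lemma card_le_fibres:
  assumes "finite B" "finite A" "g ` A \<subseteq> B" "\<And>b. b \<in> B \<Longrightarrow> card {a\<in>A. g a = b} \<le> c"
  shows "card A \<le> card B * c"
proof -
  have "A = (\<Union>b\<in>B. {a\<in>A. g a = b})" using assms(3) by auto
  then have "card A \<le> (\<Sum>b\<in>B. card {a\<in>A. g a = b})" by (metis card_UN_le[OF assms(1)])
  also have "\<dots> \<le> (\<Sum>b\<in>B. c)" by (intro sum_mono assms(4))
  finally show ?thesis by simp
qed

lemma card_subsets_between:
  assumes A: "finite A" and X: "X \<subseteq> A" and G: "G \<subseteq> A" and XG: "X \<inter> G = {}" and k: "card X \<le> k"
  shows "card {B. B \<subseteq> A \<and> card B = k \<and> X \<subseteq> B \<and> B \<inter> G = {}} = (card A - card X - card G) choose (k - card X)"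
proof -
  have fX: "finite X" and fG: "finite G" using A X G finite_subset by auto
  have "bij_betw (\<lambda>B. B - X) {B. B \<subseteq> A \<and> card B = k \<and> X \<subseteq> B \<and> B \<inter> G = {}} {C. C \<subseteq> A - X - G \<and> card C = k - card X}"
  proof (rule bij_betwI[where g = "\<lambda>C. C \<union> X"])
    show "(\<lambda>B. B - X) \<in> {B. B \<subseteq> A \<and> card B = k \<and> X \<subseteq> B \<and> B \<inter> G = {}} \<rightarrow> {C. C \<subseteq> A - X - G \<and> card C = k - card X}"
      using fX by (auto simp: card_Diff_subset)
    show "(\<lambda>C. C \<union> X) \<in> {C. C \<subseteq> A - X - G \<and> card C = k - card X} \<rightarrow> {B. B \<subseteq> A \<and> card B = k \<and> X \<subseteq> B \<and> B \<inter> G = {}}"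
    proof
      fix C assume C: "C \<in> {C. C \<subseteq> A - X - G \<and> card C = k - card X}"
      have "finite C" using C A finite_subset[of C A] by auto
      then have "card (C \<union> X) = card C + card X" using C fX by (intro card_Un_disjoint) auto
      then show "C \<union> X \<in> {B. B \<subseteq> A \<and> card B = k \<and> X \<subseteq> B \<and> B \<inter> G = {}}"
        using C X XG k by auto
    qed
  qed auto
  then have "card {B. B \<subseteq> A \<and> card B = k \<and> X \<subseteq> B \<and> B \<inter> G = {}} = card {C. C \<subseteq> A - X - G \<and> card C = k - card X}"
    by (rule bij_betw_same_card)
  also have "\<dots> = card (A - X - G) choose (k - card X)" using A by (intro n_subsets) auto
  also have "card (A - X - G) = card A - card X - card G"
  proof -
    have "card (A - X - G) = card (A - X) - card G" using fG G XG by (intro card_Diff_subset) auto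
    then show ?thesis using fX X by (simp add: card_Diff_subset)
  qed
  finally show ?thesis .
qed

section \<open>Increasing label sequences and conditional path counts\<close>

context labelling begin

definition incs :: "(nat \<Rightarrow> nat) set" where "incs = {t\<in>seqs. inc t}"

lemma finite_incs: "finite incs" unfolding incs_def using finite_seqs by simp

lemma incs_less_iff: "t \<in> incs \<Longrightarrow> i < m \<Longrightarrow> j < m \<Longrightarrow> t i < t j \<longleftrightarrow> i < j"
  unfolding incs_def inc_def by (metis (mono_tags, lifting) linorder_neqE_nat mem_Collect_eq not_less_iff_gr_or_eq)

lemma incs_eq_iff: "t \<in> incs \<Longrightarrow> i < m \<Longrightarrow> j < m \<Longrightarrow> t i = t j \<longleftrightarrow> i = j"
  by (metis incs_less_iff less_irrefl linorder_neqE_nat)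

lemma incs_inj: "t \<in> incs \<Longrightarrow> inj_on t {..<m}"
  by (auto simp: inj_on_def incs_eq_iff)

lemma incs_bound: "t \<in> incs \<Longrightarrow> i < m \<Longrightarrow> t i < Q"
  by (auto simp: incs_def seqs_def)

text \<open>A strictly increasing sequence is its set of values listed in order, so all later counts
  of such sequences are counts of subsets of \<open>{..<Q}\<close>.\<close>

lemma bij_incs: "bij_betw (\<lambda>t. t ` {..<m}) incs {B. B \<subseteq> {..<Q} \<and> card B = m}"
proof (rule bij_betwI[where g = "\<lambda>B. restrict (\<lambda>i. sorted_list_of_set B ! i) {..<m}"])
  show "(\<lambda>t. t ` {..<m}) \<in> incs \<rightarrow> {B. B \<subseteq> {..<Q} \<and> card B = m}"
    using incs_inj incs_bound by (auto simp: card_image)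
  show "(\<lambda>B. restrict (\<lambda>i. sorted_list_of_set B ! i) {..<m}) \<in> {B. B \<subseteq> {..<Q} \<and> card B = m} \<rightarrow> incs"
  proof
    fix B assume B: "B \<in> {B. B \<subseteq> {..<Q} \<and> card B = m}"
    then have fB: "finite B" using finite_subset by auto
    have len: "length (sorted_list_of_set B) = m" using B by simp
    have "sorted_list_of_set B ! i \<in> B" if "i < m" for i
      using that len fB nth_mem[of i "sorted_list_of_set B"] by simp
    then show "restrict (\<lambda>i. sorted_list_of_set B ! i) {..<m} \<in> incs"
      using B len strict_sorted_list_of_set[of B] sorted_wrt_nth_less[of "(<)" "sorted_list_of_set B"]
      by (auto simp: incs_def seqs_def inc_def subset_iff)
  qed
  show "restrict (\<lambda>i. sorted_list_of_set (t ` {..<m}) ! i) {..<m} = t" if t: "t \<in> incs" for t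
  proof
    have eq: "sorted_list_of_set (t ` {..<m}) = map t [0..<m]"
    proof (rule sorted_list_of_set_unique[THEN iffD1])
      show "finite (t ` {..<m})" by simp
      show "sorted_wrt (<) (map t [0..<m]) \<and> set (map t [0..<m]) = t ` {..<m} \<and> length (map t [0..<m]) = card (t ` {..<m})"
        using incs_less_iff[OF t] incs_inj[OF t] by (auto simp: sorted_wrt_iff_nth_less card_image)
    qed
    fix i show "restrict (\<lambda>i. sorted_list_of_set (t ` {..<m}) ! i) {..<m} i = t i"
      using t unfolding eq by (cases "i < m") (auto simp: incs_def seqs_def PiE_iff extensional_def)
  qed
  show "restrict (\<lambda>i. sorted_list_of_set B ! i) {..<m} ` {..<m} = B" if B: "B \<in> {B. B \<subseteq> {..<Q} \<and> card B = m}" for B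
  proof -
    have fB: "finite B" using B finite_subset by auto
    have len: "length (sorted_list_of_set B) = m" using B by simp
    have "restrict (\<lambda>i. sorted_list_of_set B ! i) {..<m} ` {..<m} = (\<lambda>i. sorted_list_of_set B ! i) ` {..<m}"
      by (intro image_cong) auto
    also have "\<dots> = set (sorted_list_of_set B)"
      unfolding set_conv_nth len by auto
    finally show ?thesis using fB by simp
  qed
qed

lemma card_incs_image: "card {t\<in>incs. R (t ` {..<m})} = card {B. B \<subseteq> {..<Q} \<and> card B = m \<and> R B}"
proof -
  have "bij_betw (\<lambda>t. t ` {..<m}) {t\<in>incs. R (t ` {..<m})} {B \<in> {B. B \<subseteq> {..<Q} \<and> card B = m}. R B}"
  proof (rule bij_betw_subset[OF bij_incs])
    show "(\<lambda>t. t ` {..<m}) ` {t\<in>incs. R (t ` {..<m})} = {B \<in> {B. B \<subseteq> {..<Q} \<and> card B = m}. R B}"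
      unfolding bij_betw_imp_surj_on[OF bij_incs, symmetric] by blast
  qed auto
  then have "card {t\<in>incs. R (t ` {..<m})} = card {B \<in> {B. B \<subseteq> {..<Q} \<and> card B = m}. R B}"
    by (rule bij_betw_same_card)
  then show ?thesis by (simp add: conj_assoc)
qed

lemma card_incs: "card incs = Q choose m"
  using card_incs_image[of "\<lambda>_. True"] n_subsets[of "{..<Q}" m] by simp

lemma choose_le_pow: "real (N choose k) \<le> real N ^ k / fact k"
proof -
  have "(N choose k) * fact k \<le> N ^ k" by (rule binomial_fact_pow)
  then have "real ((N choose k) * fact k) \<le> real (N ^ k)" by (simp only: of_nat_le_iff)
  then show ?thesis by (simp add: field_simps)
qed

lemma card_incs_containing:
  assumes X: "X \<subseteq> {..<Q}" and k: "card X \<le> m"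
  shows "real (card {t\<in>incs. X \<subseteq> t ` {..<m}}) \<le> real Q ^ (m - card X) / fact (m - card X)"
proof -
  have "card {t\<in>incs. X \<subseteq> t ` {..<m}} = (Q - card X) choose (m - card X)"
    using card_incs_image[of "\<lambda>B. X \<subseteq> B"] card_subsets_between[OF _ X, of "{}" m] k by simp
  then have "real (card {t\<in>incs. X \<subseteq> t ` {..<m}}) \<le> real (Q - card X) ^ (m - card X) / fact (m - card X)"
    using choose_le_pow by simp
  also have "\<dots> \<le> real Q ^ (m - card X) / fact (m - card X)"
    by (intro divide_right_mono power_mono) auto
  finally show ?thesis .
qed

lemma card_pinned:
  assumes a0: "a0 \<in> paths" and U: "U \<subseteq> {..<n}"
  shows "card {a\<in>paths. \<forall>u\<in>U. a u = a0 u} = fact (n - card U)"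
proof -
  have p0: "a0 permutes {..<n}" using a0 by (simp add: paths_def)
  have fU: "finite U" using U finite_subset by auto
  have "bij_betw (\<lambda>a. inv a0 \<circ> a) {a\<in>paths. \<forall>u\<in>U. a u = a0 u} {p. p permutes ({..<n} - U)}"
  proof (rule bij_betwI[where g = "\<lambda>p. a0 \<circ> p"])
    show "(\<lambda>a. inv a0 \<circ> a) \<in> {a\<in>paths. \<forall>u\<in>U. a u = a0 u} \<rightarrow> {p. p permutes ({..<n} - U)}"
    proof
      fix a assume a: "a \<in> {a\<in>paths. \<forall>u\<in>U. a u = a0 u}"
      then have p: "a permutes {..<n}" by (simp add: paths_def)
      have "(inv a0 \<circ> a) permutes {..<n}" by (rule permutes_compose[OF p permutes_inv[OF p0]])
      then have "(inv a0 \<circ> a) permutes ({..<n} - U)"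
        by (rule permutes_superset) (use a permutes_inverses[OF p0] in auto)
      then show "inv a0 \<circ> a \<in> {p. p permutes ({..<n} - U)}" by simp
    qed
    show "(\<lambda>p. a0 \<circ> p) \<in> {p. p permutes ({..<n} - U)} \<rightarrow> {a\<in>paths. \<forall>u\<in>U. a u = a0 u}"
    proof
      fix p assume "p \<in> {p. p permutes ({..<n} - U)}"
      then have p: "p permutes ({..<n} - U)" by simp
      have "p permutes {..<n}" by (rule permutes_subset[OF p]) auto
      then have "a0 \<circ> p \<in> paths" using permutes_compose p0 by (auto simp: paths_def)
      moreover have "p u = u" if "u \<in> U" for u using permutes_not_in[OF p] that by auto
      ultimately show "a0 \<circ> p \<in> {a\<in>paths. \<forall>u\<in>U. a u = a0 u}" by auto
    qed
  qed (auto simp: fun_eq_iff permutes_inverses[OF p0])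
  then have "card {a\<in>paths. \<forall>u\<in>U. a u = a0 u} = card {p. p permutes ({..<n} - U)}"
    by (rule bij_betw_same_card)
  also have "\<dots> = fact (n - card U)"
    by (rule card_permutations) (use U fU in \<open>auto simp: card_Diff_subset\<close>)
  finally show ?thesis .
qed

definition placed :: "nat set set \<Rightarrow> (nat set \<Rightarrow> nat) \<Rightarrow> (nat \<Rightarrow> nat) \<Rightarrow> (nat \<Rightarrow> nat) set" where
  "placed S l t = {a\<in>paths. S \<subseteq> path_set a \<and> (\<forall>i<m. edge a i \<in> S \<longrightarrow> t i = l (edge a i))}"

lemma placed_slot:
  assumes "a \<in> placed S l t" "e \<in> S"
  shows "\<exists>i<m. e = edge a i \<and> t i = l e"
  using assms by (auto simp: placed_def path_set_def)

text \<open>As \<open>t\<close> is injective, the label of an edge in \<open>S\<close> determines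
  the position it occupies. What remains free is which endpoint of each edge comes first, and the
  arrangement of the vertices outside \<open>\<Union>S\<close>.\<close>

lemma card_placed_le:
  assumes t: "t \<in> incs" and S: "finite S"
  shows "card (placed S l t) \<le> 2 ^ card S * fact (n - card (\<Union>S))"
proof (cases "placed S l t = {}")
  case False
  then obtain a1 where a1: "a1 \<in> placed S l t" by auto
  define s where "s e = inv_into {..<m} t (l e)" for e
  have s: "s e < m" "edge a (s e) = e" if a: "a \<in> placed S l t" and e: "e \<in> S" for a e
  proof -
    obtain i where i: "i < m" "e = edge a i" "t i = l e" using placed_slot[OF a e] by blast
    have "s e = i" unfolding s_def i(3)[symmetric] by (rule inv_into_f_f[OF incs_inj[OF t]]) (use i in simp)
    then show "s e < m" "edge a (s e) = e" using i by auto
  qed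
  have pa: "a \<in> paths" if "a \<in> placed S l t" for a using that by (simp add: placed_def)
  let ?B = "PiE S (\<lambda>e. e)"
  have cB: "card ?B = 2 ^ card S"
  proof -
    have "card e = 2" if "e \<in> S" for e
    proof -
      have "e \<in> path_set a1" using a1 that by (auto simp: placed_def)
      then have "e \<in> K_edges n" using path_set_K[OF pa[OF a1]] by auto
      then show ?thesis by (simp add: K_edges_def)
    qed
    then show ?thesis using S by (simp add: card_PiE)
  qed
  have fB: "finite ?B"
    using cB by (intro card_ge_0_finite) simp
  have "card (placed S l t) \<le> card ?B * fact (n - card (\<Union>S))"
  proof (rule card_le_fibres[OF fB, where g = "\<lambda>a. restrict (\<lambda>e. a (s e)) S"])
    show "finite (placed S l t)" using finite_paths by (simp add: placed_def)
    show "(\<lambda>a. restrict (\<lambda>e. a (s e)) S) ` placed S l t \<subseteq> ?B"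
    proof
      fix f assume "f \<in> (\<lambda>a. restrict (\<lambda>e. a (s e)) S) ` placed S l t"
      then obtain a where a: "a \<in> placed S l t" "f = restrict (\<lambda>e. a (s e)) S" by auto
      have "a (s e) \<in> e" if "e \<in> S" for e
      proof -
        have "a (s e) \<in> edge a (s e)" by (simp add: edge_def)
        then show ?thesis using s(2)[OF a(1) that] by simp
      qed
      then show "f \<in> ?B" using a(2) by auto
    qed
    fix f assume "f \<in> ?B"
    show "card {a \<in> placed S l t. restrict (\<lambda>e. a (s e)) S = f} \<le> fact (n - card (\<Union>S))"
    proof (cases "{a \<in> placed S l t. restrict (\<lambda>e. a (s e)) S = f} = {}")
      case False
      then obtain a0 where a0: "a0 \<in> placed S l t" "restrict (\<lambda>e. a0 (s e)) S = f" by auto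
      define U where "U = (\<Union>e\<in>S. {s e, Suc (s e)})"
      have U: "U \<subseteq> {..<n}" using s(1)[OF a0(1)] lt_m by (auto simp: U_def)
      have "a0 ` U = (\<Union>e\<in>S. edge a0 (s e))" by (auto simp: U_def edge_def)
      also have "\<dots> = \<Union>S" using s(2)[OF a0(1)] by auto
      finally have "a0 ` U = \<Union>S" .
      moreover have "inj_on a0 U" using path_inj[OF pa[OF a0(1)]] by (auto simp: inj_on_def)
      ultimately have cU: "card U = card (\<Union>S)" using card_image by metis
      have "{a \<in> placed S l t. restrict (\<lambda>e. a (s e)) S = f} \<subseteq> {a\<in>paths. \<forall>u\<in>U. a u = a0 u}"
      proof
        fix a assume a: "a \<in> {a \<in> placed S l t. restrict (\<lambda>e. a (s e)) S = f}"
        have 1: "a (s e) = a0 (s e)" if "e \<in> S" for e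
          using a a0(2) that by (metis (mono_tags, lifting) mem_Collect_eq restrict_apply')
        have 2: "a (Suc (s e)) = a0 (Suc (s e))" if e: "e \<in> S" for e
        proof -
          have "edge a (s e) = edge a0 (s e)" using a s(2)[OF _ e] a0(1) by auto
          then show ?thesis using 1[OF e] by (auto simp: edge_def doubleton_eq_iff)
        qed
        show "a \<in> {a\<in>paths. \<forall>u\<in>U. a u = a0 u}" using a pa 1 2 by (auto simp: U_def)
      qed
      then have "card {a \<in> placed S l t. restrict (\<lambda>e. a (s e)) S = f} \<le> card {a\<in>paths. \<forall>u\<in>U. a u = a0 u}"
        using finite_paths by (intro card_mono) auto
      then show ?thesis using card_pinned[OF pa[OF a0(1)] U] cU by simp
    qed (simp only: card.empty)
  qed
  then show ?thesis by (simp add: cB)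
qed simp

text \<open>The probability that a path is increasing, given the labels on \<open>E\<close>.\<close>

definition pw :: "nat set set \<Rightarrow> (nat set \<Rightarrow> nat) \<Rightarrow> (nat \<Rightarrow> nat) \<Rightarrow> real" where
  "pw E l a = real Q ^ hits E a / real Q ^ m * real (card {t \<in> match E l a. inc t})"

lemma pw_nonneg: "0 \<le> pw E l a" by (simp add: pw_def)

text \<open>Double counting: the label sequence is chosen before the vertex order, because a fixed
  sequence dictates the positions of all edges whose labels are known.\<close>

lemma sum_pw_swap:
  assumes A: "A \<subseteq> paths" and h: "\<And>a. a \<in> A \<Longrightarrow> hits E a = k"
  shows "(\<Sum>a\<in>A. pw E l a) = real Q ^ k / real Q ^ m * (\<Sum>t\<in>incs. real (card {a\<in>A. t \<in> match E l a}))"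
proof -
  have fA: "finite A" using A finite_paths finite_subset by auto
  have "(\<Sum>a\<in>A. pw E l a) = (\<Sum>a\<in>A. real Q ^ k / real Q ^ m * (\<Sum>t\<in>incs. if t \<in> match E l a then 1 else 0))"
  proof (intro sum.cong refl)
    fix a assume a: "a \<in> A"
    have "{t \<in> match E l a. inc t} = {t \<in> incs. t \<in> match E l a}" by (auto simp: match_def incs_def)
    then show "pw E l a = real Q ^ k / real Q ^ m * (\<Sum>t\<in>incs. if t \<in> match E l a then 1 else 0)"
      using finite_incs by (simp add: pw_def h[OF a] sum.If_cases Int_def)
  qed
  also have "\<dots> = real Q ^ k / real Q ^ m * (\<Sum>t\<in>incs. \<Sum>a\<in>A. if t \<in> match E l a then 1 else 0)"
    unfolding sum_distrib_left[symmetric] by (subst sum.swap) simp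
  also have "\<dots> = real Q ^ k / real Q ^ m * (\<Sum>t\<in>incs. real (card {a\<in>A. t \<in> match E l a}))"
    using fA by (simp add: sum.If_cases Int_def)
  finally show ?thesis .
qed

text \<open>Only sequences whose values include all labels on \<open>S\<close> contribute; there are
  at most \<open>Q ^ (m - card S) / fact (m - card S)\<close> of them, and each is compatible with
  as many paths as \<open>card_placed_le\<close> allows. If two edges of \<open>S\<close> carry the
  same label, nothing contributes.\<close>

lemma sum_pw_le:
  assumes l: "l \<in> labels" and S: "S \<subseteq> K_edges n" "card S \<le> m"
  shows "(\<Sum>a\<in>{a\<in>paths. path_set a \<inter> E = S}. pw E l a) \<le> 2 ^ card S * fact (n - card (\<Union>S)) / fact (m - card S)"
proof -
  define k where "k = card S"
  define A where "A = {a\<in>paths. path_set a \<inter> E = S}"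
  define M where "M = 2 ^ k * (fact (n - card (\<Union>S)) :: real)"
  have fS: "finite S" using S finite_K_edges finite_subset by auto
  have mp: "{a\<in>A. t \<in> match E l a} \<subseteq> placed S l t" for t
    by (auto simp: A_def match_def placed_def)
  have fin: "finite (placed S l t)" for t using finite_paths by (simp add: placed_def)
  have eq: "(\<Sum>a\<in>A. pw E l a) = real Q ^ k / real Q ^ m * (\<Sum>t\<in>incs. real (card {a\<in>A. t \<in> match E l a}))"
    by (rule sum_pw_swap) (auto simp: A_def hits_eq_card k_def)
  have zero: "card {a\<in>A. t \<in> match E l a} = 0" if t: "t \<in> incs" and n: "\<not> (inj_on l S \<and> l ` S \<subseteq> t ` {..<m})" for t
  proof -
    have "placed S l t = {}"
    proof (rule ccontr)
      assume "placed S l t \<noteq> {}"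
      then obtain a where a: "a \<in> placed S l t" by auto
      have "l ` S \<subseteq> t ` {..<m}"
      proof
        fix x assume "x \<in> l ` S"
        then obtain e where e: "e \<in> S" "x = l e" by auto
        then show "x \<in> t ` {..<m}" using placed_slot[OF a e(1)] by force
      qed
      moreover have "inj_on l S"
      proof (rule inj_onI)
        fix e f assume ef: "e \<in> S" "f \<in> S" "l e = l f"
        obtain i where i: "i < m" "e = edge a i" "t i = l e" using placed_slot[OF a ef(1)] by blast
        obtain j where j: "j < m" "f = edge a j" "t j = l f" using placed_slot[OF a ef(2)] by blast
        show "e = f" using i j ef(3) incs_eq_iff[OF t i(1) j(1)] by simp
      qed
      ultimately show False using n by simp
    qed
    then have "{a\<in>A. t \<in> match E l a} = {}" using mp[of t] by simp
    then show ?thesis by (simp only: card.empty)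
  qed
  have "(\<Sum>t\<in>incs. real (card {a\<in>A. t \<in> match E l a})) \<le> M * (real Q ^ (m - k) / fact (m - k))"
  proof (cases "inj_on l S")
    case False
    then have "(\<Sum>t\<in>incs. real (card {a\<in>A. t \<in> match E l a})) = 0"
      using zero by (intro sum.neutral) simp
    also have "\<dots> \<le> M * (real Q ^ (m - k) / fact (m - k))" by (simp add: M_def)
    finally show ?thesis .
  next
    case True
    have cl: "card (l ` S) = k" using True by (simp add: card_image k_def)
    have lS: "l ` S \<subseteq> {..<Q}" using l S by (auto simp: labels_def)
    have "(\<Sum>t\<in>incs. real (card {a\<in>A. t \<in> match E l a})) = (\<Sum>t\<in>{t\<in>incs. l ` S \<subseteq> t ` {..<m}}. real (card {a\<in>A. t \<in> match E l a}))"
      by (rule sum.mono_neutral_right) (use finite_incs zero in auto)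
    also have "\<dots> \<le> (\<Sum>t\<in>{t\<in>incs. l ` S \<subseteq> t ` {..<m}}. M)"
    proof (rule sum_mono)
      fix t assume t: "t \<in> {t\<in>incs. l ` S \<subseteq> t ` {..<m}}"
      have "card {a\<in>A. t \<in> match E l a} \<le> card (placed S l t)" by (rule card_mono[OF fin mp])
      also have "\<dots> \<le> 2 ^ k * fact (n - card (\<Union>S))" unfolding k_def using t by (intro card_placed_le fS) auto
      finally have "real (card {a\<in>A. t \<in> match E l a}) \<le> real (2 ^ k * fact (n - card (\<Union>S)))" by (simp only: of_nat_le_iff)
      then show "real (card {a\<in>A. t \<in> match E l a}) \<le> M" by (simp add: M_def)
    qed
    also have "\<dots> = M * real (card {t\<in>incs. l ` S \<subseteq> t ` {..<m}})" by simp
    also have "\<dots> \<le> M * (real Q ^ (m - k) / fact (m - k))"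
      using card_incs_containing[OF lS] cl S(2) by (intro mult_left_mono) (auto simp: k_def M_def)
    finally show ?thesis .
  qed
  then have "(\<Sum>a\<in>A. pw E l a) \<le> real Q ^ k / real Q ^ m * (M * (real Q ^ (m - k) / fact (m - k)))"
    unfolding eq by (intro mult_left_mono) auto
  also have "\<dots> = (real Q ^ k * real Q ^ (m - k)) / real Q ^ m * M / fact (m - k)" by simp
  also have "real Q ^ k * real Q ^ (m - k) = real Q ^ m" using S(2) by (simp add: k_def flip: power_add)
  also have "real Q ^ m / real Q ^ m * M / fact (m - k) = M / fact (m - k)" using Q1 by simp
  finally show ?thesis by (simp add: A_def M_def k_def)
qed

end

section \<open>First moments relative to a sparse edge set\<close>

text \<open>Transfer weights: a consecutive pair in the list costs \<open>y\<close> if the two edges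
  are disjoint, so that a new run begins, and \<open>y + 1\<close> if they meet. With
  \<open>y = 1 / n\<close> this majorises a factor \<open>1 / n\<close> per run while allowing lists
  to be summed like walks.\<close>

fun chain_weight :: "real \<Rightarrow> 'a set \<Rightarrow> 'a set list \<Rightarrow> real" where
  "chain_weight y e [] = 1"
| "chain_weight y e (f # fs) = (y + of_bool (e \<inter> f \<noteq> {})) * chain_weight y f fs"

fun list_weight :: "real \<Rightarrow> 'a set list \<Rightarrow> real" where
  "list_weight y [] = 1"
| "list_weight y (e # es) = chain_weight y e es"

text \<open>Meant for edges listed in their order along a path, where two successive entries meet
  exactly if they are adjacent on the path.\<close>

fun num_runs :: "'a set list \<Rightarrow> nat" where
  "num_runs [] = 0"
| "num_runs [e] = 1"
| "num_runs (e # f # es) = of_bool (e \<inter> f = {}) + num_runs (f # es)"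

lemma chain_weight_nonneg: "0 \<le> y \<Longrightarrow> 0 \<le> chain_weight y e es"
  by (induction es arbitrary: e) auto

lemma list_weight_nonneg: "0 \<le> y \<Longrightarrow> 0 \<le> list_weight y es"
  by (cases es) (auto simp: chain_weight_nonneg)

lemma num_runs_le_length: "num_runs es \<le> length es"
  by (induction es rule: num_runs.induct) auto

lemma num_runs_pos: "es \<noteq> [] \<Longrightarrow> 1 \<le> num_runs es"
  by (induction es rule: num_runs.induct) auto

lemma power_num_runs_le:
  assumes y: "0 \<le> y"
  shows "es \<noteq> [] \<Longrightarrow> y ^ num_runs es \<le> y * list_weight y es"
proof (induction es rule: num_runs.induct)
  case (3 e f es)
  have IH: "y ^ num_runs (f # es) \<le> y * chain_weight y f es" using 3 by simp
  show ?case
  proof (cases "e \<inter> f = {}")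
    case True
    then show ?thesis using mult_left_mono[OF IH y] by (simp add: mult_ac)
  next
    case False
    have "y * chain_weight y f es \<le> y * ((y + 1) * chain_weight y f es)"
      using y chain_weight_nonneg[OF y, of f es] by (intro mult_left_mono) (auto simp: distrib_right)
    then show ?thesis using IH False by simp
  qed
qed auto

lemma sum_lists_Suc:
  fixes F :: "'a list \<Rightarrow> real"
  shows "(\<Sum>xs\<in>{xs. set xs \<subseteq> E \<and> length xs = Suc k}. F xs)
    = (\<Sum>e\<in>E. \<Sum>xs\<in>{xs. set xs \<subseteq> E \<and> length xs = k}. F (e # xs))"
proof -
  let ?L = "{xs. set xs \<subseteq> E \<and> length xs = k}"
  have "(\<Sum>xs\<in>{xs. set xs \<subseteq> E \<and> length xs = Suc k}. F xs) = (\<Sum>(xs,e)\<in>?L \<times> E. F (e # xs))"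
    unfolding lists_length_Suc_eq by (subst sum.reindex) (auto simp: inj_on_def intro!: sum.cong)
  also have "\<dots> = (\<Sum>xs\<in>?L. \<Sum>e\<in>E. F (e # xs))" by (simp add: sum.cartesian_product)
  finally show ?thesis by (subst sum.swap)
qed

text \<open>Walk counting: \<open>\<beta>\<close> bounds every row sum of the transfer matrix, so
  each further entry costs one factor \<open>\<beta>\<close>.\<close>

lemma sum_chain_weight_le:
  fixes E :: "'a set set"
  assumes y: "0 \<le> y" and beta: "\<And>e. e \<in> E \<Longrightarrow> (\<Sum>f\<in>E. y + of_bool (e \<inter> f \<noteq> {})) \<le> \<beta>"
  shows "e \<in> E \<Longrightarrow> (\<Sum>xs\<in>{xs. set xs \<subseteq> E \<and> length xs = k}. chain_weight y e xs) \<le> \<beta> ^ k"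
proof (induction k arbitrary: e)
  case 0
  have "{xs. set xs \<subseteq> E \<and> length xs = 0} = {[]}" by auto
  then show ?case by simp
next
  case (Suc k)
  have b0: "0 \<le> \<beta>"
    by (rule order.trans[OF sum_nonneg beta[OF Suc.prems]]) (use y in auto)
  have "(\<Sum>xs\<in>{xs. set xs \<subseteq> E \<and> length xs = Suc k}. chain_weight y e xs)
     = (\<Sum>f\<in>E. (y + of_bool (e \<inter> f \<noteq> {})) * (\<Sum>xs\<in>{xs. set xs \<subseteq> E \<and> length xs = k}. chain_weight y f xs))"
    unfolding sum_lists_Suc by (simp add: sum_distrib_left)
  also have "\<dots> \<le> (\<Sum>f\<in>E. (y + of_bool (e \<inter> f \<noteq> {})) * \<beta> ^ k)"
    using y by (intro sum_mono mult_left_mono Suc.IH) auto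
  also have "\<dots> = (\<Sum>f\<in>E. y + of_bool (e \<inter> f \<noteq> {})) * \<beta> ^ k" by (simp only: sum_distrib_right)
  also have "\<dots> \<le> \<beta> * \<beta> ^ k" using b0 by (intro mult_right_mono beta[OF Suc.prems]) auto
  finally show ?case by simp
qed

text \<open>There are \<open>Suc k\<close> places for an entry from \<open>D\<close> and
  \<open>card D\<close> choices for it; summing outwards from it in both directions costs
  \<open>\<beta>\<close> per remaining entry, as the transfer matrix is symmetric. The induction
  peels off the first entry and splits on whether it lies in \<open>D\<close>.\<close>

lemma sum_list_weight_meeting_le:
  fixes E :: "'a set set"
  assumes fE: "finite E" and y: "0 \<le> y" and beta: "\<And>e. e \<in> E \<Longrightarrow> (\<Sum>f\<in>E. y + of_bool (e \<inter> f \<noteq> {})) \<le> \<beta>"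
    and b0: "0 \<le> \<beta>" and D: "D \<subseteq> E"
  shows "(\<Sum>xs\<in>{xs. set xs \<subseteq> E \<and> length xs = Suc k}. of_bool (set xs \<inter> D \<noteq> {}) * list_weight y xs)
    \<le> real (Suc k) * real (card D) * \<beta> ^ k"
proof (induction k)
  case 0
  have "{xs. set xs \<subseteq> E \<and> length xs = 0} = {[]}" by auto
  then have "(\<Sum>xs\<in>{xs. set xs \<subseteq> E \<and> length xs = Suc 0}. of_bool (set xs \<inter> D \<noteq> {}) * list_weight y xs)
    = (\<Sum>e\<in>E. of_bool (e \<in> D))"
    unfolding sum_lists_Suc by simp
  also have "\<dots> = real (card D)" using fE D by (simp add: of_bool_def sum.If_cases Int_absorb1 Int_def[symmetric] Int_absorb2)
  finally show ?case by simp
next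
  case (Suc k)
  let ?L = "\<lambda>k. {xs. set xs \<subseteq> E \<and> length xs = k}"
  have "(\<Sum>xs\<in>?L (Suc (Suc k)). of_bool (set xs \<inter> D \<noteq> {}) * list_weight y xs)
    = (\<Sum>e\<in>E. \<Sum>xs\<in>?L (Suc k). of_bool (set (e # xs) \<inter> D \<noteq> {}) * chain_weight y e xs)"
    by (subst sum_lists_Suc) simp
  also have "\<dots> \<le> (\<Sum>e\<in>E. \<Sum>xs\<in>?L (Suc k). of_bool (e \<in> D) * chain_weight y e xs + of_bool (set xs \<inter> D \<noteq> {}) * chain_weight y e xs)"
    using chain_weight_nonneg[OF y] by (intro sum_mono) (auto simp: of_bool_def)
  also have "\<dots> = (\<Sum>e\<in>E. of_bool (e \<in> D) * (\<Sum>xs\<in>?L (Suc k). chain_weight y e xs))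
      + (\<Sum>e\<in>E. \<Sum>xs\<in>?L (Suc k). of_bool (set xs \<inter> D \<noteq> {}) * chain_weight y e xs)"
    by (simp add: sum.distrib sum_distrib_left)
  also have "(\<Sum>e\<in>E. of_bool (e \<in> D) * (\<Sum>xs\<in>?L (Suc k). chain_weight y e xs)) \<le> (\<Sum>e\<in>E. of_bool (e \<in> D) * \<beta> ^ Suc k)"
    by (intro sum_mono mult_left_mono sum_chain_weight_le[OF y beta]) auto
  also have "(\<Sum>e\<in>E. of_bool (e \<in> D) * \<beta> ^ Suc k) = real (card D) * \<beta> ^ Suc k"
    using fE D by (simp add: of_bool_def sum_distrib_right[symmetric] sum.If_cases Int_absorb1 Int_def[symmetric] Int_absorb2)
  also have "(\<Sum>e\<in>E. \<Sum>xs\<in>?L (Suc k). of_bool (set xs \<inter> D \<noteq> {}) * chain_weight y e xs)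
      \<le> \<beta> * (\<Sum>xs\<in>?L (Suc k). of_bool (set xs \<inter> D \<noteq> {}) * list_weight y xs)"
  proof -
    have "(\<Sum>e\<in>E. \<Sum>xs\<in>?L (Suc k). of_bool (set xs \<inter> D \<noteq> {}) * chain_weight y e xs)
      = (\<Sum>xs\<in>?L (Suc k). \<Sum>e\<in>E. of_bool (set xs \<inter> D \<noteq> {}) * chain_weight y e xs)" by (rule sum.swap)
    also have "\<dots> \<le> (\<Sum>xs\<in>?L (Suc k). \<beta> * (of_bool (set xs \<inter> D \<noteq> {}) * list_weight y xs))"
    proof (rule sum_mono)
      fix xs assume "xs \<in> ?L (Suc k)"
      then obtain f fs where xs: "xs = f # fs" "f \<in> E" by (cases xs) auto
      have "(\<Sum>e\<in>E. chain_weight y e xs) = (\<Sum>e\<in>E. y + of_bool (f \<inter> e \<noteq> {})) * chain_weight y f fs"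
        by (simp add: xs sum_distrib_right Int_commute)
      also have "\<dots> \<le> \<beta> * chain_weight y f fs"
        by (intro mult_right_mono beta xs chain_weight_nonneg y)
      finally have "(\<Sum>e\<in>E. chain_weight y e xs) \<le> \<beta> * list_weight y xs" by (simp add: xs)
      then show "(\<Sum>e\<in>E. of_bool (set xs \<inter> D \<noteq> {}) * chain_weight y e xs) \<le> \<beta> * (of_bool (set xs \<inter> D \<noteq> {}) * list_weight y xs)"
        by (auto simp: of_bool_def)
    qed
    finally show ?thesis by (simp add: sum_distrib_left)
  qed
  also have "\<beta> * (\<Sum>xs\<in>?L (Suc k). of_bool (set xs \<inter> D \<noteq> {}) * list_weight y xs) \<le> \<beta> * (real (Suc k) * real (card D) * \<beta> ^ k)"
    by (intro mult_left_mono Suc.IH b0)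
  finally show ?case by (simp add: algebra_simps)
qed

lemma fact_add_ge: "c \<le> real (Suc a) \<Longrightarrow> 0 \<le> c \<Longrightarrow> c ^ b * fact a \<le> (fact (a + b) :: real)"
proof (induction b)
  case (Suc b)
  have "c ^ Suc b * fact a = c * (c ^ b * fact a)" by simp
  also have "\<dots> \<le> real (Suc (a + b)) * fact (a + b)"
    using Suc by (intro mult_mono) auto
  finally show ?case by simp
qed simp

section \<open>Conditional first moments near a sparse edge set\<close>

context labelling begin

text \<open>A run of \<open>j\<close> consecutive edges covers \<open>j + 1\<close> vertices, and
  distinct maximal runs are vertex-disjoint.\<close>

lemma card_Union_path_edges:
  assumes a: "a \<in> paths"
  shows "sorted_wrt (<) js \<Longrightarrow> card (\<Union>(set (map (edge a) js))) = length js + num_runs (map (edge a) js)"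
proof (induction js rule: induct_list012)
  case (2 i)
  then show ?case using path_inj[OF a, of i "Suc i"] by (simp add: edge_def)
next
  case (3 i j js)
  define W where "W = \<Union>(set (map (edge a) (j # js)))"
  have fW: "finite W" by (auto simp: W_def edge_def)
  have IH: "card W = length (j # js) + num_runs (map (edge a) (j # js))" using 3 by (simp add: W_def)
  have ij: "i < j" and jj: "\<And>x. x \<in> set js \<Longrightarrow> j < x" using 3(3) by auto
  have i: "a i \<notin> W" using ij jj path_inj[OF a] by (fastforce simp: W_def edge_def)
  have Si: "a (Suc i) \<in> W \<longleftrightarrow> j = Suc i"
    using ij jj path_inj[OF a] by (fastforce simp: W_def edge_def)
  have U: "\<Union>(set (map (edge a) (i # j # js))) = insert (a i) (insert (a (Suc i)) W)"
    by (auto simp: W_def edge_def)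
  have meet: "edge a i \<inter> edge a j = {} \<longleftrightarrow> j \<noteq> Suc i" using edge_meet_iff[OF a, of i j] ij by auto
  have ii: "a i \<noteq> a (Suc i)" using path_inj[OF a] by simp
  have "card (insert (a i) (insert (a (Suc i)) W)) = Suc (if j = Suc i then card W else Suc (card W))"
    using fW i Si ii by (simp add: insert_absorb)
  then show ?case unfolding U by (simp add: IH meet)
qed simp

text \<open>With \<open>r\<close> runs the shared edges cover \<open>k + r\<close> vertices, so the
  factorial quotient in \<open>sum_pw_le\<close> loses about a factor \<open>n\<close> for every run
  after the first. The list weight absorbs this. One factor \<open>2 ^ k\<close> stems from
  orientations, the other from replacing \<open>n\<close> by \<open>n / 2\<close>.\<close>

lemma sum_pw_list_le:
  assumes l: "l \<in> labels" and E: "E \<subseteq> K_edges n" and k: "4 * k \<le> n" and k1: "1 \<le> k"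
    and a: "a \<in> paths" and xs: "xs = map (edge a) (filter (\<lambda>i. edge a i \<in> E) [0..<m])" and len: "length xs = k"
  shows "(\<Sum>a\<in>{a\<in>paths. path_set a \<inter> E = set xs}. pw E l a) \<le> 4 ^ k * list_weight (1 / real n) xs"
proof -
  let ?js = "filter (\<lambda>i. edge a i \<in> E) [0..<m]"
  define r where "r = num_runs xs"
  have ne: "xs \<noteq> []" using len k1 by auto
  have r: "1 \<le> r" "r \<le> k" using num_runs_pos[OF ne] num_runs_le_length[of xs] len by (auto simp: r_def)
  have sj: "sorted_wrt (<) ?js" by (simp add: sorted_wrt_filter)
  have v: "card (\<Union>(set xs)) = k + r"
    using card_Union_path_edges[OF a sj] len by (simp add: xs r_def)
  have dist: "distinct xs" unfolding xs distinct_map by (simp add: inj_edge[OF a])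
  have cx: "card (set xs) = k" using distinct_card[OF dist] len by simp
  have SK: "set xs \<subseteq> K_edges n" using E by (auto simp: xs)
  have km: "k \<le> m" using k k1 Suc_m by linarith
  have "(\<Sum>a\<in>{a\<in>paths. path_set a \<inter> E = set xs}. pw E l a) \<le> 2 ^ k * fact (n - (k + r)) / fact (m - k)"
    using sum_pw_le[OF l SK, of E] km by (simp add: cx v)
  also have "\<dots> \<le> 2 ^ k * (2 / real n) ^ (r - 1)"
  proof -
    have eq: "m - k = (n - (k + r)) + (r - 1)" using r k Suc_m by linarith
    \<comment> \<open>As \<open>k + r \<le> 2 * k \<le> n / 2\<close>, each of the
      \<open>r - 1\<close> factors that separate the two factorials exceeds
      \<open>n / 2\<close>.\<close>
    have "(real n / 2) ^ (r - 1) * fact (n - (k + r)) \<le> (fact (m - k) :: real)"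
      unfolding eq by (rule fact_add_ge) (use k r in linarith, simp)
    then have "fact (n - (k + r)) / fact (m - k) \<le> 1 / (real n / 2) ^ (r - 1)"
      using n2 by (simp add: field_simps)
    also have "\<dots> = (2 / real n) ^ (r - 1)" by (simp add: power_divide)
    finally have "2 ^ k * (fact (n - (k + r)) / fact (m - k)) \<le> 2 ^ k * (2 / real n) ^ (r - 1)"
      by (intro mult_left_mono) auto
    then show ?thesis by simp
  qed
  also have "(2 / real n) ^ (r - 1) = 2 ^ (r - 1) * (real n * (1 / real n) ^ r)"
    using r(1) n2 by (cases r) (auto simp: power_divide)
  also have "2 ^ k * (2 ^ (r - 1) * (real n * (1 / real n) ^ r)) \<le> 2 ^ k * (2 ^ k * (real n * (1 / real n * list_weight (1 / real n) xs)))"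
    using power_num_runs_le[OF _ ne, of "1 / real n"] r
    by (intro mult_left_mono mult_mono power_increasing) (auto simp: r_def)
  also have "\<dots> = 4 ^ k * list_weight (1 / real n) xs"
    using n2 by (simp flip: power_mult_distrib)
  finally show ?thesis .
qed

text \<open>The base 40 is 4 from \<open>sum_pw_list_le\<close> times the row-sum bound 10. One
  factor \<open>\<kappa>\<close> counts the places for the edge in \<open>D\<close>, the other the
  possible overlap sizes.\<close>

definition crude :: "nat \<Rightarrow> real" where "crude \<kappa> = real \<kappa> ^ 2 * 40 ^ \<kappa>"

text \<open>The shape of a union of two paths, kept abstract so that conditioning on one path and on
  two paths is treated alike.\<close>

definition sparse :: "nat set set \<Rightarrow> bool" where
  "sparse E \<longleftrightarrow> E \<subseteq> K_edges n \<and> card E \<le> 2 * n \<and> (\<forall>v. card {e\<in>E. v \<in> e} \<le> 4)"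

lemma sparse_Un: "b \<in> paths \<Longrightarrow> c \<in> paths \<Longrightarrow> sparse (path_set b \<union> path_set c)"
proof -
  assume bc: "b \<in> paths" "c \<in> paths"
  have "card {e \<in> path_set b \<union> path_set c. v \<in> e} \<le> 4" for v
  proof -
    have "{e \<in> path_set b \<union> path_set c. v \<in> e} = {e \<in> path_set b. v \<in> e} \<union> {e \<in> path_set c. v \<in> e}" by auto
    then have "card {e \<in> path_set b \<union> path_set c. v \<in> e} \<le> card {e \<in> path_set b. v \<in> e} + card {e \<in> path_set c. v \<in> e}"
      by (simp only: card_Un_le)
    then show ?thesis using degree_path[OF bc(1), of v] degree_path[OF bc(2), of v] by linarith
  qed
  moreover have "card (path_set b \<union> path_set c) \<le> 2 * n"
    using card_Un_le[of "path_set b" "path_set c"] card_path_set[OF bc(1)] card_path_set[OF bc(2)] Suc_m by linarith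
  ultimately show ?thesis using path_set_K bc by (auto simp: sparse_def)
qed

lemma sparse_path: "b \<in> paths \<Longrightarrow> sparse (path_set b)"
  using sparse_Un[of b b] by simp

lemma sparse_finite: "sparse E \<Longrightarrow> finite E"
  using finite_K_edges finite_subset by (auto simp: sparse_def)

lemma sparse_meet:
  assumes E: "sparse E" and e: "e \<in> K_edges n"
  shows "card {f\<in>E. e \<inter> f \<noteq> {}} \<le> 8"
proof -
  obtain u v where uv: "e = {u, v}" using e by (auto simp: K_edges_def card_2_iff)
  have "{f\<in>E. e \<inter> f \<noteq> {}} = {f\<in>E. u \<in> f} \<union> {f\<in>E. v \<in> f}" using uv by auto
  then have "card {f\<in>E. e \<inter> f \<noteq> {}} \<le> card {f\<in>E. u \<in> f} + card {f\<in>E. v \<in> f}" by (simp only: card_Un_le)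
  moreover have "card {f\<in>E. u \<in> f} \<le> 4" "card {f\<in>E. v \<in> f} \<le> 4" using E by (auto simp: sparse_def)
  ultimately show ?thesis by linarith
qed

text \<open>Paths are grouped by the list of their edges in \<open>E\<close>, and list weights are
  summed over lists that meet \<open>D\<close>. The bound is proportional to \<open>card D\<close>
  and not to \<open>n\<close>: being forced through a bounded set of edges costs a full factor
  \<open>n\<close>. This is how touching triples are controlled later.\<close>

lemma crude_bound:
  assumes l: "l \<in> labels" and E: "sparse E" and D: "D \<subseteq> E" and \<kappa>: "4 * \<kappa> \<le> n"
  shows "(\<Sum>a\<in>{a\<in>paths. hits E a \<le> \<kappa> \<and> path_set a \<inter> D \<noteq> {}}. pw E l a) \<le> crude \<kappa> * real (card D)"
proof -
  let ?y = "1 / real n"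
  let ?L = "\<lambda>k. {xs. set xs \<subseteq> E \<and> length xs = k}"
  define sl where "sl a = map (edge a) (filter (\<lambda>i. edge a i \<in> E) [0..<m])" for a
  define A where "A k = {a\<in>paths. hits E a = k \<and> path_set a \<inter> D \<noteq> {}}" for k
  have fE: "finite E" by (rule sparse_finite[OF E])
  have EK: "E \<subseteq> K_edges n" using E by (simp add: sparse_def)
  have set_sl: "set (sl a) = path_set a \<inter> E" for a by (auto simp: sl_def path_set_def)
  have len_sl: "length (sl a) = hits E a" for a
  proof -
    have "length (sl a) = card (set (filter (\<lambda>i. edge a i \<in> E) [0..<m]))"
      unfolding sl_def length_map by (rule distinct_card[symmetric]) simp
    also have "set (filter (\<lambda>i. edge a i \<in> E) [0..<m]) = {i\<in>{..<m}. edge a i \<in> E}" by auto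
    finally show ?thesis by (simp add: hits_def)
  qed
  \<comment> \<open>At most \<open>2 * n\<close> edges at \<open>1 / n\<close> each, plus at most 8
    edges of \<open>E\<close> that meet \<open>e\<close>.\<close>
  have beta: "(\<Sum>f\<in>E. ?y + of_bool (e \<inter> f \<noteq> {})) \<le> 10" if "e \<in> E" for e
  proof -
    have "(\<Sum>f\<in>E. ?y + of_bool (e \<inter> f \<noteq> {})) = real (card E) * ?y + real (card {f\<in>E. e \<inter> f \<noteq> {}})"
      using fE by (simp add: sum.distrib of_bool_def sum.If_cases Int_def)
    also have "\<dots> \<le> real (2 * n) * ?y + real 8"
      using E sparse_meet[OF E, of e] that EK by (intro add_mono mult_right_mono of_nat_mono) (auto simp: sparse_def)
    also have "\<dots> = 10" using n2 by simp
    finally show ?thesis .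
  qed
  have main: "(\<Sum>a\<in>A (Suc k). pw E l a) \<le> real \<kappa> * 40 ^ \<kappa> * real (card D)" if k: "Suc k \<le> \<kappa>" for k
  proof -
    have fA: "finite (A (Suc k))" using finite_paths by (simp add: A_def)
    have "(\<Sum>a\<in>A (Suc k). pw E l a) = (\<Sum>xs\<in>sl ` A (Suc k). \<Sum>a\<in>{a\<in>A (Suc k). sl a = xs}. pw E l a)"
      by (rule sum.image_gen[OF fA])
    also have "\<dots> \<le> (\<Sum>xs\<in>sl ` A (Suc k). 4 ^ Suc k * list_weight ?y xs)"
    proof (rule sum_mono)
      fix xs assume "xs \<in> sl ` A (Suc k)"
      then obtain a where a: "a \<in> A (Suc k)" "xs = sl a" by auto
      have "(\<Sum>a\<in>{a\<in>A (Suc k). sl a = xs}. pw E l a) \<le> (\<Sum>a\<in>{a\<in>paths. path_set a \<inter> E = set xs}. pw E l a)"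
        by (rule sum_mono2) (use finite_paths pw_nonneg in \<open>auto simp: A_def set_sl\<close>)
      also have "\<dots> \<le> 4 ^ Suc k * list_weight ?y xs"
        by (rule sum_pw_list_le[OF l EK, of "Suc k" a]) (use a k \<kappa> in \<open>auto simp: A_def len_sl, auto simp: sl_def\<close>)
      finally show "(\<Sum>a\<in>{a\<in>A (Suc k). sl a = xs}. pw E l a) \<le> 4 ^ Suc k * list_weight ?y xs" .
    qed
    also have "\<dots> = (\<Sum>xs\<in>sl ` A (Suc k). 4 ^ Suc k * (of_bool (set xs \<inter> D \<noteq> {}) * list_weight ?y xs))"
      by (intro sum.cong refl) (use D in \<open>auto simp: A_def set_sl Int_assoc Int_absorb1\<close>)
    also have "\<dots> \<le> (\<Sum>xs\<in>?L (Suc k). 4 ^ Suc k * (of_bool (set xs \<inter> D \<noteq> {}) * list_weight ?y xs))"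
    proof (rule sum_mono2)
      show "finite (?L (Suc k))" by (rule finite_lists_length_eq[OF fE])
      show "sl ` A (Suc k) \<subseteq> ?L (Suc k)" by (auto simp: A_def set_sl len_sl)
      show "0 \<le> 4 ^ Suc k * (of_bool (set xs \<inter> D \<noteq> {}) * list_weight ?y xs)" for xs
        by (intro mult_nonneg_nonneg list_weight_nonneg) auto
    qed
    also have "\<dots> \<le> 4 ^ Suc k * (real (Suc k) * real (card D) * 10 ^ k)"
      unfolding sum_distrib_left[symmetric]
      by (intro mult_left_mono sum_list_weight_meeting_le[OF fE _ beta _ D]) auto
    also have "\<dots> \<le> 4 ^ \<kappa> * (real \<kappa> * real (card D) * 10 ^ \<kappa>)"
      using k by (intro mult_mono power_increasing) auto
    also have "\<dots> = real \<kappa> * 40 ^ \<kappa> * real (card D)"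
      by (simp add: mult_ac flip: power_mult_distrib)
    finally show ?thesis .
  qed
  have zero: "A 0 = {}"
    using D by (auto simp: A_def hits_eq_card finite_path_set; blast)
  have "{a\<in>paths. hits E a \<le> \<kappa> \<and> path_set a \<inter> D \<noteq> {}} = (\<Union>k\<in>{..\<kappa>}. A k)" by (auto simp: A_def)
  then have "(\<Sum>a\<in>{a\<in>paths. hits E a \<le> \<kappa> \<and> path_set a \<inter> D \<noteq> {}}. pw E l a) = (\<Sum>k\<le>\<kappa>. \<Sum>a\<in>A k. pw E l a)"
    using finite_paths by (simp only:) (intro sum.UNION_disjoint, auto simp: A_def)
  also have "\<dots> = (\<Sum>k<\<kappa>. \<Sum>a\<in>A (Suc k). pw E l a)"
    unfolding lessThan_Suc_atMost[symmetric] sum.lessThan_Suc_shift by (simp add: zero)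
  also have "\<dots> \<le> (\<Sum>k<\<kappa>. real \<kappa> * 40 ^ \<kappa> * real (card D))"
    by (intro sum_mono main) auto
  also have "\<dots> = crude \<kappa> * real (card D)" by (simp add: crude_def power2_eq_square)
  finally show ?thesis .
qed

text \<open>Paths that avoid \<open>E\<close> have conditional mean at most
  \<open>fact n / fact m = n\<close>; all others fall under \<open>crude_bound\<close> with
  \<open>D = E\<close>.\<close>

lemma crude_bound_all:
  assumes l: "l \<in> labels" and E: "sparse E" and \<kappa>: "4 * \<kappa> \<le> n"
  shows "(\<Sum>a\<in>{a\<in>paths. hits E a \<le> \<kappa>}. pw E l a) \<le> (1 + 2 * crude \<kappa>) * real n"
proof -
  let ?A = "{a\<in>paths. hits E a \<le> \<kappa> \<and> path_set a \<inter> E \<noteq> {}}" and ?B = "{a\<in>paths. path_set a \<inter> E = {}}"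
  have "(\<Sum>a\<in>{a\<in>paths. hits E a \<le> \<kappa>}. pw E l a) = (\<Sum>a\<in>?A \<union> ?B. pw E l a)"
    by (intro sum.cong) (auto simp: hits_eq_card)
  also have "\<dots> = (\<Sum>a\<in>?A. pw E l a) + (\<Sum>a\<in>?B. pw E l a)"
    using finite_paths by (intro sum.union_disjoint) auto
  also have "(\<Sum>a\<in>?A. pw E l a) \<le> crude \<kappa> * real (card E)" by (rule crude_bound[OF l E _ \<kappa>]) simp
  also have "(\<Sum>a\<in>?B. pw E l a) \<le> fact n / fact m"
    using sum_pw_le[OF l, of "{}" E] by simp
  also have "fact n / fact m = real n" using Suc_m by (metis fact_Suc fact_nonzero nonzero_mult_div_cancel_right of_nat_fact of_nat_mult)
  also have "crude \<kappa> * real (card E) \<le> crude \<kappa> * real (2 * n)"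
    using E by (intro mult_left_mono of_nat_mono) (auto simp: sparse_def crude_def)
  finally show ?thesis by (simp add: algebra_simps)
qed

end

section \<open>Paths meeting an edge set in a prescribed pattern\<close>

text \<open>Positions of edges along a path: a set \<open>J\<close> of positions splits into runs of consecutive numbers.
  \<open>singles J\<close> are the runs of length one, and \<open>covered J\<close> are the positions of the vertices involved.\<close>

definition starts :: "nat set \<Rightarrow> nat set" where "starts J = J - Suc ` J"

definition joints :: "nat set \<Rightarrow> nat set" where "joints J = {j\<in>J. Suc j \<in> J}"

definition singles :: "nat set \<Rightarrow> nat set" where "singles J = starts J - joints J"

definition covered :: "nat set \<Rightarrow> nat set" where "covered J = J \<union> Suc ` J"

definition spread :: "(nat \<Rightarrow> nat) \<Rightarrow> nat set \<Rightarrow> nat" where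
  "spread x J = (\<Sum>j\<in>joints J. x (Suc j) - x j)"

lemma finite_patterns: "finite J \<Longrightarrow> finite (starts J)" "finite J \<Longrightarrow> finite (joints J)"
  "finite J \<Longrightarrow> finite (singles J)" "finite J \<Longrightarrow> finite (covered J)"
  by (auto simp: starts_def joints_def singles_def covered_def)

lemma card_covered: "finite J \<Longrightarrow> card (covered J) = card J + card (starts J)"
proof -
  assume J: "finite J"
  have "covered J = Suc ` J \<union> starts J" by (auto simp: covered_def starts_def)
  then have "card (covered J) = card (Suc ` J) + card (starts J)"
    using J by (simp only:) (intro card_Un_disjoint, auto simp: starts_def)
  then show ?thesis by (simp add: card_image)
qed

lemma card_starts_joints: "finite J \<Longrightarrow> card (starts J) + card (joints J) = card J"
proof -
  assume J: "finite J"
  have "Suc ` joints J = J \<inter> Suc ` J" by (auto simp: joints_def)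
  then have "card (joints J) = card (J \<inter> Suc ` J)" using card_image[of Suc "joints J"] by simp
  moreover have "card (starts J) + card (J \<inter> Suc ` J) = card J"
    using J card_Diff_subset_Int[of J "Suc ` J"] card_mono[of J "J \<inter> Suc ` J"] by (simp add: starts_def)
  ultimately show ?thesis by simp
qed

lemma card_starts_le: "finite J \<Longrightarrow> card (starts J) \<le> card J"
  using card_starts_joints by fastforce

lemma card_singles_le: "finite J \<Longrightarrow> card (singles J) \<le> card (starts J)"
  by (intro card_mono finite_patterns) (auto simp: singles_def)

lemma starts_nonempty: "J \<noteq> {} \<Longrightarrow> starts J \<noteq> {}"
proof
  assume "J \<noteq> {}" "starts J = {}"
  have "Least (\<lambda>j. j \<in> J) \<in> J" using \<open>J \<noteq> {}\<close> by (meson LeastI ex_in_conv)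
  moreover have "Least (\<lambda>j. j \<in> J) \<notin> Suc ` J"
  proof
    assume "Least (\<lambda>j. j \<in> J) \<in> Suc ` J"
    then obtain i where "i \<in> J" "Least (\<lambda>j. j \<in> J) = Suc i" by auto
    then show False using Least_le[of "\<lambda>j. j \<in> J" i] by simp
  qed
  ultimately show False using \<open>starts J = {}\<close> by (auto simp: starts_def)
qed

text \<open>The ways to place the edges \<open>edge d j\<close>, \<open>j \<in> J\<close>, of an unordered pattern on the vertex slots
  \<open>covered J\<close>: only an isolated edge can be reversed.\<close>

definition orientations :: "(nat \<Rightarrow> nat) \<Rightarrow> nat set \<Rightarrow> (nat \<Rightarrow> nat) set" where
  "orientations d J = {g \<in> covered J \<rightarrow>\<^sub>E UNIV. \<forall>j\<in>J. edge g j = edge d j}"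

text \<open>In a run of at least two edges, the vertex shared by two consecutive edges is determined
  as their intersection, and this fixes all other vertices of the run.\<close>

lemma orientations_rigid:
  assumes inj: "inj_on d (covered J)" and g: "g \<in> orientations d J" and u: "u \<in> covered J"
    and ns: "u \<notin> singles J" "u \<notin> Suc ` singles J"
  shows "g u = d u"
proof -
  have e: "edge g j = edge d j" if "j \<in> J" for j using g that by (simp add: orientations_def)
  have dd: "d i = d j \<longleftrightarrow> i = j" if "i \<in> covered J" "j \<in> covered J" for i j
    using inj that by (auto simp: inj_on_def)
  have mid: "g (Suc j) = d (Suc j)" if j: "j \<in> J" "Suc j \<in> J" for j
  proof -
    have "d j \<noteq> d (Suc j)" "d (Suc j) \<noteq> d (Suc (Suc j))" "d j \<noteq> d (Suc (Suc j))"
      using dd j by (auto simp: covered_def)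
    then show ?thesis using e[OF j(1)] e[OF j(2)] by (auto simp: edge_def doubleton_eq_iff)
  qed
  have first: "g j = d j" if j: "j \<in> J" "Suc j \<in> J" for j
    using mid[OF j] e[OF j(1)] by (auto simp: edge_def doubleton_eq_iff)
  have last: "g (Suc j) = d (Suc j)" if j: "j \<in> J" "j \<notin> singles J" for j
  proof (cases "Suc j \<in> J")
    case True then show ?thesis using mid j by simp
  next
    case False
    then have "j \<in> Suc ` J" using j by (auto simp: singles_def starts_def joints_def)
    then obtain i where "j = Suc i" "i \<in> J" by auto
    then have "g j = d j" using mid[of i] j by simp
    then show ?thesis using e[OF j(1)] by (auto simp: edge_def doubleton_eq_iff)
  qed
  show ?thesis
  proof (cases "u \<in> J")
    case True
    then have "u \<in> Suc ` J \<or> Suc u \<in> J" using ns(1) by (auto simp: singles_def starts_def joints_def)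
    then show ?thesis using True mid first by auto
  next
    case False
    then obtain j where "u = Suc j" "j \<in> J" using u by (auto simp: covered_def)
    then show ?thesis using last ns(2) by auto
  qed
qed

lemma card_orientations:
  assumes J: "finite J" and inj: "inj_on d (covered J)"
  shows "card (orientations d J) = 2 ^ card (singles J)"
proof -
  define flip where "flip F = restrict (\<lambda>u. if u \<in> F then d (Suc u) else if u \<in> Suc ` F then d (u - 1) else d u) (covered J)" for F
  have dd: "d i = d j \<longleftrightarrow> i = j" if "i \<in> covered J" "j \<in> covered J" for i j
    using inj that by (auto simp: inj_on_def)
  have sJ: "j \<in> J" "Suc j \<notin> J" "j \<notin> Suc ` J" if "j \<in> singles J" for j
    using that by (auto simp: singles_def starts_def joints_def)
  have cJ: "j \<in> covered J" "Suc j \<in> covered J" if "j \<in> J" for j using that by (auto simp: covered_def)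
  have bij: "bij_betw flip (Pow (singles J)) (orientations d J)"
  proof (rule bij_betwI[where g = "\<lambda>g. {j\<in>singles J. g j = d (Suc j)}"])
    show "flip \<in> Pow (singles J) \<rightarrow> orientations d J"
    proof
      fix F assume F: "F \<in> Pow (singles J)"
      have "edge (flip F) j = edge d j" if j: "j \<in> J" for j
      proof (cases "j \<in> F")
        case True
        then have "Suc j \<notin> F" using F sJ(2)[of j] sJ(1)[of "Suc j"] by auto
        then show ?thesis using True cJ[OF j] by (auto simp: edge_def flip_def)
      next
        case False
        have 1: "j \<notin> Suc ` F"
        proof
          assume "j \<in> Suc ` F"
          then obtain i where "j = Suc i" "i \<in> F" by auto
          then show False using F sJ(2)[of i] j by auto
        qed
        have 2: "Suc j \<notin> F" using F sJ(3)[of "Suc j"] j by auto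
        show ?thesis using False 1 2 cJ[OF j] by (auto simp: edge_def flip_def)
      qed
      then show "flip F \<in> orientations d J" by (simp add: orientations_def flip_def)
    qed
    show "(\<lambda>g. {j\<in>singles J. g j = d (Suc j)}) \<in> orientations d J \<rightarrow> Pow (singles J)" by auto
    show "{j\<in>singles J. flip F j = d (Suc j)} = F" if F: "F \<in> Pow (singles J)" for F
    proof -
      have "flip F j = d (Suc j) \<longleftrightarrow> j \<in> F" if j: "j \<in> singles J" for j
      proof -
        have "j \<notin> Suc ` F" using F sJ(3)[OF j] sJ(1) by auto
        then show ?thesis using j cJ[OF sJ(1)[OF j]] dd[OF cJ[OF sJ(1)[OF j]]] by (auto simp: flip_def)
      qed
      then show ?thesis using F by auto
    qed
    show "flip {j\<in>singles J. g j = d (Suc j)} = g" if g: "g \<in> orientations d J" for g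
    proof
      fix u
      let ?F = "{j\<in>singles J. g j = d (Suc j)}"
      have e: "edge g j = edge d j" if "j \<in> J" for j using g that by (simp add: orientations_def)
      consider "u \<notin> covered J" | "u \<in> singles J" | "u \<in> Suc ` singles J"
        | "u \<in> covered J" "u \<notin> singles J" "u \<notin> Suc ` singles J" by blast
      then show "flip ?F u = g u"
      proof cases
        case 1 then show ?thesis using g by (auto simp: flip_def orientations_def PiE_iff extensional_def)
      next
        case 2
        have "u \<notin> Suc ` ?F" using sJ[OF 2] sJ(1) by auto
        moreover have "g u = d u \<or> g u = d (Suc u)"
          using e[OF sJ(1)[OF 2]] by (auto simp: edge_def doubleton_eq_iff)
        ultimately show ?thesis using 2 cJ(1)[OF sJ(1)[OF 2]] by (auto simp: flip_def)
      next
        case 3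
        then obtain j where j: "u = Suc j" "j \<in> singles J" by auto
        have us: "u \<notin> singles J" using sJ(1)[of u] sJ(2)[OF j(2)] j(1) by auto
        have "d j \<noteq> d (Suc j)" using dd cJ[OF sJ(1)[OF j(2)]] by simp
        moreover have "edge g j = edge d j" using e[OF sJ(1)[OF j(2)]] .
        ultimately show ?thesis using j us cJ(2)[OF sJ(1)[OF j(2)]]
          by (auto simp: flip_def edge_def doubleton_eq_iff)
      next
        case 4
        then show ?thesis using orientations_rigid[OF inj g 4] by (auto simp: flip_def)
      qed
    qed
  qed
  have "card (orientations d J) = card (Pow (singles J))" using bij_betw_same_card[OF bij] by simp
  then show ?thesis using finite_patterns(3)[OF J] by (simp add: card_Pow)
qed

lemma finite_orientations: "finite J \<Longrightarrow> inj_on d (covered J) \<Longrightarrow> finite (orientations d J)"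
  using card_orientations by (metis card.infinite power_not_zero zero_neq_numeral)

text \<open>\<open>d\<close> lists vertices and \<open>J\<close> marks the positions of the edges to
  be met. Injectivity is asked only on the covered positions, so \<open>d\<close> may be a
  concatenation of two paths. The conditions on labels say what positions in a single increasing
  path satisfy automatically: labels increase along runs, and no label of the pattern lies strictly
  between those of two consecutive edges of a run.\<close>

locale pattern = labelling +
  fixes d :: "nat \<Rightarrow> nat" and J :: "nat set" and l :: "nat set \<Rightarrow> nat" and E :: "nat set set"
  assumes finJ: "finite J" and inj: "inj_on d (covered J)" and l: "l \<in> labels"
    and EK: "E \<subseteq> K_edges n" and SE: "edge d ` J \<subseteq> E"
    and x_inj: "inj_on (\<lambda>j. l (edge d j)) J"
    and x_less: "\<And>j. j \<in> J \<Longrightarrow> Suc j \<in> J \<Longrightarrow> l (edge d j) < l (edge d (Suc j))"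
    and no_between: "\<And>i j. i \<in> J \<Longrightarrow> Suc i \<in> J \<Longrightarrow> j \<in> J \<Longrightarrow> l (edge d i) < l (edge d j) \<Longrightarrow> \<not> l (edge d j) < l (edge d (Suc i))"
    and card_J: "card J \<le> m"
begin

abbreviation "x j \<equiv> l (edge d j)"
abbreviation "S \<equiv> edge d ` J"

text \<open>Consecutive edges of a run share a vertex, so a path through both has them in adjacent
  positions, and its labels omit every value strictly between theirs.\<close>

definition Gap :: "nat set" where "Gap = (\<Union>j\<in>joints J. {x j<..<x (Suc j)})"

definition TJ :: "(nat \<Rightarrow> nat) set" where
  "TJ = {t\<in>incs. x ` J \<subseteq> t ` {..<m} \<and> t ` {..<m} \<inter> Gap = {}}"

definition slot :: "(nat \<Rightarrow> nat) \<Rightarrow> nat \<Rightarrow> nat" where "slot t j = inv_into {..<m} t (x j)"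

text \<open>The last vertex of a run is covered but is not the position of an edge of
  \<open>J\<close>; its place is one after that of the last edge.\<close>

definition vslot :: "(nat \<Rightarrow> nat) \<Rightarrow> nat \<Rightarrow> nat" where
  "vslot t u = (if u \<in> J then slot t u else Suc (slot t (u - 1)))"

definition fits :: "(nat \<Rightarrow> nat) \<Rightarrow> (nat \<Rightarrow> nat) set" where
  "fits t = {a\<in>paths. path_set a \<inter> E = S \<and> t \<in> match E l a}"

lemma finite_fits: "finite (fits t)" using finite_paths by (simp add: fits_def)

lemma finite_TJ: "finite TJ" using finite_incs by (simp add: TJ_def)

lemma inj_edge_d: "inj_on (edge d) J"
  using x_inj by (auto simp: inj_on_def)

lemma card_S: "card S = card J" by (simp add: card_image inj_edge_d)

lemma xQ: "j \<in> J \<Longrightarrow> x j < Q"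
  using l SE EK by (auto simp: labels_def)

lemma Union_S: "\<Union>S = d ` covered J"
  by (auto simp: edge_def covered_def)

lemma card_Union_S: "card (\<Union>S) = card J + card (starts J)"
  unfolding Union_S using inj by (simp add: card_image card_covered finJ)

lemma fits_slot:
  assumes t: "t \<in> incs" and a: "a \<in> fits t" and j: "j \<in> J"
  shows "slot t j < m \<and> edge a (slot t j) = edge d j \<and> t (slot t j) = x j"
proof -
  have "edge d j \<in> path_set a" using a j by (auto simp: fits_def)
  then obtain i where i: "i < m" "edge d j = edge a i" by (auto simp: path_set_def)
  then have "t i = x j" using a j SE by (auto simp: fits_def match_def)
  moreover have "slot t j = i"
    unfolding slot_def \<open>t i = x j\<close>[symmetric] using i by (intro inv_into_f_f incs_inj[OF t]) auto
  ultimately show ?thesis using i by simp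
qed

lemma slot_TJ:
  assumes t: "t \<in> TJ" and j: "j \<in> J"
  shows "slot t j < m" "t (slot t j) = x j"
proof -
  have "x j \<in> t ` {..<m}" using t j by (auto simp: TJ_def)
  then show "slot t j < m" "t (slot t j) = x j"
    unfolding slot_def using inv_into_into[of "x j" t "{..<m}"] f_inv_into_f[of "x j" t "{..<m}"] by auto
qed

lemma slot_less_iff: "t \<in> TJ \<Longrightarrow> i \<in> J \<Longrightarrow> j \<in> J \<Longrightarrow> slot t i < slot t j \<longleftrightarrow> x i < x j"
proof -
  assume a: "t \<in> TJ" "i \<in> J" "j \<in> J"
  have "t (slot t i) < t (slot t j) \<longleftrightarrow> slot t i < slot t j"
    by (rule incs_less_iff) (use a slot_TJ(1)[OF a(1)] in \<open>auto simp: TJ_def\<close>)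
  then show ?thesis using slot_TJ(2)[OF a(1,2)] slot_TJ(2)[OF a(1,3)] by simp
qed

lemma slot_inj: "t \<in> TJ \<Longrightarrow> inj_on (slot t) J"
proof (rule inj_onI)
  fix i j assume t: "t \<in> TJ" and ij: "i \<in> J" "j \<in> J" "slot t i = slot t j"
  then have "x i = x j" using slot_TJ[OF t] by metis
  then show "i = j" using x_inj ij by (auto simp: inj_on_def)
qed

lemma slot_Suc:
  assumes t: "t \<in> TJ" and j: "j \<in> J" "Suc j \<in> J"
  shows "slot t (Suc j) = Suc (slot t j)"
proof (rule ccontr)
  assume ne: "slot t (Suc j) \<noteq> Suc (slot t j)"
  have "slot t j < slot t (Suc j)" using slot_less_iff[OF t j] x_less[OF j] by simp
  then have lt: "Suc (slot t j) < slot t (Suc j)" using ne by simp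
  have m: "slot t (Suc j) < m" using slot_TJ[OF t j(2)] by simp
  have ti: "t \<in> incs" using t by (simp add: TJ_def)
  have "x j < t (Suc (slot t j))" "t (Suc (slot t j)) < x (Suc j)"
    using incs_less_iff[OF ti] lt m slot_TJ[OF t j(1)] slot_TJ[OF t j(2)] by (metis Suc_lessD lessI less_trans)+
  then have "t (Suc (slot t j)) \<in> t ` {..<m} \<inter> Gap" using j lt m by (auto simp: Gap_def joints_def)
  then show False using t by (auto simp: TJ_def)
qed

lemma fits_empty:
  assumes t: "t \<in> incs" and n: "t \<notin> TJ"
  shows "fits t = {}"
proof (rule ccontr)
  assume "fits t \<noteq> {}"
  then obtain a where a: "a \<in> fits t" by auto
  have ap: "a \<in> paths" using a by (simp add: fits_def)
  have "x ` J \<subseteq> t ` {..<m}" using fits_slot[OF t a] by (metis (no_types, lifting) image_eqI image_subsetI lessThan_iff)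
  then obtain j i where j: "j \<in> J" "Suc j \<in> J" and i: "i < m" "x j < t i" "t i < x (Suc j)"
    using n t by (auto simp: TJ_def Gap_def joints_def)
  note s = fits_slot[OF t a j(1)] and s' = fits_slot[OF t a j(2)]
  have "edge a (slot t j) \<inter> edge a (slot t (Suc j)) \<noteq> {}" using s s' by (auto simp: edge_def)
  then have "slot t j = slot t (Suc j) \<or> slot t j = Suc (slot t (Suc j)) \<or> slot t (Suc j) = Suc (slot t j)"
    using edge_meet_iff[OF ap] by blast
  moreover have "slot t j < i" "i < slot t (Suc j)"
    using incs_less_iff[OF t, of "slot t j" i] incs_less_iff[OF t, of i "slot t (Suc j)"] s s' i by auto
  ultimately show False by auto
qed

text \<open>Once \<open>t\<close> belongs to \<open>TJ\<close>, the label conditions are settled by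
  placing each edge of the pattern at its slot; what remains concerns the vertex order alone, which
  is then accessible to counting permutations.\<close>

lemma fits_iff:
  assumes t: "t \<in> TJ"
  shows "fits t = {a\<in>paths. (\<forall>j\<in>J. edge a (slot t j) = edge d j) \<and> (\<forall>i<m. i \<notin> slot t ` J \<longrightarrow> edge a i \<notin> E)}"
    (is "_ = ?R")
proof
  have ti: "t \<in> incs" using t by (simp add: TJ_def)
  show "fits t \<subseteq> ?R"
  proof
    fix a assume a: "a \<in> fits t"
    have "edge a i \<notin> E" if i: "i < m" "i \<notin> slot t ` J" for i
    proof
      assume E: "edge a i \<in> E"
      then have "edge a i \<in> S" using a i(1) by (auto simp: fits_def path_set_def)
      then obtain j where j: "j \<in> J" "edge a i = edge d j" by auto
      have "t i = x j" using a i(1) E j by (auto simp: fits_def match_def)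
      then have "i = slot t j" using slot_TJ[OF t j(1)] incs_eq_iff[OF ti i(1)] by metis
      then show False using i(2) j(1) by simp
    qed
    then show "a \<in> ?R" using a fits_slot[OF ti a] by (auto simp: fits_def)
  qed
  show "?R \<subseteq> fits t"
  proof
    fix a assume a: "a \<in> ?R"
    have ts: "t \<in> seqs" using ti by (simp add: incs_def)
    have 1: "\<exists>j\<in>J. i = slot t j" if "i < m" "edge a i \<in> E" for i using a that by auto
    have "path_set a \<inter> E \<subseteq> S" using a 1 by (fastforce simp: path_set_def)
    moreover have "S \<subseteq> path_set a \<inter> E"
    proof
      fix e assume "e \<in> S"
      then obtain j where j: "j \<in> J" "e = edge d j" by auto
      then have "e = edge a (slot t j)" using a by auto
      then show "e \<in> path_set a \<inter> E" using slot_TJ(1)[OF t j(1)] j SE by (auto simp: path_set_def)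
    qed
    moreover have "t i = l (edge a i)" if i: "i < m" "edge a i \<in> E" for i
    proof -
      obtain j where j: "j \<in> J" "i = slot t j" using 1[OF i] by blast
      then have "edge a i = edge d j" using a by auto
      then show ?thesis using slot_TJ(2)[OF t j(1)] j(2) by simp
    qed
    ultimately show "a \<in> fits t" using a ts by (auto simp: fits_def match_def)
  qed
qed

lemma vslot_Suc: "t \<in> TJ \<Longrightarrow> j \<in> J \<Longrightarrow> vslot t j = slot t j \<and> vslot t (Suc j) = Suc (slot t j)"
  using slot_Suc by (auto simp: vslot_def)

lemma card_fits_sum:
  assumes t: "t \<in> TJ"
  shows "card (fits t) = (\<Sum>g\<in>orientations d J.
    card {a\<in>paths. (\<forall>u\<in>covered J. a (vslot t u) = g u) \<and> (\<forall>i<m. i \<notin> slot t ` J \<longrightarrow> edge a i \<notin> E)})"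
proof -
  let ?g = "\<lambda>a. restrict (\<lambda>u. a (vslot t u)) (covered J)"
  have ed: "edge (?g a) j = edge a (slot t j)" if "j \<in> J" for a j
    using vslot_Suc[OF t that] that by (simp add: edge_def covered_def)
  have im: "?g ` fits t \<subseteq> orientations d J"
    using ed by (auto simp: fits_iff[OF t] orientations_def)
  have "card (fits t) = (\<Sum>g\<in>orientations d J. card {a\<in>fits t. ?g a = g})"
  proof -
    have "(\<Sum>a\<in>fits t. 1) = (\<Sum>g\<in>orientations d J. \<Sum>a\<in>{a\<in>fits t. ?g a = g}. (1::nat))"
      by (rule sum.group[symmetric, OF finite_fits finite_orientations[OF finJ inj] im])
    then show ?thesis by simp
  qed
  also have "\<dots> = (\<Sum>g\<in>orientations d J. card {a\<in>paths. (\<forall>u\<in>covered J. a (vslot t u) = g u) \<and> (\<forall>i<m. i \<notin> slot t ` J \<longrightarrow> edge a i \<notin> E)})"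
  proof (intro sum.cong refl arg_cong[where f = card])
    fix g assume g: "g \<in> orientations d J"
    have gx: "?g a = g \<longleftrightarrow> (\<forall>u\<in>covered J. a (vslot t u) = g u)" for a
      using g by (auto simp: orientations_def fun_eq_iff PiE_iff extensional_def restrict_def)
    have "(\<forall>j\<in>J. edge a (slot t j) = edge d j)" if "?g a = g" for a
      using that ed g by (auto simp: orientations_def)
    then show "{a\<in>fits t. ?g a = g} = {a\<in>paths. (\<forall>u\<in>covered J. a (vslot t u) = g u) \<and> (\<forall>i<m. i \<notin> slot t ` J \<longrightarrow> edge a i \<notin> E)}"
      unfolding fits_iff[OF t] using gx by blast
  qed
  finally show ?thesis .
qed

lemma vslot_n: "t \<in> TJ \<Longrightarrow> u \<in> covered J \<Longrightarrow> vslot t u < n"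
  using vslot_Suc slot_TJ(1) lt_m by (auto simp: covered_def)

text \<open>As soon as one path exists for an orientation, it maps the pinned places injectively
  onto the vertices of the pattern, so their number is \<open>card (covered J)\<close>. This covers
  also those \<open>t\<close> for which two runs might collide.\<close>

lemma card_fits_le:
  assumes t: "t \<in> TJ"
  shows "card (fits t) \<le> 2 ^ card (singles J) * fact (n - card (covered J))"
proof -
  have "card {a\<in>paths. (\<forall>u\<in>covered J. a (vslot t u) = g u) \<and> (\<forall>i<m. i \<notin> slot t ` J \<longrightarrow> edge a i \<notin> E)} \<le> fact (n - card (covered J))"
    (is "card ?A \<le> _") if g: "g \<in> orientations d J" for g
  proof (cases "?A = {}")
    case False
    then obtain a0 where a0: "a0 \<in> ?A" by auto
    define U where "U = vslot t ` covered J"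
    have U: "U \<subseteq> {..<n}" using vslot_n[OF t] by (auto simp: U_def)
    have "U = (\<Union>j\<in>J. {vslot t j, vslot t (Suc j)})" unfolding U_def covered_def by blast
    also have "\<dots> = (\<Union>j\<in>J. {slot t j, Suc (slot t j)})"
      by (intro SUP_cong refl) (simp add: vslot_Suc[OF t])
    finally have "a0 ` U = (\<Union>j\<in>J. edge a0 (slot t j))"
      by (simp add: image_UN edge_def)
    also have "\<dots> = (\<Union>j\<in>J. edge d j)"
    proof -
      have "edge a0 (slot t j) = edge d j" if j: "j \<in> J" for j
      proof -
        have "a0 (vslot t j) = g j" "a0 (vslot t (Suc j)) = g (Suc j)" using a0 j by (auto simp: covered_def)
        then have "edge a0 (slot t j) = edge g j" using vslot_Suc[OF t j] by (simp add: edge_def)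
        then show ?thesis using g j by (simp add: orientations_def)
      qed
      then show ?thesis by auto
    qed
    finally have im: "a0 ` U = d ` covered J" using Union_S by simp
    have "card U = card (a0 ` U)" using a0 path_inj by (intro card_image[symmetric]) (auto simp: inj_on_def)
    then have cU: "card U = card (covered J)" unfolding im using inj by (simp add: card_image)
    have "?A \<subseteq> {a\<in>paths. \<forall>u\<in>U. a u = a0 u}" using a0 by (auto simp: U_def)
    then have "card ?A \<le> card {a\<in>paths. \<forall>u\<in>U. a u = a0 u}" using finite_paths by (intro card_mono) auto
    then show ?thesis using card_pinned[OF _ U, of a0] a0 cU by simp
  qed (simp only: card.empty)
  then have "card (fits t) \<le> (\<Sum>g\<in>orientations d J. fact (n - card (covered J)))"
    unfolding card_fits_sum[OF t] by (rule sum_mono)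
  then show ?thesis using card_orientations[OF finJ inj] by simp
qed

lemma card_Gap: "card Gap + card (joints J) = spread x J" and Gap_disj: "x ` J \<inter> Gap = {}"
proof -
  show "x ` J \<inter> Gap = {}" using no_between by (auto simp: Gap_def joints_def)
  \<comment> \<open>If two gaps overlapped, the larger of their lower ends would lie strictly inside
    the other gap, against \<open>no_between\<close>.\<close>
  have disj: "{x i<..<x (Suc i)} \<inter> {x j<..<x (Suc j)} = {}" if ij: "i \<in> joints J" "j \<in> joints J" "i \<noteq> j" for i j
  proof (rule ccontr)
    assume "{x i<..<x (Suc i)} \<inter> {x j<..<x (Suc j)} \<noteq> {}"
    then have *: "x i < x (Suc j)" "x j < x (Suc i)" by auto
    have J: "i \<in> J" "Suc i \<in> J" "j \<in> J" "Suc j \<in> J" using ij by (auto simp: joints_def)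
    have "x i \<noteq> x j" using x_inj ij J by (auto simp: inj_on_def)
    then show False using no_between[OF J(1,2,3)] no_between[OF J(3,4,1)] * by linarith
  qed
  have "card Gap = (\<Sum>j\<in>joints J. card {x j<..<x (Suc j)})"
    unfolding Gap_def using disj finite_patterns[OF finJ] by (intro card_UN_disjoint) auto
  then have "card Gap + card (joints J) = (\<Sum>j\<in>joints J. card {x j<..<x (Suc j)} + 1)" by (simp add: sum_Suc)
  also have "\<dots> = spread x J" unfolding spread_def
  proof (intro sum.cong refl)
    fix j assume "j \<in> joints J"
    then show "card {x j<..<x (Suc j)} + 1 = x (Suc j) - x j" using x_less[of j] by (simp add: joints_def)
  qed
  finally show "card Gap + card (joints J) = spread x J" .
qed

lemma Gap_Q: "Gap \<subseteq> {..<Q}"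
proof
  fix y assume "y \<in> Gap"
  then obtain j where "Suc j \<in> J" "y < x (Suc j)" by (auto simp: Gap_def joints_def)
  then show "y \<in> {..<Q}" using xQ[of "Suc j"] by simp
qed

text \<open>The label set contains the \<open>card J\<close> prescribed values, avoids
  \<open>Gap\<close>, and is otherwise free. Since joints and run starts together number
  \<open>card J\<close>, the excluded values amount to the spread plus one per run.\<close>

lemma card_TJ: "card TJ = (Q - (spread x J + card (starts J))) choose (m - card J)"
proof -
  have X: "x ` J \<subseteq> {..<Q}" using xQ by auto
  have G: "Gap \<subseteq> {..<Q}" by (rule Gap_Q)
  have cX: "card (x ` J) = card J" using x_inj by (simp add: card_image)
  have "card TJ = (Q - card J - card Gap) choose (m - card J)"
    unfolding TJ_def card_incs_image[of "\<lambda>B. x ` J \<subseteq> B \<and> B \<inter> Gap = {}"]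
    using card_subsets_between[OF _ X G Gap_disj, of m] card_J by (simp add: cX)
  also have "Q - card J - card Gap = Q - (spread x J + card (starts J))"
    using card_Gap card_starts_joints[OF finJ] by linarith
  finally show ?thesis .
qed

lemma spread_le: "spread x J + card (starts J) \<le> Q"
proof -
  have X: "x ` J \<subseteq> {..<Q}" using xQ by auto
  have G: "Gap \<subseteq> {..<Q}" by (rule Gap_Q)
  have "card (x ` J \<union> Gap) \<le> Q" using card_mono[of "{..<Q}" "x ` J \<union> Gap"] X G by simp
  moreover have "card (x ` J \<union> Gap) = card (x ` J) + card Gap"
    using Gap_disj finJ finite_subset[OF G] by (intro card_Un_disjoint) auto
  moreover have "card (x ` J) = card J" using x_inj by (simp add: card_image)
  ultimately show ?thesis using card_Gap card_starts_joints[OF finJ] by linarith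
qed

lemma sum_pw_fits:
  "(\<Sum>a\<in>{a\<in>paths. path_set a \<inter> E = S}. pw E l a) = real Q ^ card J / real Q ^ m * (\<Sum>t\<in>TJ. real (card (fits t)))"
proof -
  have "(\<Sum>a\<in>{a\<in>paths. path_set a \<inter> E = S}. pw E l a)
     = real Q ^ card J / real Q ^ m * (\<Sum>t\<in>incs. real (card {a\<in>{a\<in>paths. path_set a \<inter> E = S}. t \<in> match E l a}))"
    by (rule sum_pw_swap) (auto simp: hits_eq_card card_S)
  also have "(\<Sum>t\<in>incs. real (card {a\<in>{a\<in>paths. path_set a \<inter> E = S}. t \<in> match E l a})) = (\<Sum>t\<in>incs. real (card (fits t)))"
    by (intro sum.cong refl arg_cong[where f = "\<lambda>A. real (card A)"]) (auto simp: fits_def)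
  also have "\<dots> = (\<Sum>t\<in>TJ. real (card (fits t)))"
    by (rule sum.mono_neutral_right) (use finite_incs fits_empty in \<open>auto simp: TJ_def\<close>)
  finally show ?thesis .
qed

lemma sum_pw_pattern_le:
  "(\<Sum>a\<in>{a\<in>paths. path_set a \<inter> E = S}. pw E l a)
   \<le> 2 ^ card (singles J) * fact (n - card (covered J))
      * real ((Q - (spread x J + card (starts J))) choose (m - card J)) / real Q ^ (m - card J)"
proof -
  have "(\<Sum>t\<in>TJ. real (card (fits t))) \<le> (\<Sum>t\<in>TJ. real (2 ^ card (singles J) * fact (n - card (covered J))))"
    by (intro sum_mono of_nat_mono card_fits_le)
  also have "\<dots> = real (card TJ) * (2 ^ card (singles J) * fact (n - card (covered J)))" by simp
  finally have 1: "(\<Sum>t\<in>TJ. real (card (fits t))) \<le> real (card TJ) * (2 ^ card (singles J) * fact (n - card (covered J)))" .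
  have Qm: "real Q ^ m = real Q ^ card J * real Q ^ (m - card J)"
    using card_J by (simp flip: power_add)
  have "(\<Sum>a\<in>{a\<in>paths. path_set a \<inter> E = S}. pw E l a)
    \<le> real Q ^ card J / real Q ^ m * (real (card TJ) * (2 ^ card (singles J) * fact (n - card (covered J))))"
    unfolding sum_pw_fits by (rule mult_left_mono[OF 1]) simp
  also have "\<dots> = 2 ^ card (singles J) * fact (n - card (covered J)) * real (card TJ) / real Q ^ (m - card J)"
    unfolding Qm using Q1 by (simp add: field_simps)
  finally show ?thesis by (simp add: card_TJ)
qed

end

section \<open>Pairs of paths with large overlap\<close>

definition gap_funs :: "nat set \<Rightarrow> nat \<Rightarrow> (nat \<Rightarrow> nat) set" where
  "gap_funs A s = {g \<in> A \<rightarrow>\<^sub>E {..s}. sum g A \<le> s}"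

lemma finite_gap_funs: "finite A \<Longrightarrow> finite (gap_funs A s)"
  unfolding gap_funs_def by (intro finite_subset[OF _ finite_PiE[of A "\<lambda>_. {..s}"]]) auto

lemma gap_funs_le: "finite A \<Longrightarrow> g \<in> A \<rightarrow>\<^sub>E UNIV \<Longrightarrow> sum g A \<le> s \<Longrightarrow> g \<in> gap_funs A s"
proof -
  assume A: "finite A" "g \<in> A \<rightarrow>\<^sub>E UNIV" "sum g A \<le> s"
  have "g i \<le> s" if "i \<in> A" for i
    by (rule order.trans[OF member_le_sum A(3)]) (use A that in auto)
  then show ?thesis using A by (auto simp: gap_funs_def PiE_iff)
qed

lemma sum_gap_funs_Un:
  fixes F :: "(nat \<Rightarrow> nat) \<Rightarrow> (nat \<Rightarrow> nat) \<Rightarrow> nat"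
  assumes A: "finite A" and B: "finite B" and AB: "A \<inter> B = {}"
  shows "(\<Sum>g\<in>gap_funs (A \<union> B) s. F (restrict g A) (restrict g B))
    = (\<Sum>h\<in>gap_funs A s. \<Sum>h'\<in>gap_funs B (s - sum h A). F h h')"
proof -
  have "(\<Sum>h\<in>gap_funs A s. \<Sum>h'\<in>gap_funs B (s - sum h A). F h h')
    = (\<Sum>(h,h')\<in>Sigma (gap_funs A s) (\<lambda>h. gap_funs B (s - sum h A)). F h h')"
    by (rule sum.Sigma) (auto simp: finite_gap_funs A B)
  also have "\<dots> = (\<Sum>g\<in>gap_funs (A \<union> B) s. F (restrict g A) (restrict g B))"
  proof (rule sum.reindex_bij_witness[of _ "\<lambda>g. (restrict g A, restrict g B)" "\<lambda>(h,h'). override_on h h' B"])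
    fix z assume z: "z \<in> Sigma (gap_funs A s) (\<lambda>h. gap_funs B (s - sum h A))"
    obtain h h' where hh: "z = (h, h')" "h \<in> gap_funs A s" "h' \<in> gap_funs B (s - sum h A)" using z by auto
    have rA: "restrict (override_on h h' B) A = h"
      using hh(2) AB by (intro ext) (auto simp: override_on_def gap_funs_def PiE_iff extensional_def)
    have rB: "restrict (override_on h h' B) B = h'"
      using hh(3) AB by (intro ext) (auto simp: override_on_def gap_funs_def PiE_iff extensional_def)
    show "(restrict (case z of (h, h') \<Rightarrow> override_on h h' B) A, restrict (case z of (h, h') \<Rightarrow> override_on h h' B) B) = z"
      by (simp add: hh(1) rA rB)
    have "sum (override_on h h' B) (A \<union> B) = sum (override_on h h' B) A + sum (override_on h h' B) B"
      by (rule sum.union_disjoint[OF A B AB])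
    also have "sum (override_on h h' B) A = sum h A" using AB by (intro sum.cong) (auto simp: override_on_def)
    also have "sum (override_on h h' B) B = sum h' B" by (intro sum.cong) (auto simp: override_on_def)
    also have "sum h A + sum h' B \<le> s" using hh by (auto simp: gap_funs_def)
    finally have "override_on h h' B \<in> gap_funs (A \<union> B) s"
      by (intro gap_funs_le) (use A B hh in \<open>auto simp: gap_funs_def PiE_iff extensional_def override_on_def\<close>)
    then show "(case z of (h, h') \<Rightarrow> override_on h h' B) \<in> gap_funs (A \<union> B) s" by (simp add: hh(1))
    show "F (restrict (case z of (h, h') \<Rightarrow> override_on h h' B) A) (restrict (case z of (h, h') \<Rightarrow> override_on h h' B) B) = (case z of (h, h') \<Rightarrow> F h h')"
      by (simp add: hh(1) rA rB)
  next
    fix g assume g: "g \<in> gap_funs (A \<union> B) s"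
    show "(case (restrict g A, restrict g B) of (h, h') \<Rightarrow> override_on h h' B) = g"
      using g by (intro ext) (auto simp: override_on_def gap_funs_def PiE_iff extensional_def)
    have s: "sum g A + sum g B \<le> s" using g sum.union_disjoint[OF A B AB, of g] by (simp add: gap_funs_def)
    have "restrict g A \<in> gap_funs A s" "restrict g B \<in> gap_funs B (s - sum g A)"
      using s by (auto intro!: gap_funs_le A B)
    then show "(restrict g A, restrict g B) \<in> Sigma (gap_funs A s) (\<lambda>h. gap_funs B (s - sum h A))"
      by simp
  qed
  finally show ?thesis by simp
qed

text \<open>One coordinate is summed out at a time; each step is the hockey-stick identity, which
  raises both entries of the binomial by one. For \<open>p = 0\<close> it bounds the number of gap
  vectors.\<close>

lemma sum_gap_funs_choose_le:
  "finite A \<Longrightarrow> s \<le> M \<Longrightarrow> (\<Sum>g\<in>gap_funs A s. (M - sum g A) choose p) \<le> (M + card A) choose (p + card A)"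
proof (induction A arbitrary: s M rule: finite_induct)
  case empty
  have "gap_funs {} s = {\<lambda>_. undefined}" by (auto simp: gap_funs_def)
  then show ?case by simp
next
  case (insert a A)
  have "(\<Sum>g\<in>gap_funs (insert a A) s. (M - sum g (insert a A)) choose p)
    = (\<Sum>g\<in>gap_funs ({a} \<union> A) s. (M - (sum (restrict g {a}) {a} + sum (restrict g A) A)) choose p)"
    using insert by (intro sum.cong) auto
  also have "\<dots> = (\<Sum>h\<in>gap_funs {a} s. \<Sum>h'\<in>gap_funs A (s - sum h {a}). (M - (sum h {a} + sum h' A)) choose p)"
    by (rule sum_gap_funs_Un) (use insert in auto)
  also have "\<dots> \<le> (\<Sum>h\<in>gap_funs {a} s. (M - h a + card A) choose (p + card A))"
  proof (rule sum_mono)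
    fix h assume h: "h \<in> gap_funs {a} s"
    have "(\<Sum>h'\<in>gap_funs A (s - h a). (M - h a - sum h' A) choose p) \<le> (M - h a + card A) choose (p + card A)"
      using insert by (intro insert.IH) simp
    then show "(\<Sum>h'\<in>gap_funs A (s - sum h {a}). (M - (sum h {a} + sum h' A)) choose p) \<le> (M - h a + card A) choose (p + card A)"
      by simp
  qed
  also have "\<dots> = (\<Sum>v\<le>s. (M - v + card A) choose (p + card A))"
    by (rule sum.reindex_bij_witness[of _ "\<lambda>v. restrict (\<lambda>_. v) {a}" "\<lambda>h. h a"])
       (auto simp: gap_funs_def PiE_iff extensional_def fun_eq_iff)
  also have "\<dots> \<le> (\<Sum>v\<le>M. (M - v + card A) choose (p + card A))"
    using insert.prems by (intro sum_mono2) auto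
  also have "\<dots> = (\<Sum>j\<le>M. (j + card A) choose (p + card A))"
    by (rule sum.reindex_bij_witness[of _ "\<lambda>j. M - j" "\<lambda>v. M - v"]) auto
  also have "\<dots> = (\<Sum>k\<in>(\<lambda>j. j + card A) ` {..M}. k choose (p + card A))"
    by (subst sum.reindex) (auto simp: inj_on_def)
  also have "\<dots> \<le> (\<Sum>k\<le>M + card A. k choose (p + card A))"
    by (intro sum_mono2) auto
  also have "\<dots> = (M + card (insert a A)) choose (p + card (insert a A))"
    using insert by (simp add: sum_choose_upper)
  finally show ?case .
qed

text \<open>After enlarging one factor to \<open>(A + q) choose q\<close>, the product regroups as
  choosing \<open>p + q\<close> elements out of \<open>A + q\<close> and then \<open>q\<close> of
  these.\<close>

lemma choose_mult_le: "(A choose p) * (A choose q) \<le> ((p + q) choose q) * ((A + q) choose (p + q))"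
proof (cases "p \<le> A")
  case True
  have "((p + q) choose q) * ((A + q) choose (p + q)) = (A choose p) * ((A + q) choose q)"
  proof -
    have "((A + q) choose (p + q)) * ((p + q) choose q) = ((A + q) choose q) * ((A + q - q) choose (p + q - q))"
      by (rule choose_mult) (use True in auto)
    then show ?thesis by (simp add: mult_ac)
  qed
  moreover have "A choose q \<le> (A + q) choose q" by (rule binomial_right_mono) simp
  ultimately show ?thesis by simp
next
  case False
  then show ?thesis by (simp add: binomial_eq_0)
qed

text \<open>The recursion on \<open>M\<close> has to know whether the last position
  \<open>M - 1\<close> is occupied, because adding \<open>M\<close> then prolongs a run instead of
  opening one.\<close>

definition runs_at :: "nat \<Rightarrow> nat \<Rightarrow> nat \<Rightarrow> nat set set" where
  "runs_at M k r = {J. J \<subseteq> {..<M} \<and> card J = k \<and> card (starts J) = r \<and> M \<in> Suc ` J}"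

definition runs_off :: "nat \<Rightarrow> nat \<Rightarrow> nat \<Rightarrow> nat set set" where
  "runs_off M k r = {J. J \<subseteq> {..<M} \<and> card J = k \<and> card (starts J) = r \<and> M \<notin> Suc ` J}"

lemma finite_runs: "finite (runs_at M k r)" "finite (runs_off M k r)"
  by (rule finite_subset[of _ "Pow {..<M}"], auto simp: runs_at_def runs_off_def)+

lemma starts_insert:
  assumes "J \<subseteq> {..<M}"
  shows "starts (insert M J) = (if M \<in> Suc ` J then starts J else insert M (starts J))"
  using assms by (auto simp: starts_def)

lemma runs_off_Suc: "runs_off (Suc M) k r \<subseteq> runs_at M k r \<union> runs_off M k r"
  by (auto simp: runs_at_def runs_off_def less_Suc_eq subset_iff) 

lemma card_runs_at_Suc: "card (runs_at (Suc M) (Suc k) (Suc r)) \<le> card (runs_at M k (Suc r)) + card (runs_off M k r)"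
proof -
  have "card (runs_at (Suc M) (Suc k) (Suc r)) \<le> card (runs_at M k (Suc r) \<union> runs_off M k r)"
  proof (rule card_inj_on_le[where f = "\<lambda>J. J - {M}"])
    show "inj_on (\<lambda>J. J - {M}) (runs_at (Suc M) (Suc k) (Suc r))"
      by (rule inj_onI) (auto simp: runs_at_def)
    show "(\<lambda>J. J - {M}) ` runs_at (Suc M) (Suc k) (Suc r) \<subseteq> runs_at M k (Suc r) \<union> runs_off M k r"
    proof
      fix J' assume "J' \<in> (\<lambda>J. J - {M}) ` runs_at (Suc M) (Suc k) (Suc r)"
      then obtain J where J: "J \<in> runs_at (Suc M) (Suc k) (Suc r)" "J' = J - {M}" by auto
      have MJ: "M \<in> J" "J = insert M J'" using J by (auto simp: runs_at_def)
      have J'M: "J' \<subseteq> {..<M}" using J by (auto simp: runs_at_def less_Suc_eq)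
      have fin: "finite J'" using J'M finite_subset by auto
      have "card J = Suc k" using J by (simp add: runs_at_def)
      moreover have "card J = Suc (card J')" using card_insert_disjoint[OF fin, of M] J'M by (subst MJ(2)) auto
      ultimately have c: "card J' = k" by simp
      have s: "card (starts J) = Suc r" using J by (simp add: runs_at_def)
      have "M \<notin> starts J'" using J'M by (auto simp: starts_def)
      then have "card (starts J') = (if M \<in> Suc ` J' then Suc r else r)"
        using s finite_patterns(1)[OF fin] unfolding starts_insert[OF J'M, folded MJ(2)] by (auto split: if_splits)
      then show "J' \<in> runs_at M k (Suc r) \<union> runs_off M k r"
        using J'M c by (auto simp: runs_at_def runs_off_def split: if_splits)
    qed
  qed (simp add: finite_runs)
  then show ?thesis using card_Un_le le_trans by blast
qed

lemma runs_off_0: "card (runs_off M (Suc k) 0) = 0" "card (runs_at M (Suc k) 0) = 0"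
proof -
  have "starts J \<noteq> {}" "finite (starts J)" if "J \<subseteq> {..<M}" "card J = Suc k" for J
    using that starts_nonempty[of J] finite_patterns(1)[of J] finite_subset[of J "{..<M}"] by fastforce+
  then have "runs_off M (Suc k) 0 = {}" "runs_at M (Suc k) 0 = {}" unfolding runs_off_def runs_at_def by auto
  then show "card (runs_off M (Suc k) 0) = 0" "card (runs_at M (Suc k) 0) = 0" by simp_all
qed

lemma runs_empty: "runs_at M 0 r = {}" "runs_off M 0 (Suc r) = {}" "runs_off M 0 0 \<subseteq> {{}}"
proof -
  have z: "J = {}" if "J \<subseteq> {..<M}" "card J = 0" for J using that finite_subset[of J "{..<M}"] by auto
  have "J \<notin> runs_at M 0 r" for J using z[of J] unfolding runs_at_def by blast
  then show "runs_at M 0 r = {}" by blast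
  have "J = {} \<and> r' = 0" if "J \<in> runs_off M 0 r'" for J r'
    using z[of J] that by (simp add: runs_off_def starts_def)
  then show "runs_off M 0 (Suc r) = {}" "runs_off M 0 0 \<subseteq> {{}}" by blast+
qed

text \<open>The first binomial splits the elements into runs, the second distributes the runs among
  the \<open>M - Suc k\<close> unoccupied positions. The two recursions, for an occupied and for a
  free last position, are instances of Pascal's rule.\<close>

lemma card_runs_le:
  "card (runs_at M (Suc k) (Suc r)) \<le> (k choose r) * ((M - Suc k) choose r) \<and>
   card (runs_off M (Suc k) (Suc r)) \<le> (k choose r) * ((M - Suc k) choose (Suc r))"
proof (induction M arbitrary: k r)
  case 0
  have "runs_at 0 (Suc k) (Suc r) = {}" "runs_off 0 (Suc k) (Suc r) = {}" by (auto simp: runs_at_def runs_off_def)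
  then show ?case by simp
next
  case (Suc M)
  have "card (runs_off (Suc M) (Suc k) (Suc r)) \<le> card (runs_at M (Suc k) (Suc r)) + card (runs_off M (Suc k) (Suc r))"
    by (rule order.trans[OF card_mono[OF _ runs_off_Suc] card_Un_le]) (simp add: finite_runs)
  also have "\<dots> \<le> (k choose r) * ((Suc M - Suc k) choose (Suc r))"
  proof (cases "Suc k \<le> M")
    case True
    then have "Suc M - Suc k = Suc (M - Suc k)" by simp
    then show ?thesis using Suc.IH[of k r] by (simp add: distrib_left)
  next
    case False
    have "card J \<noteq> Suc k" if "J \<subseteq> {..<M}" for J using card_mono[of "{..<M}" J] that False by auto
    then have "runs_at M (Suc k) (Suc r) = {}" "runs_off M (Suc k) (Suc r) = {}" by (auto simp: runs_at_def runs_off_def)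
    then show ?thesis by simp
  qed
  finally have off: "card (runs_off (Suc M) (Suc k) (Suc r)) \<le> (k choose r) * ((Suc M - Suc k) choose (Suc r))" .
  have "card (runs_at (Suc M) (Suc k) (Suc r)) \<le> card (runs_at M k (Suc r)) + card (runs_off M k r)"
    by (rule card_runs_at_Suc)
  also have "\<dots> \<le> (k choose r) * ((Suc M - Suc k) choose r)"
  proof (cases k)
    case 0
    show ?thesis
    proof (cases r)
      case r: 0
      have "card (runs_off M 0 0) \<le> 1" using card_mono[OF _ runs_empty(3)] by simp
      then show ?thesis using 0 r by (simp add: runs_empty)
    qed (simp add: 0 runs_empty)
  next
    case k: (Suc k')
    show ?thesis
    proof (cases r)
      case 0
      then show ?thesis using Suc.IH[of k' 0] by (simp add: k runs_off_0)
    next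
      case r: (Suc r')
      have "card (runs_at M k (Suc r)) \<le> (k' choose r) * ((M - k) choose r)" using Suc.IH[of k' r] by (simp add: k)
      moreover have "card (runs_off M k r) \<le> (k' choose r') * ((M - k) choose r)" using Suc.IH[of k' r'] by (simp add: k r)
      ultimately show ?thesis by (simp add: k r distrib_right)
    qed
  qed
  finally show ?case using off by simp
qed

lemma card_patterns_le:
  assumes k: "1 \<le> k" and r: "1 \<le> r" and kM: "k \<le> M"
  shows "card {J. J \<subseteq> {..<M} \<and> card J = k \<and> card (starts J) = r} \<le> ((k - 1) choose (r - 1)) * ((M - k + 1) choose r)"
proof -
  obtain k' r' where kr: "k = Suc k'" "r = Suc r'" using k r by (metis Suc_le_D One_nat_def)
  have "{J. J \<subseteq> {..<M} \<and> card J = k \<and> card (starts J) = r} \<subseteq> runs_at M k r \<union> runs_off M k r"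
    by (auto simp: runs_at_def runs_off_def)
  then have "card {J. J \<subseteq> {..<M} \<and> card J = k \<and> card (starts J) = r} \<le> card (runs_at M k r \<union> runs_off M k r)"
    by (intro card_mono) (auto simp: finite_runs)
  also have "\<dots> \<le> card (runs_at M k r) + card (runs_off M k r)" by (rule card_Un_le)
  also have "\<dots> \<le> ((k - 1) choose (r - 1)) * ((M - k + 1) choose r)"
    using card_runs_le[of M k' r'] by (simp add: kr distrib_left)
  finally show ?thesis .
qed

section \<open>Expectations over labellings and the mean overlap of two increasing paths\<close>

context labelling begin

definition ex :: "((nat set \<Rightarrow> nat) \<Rightarrow> real) \<Rightarrow> real" where
  "ex f = (\<Sum>l\<in>labels. f l) / real Q ^ card (K_edges n)"

lemma ex_const: "ex (\<lambda>_. c) = c"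
  using Q1 by (simp add: ex_def card_labels)

lemma ex_mono: "(\<And>l. l \<in> labels \<Longrightarrow> f l \<le> g l) \<Longrightarrow> ex f \<le> ex g"
  unfolding ex_def by (intro divide_right_mono sum_mono) auto

lemma ex_nonneg: "(\<And>l. l \<in> labels \<Longrightarrow> 0 \<le> f l) \<Longrightarrow> 0 \<le> ex f"
  unfolding ex_def by (intro divide_nonneg_nonneg sum_nonneg) auto

lemma ex_add: "ex (\<lambda>l. f l + g l) = ex f + ex g"
  by (simp add: ex_def sum.distrib add_divide_distrib)

lemma ex_cmult: "ex (\<lambda>l. c * f l) = c * ex f"
  by (simp add: ex_def sum_distrib_left)

lemma ex_sum: "ex (\<lambda>l. \<Sum>i\<in>A. f i l) = (\<Sum>i\<in>A. ex (f i))"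
  unfolding ex_def by (subst sum.swap) (simp add: sum_divide_distrib)

text \<open>Stands for measurability with respect to the labels on \<open>E\<close>.\<close>

abbreviation dep :: "nat set set \<Rightarrow> ((nat set \<Rightarrow> nat) \<Rightarrow> real) \<Rightarrow> bool" where
  "dep E F \<equiv> \<forall>l\<in>labels. \<forall>l'\<in>labels. (\<forall>e\<in>E. l e = l' e) \<longrightarrow> F l = F l'"

definition Inc :: "(nat set \<Rightarrow> nat) \<Rightarrow> (nat \<Rightarrow> nat) \<Rightarrow> real" where
  "Inc l a = of_bool (inc (lab l a))"

lemma ex_path:
  assumes "a \<in> paths" "E \<subseteq> K_edges n" "dep E F"
  shows "ex (\<lambda>l. F l * \<phi> (lab l a)) = ex (\<lambda>l. F l * (real Q ^ hits E a / real Q ^ m * (\<Sum>t\<in>match E l a. \<phi> t)))"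
proof -
  have H: "F l = F l'" if "l \<in> labels" "l' \<in> labels" "\<And>e. e \<in> E \<Longrightarrow> l e = l' e" for l l'
    using assms(3) that by blast
  show ?thesis unfolding ex_def
    by (rule arg_cong[where f = "\<lambda>z. z / _"], rule sum_labels_path[OF assms(1,2)], rule H)
qed

lemma finite_match: "finite (match E l a)" using finite_seqs by (simp add: match_def)

lemma ex_Inc:
  assumes "a \<in> paths" "E \<subseteq> K_edges n" "dep E F"
  shows "ex (\<lambda>l. F l * Inc l a) = ex (\<lambda>l. F l * pw E l a)"
  unfolding Inc_def pw_def using ex_path[OF assms, of "\<lambda>t. of_bool (inc t)"] finite_match
  by (simp add: of_bool_def sum.If_cases Int_def)

lemma ex_lab:
  assumes a: "a \<in> paths"
  shows "ex (\<lambda>l. \<phi> (lab l a)) = (\<Sum>t\<in>seqs. \<phi> t) / real Q ^ m"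
proof -
  have "match {} l a = seqs" for l by (simp add: match_def)
  then show ?thesis using ex_path[OF a, of "{}" "\<lambda>_. 1" \<phi>] by (simp add: hits_def ex_const)
qed

lemma inc_iff_incs: "a \<in> paths \<Longrightarrow> l \<in> labels \<Longrightarrow> inc (lab l a) \<longleftrightarrow> lab l a \<in> incs"
  using lab_in_seqs by (simp add: incs_def)

lemma spread_lab: "J \<subseteq> {..<m} \<Longrightarrow> spread (\<lambda>j. l (edge a j)) J = spread (lab l a) J"
  unfolding spread_def by (intro sum.cong refl) (auto simp: joints_def lab_def)

lemma path_pattern:
  assumes a: "a \<in> paths" and l: "l \<in> labels" and i: "inc (lab l a)" and J: "J \<subseteq> {..<m}"
  shows "pattern n Q a J l (path_set a)"
proof
  have t: "lab l a \<in> incs" using i inc_iff_incs[OF a l] by simp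
  have lt: "l (edge a i) < l (edge a j) \<longleftrightarrow> i < j" if "i < m" "j < m" for i j
    using incs_less_iff[OF t that] that by (simp add: lab_def)
  show "finite J" using J finite_subset by auto
  show "inj_on a (covered J)" using path_inj[OF a] by (auto simp: inj_on_def)
  show "l \<in> labels" by fact
  show "path_set a \<subseteq> K_edges n" by (rule path_set_K[OF a])
  show "edge a ` J \<subseteq> path_set a" using J by (auto simp: path_set_def)
  show "inj_on (\<lambda>j. l (edge a j)) J"
    using J lt by (auto simp: inj_on_def) (metis lessThan_iff linorder_neqE_nat nat_less_le subsetD)
  show "l (edge a j) < l (edge a (Suc j))" if "j \<in> J" "Suc j \<in> J" for j
    using lt J that by auto
  show "\<not> l (edge a j) < l (edge a (Suc i))" if "i \<in> J" "Suc i \<in> J" "j \<in> J" "l (edge a i) < l (edge a j)" for i j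
  proof -
    have "i < m" "Suc i < m" "j < m" using J that by auto
    then show ?thesis using lt[of i j] lt[of j "Suc i"] that(4) by auto
  qed
  show "card J \<le> m" using card_mono[OF _ J] by simp
qed

text \<open>The part of \<open>sum_pw_pattern_le\<close> that depends on the pattern only through
  its size \<open>k\<close> and its number \<open>r\<close> of runs, after relaxing the number of
  single edges to \<open>r\<close>.\<close>

definition chi :: "nat \<Rightarrow> nat \<Rightarrow> real" where
  "chi k r = 2 ^ r * fact (n - (k + r)) / real Q ^ (m - k)"

lemma sum_overlap_le:
  assumes a: "a \<in> paths" and l: "l \<in> labels" and i: "inc (lab l a)"
  shows "(\<Sum>b\<in>{b\<in>paths. hits (path_set a) b = k}. pw (path_set a) l b)
    \<le> (\<Sum>J\<in>{J. J \<subseteq> {..<m} \<and> card J = k}. chi k (card (starts J)) *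
          real ((Q - (spread (lab l a) J + card (starts J))) choose (m - k)))"
proof -
  let ?P = "{b\<in>paths. hits (path_set a) b = k}" and ?JJ = "{J. J \<subseteq> {..<m} \<and> card J = k}"
  define f where "f b = {j\<in>{..<m}. edge a j \<in> path_set b}" for b
  have ef: "path_set b \<inter> path_set a = edge a ` f b" for b by (auto simp: f_def path_set_def)
  have cf: "card (f b) = hits (path_set a) b" if "b \<in> paths" for b
    unfolding hits_eq_card[OF that] ef by (rule card_image[OF inj_edge[OF a], symmetric])
  have "(\<Sum>b\<in>?P. pw (path_set a) l b) = (\<Sum>J\<in>?JJ. \<Sum>b\<in>{b\<in>?P. f b = J}. pw (path_set a) l b)"
  proof (rule sum.group[symmetric])
    show "finite ?P" using finite_paths by simp
    show "finite ?JJ" by (rule finite_subset[of _ "Pow {..<m}"]) auto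
    show "f ` ?P \<subseteq> ?JJ" using cf by (auto simp: f_def)
  qed
  also have "\<dots> \<le> (\<Sum>J\<in>?JJ. chi k (card (starts J)) * real ((Q - (spread (lab l a) J + card (starts J))) choose (m - k)))"
  proof (rule sum_mono)
    fix J assume J: "J \<in> ?JJ"
    interpret pattern n Q a J l "path_set a" by (rule path_pattern[OF a l i]) (use J in auto)
    have "(\<Sum>b\<in>{b\<in>?P. f b = J}. pw (path_set a) l b) \<le> (\<Sum>b\<in>{b\<in>paths. path_set b \<inter> path_set a = edge a ` J}. pw (path_set a) l b)"
      by (rule sum_mono2) (use finite_paths pw_nonneg ef in auto)
    also have "\<dots> \<le> 2 ^ card (singles J) * fact (n - card (covered J))
        * real ((Q - (spread (\<lambda>j. l (edge a j)) J + card (starts J))) choose (m - card J)) / real Q ^ (m - card J)"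
      by (rule sum_pw_pattern_le)
    also have "\<dots> \<le> 2 ^ card (starts J) * fact (n - card (covered J))
        * real ((Q - (spread (\<lambda>j. l (edge a j)) J + card (starts J))) choose (m - card J)) / real Q ^ (m - card J)"
      using card_singles_le[OF finJ] by (intro divide_right_mono mult_right_mono power_increasing) auto
    also have "\<dots> = chi k (card (starts J)) * real ((Q - (spread (lab l a) J + card (starts J))) choose (m - k))"
      using J by (simp add: chi_def card_covered[OF finJ] spread_lab)
    finally show "(\<Sum>b\<in>{b\<in>?P. f b = J}. pw (path_set a) l b) \<le> chi k (card (starts J)) * real ((Q - (spread (lab l a) J + card (starts J))) choose (m - k))" .
  qed
  finally show ?thesis .
qed

text \<open>Increasing sequences are encoded by their gaps; the gaps inside the runs of \<open>J\<close> determine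
  the spread of \<open>J\<close>.\<close>

lemma sum_incs_choose_le:
  assumes J: "J \<subseteq> {..<m}" and k: "card J = k" and r: "card (starts J) = r"
  shows "(\<Sum>t\<in>incs. (Q - (spread t J + r)) choose (m - k))
    \<le> ((2 * (m - k) + r) choose (m - k)) * ((Q + (m - k)) choose (2 * (m - k) + k))"
proof (cases "incs = {}")
  case False
  define N where "N = m - k"
  define I where "I = Suc ` joints J"
  define C where "C = {..<m} - I"
  define \<kappa> where "\<kappa> = card (joints J)"
  \<comment> \<open>One is subtracted from each difference so that the gaps range over nonnegative
    integers; their total is at most \<open>Q - m\<close>.\<close>
  define gp where "gp t = restrict (\<lambda>i. if i = 0 then t 0 else t i - t (i - 1) - 1) {..<m}" for t :: "nat \<Rightarrow> nat"
  have finJ: "finite J" using J finite_subset by auto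
  have km: "k \<le> m" using card_mono[OF _ J] k by simp
  have rk: "r + \<kappa> = k" using card_starts_joints[OF finJ] k r by (simp add: \<kappa>_def)
  have Im: "I \<subseteq> {..<m}" "0 \<notin> I" using J by (auto simp: I_def joints_def)
  have cI: "card I = \<kappa>" by (simp add: I_def \<kappa>_def card_image)
  have fin: "finite I" "finite C" using Im finite_subset by (auto simp: C_def)
  have cC: "card C = N + r" using Im fin cI rk km by (simp add: C_def N_def card_Diff_subset)
  have mQ: "m \<le> Q" using card_incs False finite_incs by (metis binomial_eq_0_iff card_0_eq not_less)
  have partial: "(\<Sum>j<Suc i. gp t j) + i = t i" if t: "t \<in> incs" and i: "i < m" for t i
    using i
  proof (induction i)
    case (Suc i)
    then have "t i < t (Suc i)" using incs_less_iff[OF t] by simp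
    then show ?case using Suc by (simp add: gp_def)
  qed (use m_pos in \<open>simp add: gp_def\<close>)
  have gpQ: "gp t \<in> gap_funs {..<m} (Q - m)" if t: "t \<in> incs" for t
  proof (rule gap_funs_le)
    have "(\<Sum>j<m. gp t j) + (m - 1) = t (m - 1)" using partial[OF t, of "m - 1"] m_pos by simp
    moreover have "t (m - 1) < Q" using incs_bound[OF t] m_pos by simp
    ultimately show "sum (gp t) {..<m} \<le> Q - m" using m_pos by linarith
  qed (auto simp: gp_def)
  have inj: "inj_on gp incs"
  proof (rule inj_onI)
    fix t t' assume tt: "t \<in> incs" "t' \<in> incs" "gp t = gp t'"
    show "t = t'"
    proof
      fix i show "t i = t' i"
      proof (cases "i < m")
        case True then show ?thesis using partial[OF tt(1) True] partial[OF tt(2) True] tt(3) by simp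
      next
        case False then show ?thesis using tt by (auto simp: incs_def seqs_def PiE_iff extensional_def)
      qed
    qed
  qed
  have spr: "spread t J = \<kappa> + sum (gp t) I" if t: "t \<in> incs" for t
  proof -
    have "sum (gp t) I = (\<Sum>j\<in>joints J. gp t (Suc j))" by (simp add: I_def sum.reindex)
    then have "\<kappa> + sum (gp t) I = (\<Sum>j\<in>joints J. Suc (gp t (Suc j)))" by (simp add: sum_Suc \<kappa>_def)
    also have "\<dots> = spread t J" unfolding spread_def
    proof (intro sum.cong refl)
      fix j assume "j \<in> joints J"
      then have "Suc j < m" using J by (auto simp: joints_def)
      then show "Suc (gp t (Suc j)) = t (Suc j) - t j" using incs_less_iff[OF t, of j "Suc j"] by (simp add: gp_def)
    qed
    finally show ?thesis by simp
  qed
  have "(\<Sum>t\<in>incs. (Q - (spread t J + r)) choose N) = (\<Sum>t\<in>incs. (Q - k - sum (gp t) I) choose N)"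
    by (intro sum.cong refl) (simp add: spr rk[symmetric] algebra_simps)
  also have "\<dots> = (\<Sum>g\<in>gp ` incs. (Q - k - sum g I) choose N)" by (simp add: sum.reindex[OF inj])
  also have "\<dots> \<le> (\<Sum>g\<in>gap_funs {..<m} (Q - m). (Q - k - sum g I) choose N)"
    using gpQ by (intro sum_mono2) (auto simp: finite_gap_funs)
  also have "{..<m} = I \<union> C" using Im by (auto simp: C_def)
  also have "(\<Sum>g\<in>gap_funs (I \<union> C) (Q - m). (Q - k - sum g I) choose N)
     = (\<Sum>g\<in>gap_funs (I \<union> C) (Q - m). (\<lambda>h h'. (Q - k - sum h I) choose N) (restrict g I) (restrict g C))"
    by simp
  \<comment> \<open>The summand sees only the gaps inside runs, so the other \<open>N + r\<close>
    gaps are merely counted. Their number and the binomial of the summand are then merged by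
    \<open>choose_mult_le\<close> into a single binomial, ready for the hockey-stick summation over
    the inner gaps.\<close>
  also have "\<dots> = (\<Sum>h\<in>gap_funs I (Q - m). \<Sum>h'\<in>gap_funs C (Q - m - sum h I). (Q - k - sum h I) choose N)"
    by (rule sum_gap_funs_Un) (use fin in \<open>auto simp: C_def\<close>)
  also have "\<dots> \<le> (\<Sum>h\<in>gap_funs I (Q - m). ((2 * N + r) choose N) * ((Q - \<kappa> + N - sum h I) choose (2 * N + r)))"
  proof (rule sum_mono)
    fix h assume h: "h \<in> gap_funs I (Q - m)"
    define y where "y = sum h I"
    have y: "y \<le> Q - m" using h by (simp add: gap_funs_def y_def)
    have "card (gap_funs C (Q - m - y)) \<le> (Q - m - y + (N + r)) choose (N + r)"
      using sum_gap_funs_choose_le[OF fin(2) order.refl, of "Q - m - y" 0] by (simp add: cC)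
    also have "Q - m - y + (N + r) = Q - \<kappa> - y" using y mQ rk km by (simp add: N_def)
    finally have c: "card (gap_funs C (Q - m - y)) \<le> (Q - \<kappa> - y) choose (N + r)" .
    have "(Q - k - y) choose N \<le> (Q - \<kappa> - y) choose N" using rk by (intro binomial_right_mono) linarith
    then have "(\<Sum>h'\<in>gap_funs C (Q - m - y). (Q - k - y) choose N) \<le> ((Q - \<kappa> - y) choose (N + r)) * ((Q - \<kappa> - y) choose N)"
      using c by (simp add: mult_le_mono)
    also have "\<dots> \<le> ((N + r + N) choose N) * ((Q - \<kappa> - y + N) choose (N + r + N))" by (rule choose_mult_le)
    also have "\<dots> = ((2 * N + r) choose N) * ((Q - \<kappa> + N - y) choose (2 * N + r))"
    proof -
      have "N + r + N = 2 * N + r" "Q - \<kappa> - y + N = Q - \<kappa> + N - y" using y mQ rk km by linarith+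
      then show ?thesis by (simp only:)
    qed
    finally show "(\<Sum>h'\<in>gap_funs C (Q - m - sum h I). (Q - k - sum h I) choose N) \<le> ((2 * N + r) choose N) * ((Q - \<kappa> + N - sum h I) choose (2 * N + r))"
      by (simp add: y_def)
  qed
  also have "\<dots> = ((2 * N + r) choose N) * (\<Sum>h\<in>gap_funs I (Q - m). (Q - \<kappa> + N - sum h I) choose (2 * N + r))"
    by (simp add: sum_distrib_left)
  also have "\<dots> \<le> ((2 * N + r) choose N) * ((Q - \<kappa> + N + card I) choose (2 * N + r + card I))"
    using rk km by (intro mult_le_mono2 sum_gap_funs_choose_le fin) simp
  also have "\<dots> = ((2 * N + r) choose N) * ((Q + N) choose (2 * N + k))"
  proof -
    have "Q - \<kappa> + N + card I = Q + N" "2 * N + r + card I = 2 * N + k" using mQ rk km cI by linarith+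
    then show ?thesis by (simp only:)
  qed
  finally show ?thesis by (simp add: N_def)
qed simp

end

text \<open>For a fixed path, \<open>3 * tau (m - k) k / fact m\<close> bounds the expected number
  of increasing paths sharing exactly \<open>k\<close> edges with it, counted only when the fixed
  path is increasing. The sum runs over the number \<open>r\<close> of runs, and \<open>N\<close> is
  the number of edges not shared; \<open>(N + 1) choose r\<close> times a factorial leaves the
  factor \<open>(N + 1) / fact r\<close>.\<close>

definition tau :: "nat \<Rightarrow> nat \<Rightarrow> real" where
  "tau N k = real (N + 1) * (\<Sum>r=1..N+1. 2 ^ r / fact r * real ((k - 1) choose (r - 1))
     * (fact (N + k) * fact (2 * N + r) / (fact (N + r) * fact (2 * N + k))))"

text \<open>The quotient is a product of \<open>k - r\<close> ratios of corresponding factors, each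
  at most \<open>q\<close>.\<close>

lemma fact_ratio_le:
  assumes rk: "r \<le> k" and q: "\<And>i. i < k - r \<Longrightarrow> real (a + r + Suc i) \<le> q * real (b + r + Suc i)" and q0: "0 \<le> q"
  shows "fact (a + k) * fact (b + r) / (fact (a + r) * fact (b + k)) \<le> q ^ (k - r)"
proof -
  have "fact (a + r + j) * fact (b + r) \<le> q ^ j * (fact (a + r) * (fact (b + r + j) :: real))" if "j \<le> k - r" for j
    using that
  proof (induction j)
    case (Suc j)
    have "fact (a + r + Suc j) * fact (b + r) = real (a + r + Suc j) * (fact (a + r + j) * (fact (b + r) :: real))"
      by (simp add: algebra_simps)
    also have "\<dots> \<le> (q * real (b + r + Suc j)) * (q ^ j * (fact (a + r) * fact (b + r + j)))"
      by (rule mult_mono) (use Suc q q0 in \<open>auto simp del: of_nat_add of_nat_Suc\<close>)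
    also have "\<dots> = q ^ Suc j * (fact (a + r) * fact (b + r + Suc j))" by (simp add: algebra_simps)
    finally show ?case .
  qed simp
  from this[of "k - r"] have "fact (a + k) * fact (b + r) \<le> q ^ (k - r) * (fact (a + r) * (fact (b + k) :: real))"
    using rk by simp
  then show ?thesis by (simp add: divide_le_eq)
qed

lemma exp_partial_sum: "0 \<le> (z::real) \<Longrightarrow> finite A \<Longrightarrow> (\<Sum>j\<in>A. z ^ j / fact j) \<le> exp z"
proof -
  assume z: "0 \<le> z" and A: "finite A"
  have s: "(\<lambda>j. z ^ j / fact j) sums exp z"
    using exp_converges[of z] by (simp add: divide_inverse mult_ac scaleR_conv_of_real)
  show ?thesis using sum_le_suminf[OF sums_summable[OF s] A] sums_unique[OF s] z by simp
qed

lemma pow_div_fact_le_exp: "0 \<le> (z::real) \<Longrightarrow> z ^ j / fact j \<le> exp z"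
  using exp_partial_sum[of z "{j}"] by simp

text \<open>This is \<open>100 / 101 + 1 / 202\<close>: a ratio bound for overlaps that leave one
  edge in a hundred unshared, plus a slack that pays for a binomial coefficient.\<close>

definition tail_rate :: real where "tail_rate = 201 / 202"

lemma tail_rate: "0 < tail_rate" "tail_rate < 1" by (auto simp: tail_rate_def)

text \<open>A factor \<open>x / (x + N)\<close> with \<open>x \<le> 100 * N\<close> is at most
  \<open>100 / 101\<close>, which gives geometric decay in \<open>k - r\<close>. One term of the
  binomial expansion of \<open>(1 / 202 + 100 / 101) ^ (k - 1)\<close> absorbs
  \<open>(k - 1) choose (r - 1)\<close> at the price of \<open>202 ^ r\<close>, which together with
  \<open>2 ^ r\<close> makes \<open>404 ^ r\<close> and is harmless against
  \<open>fact r\<close>.\<close>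

lemma tau_le_bulk:
  assumes k: "1 \<le> k" and N: "N + k \<le> 100 * N"
  shows "tau N k \<le> real (N + 1) * (exp 404 * tail_rate ^ (k - 1))"
proof -
  let ?\<rho> = "100 / 101 :: real"
  have "(\<Sum>r=1..N+1. 2 ^ r / fact r * real ((k - 1) choose (r - 1))
     * (fact (N + k) * fact (2 * N + r) / (fact (N + r) * fact (2 * N + k))))
     \<le> (\<Sum>r=1..N+1. 404 ^ r / fact r * tail_rate ^ (k - 1))"
  proof (rule sum_mono)
    fix r assume r: "r \<in> {1..N+1}"
    show "2 ^ r / fact r * real ((k - 1) choose (r - 1))
     * (fact (N + k) * fact (2 * N + r) / (fact (N + r) * fact (2 * N + k))) \<le> 404 ^ r / fact r * tail_rate ^ (k - 1)"
    proof (cases "r \<le> k")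
      case True
      have 1: "fact (N + k) * fact (2 * N + r) / (fact (N + r) * fact (2 * N + k)) \<le> ?\<rho> ^ (k - r)"
        using True N by (intro fact_ratio_le) (auto simp: field_simps)
      have 2: "real ((k - 1) choose (r - 1)) * (1 / 202) ^ (r - 1) * ?\<rho> ^ (k - r) \<le> tail_rate ^ (k - 1)"
      proof -
        have "real ((k - 1) choose (r - 1)) * (1 / 202) ^ (r - 1) * ?\<rho> ^ (k - 1 - (r - 1))
          \<le> (\<Sum>j\<le>k - 1. real ((k - 1) choose j) * (1 / 202) ^ j * ?\<rho> ^ (k - 1 - j))"
          using True r by (intro member_le_sum) auto
        also have "\<dots> = (1 / 202 + ?\<rho>) ^ (k - 1)" by (rule binomial_ring[symmetric])
        also have "1 / 202 + ?\<rho> = tail_rate" by (simp add: tail_rate_def)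
        also have "k - 1 - (r - 1) = k - r" using r by auto
        finally show ?thesis .
      qed
      have "real ((k - 1) choose (r - 1)) * (fact (N + k) * fact (2 * N + r) / (fact (N + r) * fact (2 * N + k)))
         \<le> real ((k - 1) choose (r - 1)) * ?\<rho> ^ (k - r)" by (intro mult_left_mono 1) auto
      also have "\<dots> = 202 ^ (r - 1) * (real ((k - 1) choose (r - 1)) * (1 / 202) ^ (r - 1) * ?\<rho> ^ (k - r))"
        by (simp add: power_divide)
      also have "\<dots> \<le> 202 ^ r * tail_rate ^ (k - 1)"
        using tail_rate by (intro mult_mono 2 power_increasing) auto
      finally have "2 ^ r / fact r * (real ((k - 1) choose (r - 1)) * (fact (N + k) * fact (2 * N + r) / (fact (N + r) * fact (2 * N + k))))
        \<le> 2 ^ r / fact r * (202 ^ r * tail_rate ^ (k - 1))" by (intro mult_left_mono) auto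
      also have "\<dots> = (2 * 202) ^ r / fact r * tail_rate ^ (k - 1)" by (simp only: power_mult_distrib) simp
      finally show ?thesis by (simp add: mult_ac)
    next
      case False
      then show ?thesis using tail_rate k r by (simp add: binomial_eq_0)
    qed
  qed
  also have "\<dots> = (\<Sum>r=1..N+1. 404 ^ r / fact r) * tail_rate ^ (k - 1)" by (simp only: sum_distrib_right)
  also have "\<dots> \<le> exp 404 * tail_rate ^ (k - 1)"
    using tail_rate by (intro mult_right_mono exp_partial_sum) auto
  finally show ?thesis unfolding tau_def by (intro mult_left_mono) auto
qed

text \<open>A convolution of an exponential and a geometric series, hence summable in
  \<open>N\<close>, and free of \<open>k\<close>. The constants bound \<open>12 * exp 1\<close> and
  \<open>2 * exp 1 / 25\<close> using 3 for \<open>exp 1\<close>.\<close>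

definition diag_bound :: "nat \<Rightarrow> real" where
  "diag_bound N = 2 * exp 1 * (\<Sum>j\<le>N. (36 ^ j / fact j) * (6 / 25) ^ (N - j))"

text \<open>For nearly coinciding paths the ratios of \<open>tau_le_bulk\<close> approach 1.
  Instead, the \<open>N\<close> factors by which \<open>fact (2 * N + k)\<close> exceeds
  \<open>fact (N + k)\<close> are all at least \<open>N + k + 1\<close>; they beat the binomial
  coefficient, which is of order \<open>(N + k + 1) ^ j / fact j\<close> with
  \<open>j \<le> N\<close>. A factor \<open>2 ^ N\<close> is set aside for the prefactor
  \<open>N + 1\<close>.\<close>

lemma tau_le_diag:
  assumes k: "1 \<le> k" and N: "100 * N \<le> N + k"
  shows "tau N k \<le> diag_bound N"
proof -
  let ?n = "real (N + k + 1)"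
  have np: "0 < ?n" by simp
  have e3: "exp 1 \<le> (3::real)" by (rule exp_le)
  have summand: "2 ^ Suc j / fact (Suc j) * real ((k - 1) choose j)
     * (fact (N + k) * fact (2 * N + Suc j) / (fact (N + Suc j) * fact (2 * N + k)))
     \<le> 2 / 2 ^ N * (exp 1 * ((36 ^ j / fact j) * (6 / 25) ^ (N - j)))" if j: "j \<le> N" for j
  proof (cases "Suc j \<le> k")
    case True
    have A: "fact (2 * N + Suc j) / fact (N + Suc j) \<le> real (3 * N + 1) ^ N"
    proof -
      have "fact (N + Suc j + i) \<le> real (3 * N + 1) ^ i * (fact (N + Suc j) :: real)" if "i \<le> N" for i
        using that
      proof (induction i)
        case (Suc i)
        have "fact (N + Suc j + Suc i) = real (N + Suc j + Suc i) * (fact (N + Suc j + i) :: real)" by simp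
        also have "\<dots> \<le> real (3 * N + 1) * (real (3 * N + 1) ^ i * fact (N + Suc j))"
          using Suc j by (intro mult_mono) auto
        finally show ?case by simp
      qed simp
      from this[of N] have "fact (2 * N + Suc j) \<le> real (3 * N + 1) ^ N * (fact (N + Suc j) :: real)"
      proof -
        assume H: "N \<le> N \<Longrightarrow> fact (N + Suc j + N) \<le> real (3 * N + 1) ^ N * (fact (N + Suc j) :: real)"
        have "2 * N + Suc j = N + Suc j + N" by simp
        then show ?thesis using H[OF order.refl] by (simp only:)
      qed
      then show ?thesis by (subst pos_divide_le_eq) (rule fact_gt_zero)
    qed
    have B: "?n ^ N * fact (N + k) \<le> (fact (2 * N + k) :: real)"
    proof -
      have "2 * N + k = N + k + N" by simp
      moreover have "?n ^ N * fact (N + k) \<le> (fact (N + k + N) :: real)" by (rule fact_add_ge) auto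
      ultimately show ?thesis by (simp only:)
    qed
    have "fact (N + k) * fact (2 * N + Suc j) / (fact (N + Suc j) * fact (2 * N + k))
      = (fact (2 * N + Suc j) / fact (N + Suc j)) * (fact (N + k) / (fact (2 * N + k) :: real))" by simp
    also have "\<dots> \<le> real (3 * N + 1) ^ N * (1 / ?n ^ N)"
      using A B np by (intro mult_mono) (auto simp: field_simps)
    finally have R: "fact (N + k) * fact (2 * N + Suc j) / (fact (N + Suc j) * fact (2 * N + k)) \<le> (real (3 * N + 1) / ?n) ^ N"
      by (simp add: power_divide)
    have C: "real ((k - 1) choose j) \<le> ?n ^ j / fact j"
    proof -
      have "((k - 1) choose j) * fact j \<le> (k - 1) ^ j" by (rule binomial_fact_pow)
      then have "real (((k - 1) choose j) * fact j) \<le> real ((k - 1) ^ j)" by (simp only: of_nat_le_iff)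
      also have "\<dots> \<le> ?n ^ j" unfolding of_nat_power by (intro power_mono) auto
      finally show ?thesis by (simp add: field_simps)
    qed
    have D: "2 ^ Suc j / fact (Suc j) \<le> 2 * 2 ^ j / (fact j :: real)"
    proof -
      have "2 ^ Suc j / fact (Suc j) \<le> 2 ^ Suc j / (fact j :: real)"
        by (intro divide_left_mono fact_mono mult_pos_pos) auto
      then show ?thesis by simp
    qed
    have "2 ^ Suc j / fact (Suc j) * real ((k - 1) choose j)
     * (fact (N + k) * fact (2 * N + Suc j) / (fact (N + Suc j) * fact (2 * N + k)))
      \<le> (2 * 2 ^ j / fact j) * (?n ^ j / fact j) * (real (3 * N + 1) / ?n) ^ N"
      by (intro mult_mono R C D) auto
    also have "(real (3 * N + 1) / ?n) ^ N = (real (3 * N + 1) / ?n) ^ j * (real (3 * N + 1) / ?n) ^ (N - j)"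
      using j by (simp flip: power_add)
    also have "(2 * 2 ^ j / fact j) * (?n ^ j / fact j) * ((real (3 * N + 1) / ?n) ^ j * (real (3 * N + 1) / ?n) ^ (N - j))
      = 2 * ((2 * real (3 * N + 1)) ^ j / fact j) / fact j * (real (3 * N + 1) / ?n) ^ (N - j)"
    proof -
      have gen: "(2 * 2 ^ j / F) * (w ^ j / F) * ((z / w) ^ j * y) = 2 * ((2 * z) ^ j / F) / F * y"
        if "w \<noteq> 0" for z w F y :: real
        using that by (simp add: power_divide power_mult_distrib)
      show ?thesis by (rule gen) simp
    qed
    also have "\<dots> \<le> 2 * (exp (real N + 1) * 6 ^ j) / fact j * (1 / 25) ^ (N - j)"
    proof -
      \<comment> \<open>One of the two factorials is spent on
        \<open>z ^ j / fact j \<le> exp z\<close> with \<open>z = N + 1 / 3\<close>; the resulting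
        \<open>exp (N + 1)\<close> is later shared out as \<open>N\<close> factors
        \<open>exp 1\<close> among both powers.\<close>
      have "(2 * real (3 * N + 1) / 6) ^ j / fact j \<le> exp (2 * real (3 * N + 1) / 6)"
        by (rule pow_div_fact_le_exp) simp
      also have "\<dots> \<le> exp (real N + 1)" by simp
      finally have "(2 * real (3 * N + 1)) ^ j / fact j \<le> exp (real N + 1) * 6 ^ j"
        by (simp add: power_divide field_simps)
      \<comment> \<open>For \<open>N \<ge> 1\<close> one has
        \<open>25 * (3 * N + 1) \<le> 100 * N \<le> N + k\<close>; for \<open>N = 0\<close> the
        exponent vanishes.\<close>
      moreover have "(real (3 * N + 1) / ?n) ^ (N - j) \<le> (1 / 25) ^ (N - j)"
      proof (cases "N = 0")
        case False
        then have "1 \<le> N" by simp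
        moreover have "25 * (3 * N + 1) = 75 * N + 25" by simp
        ultimately have "25 * (3 * N + 1) \<le> N + k + 1" using N by linarith
        then have "real (25 * (3 * N + 1)) \<le> ?n" by (simp only: of_nat_le_iff)
        then show ?thesis using np by (intro power_mono) (auto simp: field_simps)
      qed simp
      ultimately show ?thesis by (intro mult_mono divide_right_mono) auto
    qed
    also have "\<dots> = 2 / 2 ^ N * (exp 1 * ((2 * exp 1 * 6) ^ j / fact j * (2 * exp 1 / 25) ^ (N - j)))"
    proof -
      have "exp (real N + 1) = exp 1 * (exp 1 ^ j * exp 1 ^ (N - j) :: real)"
      proof -
        have "exp 1 ^ j * exp 1 ^ (N - j) = (exp 1 ^ N :: real)" using j by (simp flip: power_add)
        moreover have "exp (real N) = exp 1 ^ N" using exp_of_nat_mult[of N "1::real"] by simp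
        ultimately show ?thesis by (simp only: exp_add mult_ac)
      qed
      moreover have "(2::real) ^ N = 2 ^ j * 2 ^ (N - j)" using j by (simp flip: power_add)
      moreover have gen: "2 * (e * (e ^ j * e ^ p) * d ^ j) / F * (1 / h) ^ p
          = 2 / (c ^ j * c ^ p) * (e * ((c * e * d) ^ j / F * (c * e / h) ^ p))"
        if "c \<noteq> 0" for c d e F h :: real and p
        using that by (simp add: power_mult_distrib power_divide)
      ultimately show ?thesis using gen[of 2 "exp 1" "N - j" 6 "fact j" 25] by (simp only:)
    qed
    also have "\<dots> \<le> 2 / 2 ^ N * (exp 1 * ((36 ^ j / fact j) * (6 / 25) ^ (N - j)))"
      using e3 by (intro mult_left_mono mult_mono divide_right_mono power_mono) auto
    finally show ?thesis .
  next
    case False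
    then show ?thesis using k by (simp add: binomial_eq_0)
  qed
  have "(\<Sum>r=1..N+1. 2 ^ r / fact r * real ((k - 1) choose (r - 1))
     * (fact (N + k) * fact (2 * N + r) / (fact (N + r) * fact (2 * N + k))))
    = (\<Sum>j=0..N. 2 ^ Suc j / fact (Suc j) * real ((k - 1) choose j)
     * (fact (N + k) * fact (2 * N + Suc j) / (fact (N + Suc j) * fact (2 * N + k))))"
    by (rule sum.reindex_bij_witness[of _ Suc "\<lambda>r. r - 1"]) auto
  also have "\<dots> \<le> (\<Sum>j=0..N. 2 / 2 ^ N * (exp 1 * ((36 ^ j / fact j) * (6 / 25) ^ (N - j))))"
    by (intro sum_mono summand) auto
  also have "\<dots> = 2 / 2 ^ N * (exp 1 * (\<Sum>j\<le>N. (36 ^ j / fact j) * (6 / 25) ^ (N - j)))"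
    by (simp only: sum_distrib_left atLeast0AtMost)
  also have "\<dots> = diag_bound N / 2 ^ N" by (simp add: diag_bound_def)
  finally have *: "tau N k \<le> real (N + 1) * (diag_bound N / 2 ^ N)"
    unfolding tau_def by (intro mult_left_mono) auto
  have "N + 1 \<le> 2 ^ N" by (induction N) auto
  then have "real (N + 1) \<le> 2 ^ N" by (metis of_nat_le_iff of_nat_numeral of_nat_power)
  then have "real (N + 1) * (diag_bound N / 2 ^ N) \<le> 2 ^ N * (diag_bound N / 2 ^ N)"
    by (intro mult_right_mono divide_nonneg_nonneg) (auto simp: diag_bound_def intro!: sum_nonneg mult_nonneg_nonneg)
  then show ?thesis using * by simp
qed

lemma sum_diag_bound_le: "(\<Sum>N<M. diag_bound N) \<le> 4 * exp 1 * exp 36"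
proof -
  have "(\<Sum>N<M. \<Sum>j\<le>N. (36 ^ j / fact j) * (6 / 25) ^ (N - j)) \<le> exp 36 * (2::real)"
  proof -
    have "(\<Sum>N<M. \<Sum>j\<le>N. (36 ^ j / fact j) * (6 / 25) ^ (N - j))
      = (\<Sum>(N,j)\<in>Sigma {..<M} (\<lambda>N. {..N}). (36 ^ j / fact j) * (6 / 25 :: real) ^ (N - j))"
      by (rule sum.Sigma) auto
    also have "\<dots> = (\<Sum>(j,i)\<in>(\<lambda>(N,j). (j, N - j)) ` Sigma {..<M} (\<lambda>N. {..N}). (36 ^ j / fact j) * (6 / 25) ^ i)"
      by (subst sum.reindex) (auto simp: inj_on_def intro!: sum.cong)
    also have "\<dots> \<le> (\<Sum>(j,i)\<in>{..<M} \<times> {..<M}. (36 ^ j / fact j) * (6 / 25) ^ i)"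
      by (rule sum_mono2) auto
    also have "\<dots> = (\<Sum>j<M. 36 ^ j / fact j) * (\<Sum>i<M. (6 / 25) ^ i)"
      by (simp add: sum.cartesian_product[symmetric] sum_product)
    also have "\<dots> \<le> exp 36 * 2"
    proof (intro mult_mono exp_partial_sum)
      have "(\<Sum>i<M. (6 / 25 :: real) ^ i) = (1 - (6 / 25) ^ M) / (1 - 6 / 25)" by (subst sum_gp_strict) simp
      also have "\<dots> \<le> 2" by (simp add: field_simps)
      finally show "(\<Sum>i<M. (6 / 25 :: real) ^ i) \<le> 2" .
    qed (auto intro: sum_nonneg)
    finally show ?thesis .
  qed
  then have "2 * exp 1 * (\<Sum>N<M. \<Sum>j\<le>N. (36 ^ j / fact j) * (6 / 25) ^ (N - j)) \<le> 2 * exp 1 * (exp 36 * (2::real))"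
    by (intro mult_left_mono) auto
  then show ?thesis by (simp add: diag_bound_def sum_distrib_left mult_ac)
qed

text \<open>The first term is quadratic in \<open>n\<close> but decays in \<open>K\<close>. The
  second accounts for nearly coinciding pairs, a path with itself among them; being linear in
  \<open>n\<close>, it vanishes against \<open>n ^ 2\<close>.\<close>

definition overlap_tail :: "nat \<Rightarrow> nat \<Rightarrow> real" where
  "overlap_tail n K = 3 * real n * (202 * exp 404 * tail_rate ^ K * real n + 4 * exp 1 * exp 36)"

text \<open>Each overlap size falls under the bulk or the diagonal bound according to whether a
  hundredth of the edges is unshared. The factor 202 is \<open>1 / (1 - tail_rate)\<close>.\<close>

lemma sum_tau_le:
  "(\<Sum>k\<in>{K<..m}. tau (m - k) k) \<le> 202 * exp 404 * tail_rate ^ K * real (Suc m) + 4 * exp 1 * exp 36"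
proof -
  have db: "0 \<le> diag_bound N" for N by (auto simp: diag_bound_def intro!: sum_nonneg mult_nonneg_nonneg)
  have "(\<Sum>k\<in>{K<..m}. tau (m - k) k) \<le> (\<Sum>k\<in>{K<..m}. real (Suc m) * (exp 404 * tail_rate ^ (k - 1)) + diag_bound (m - k))"
  proof (rule sum_mono)
    fix k assume k: "k \<in> {K<..m}"
    show "tau (m - k) k \<le> real (Suc m) * (exp 404 * tail_rate ^ (k - 1)) + diag_bound (m - k)"
    proof (cases "m \<le> 100 * (m - k)")
      case True
      have "tau (m - k) k \<le> real (m - k + 1) * (exp 404 * tail_rate ^ (k - 1))"
        using True k by (intro tau_le_bulk) auto
      also have "\<dots> \<le> real (Suc m) * (exp 404 * tail_rate ^ (k - 1))"
        using tail_rate by (intro mult_right_mono) auto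
      finally show ?thesis using db[of "m - k"] by linarith
    next
      case False
      have "tau (m - k) k \<le> diag_bound (m - k)" using False k by (intro tau_le_diag) auto
      moreover have "0 \<le> real (Suc m) * (exp 404 * tail_rate ^ (k - 1))" using tail_rate by simp
      ultimately show ?thesis by linarith
    qed
  qed
  also have "\<dots> = real (Suc m) * exp 404 * (\<Sum>k\<in>{K<..m}. tail_rate ^ (k - 1)) + (\<Sum>k\<in>{K<..m}. diag_bound (m - k))"
    by (simp only: sum.distrib sum_distrib_left mult.assoc)
  also have "(\<Sum>k\<in>{K<..m}. tail_rate ^ (k - 1)) \<le> 202 * tail_rate ^ K"
  proof -
    have "(\<Sum>k\<in>{K<..m}. tail_rate ^ (k - 1)) = (\<Sum>i<m - K. tail_rate ^ K * tail_rate ^ i)"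
      by (rule sum.reindex_bij_witness[of _ "\<lambda>i. Suc (K + i)" "\<lambda>k. k - K - 1"]) (auto simp flip: power_add)
    also have "\<dots> = tail_rate ^ K * (\<Sum>i<m - K. tail_rate ^ i)" by (simp only: sum_distrib_left)
    also have "(\<Sum>i<m - K. tail_rate ^ i) = (1 - tail_rate ^ (m - K)) / (1 - tail_rate)"
      using tail_rate by (subst sum_gp_strict) auto
    also have "\<dots> \<le> 202" using tail_rate(1) by (simp add: tail_rate_def field_simps)
    finally show ?thesis using tail_rate by (simp add: mult_ac)
  qed
  also have "(\<Sum>k\<in>{K<..m}. diag_bound (m - k)) \<le> (\<Sum>N<m. diag_bound N)"
  proof -
    have "(\<Sum>k\<in>{K<..m}. diag_bound (m - k)) = (\<Sum>N\<in>(\<lambda>k. m - k) ` {K<..m}. diag_bound N)"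
      by (subst sum.reindex) (auto simp: inj_on_def)
    also have "\<dots> \<le> (\<Sum>N<m. diag_bound N)" using db by (intro sum_mono2) auto
    finally show ?thesis .
  qed
  also have "\<dots> \<le> 4 * exp 1 * exp 36" by (rule sum_diag_bound_le)
  finally show ?thesis by (simp add: mult_ac)
qed

section \<open>The expected number of increasing pairs with large overlap\<close>

context labelling begin

lemma dep_Inc: "dep (path_set a) (\<lambda>l. Inc l a)"
proof (intro ballI impI)
  fix l l' assume "\<forall>e\<in>path_set a. l e = (l' e :: nat)"
  then have "lab l a = lab l' a" by (intro ext) (auto simp: lab_def path_set_def)
  then show "Inc l a = Inc l' a" by (simp add: Inc_def)
qed

text \<open>Given the labels of \<open>a\<close>, the pattern bound is summed over all patterns of
  size \<open>k\<close>; averaging over increasing label sequences of \<open>a\<close> replaces the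
  spread by binomials, after which only the number of runs matters and
  \<open>card_patterns_le\<close> counts the patterns.\<close>

lemma ex_overlap_le:
  assumes a: "a \<in> paths" and Q: "2 * n ^ 2 \<le> Q" and k: "1 \<le> k" "k \<le> m"
  shows "ex (\<lambda>l. Inc l a * (\<Sum>b\<in>{b\<in>paths. hits (path_set a) b = k}. Inc l b)) \<le> 3 * tau (m - k) k / fact m"
proof -
  define N where "N = m - k"
  have Nk: "N + k = m" using k by (simp add: N_def)
  let ?P = "{b\<in>paths. hits (path_set a) b = k}" and ?JJ = "{J. J \<subseteq> {..<m} \<and> card J = k}"
  define W where "W r = chi k r * real (((2 * N + r) choose N) * ((Q + N) choose (2 * N + k))) / real Q ^ m" for r
  have finJJ: "finite ?JJ" by (rule finite_subset[of _ "Pow {..<m}"]) auto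
  have chi0: "0 \<le> chi k r" for r by (simp add: chi_def)
  have "ex (\<lambda>l. Inc l a * (\<Sum>b\<in>?P. Inc l b)) = (\<Sum>b\<in>?P. ex (\<lambda>l. Inc l a * Inc l b))"
    by (simp add: sum_distrib_left ex_sum)
  also have "\<dots> = (\<Sum>b\<in>?P. ex (\<lambda>l. Inc l a * pw (path_set a) l b))"
    by (intro sum.cong refl ex_Inc path_set_K a dep_Inc) auto
  also have "\<dots> = ex (\<lambda>l. Inc l a * (\<Sum>b\<in>?P. pw (path_set a) l b))"
    by (simp add: sum_distrib_left ex_sum)
  also have "\<dots> \<le> ex (\<lambda>l. Inc l a * (\<Sum>J\<in>?JJ. chi k (card (starts J)) * real ((Q - (spread (lab l a) J + card (starts J))) choose (m - k))))"
    using sum_overlap_le[OF a] by (intro ex_mono) (auto simp: Inc_def)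
  also have "\<dots> = (\<Sum>t\<in>seqs. of_bool (inc t) * (\<Sum>J\<in>?JJ. chi k (card (starts J)) * real ((Q - (spread t J + card (starts J))) choose (m - k)))) / real Q ^ m"
    unfolding Inc_def by (rule ex_lab[OF a])
  also have "\<dots> = (\<Sum>t\<in>incs. \<Sum>J\<in>?JJ. chi k (card (starts J)) * real ((Q - (spread t J + card (starts J))) choose (m - k))) / real Q ^ m"
    using finite_seqs unfolding incs_def by (simp add: of_bool_def if_distrib[of "\<lambda>z. z * _"] sum.If_cases Int_def cong: if_cong)
  also have "(\<Sum>t\<in>incs. \<Sum>J\<in>?JJ. chi k (card (starts J)) * real ((Q - (spread t J + card (starts J))) choose (m - k)))
     = (\<Sum>J\<in>?JJ. chi k (card (starts J)) * real (\<Sum>t\<in>incs. (Q - (spread t J + card (starts J))) choose (m - k)))"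
    by (subst sum.swap) (simp add: sum_distrib_left)
  also have "\<dots> / real Q ^ m \<le> (\<Sum>J\<in>?JJ. chi k (card (starts J)) * real (((2 * N + card (starts J)) choose N) * ((Q + N) choose (2 * N + k)))) / real Q ^ m"
    unfolding N_def by (intro divide_right_mono sum_mono mult_left_mono of_nat_mono sum_incs_choose_le chi0) auto
  also have "\<dots> = (\<Sum>J\<in>?JJ. W (card (starts J)))" by (simp add: W_def sum_divide_distrib)
  also have "\<dots> = (\<Sum>r=1..k. \<Sum>J\<in>{J\<in>?JJ. card (starts J) = r}. W (card (starts J)))"
  proof (rule sum.group[symmetric, OF finJJ])
    show "(\<lambda>J. card (starts J)) ` ?JJ \<subseteq> {1..k}"
    proof
      fix r assume "r \<in> (\<lambda>J. card (starts J)) ` ?JJ"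
      then obtain J where J: "J \<subseteq> {..<m}" "card J = k" "r = card (starts J)" by auto
      have f: "finite J" using J finite_subset by auto
      have "J \<noteq> {}" using J k by auto
      then show "r \<in> {1..k}" using card_starts_le[OF f] starts_nonempty[of J] finite_patterns(1)[OF f] J
        by (simp add: Suc_le_eq card_gt_0_iff)
    qed
  qed simp
  also have "\<dots> = (\<Sum>r=1..k. real (card {J. J \<subseteq> {..<m} \<and> card J = k \<and> card (starts J) = r}) * W r)"
    by (simp add: conj_assoc)
  also have "\<dots> \<le> (\<Sum>r=1..k. real (((k - 1) choose (r - 1)) * ((N + 1) choose r)) * W r)"
    unfolding N_def using k chi0
    by (intro sum_mono mult_right_mono of_nat_mono card_patterns_le) (auto simp: W_def)
  also have "\<dots> \<le> (\<Sum>r=1..k. if r \<le> N + 1 then 3 / fact m * (real (N + 1) * (2 ^ r / fact r * real ((k - 1) choose (r - 1))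
     * (fact (N + k) * fact (2 * N + r) / (fact (N + r) * fact (2 * N + k))))) else 0)"
  proof (rule sum_mono)
    fix r assume r: "r \<in> {1..k}"
    show "real (((k - 1) choose (r - 1)) * ((N + 1) choose r)) * W r \<le> (if r \<le> N + 1 then 3 / fact m * (real (N + 1) * (2 ^ r / fact r * real ((k - 1) choose (r - 1))
     * (fact (N + k) * fact (2 * N + r) / (fact (N + r) * fact (2 * N + k))))) else 0)"
    proof (cases "r \<le> N + 1")
      case True
      have Qp: "0 < real Q" using Q1 by simp
      have c1: "real ((N + 1) choose r) * fact (N + 1 - r) = real (N + 1) * fact N / fact r"
        using binomial_fact[OF True, where 'a = real] by (simp add: field_simps)
      have c2: "real ((2 * N + r) choose N) = fact (2 * N + r) / (fact N * fact (N + r))"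
        using binomial_fact[of N "2 * N + r", where 'a = real] by (simp add: mult_2 add_ac)
      \<comment> \<open>The exponent times \<open>N / Q\<close> is at most
        \<open>2 * n ^ 2 / Q \<le> 1\<close>, so the binomial exceeds its leading term by at most
        \<open>exp 1\<close>; this is the origin of the factor 3.\<close>
      have c3: "real ((Q + N) choose (2 * N + k)) / real Q ^ (2 * N + k) \<le> 3 / fact (2 * N + k)"
      proof -
        have "real ((Q + N) choose (2 * N + k)) / real Q ^ (2 * N + k) \<le> (real (Q + N) ^ (2 * N + k) / fact (2 * N + k)) / real Q ^ (2 * N + k)"
          by (intro divide_right_mono choose_le_pow) auto
        also have "\<dots> = (1 + real N / real Q) ^ (2 * N + k) / fact (2 * N + k)"
        proof -
          have "1 + real N / real Q = real (Q + N) / real Q" using Qp by (simp add: field_simps)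
          then show ?thesis by (simp only: power_divide divide_divide_eq_left mult.commute)
        qed
        also have "(1 + real N / real Q) ^ (2 * N + k) \<le> exp (real N / real Q) ^ (2 * N + k)"
          by (intro power_mono exp_ge_add_one_self) auto
        also have "\<dots> = exp (real (2 * N + k) * (real N / real Q))" by (rule exp_of_nat_mult[symmetric])
        also have "\<dots> \<le> exp 1"
        proof -
          have "(2 * N + k) * N \<le> (2 * n) * n" using Nk Suc_m by (intro mult_le_mono) linarith+
          also have "\<dots> \<le> Q" using Q by (simp add: power2_eq_square)
          finally have "real ((2 * N + k) * N) \<le> real Q" by (simp only: of_nat_le_iff)
          then show ?thesis using Qp by (simp add: field_simps)
        qed
        also have "\<dots> \<le> 3" by (rule exp_le)
        finally show ?thesis by (simp add: divide_right_mono)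
      qed
      have Qm: "real Q ^ N * real Q ^ m = real Q ^ (2 * N + k)" 
      proof -
        have "N + m = 2 * N + k" using Nk by simp
        then show ?thesis by (metis power_add)
      qed
      have nk: "n - (k + r) = N + 1 - r" using Nk Suc_m by linarith
      have "real (((k - 1) choose (r - 1)) * ((N + 1) choose r)) * W r
        = real ((k - 1) choose (r - 1)) * 2 ^ r * (real ((N + 1) choose r) * fact (N + 1 - r)) * real ((2 * N + r) choose N)
           * (real ((Q + N) choose (2 * N + k)) / (real Q ^ N * real Q ^ m))"
        by (simp add: W_def chi_def nk N_def[symmetric])
      also have "\<dots> \<le> real ((k - 1) choose (r - 1)) * 2 ^ r * (real (N + 1) * fact N / fact r) * (fact (2 * N + r) / (fact N * fact (N + r)))
           * (3 / fact (2 * N + k))"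
        unfolding c1 c2 Qm by (intro mult_left_mono c3) auto
      also have "\<dots> = 3 / fact m * (real (N + 1) * (2 ^ r / fact r * real ((k - 1) choose (r - 1))
     * (fact (N + k) * fact (2 * N + r) / (fact (N + r) * fact (2 * N + k)))))"
        unfolding Nk by (simp add: field_simps)
      finally show ?thesis using True by simp
    qed (simp add: binomial_eq_0)
  qed
  also have "\<dots> = (\<Sum>r\<in>{1..k} \<inter> {1..N+1}. 3 / fact m * (real (N + 1) * (2 ^ r / fact r * real ((k - 1) choose (r - 1))
     * (fact (N + k) * fact (2 * N + r) / (fact (N + r) * fact (2 * N + k))))))"
    by (rule sum.mono_neutral_cong_right) auto
  also have "\<dots> \<le> (\<Sum>r=1..N+1. 3 / fact m * (real (N + 1) * (2 ^ r / fact r * real ((k - 1) choose (r - 1))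
     * (fact (N + k) * fact (2 * N + r) / (fact (N + r) * fact (2 * N + k))))))"
    by (rule sum_mono2) auto
  also have "\<dots> = 3 / fact m * tau N k" unfolding tau_def by (simp only: sum_distrib_left)
  finally show ?thesis by (simp add: N_def)
qed

lemma overlap_tail_bound:
  assumes Q: "2 * n ^ 2 \<le> Q"
  shows "(\<Sum>a\<in>paths. ex (\<lambda>l. Inc l a * (\<Sum>b\<in>{b\<in>paths. K < hits (path_set a) b}. Inc l b))) \<le> overlap_tail n K"
proof -
  have "ex (\<lambda>l. Inc l a * (\<Sum>b\<in>{b\<in>paths. K < hits (path_set a) b}. Inc l b)) \<le> (\<Sum>k\<in>{K<..m}. 3 * tau (m - k) k / fact m)"
    if a: "a \<in> paths" for a
  proof -
    have "(\<Sum>b\<in>{b\<in>paths. K < hits (path_set a) b}. Inc l b) = (\<Sum>k\<in>{K<..m}. \<Sum>b\<in>{b\<in>paths. hits (path_set a) b = k}. Inc l b)" for l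
    proof -
      have "(\<Sum>b\<in>{b\<in>paths. K < hits (path_set a) b}. Inc l b)
        = (\<Sum>k\<in>{K<..m}. \<Sum>b\<in>{b\<in>{b\<in>paths. K < hits (path_set a) b}. hits (path_set a) b = k}. Inc l b)"
        by (rule sum.group[symmetric]) (use finite_paths hits_le in auto)
      also have "\<dots> = (\<Sum>k\<in>{K<..m}. \<Sum>b\<in>{b\<in>paths. hits (path_set a) b = k}. Inc l b)"
        by (intro sum.cong) auto
      finally show ?thesis .
    qed
    then have "ex (\<lambda>l. Inc l a * (\<Sum>b\<in>{b\<in>paths. K < hits (path_set a) b}. Inc l b))
      = (\<Sum>k\<in>{K<..m}. ex (\<lambda>l. Inc l a * (\<Sum>b\<in>{b\<in>paths. hits (path_set a) b = k}. Inc l b)))"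
      by (simp add: sum_distrib_left ex_sum)
    also have "\<dots> \<le> (\<Sum>k\<in>{K<..m}. 3 * tau (m - k) k / fact m)"
      by (intro sum_mono ex_overlap_le a Q) auto
    finally show ?thesis .
  qed
  then have "(\<Sum>a\<in>paths. ex (\<lambda>l. Inc l a * (\<Sum>b\<in>{b\<in>paths. K < hits (path_set a) b}. Inc l b)))
    \<le> (\<Sum>a\<in>paths. \<Sum>k\<in>{K<..m}. 3 * tau (m - k) k / fact m)" by (intro sum_mono)
  also have "\<dots> = fact n * (\<Sum>k\<in>{K<..m}. 3 * tau (m - k) k / fact m)" by (simp add: card_paths)
  also have "\<dots> = (fact n / fact m) * (3 * (\<Sum>k\<in>{K<..m}. tau (m - k) k))"
    by (simp add: sum_distrib_left sum_divide_distrib)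
  also have "fact n / fact m = real n" using Suc_m by (metis fact_Suc fact_nonzero nonzero_mult_div_cancel_right of_nat_fact of_nat_mult)
  also have "real n * (3 * (\<Sum>k\<in>{K<..m}. tau (m - k) k)) \<le> real n * (3 * (202 * exp 404 * tail_rate ^ K * real (Suc m) + 4 * exp 1 * exp 36))"
    by (intro mult_left_mono sum_tau_le) auto
  finally show ?thesis unfolding overlap_tail_def Suc_m by (simp only: mult.left_commute mult.commute)
qed

end

section \<open>Asymptotics for separated patterns\<close>

context labelling begin

section \<open>Switching arguments for vertex orders with pinned places\<close>

definition avoiding :: "nat set set \<Rightarrow> nat set \<Rightarrow> (nat \<Rightarrow> nat) set" where
  "avoiding E X = {a\<in>paths. \<forall>i<m. i \<notin> X \<longrightarrow> edge a i \<notin> E}"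

definition pinned :: "nat set \<Rightarrow> (nat \<Rightarrow> nat) \<Rightarrow> (nat \<Rightarrow> nat) set" where
  "pinned W p = {a\<in>paths. \<forall>u\<in>W. a u = p u}"

definition touching :: "nat set set \<Rightarrow> nat set \<Rightarrow> nat \<Rightarrow> nat \<Rightarrow> (nat \<Rightarrow> nat) set" where
  "touching E X x x' = {a\<in>paths. \<exists>i<m. i \<notin> X \<and> edge a i \<in> E \<and> (x \<in> edge a i \<or> x' \<in> edge a i)}"

lemma finite_pin: "finite (pinned W p \<inter> A)"
  using finite_paths by (simp add: pinned_def)

lemma card_pinned_le:
  assumes W: "W \<subseteq> {..<n}"
  shows "card (pinned W p) \<le> fact (n - card W)"
proof (cases "pinned W p = {}")
  case False
  then obtain a0 where a0: "a0 \<in> pinned W p" by auto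
  have "pinned W p = {a\<in>paths. \<forall>u\<in>W. a u = a0 u}" using a0 by (auto simp: pinned_def)
  then show ?thesis using card_pinned[OF _ W, of a0] a0 by (simp add: pinned_def)
qed (simp only: card.empty)

lemma transpose_path:
  assumes "x < n" "x' < n" "a \<in> paths"
  shows "Transposition.transpose x x' \<circ> a \<in> paths"
  using assms permutes_compose[of a "{..<n}" "Transposition.transpose x x'"] permutes_swap_id[of x "{..<n}" x']
  by (simp add: paths_def)

text \<open>Exchange the vertices \<open>x\<close> and \<open>x'\<close> throughout the path. Edges
  containing neither of them are unchanged and still outside \<open>E\<close>, so whenever the
  result fails to avoid \<open>E\<close>, the offending edge contains \<open>x\<close> or
  \<open>x'\<close>.\<close>

lemma card_swap_le:
  assumes x: "x < n" "x' < n"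
  shows "card (pinned W p \<inter> avoiding E X)
    \<le> card (pinned W (Transposition.transpose x x' \<circ> p) \<inter> avoiding E X) + card (pinned W (Transposition.transpose x x' \<circ> p) \<inter> touching E X x x')"
proof -
  let ?t = "Transposition.transpose x x'"
  let ?G = "pinned W (?t \<circ> p) \<inter> avoiding E X" and ?B = "pinned W (?t \<circ> p) \<inter> touching E X x x'"
  have tt: "?t (?t v) = v" for v by (metis transpose_involutory)
  have "card (pinned W p \<inter> avoiding E X) \<le> card (?G \<union> ?B)"
  proof (rule card_inj_on_le[where f = "\<lambda>a. ?t \<circ> a"])
    show "inj_on (\<lambda>a. ?t \<circ> a) (pinned W p \<inter> avoiding E X)"
    proof (rule inj_onI)
      fix a b assume "?t \<circ> a = ?t \<circ> b"
      then have "?t (?t (a i)) = ?t (?t (b i))" for i by (metis comp_apply)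
      then show "a = b" by (auto simp: tt)
    qed
    show "(\<lambda>a. ?t \<circ> a) ` (pinned W p \<inter> avoiding E X) \<subseteq> ?G \<union> ?B"
    proof
      fix b assume "b \<in> (\<lambda>a. ?t \<circ> a) ` (pinned W p \<inter> avoiding E X)"
      then obtain a where a: "a \<in> pinned W p" "a \<in> avoiding E X" and b: "b = ?t \<circ> a" by auto
      have bp: "b \<in> paths" using transpose_path[OF x] a by (simp add: b pinned_def)
      have b1: "b \<in> pinned W (?t \<circ> p)" using a bp by (auto simp: pinned_def b)
      show "b \<in> ?G \<union> ?B"
      proof (cases "b \<in> avoiding E X")
        case False
        then obtain i where i: "i < m" "i \<notin> X" "edge b i \<in> E" using bp by (auto simp: avoiding_def)
        have "edge a i \<notin> E" using a i by (auto simp: avoiding_def)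
        then have "edge b i \<noteq> edge a i" using i by auto
        have "x \<in> edge b i \<or> x' \<in> edge b i"
        proof (rule ccontr)
          assume c: "\<not> (x \<in> edge b i \<or> x' \<in> edge b i)"
          have "a v = b v" if "b v \<noteq> x" "b v \<noteq> x'" for v
          proof -
            have "a v = ?t (b v)" by (simp add: b tt)
            then show ?thesis using that by (simp add: transpose_apply_other)
          qed
          then show False using c \<open>edge b i \<noteq> edge a i\<close> by (auto simp: edge_def)
        qed
        then show ?thesis using b1 bp i by (auto simp: touching_def)
      qed (use b1 in simp)
    qed
    show "finite (?G \<union> ?B)" by (simp add: finite_pin)
  qed
  then show ?thesis using card_Un_le le_trans by blast
qed

text \<open>A position with two free ends admits \<open>e\<close> in at most
  \<open>2 * fact (n - card W - 2)\<close> ways. A position with one pinned end admits it more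
  often, but there are at most \<open>2 * card W\<close> such positions. The hypothesis on
  \<open>X\<close> excludes positions whose ends are both pinned.\<close>

lemma card_two_slots_le:
  assumes W: "W \<subseteq> {..<n}" and E: "card e = 2"
    and X: "\<And>i. i < m \<Longrightarrow> i \<notin> X \<Longrightarrow> \<not> (i \<in> W \<and> Suc i \<in> W)"
  shows "card {a \<in> pinned W p. \<exists>i<m. i \<notin> X \<and> edge a i = e}
    \<le> n * (2 * fact (n - card W - 2)) + 2 * card W * (2 * fact (n - card W - 1))"
proof -
  obtain y z where yz: "e = {y, z}" using E by (auto simp: card_2_iff)
  have fW: "finite W" using W finite_subset by auto
  define I0 where "I0 = {i. i < m \<and> i \<notin> X \<and> i \<notin> W \<and> Suc i \<notin> W}"
  define I1 where "I1 = {i. i < m \<and> i \<notin> X \<and> (i \<in> W \<and> Suc i \<notin> W \<or> i \<notin> W \<and> Suc i \<in> W)}"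
  have fin: "finite I0" "finite I1" by (auto simp: I0_def I1_def)
  have c0: "card I0 \<le> n"
  proof -
    have "card I0 \<le> card {..<m}" by (intro card_mono) (auto simp: I0_def)
    then show ?thesis using Suc_m by simp
  qed
  have c1: "card I1 \<le> 2 * card W"
  proof -
    have "I1 \<subseteq> W \<union> (\<lambda>u. u - 1) ` W" by (force simp: I1_def)
    then have "card I1 \<le> card (W \<union> (\<lambda>u. u - 1) ` W)" using fW by (intro card_mono) auto
    also have "\<dots> \<le> card W + card ((\<lambda>u. u - 1) ` W)" by (rule card_Un_le)
    also have "card ((\<lambda>u. u - 1) ` W) \<le> card W" by (rule card_image_le[OF fW])
    finally show ?thesis by simp
  qed
  have sub: "{a \<in> pinned W p. \<exists>i<m. i \<notin> X \<and> edge a i = e} \<subseteq>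
    (\<Union>i\<in>I0. {a \<in> pinned W p. edge a i = e}) \<union> (\<Union>i\<in>I1. {a \<in> pinned W p. edge a i = e})"
    using X by (auto simp: I0_def I1_def)
  have fa: "finite {a \<in> pinned W p. P a}" for P using finite_pin[of W p UNIV] by simp
  have two: "card {a \<in> pinned W p. edge a i = e} \<le> 2 * fact (n - card (W \<union> {i, Suc i}))" if i: "i < m" for i
  proof -
    let ?W = "W \<union> {i, Suc i}"
    have one: "card {a \<in> pinned W p. a i = u \<and> a (Suc i) = v} \<le> fact (n - card ?W)" for u v
    proof (cases "{a \<in> pinned W p. a i = u \<and> a (Suc i) = v} = {}")
      case False
      then obtain a0 where a0: "a0 \<in> pinned W p" "a0 i = u" "a0 (Suc i) = v" by auto
      have "{a \<in> pinned W p. a i = u \<and> a (Suc i) = v} \<subseteq> pinned ?W a0" using a0 by (auto simp: pinned_def)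
      then have "card {a \<in> pinned W p. a i = u \<and> a (Suc i) = v} \<le> card (pinned ?W a0)"
        using finite_pin[of ?W a0 UNIV] by (intro card_mono) auto
      also have "\<dots> \<le> fact (n - card ?W)" using W i lt_m by (intro card_pinned_le) auto
      finally show ?thesis .
    qed (simp only: card.empty)
    have "{a \<in> pinned W p. edge a i = e} \<subseteq> {a \<in> pinned W p. a i = y \<and> a (Suc i) = z} \<union> {a \<in> pinned W p. a i = z \<and> a (Suc i) = y}"
      by (auto simp: edge_def yz doubleton_eq_iff)
    then have "card {a \<in> pinned W p. edge a i = e} \<le> card ({a \<in> pinned W p. a i = y \<and> a (Suc i) = z} \<union> {a \<in> pinned W p. a i = z \<and> a (Suc i) = y})"
      by (intro card_mono) (simp_all add: fa)
    also have "\<dots> \<le> card {a \<in> pinned W p. a i = y \<and> a (Suc i) = z} + card {a \<in> pinned W p. a i = z \<and> a (Suc i) = y}"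
      by (rule card_Un_le)
    finally show ?thesis using one[of y z] one[of z y] by simp
  qed
  have "card {a \<in> pinned W p. \<exists>i<m. i \<notin> X \<and> edge a i = e}
    \<le> card ((\<Union>i\<in>I0. {a \<in> pinned W p. edge a i = e}) \<union> (\<Union>i\<in>I1. {a \<in> pinned W p. edge a i = e}))"
    by (rule card_mono[OF _ sub]) (simp add: fin fa)
  also have "\<dots> \<le> card (\<Union>i\<in>I0. {a \<in> pinned W p. edge a i = e}) + card (\<Union>i\<in>I1. {a \<in> pinned W p. edge a i = e})"
    by (rule card_Un_le)
  also have "card (\<Union>i\<in>I0. {a \<in> pinned W p. edge a i = e}) \<le> (\<Sum>i\<in>I0. card {a \<in> pinned W p. edge a i = e})"
    by (rule card_UN_le[OF fin(1)])
  also have "\<dots> \<le> (\<Sum>i\<in>I0. 2 * fact (n - card W - 2))"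
  proof (rule sum_mono)
    fix i assume i: "i \<in> I0"
    have "card (W \<union> {i, Suc i}) = card W + 2"
      using i fW card_Un_disjoint[of W "{i, Suc i}"] by (simp add: I0_def)
    then show "card {a \<in> pinned W p. edge a i = e} \<le> 2 * fact (n - card W - 2)"
      using two[of i] i by (simp add: I0_def)
  qed
  also have "\<dots> \<le> n * (2 * fact (n - card W - 2))" using c0 by simp
  also have "card (\<Union>i\<in>I1. {a \<in> pinned W p. edge a i = e}) \<le> (\<Sum>i\<in>I1. card {a \<in> pinned W p. edge a i = e})"
    by (rule card_UN_le[OF fin(2)])
  also have "\<dots> \<le> (\<Sum>i\<in>I1. 2 * fact (n - card W - 1))"
  proof (rule sum_mono)
    fix i assume i: "i \<in> I1"
    then have "W \<union> {i, Suc i} = insert i W \<and> i \<notin> W \<or> W \<union> {i, Suc i} = insert (Suc i) W \<and> Suc i \<notin> W"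
      by (auto simp: I1_def)
    then have "card (W \<union> {i, Suc i}) = card W + 1" using fW by auto
    then show "card {a \<in> pinned W p. edge a i = e} \<le> 2 * fact (n - card W - 1)"
      using two[of i] i by (simp add: I1_def)
  qed
  also have "\<dots> \<le> 2 * card W * (2 * fact (n - card W - 1))" using c1 by simp
  finally show ?thesis by simp
qed

text \<open>At most 8 edges of \<open>E\<close> contain \<open>x\<close> or \<open>x'\<close>, and
  each occurs outside \<open>X\<close> in at most a fraction \<open>8 * (card W + 1) / n\<close> of
  \<open>fact (n - card W)\<close> vertex orders; hence 64.\<close>

lemma card_touching_le:
  assumes W: "W \<subseteq> {..<n}" and E: "sparse E"
    and X: "\<And>i. i < m \<Longrightarrow> i \<notin> X \<Longrightarrow> \<not> (i \<in> W \<and> Suc i \<in> W)" and v: "4 * (card W + 1) \<le> n"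
  shows "real (card (pinned W p \<inter> touching E X x x')) \<le> 64 * (real (card W) + 1) / real n * fact (n - card W)"
proof -
  define EE where "EE = {e\<in>E. x \<in> e \<or> x' \<in> e}"
  let ?c = "card W"
  have fE: "finite EE" using sparse_finite[OF E] by (simp add: EE_def)
  have cE: "card EE \<le> 8"
  proof -
    have "EE = {e\<in>E. x \<in> e} \<union> {e\<in>E. x' \<in> e}" by (auto simp: EE_def)
    then have "card EE \<le> card {e\<in>E. x \<in> e} + card {e\<in>E. x' \<in> e}" by (simp only: card_Un_le)
    moreover have "card {e\<in>E. x \<in> e} \<le> 4" "card {e\<in>E. x' \<in> e} \<le> 4" using E by (auto simp: sparse_def)
    ultimately show ?thesis by linarith
  qed
  define R where "R = n * (2 * fact (n - ?c - 2)) + 2 * ?c * (2 * fact (n - ?c - 1))"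
  have "pinned W p \<inter> touching E X x x' \<subseteq> (\<Union>e\<in>EE. {a \<in> pinned W p. \<exists>i<m. i \<notin> X \<and> edge a i = e})"
    by (auto simp: touching_def EE_def)
  then have "card (pinned W p \<inter> touching E X x x') \<le> card (\<Union>e\<in>EE. {a \<in> pinned W p. \<exists>i<m. i \<notin> X \<and> edge a i = e})"
    using finite_pin[of W p UNIV] fE by (intro card_mono) auto
  also have "\<dots> \<le> (\<Sum>e\<in>EE. card {a \<in> pinned W p. \<exists>i<m. i \<notin> X \<and> edge a i = e})" by (rule card_UN_le[OF fE])
  also have "\<dots> \<le> (\<Sum>e\<in>EE. R)"
  proof (rule sum_mono)
    fix e assume "e \<in> EE"
    then have "card e = 2" using E by (auto simp: EE_def sparse_def K_edges_def)
    then show "card {a \<in> pinned W p. \<exists>i<m. i \<notin> X \<and> edge a i = e} \<le> R"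
      unfolding R_def by (rule card_two_slots_le[OF W _ X])
  qed
  also have "\<dots> \<le> 8 * R" using cE by simp
  finally have 1: "card (pinned W p \<inter> touching E X x x') \<le> 8 * R" .
  define q where "q = n - ?c - 2"
  have nq: "n - ?c = Suc (Suc q)" "n - ?c - 1 = Suc q" "n \<le> 2 * Suc q" using v by (auto simp: q_def)
  have np: "0 < real n" using n2 by simp
  have b: "real n / real (Suc q) \<le> 2" "1 / real (Suc (Suc q)) \<le> 2 / real n" using nq np by (auto simp: field_simps)
  have "real R = (real n / real (Suc q) * 2 * (1 / real (Suc (Suc q))) + 4 * real ?c * (1 / real (Suc (Suc q)))) * fact (n - ?c)"
  proof -
    have gen: "N * (2 * f) + 2 * c * (2 * (A * f)) = (N / A * 2 * (1 / B) + 4 * c * (1 / B)) * (B * (A * f))"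
      if "A \<noteq> 0" "B \<noteq> 0" for N f c A B :: real using that by (simp add: field_simps)
    have f: "fact (n - ?c) = real (Suc (Suc q)) * (real (Suc q) * fact q)" by (simp only: nq fact_Suc of_nat_mult)
    have "real R = real n * (2 * fact q) + 2 * real ?c * (2 * (real (Suc q) * fact q))"
      unfolding R_def nq(2) q_def[symmetric] by (simp only: fact_Suc of_nat_mult of_nat_add of_nat_numeral of_nat_fact of_nat_id)
    then show ?thesis unfolding f by (simp only: gen[of "real (Suc q)" "real (Suc (Suc q))"] of_nat_neq_0 not_False_eq_True)
  qed
  also have "\<dots> \<le> (2 * 2 * (2 / real n) + 4 * real ?c * (2 / real n)) * fact (n - ?c)"
    by (intro mult_right_mono add_mono mult_mono b) auto
  also have "\<dots> = 8 * (real ?c + 1) / real n * fact (n - ?c)" by (simp add: add_divide_distrib algebra_simps)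
  finally have 2: "real R \<le> 8 * (real ?c + 1) / real n * fact (n - ?c)" .
  have "real (card (pinned W p \<inter> touching E X x x')) \<le> real (8 * R)" using 1 by (simp only: of_nat_le_iff)
  also have "\<dots> \<le> 8 * (8 * (real ?c + 1) / real n * fact (n - ?c))" using 2 by simp
  also have "8 * (8 * z / N * f) = 64 * z / N * f" for z N f :: real by simp
  finally show ?thesis .
qed

lemma pinned_cong: "(\<And>u. u \<in> W \<Longrightarrow> p u = p' u) \<Longrightarrow> pinned W p = pinned W p'"
  by (auto simp: pinned_def)

text \<open>The pins \<open>p\<close> are transformed into \<open>p'\<close> by exchanging two
  vertices at a time; each exchange removes a disagreement and, by \<open>card_swap_le\<close> in
  both directions, changes the count by at most the number of touching orders.\<close>

lemma card_pinned_avoiding_diff: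
  assumes W: "W \<subseteq> {..<n}" and E: "sparse E"
    and X: "\<And>i. i < m \<Longrightarrow> i \<notin> X \<Longrightarrow> \<not> (i \<in> W \<and> Suc i \<in> W)" and v: "4 * (card W + 1) \<le> n"
  shows "inj_on p W \<Longrightarrow> p ` W \<subseteq> {..<n} \<Longrightarrow> inj_on p' W \<Longrightarrow> p' ` W \<subseteq> {..<n} \<Longrightarrow> card {u\<in>W. p u \<noteq> p' u} \<le> k \<Longrightarrow>
    \<bar>real (card (pinned W p \<inter> avoiding E X)) - real (card (pinned W p' \<inter> avoiding E X))\<bar>
      \<le> real k * (64 * (real (card W) + 1) / real n * fact (n - card W))"
proof (induction k arbitrary: p)
  case 0
  have "finite {u\<in>W. p u \<noteq> p' u}" using W finite_subset[of W "{..<n}"] by simp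
  then have "{u\<in>W. p u \<noteq> p' u} = {}" using 0(5) by simp
  then have "pinned W p = pinned W p'" by (intro pinned_cong) auto
  then show ?case by simp
next
  case (Suc k)
  let ?R = "64 * (real (card W) + 1) / real n * fact (n - card W)"
  have fin: "finite {u\<in>W. p u \<noteq> p' u}" using W finite_subset[of W "{..<n}"] by simp
  show ?case
  proof (cases "{u\<in>W. p u \<noteq> p' u} = {}")
    case True
    then have "pinned W p = pinned W p'" by (intro pinned_cong) auto
    then show ?thesis by simp
  next
    case False
  then obtain u where u: "u \<in> W" "p u \<noteq> p' u" by auto
  define x x' where "x = p u" and "x' = p' u"
  have xn: "x < n" "x' < n" using u Suc(3,5) by (auto simp: x_def x'_def)
  let ?t = "Transposition.transpose x x'"
  define q where "q = ?t \<circ> p"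
  have tt: "?t (?t y) = y" for y by (metis transpose_involutory)
  have tq: "?t \<circ> q = p" by (auto simp: q_def tt)
  have injq: "inj_on q W" unfolding q_def using Suc(2) by (intro comp_inj_on) (auto intro: inj_on_subset[OF inj_transpose])
  have qn: "q ` W \<subseteq> {..<n}" using Suc(3) xn by (auto simp: q_def Transposition.transpose_def)
  \<comment> \<open>The exchange corrects the place \<open>u\<close>. The only other place it can
    affect has \<open>p w = x'\<close>, and there \<open>p\<close> already disagreed with
    \<open>p'\<close>, which takes the value \<open>x'\<close> at \<open>u\<close>.\<close>
  have "{w\<in>W. q w \<noteq> p' w} \<subseteq> {w\<in>W. p w \<noteq> p' w} - {u}"
  proof
    fix w assume w: "w \<in> {w\<in>W. q w \<noteq> p' w}"
    have wu: "w \<noteq> u" using w by (auto simp: q_def x_def x'_def)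
    have px: "p w \<noteq> x" using Suc(2) u w wu by (auto simp: x_def inj_on_def)
    have px': "p' w \<noteq> x'" using Suc(4) u w wu by (auto simp: x'_def inj_on_def)
    have "p w \<noteq> p' w"
    proof (cases "p w = x'")
      case True then show ?thesis using px' by simp
    next
      case F: False
      then have "q w = p w" using px by (simp add: q_def transpose_apply_other)
      then show ?thesis using w by simp
    qed
    then show "w \<in> {w\<in>W. p w \<noteq> p' w} - {u}" using w wu by simp
  qed
  then have "card {w\<in>W. q w \<noteq> p' w} \<le> card ({w\<in>W. p w \<noteq> p' w} - {u})" using fin by (intro card_mono) auto
  also have "\<dots> \<le> k" using u fin Suc(6) by simp
  finally have "card {w\<in>W. q w \<noteq> p' w} \<le> k" .
  then have IH: "\<bar>real (card (pinned W q \<inter> avoiding E X)) - real (card (pinned W p' \<inter> avoiding E X))\<bar> \<le> real k * ?R"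
    by (rule Suc.IH[OF injq qn Suc(4,5)])
  have t: "real (card (pinned W r \<inter> touching E X x x')) \<le> ?R" for r by (rule card_touching_le[OF W E X v])
  have "card (pinned W p \<inter> avoiding E X) \<le> card (pinned W q \<inter> avoiding E X) + card (pinned W q \<inter> touching E X x x')"
    unfolding q_def by (rule card_swap_le[OF xn])
  then have "real (card (pinned W p \<inter> avoiding E X)) \<le> real (card (pinned W q \<inter> avoiding E X)) + ?R"
    using t[of q] by linarith
  moreover have "card (pinned W q \<inter> avoiding E X) \<le> card (pinned W p \<inter> avoiding E X) + card (pinned W p \<inter> touching E X x x')"
    using card_swap_le[OF xn, of W q E X] by (simp only: tq)
  then have "real (card (pinned W q \<inter> avoiding E X)) \<le> real (card (pinned W p \<inter> avoiding E X)) + ?R"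
    using t[of p] by linarith
  ultimately have "\<bar>real (card (pinned W p \<inter> avoiding E X)) - real (card (pinned W q \<inter> avoiding E X))\<bar> \<le> ?R" by linarith
  moreover have gen: "\<bar>a - c\<bar> \<le> (1 + r) * R" if "\<bar>a - b\<bar> \<le> R" "\<bar>b - c\<bar> \<le> r * R" for a b c r R :: real
    using that unfolding distrib_right by linarith
  ultimately show ?thesis using gen[OF _ IH] by (simp only: of_nat_Suc)
  qed
qed

lemma sum_pins:
  assumes W: "W \<subseteq> {..<n}" and A: "A \<subseteq> paths"
  shows "card A = (\<Sum>p\<in>{p\<in>W \<rightarrow>\<^sub>E {..<n}. inj_on p W}. card (pinned W p \<inter> A))"
proof -
  let ?P = "{p\<in>W \<rightarrow>\<^sub>E {..<n}. inj_on p W}"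
  have fA: "finite A" using A finite_paths finite_subset by auto
  have fW: "finite W" using W finite_subset by auto
  have fP: "finite ?P" using fW by (auto intro!: finite_PiE)
  have "(\<Sum>a\<in>A. 1) = (\<Sum>p\<in>?P. \<Sum>a\<in>{a\<in>A. restrict a W = p}. (1::nat))"
  proof (rule sum.group[symmetric, OF fA fP])
    show "(\<lambda>a. restrict a W) ` A \<subseteq> ?P"
    proof
      fix p assume "p \<in> (\<lambda>a. restrict a W) ` A"
      then obtain a where a: "a \<in> paths" "p = restrict a W" using A by auto
      show "p \<in> ?P" using a path_lt[OF a(1)] path_inj[OF a(1)] W by (auto simp: inj_on_def)
    qed
  qed
  also have "\<dots> = (\<Sum>p\<in>?P. card (pinned W p \<inter> A))"
  proof (intro sum.cong refl)
    fix p assume p: "p \<in> ?P"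
    have "{a\<in>A. restrict a W = p} = pinned W p \<inter> A"
      using p A by (auto simp: pinned_def fun_eq_iff PiE_iff extensional_def restrict_def)
    then show "(\<Sum>a\<in>{a\<in>A. restrict a W = p}. 1) = card (pinned W p \<inter> A)" by simp
  qed
  finally show ?thesis by simp
qed

text \<open>Union bound over a position in \<open>X\<close> and one of the at most
  \<open>2 * n\<close> edges of \<open>E\<close>; a given edge occupies a given position in at most
  \<open>2 * fact (n - 2)\<close> vertex orders.\<close>

lemma card_avoiding_diff:
  assumes E: "sparse E" and X: "X \<subseteq> {..<m}"
  shows "real (card (avoiding E {})) \<le> real (card (avoiding E X))"
    "real (card (avoiding E X)) \<le> real (card (avoiding E {})) + 8 * real (card X) / real n * fact n"
proof -
  have fX: "finite X" using X finite_subset by auto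
  have fE: "finite E" by (rule sparse_finite[OF E])
  have fav: "finite (avoiding E Y)" for Y using finite_paths by (simp add: avoiding_def)
  show "real (card (avoiding E {})) \<le> real (card (avoiding E X))"
    by (intro of_nat_mono card_mono fav) (auto simp: avoiding_def)
  have one: "card {a\<in>paths. edge a i = e} \<le> 2 * fact (n - 2)" if i: "i < m" and e: "card e = 2" for i e
  proof -
    obtain y z where yz: "e = {y, z}" using e by (auto simp: card_2_iff)
    have p: "card (pinned {i, Suc i} q) \<le> fact (n - 2)" for q
      using card_pinned_le[of "{i, Suc i}" q] i lt_m by (simp add: numeral_2_eq_2)
    have "{a\<in>paths. edge a i = e} \<subseteq> pinned {i, Suc i} (\<lambda>j. if j = i then y else z) \<union> pinned {i, Suc i} (\<lambda>j. if j = i then z else y)"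
      by (auto simp: pinned_def edge_def yz doubleton_eq_iff)
    then have "card {a\<in>paths. edge a i = e} \<le> card (pinned {i, Suc i} (\<lambda>j. if j = i then y else z) \<union> pinned {i, Suc i} (\<lambda>j. if j = i then z else y))"
      using finite_pin[of _ _ UNIV] by (intro card_mono) auto
    also have "\<dots> \<le> card (pinned {i, Suc i} (\<lambda>j. if j = i then y else z)) + card (pinned {i, Suc i} (\<lambda>j. if j = i then z else y))"
      by (rule card_Un_le)
    finally show ?thesis using p[of "\<lambda>j. if j = i then y else z"] p[of "\<lambda>j. if j = i then z else y"] by linarith
  qed
  have "avoiding E X \<subseteq> avoiding E {} \<union> (\<Union>i\<in>X. \<Union>e\<in>E. {a\<in>paths. edge a i = e})"
    by (auto simp: avoiding_def)
  then have "card (avoiding E X) \<le> card (avoiding E {} \<union> (\<Union>i\<in>X. \<Union>e\<in>E. {a\<in>paths. edge a i = e}))"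
    using fX fE fav finite_paths by (intro card_mono) auto
  also have "\<dots> \<le> card (avoiding E {}) + card (\<Union>i\<in>X. \<Union>e\<in>E. {a\<in>paths. edge a i = e})" by (rule card_Un_le)
  also have "card (\<Union>i\<in>X. \<Union>e\<in>E. {a\<in>paths. edge a i = e}) \<le> (\<Sum>i\<in>X. card (\<Union>e\<in>E. {a\<in>paths. edge a i = e}))"
    by (rule card_UN_le[OF fX])
  also have "\<dots> \<le> (\<Sum>i\<in>X. 2 * n * (2 * fact (n - 2)))"
  proof (rule sum_mono)
    fix i assume i: "i \<in> X"
    have "card (\<Union>e\<in>E. {a\<in>paths. edge a i = e}) \<le> (\<Sum>e\<in>E. card {a\<in>paths. edge a i = e})" by (rule card_UN_le[OF fE])
    also have "\<dots> \<le> (\<Sum>e\<in>E. 2 * fact (n - 2))"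
      using i X E by (intro sum_mono one) (auto simp: sparse_def K_edges_def)
    also have "\<dots> \<le> 2 * n * (2 * fact (n - 2))" using E by (simp add: sparse_def)
    finally show "card (\<Union>e\<in>E. {a\<in>paths. edge a i = e}) \<le> 2 * n * (2 * fact (n - 2))" .
  qed
  also have "\<dots> = card X * (2 * n * (2 * fact (n - 2)))" by simp
  finally have "real (card (avoiding E X)) \<le> real (card (avoiding E {}) + card X * (2 * n * (2 * fact (n - 2))))"
    by (simp only: of_nat_le_iff)
  also have "real (card (avoiding E {}) + card X * (2 * n * (2 * fact (n - 2))))
      = real (card (avoiding E {})) + real (card X) * (4 * (real n * fact (n - 2)))" by simp
  also have "4 * (real n * fact (n - 2)) \<le> 8 / real n * fact n"
  proof -
    obtain q where q: "n = Suc (Suc q)" using n2 by (metis Suc_le_D numeral_2_eq_2 Suc_le_mono)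
    have "4 * (real n * fact q) * real n \<le> 8 * (real n * (real (Suc q) * fact q))" unfolding q
      by (simp add: algebra_simps)
    then show ?thesis unfolding q by (simp add: field_simps)
  qed
  then have "real (card X) * (4 * (real n * fact (n - 2))) \<le> real (card X) * (8 / real n * fact n)" by (intro mult_left_mono) auto
  finally show "real (card (avoiding E X)) \<le> real (card (avoiding E {})) + 8 * real (card X) / real n * fact n"
    by (simp add: mult_ac)
qed

text \<open>Only its lying between 0 and 1 is ever used, besides its being the same for all
  patterns.\<close>

definition free_prob :: "nat set set \<Rightarrow> real" where
  "free_prob E = real (card (avoiding E {})) / fact n"

lemma free_prob_bounds: "0 \<le> free_prob E" "free_prob E \<le> 1"
proof -
  have "card (avoiding E {}) \<le> card paths" using finite_paths by (intro card_mono) (auto simp: avoiding_def)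
  then have "real (card (avoiding E {})) \<le> real (fact n)" unfolding card_paths by (simp only: of_nat_le_iff)
  then show "0 \<le> free_prob E" "free_prob E \<le> 1" by (auto simp: free_prob_def)
qed

text \<open>By switching, the count is nearly the same for all injective pins, hence close to its
  average, which is an even share of \<open>avoiding E X\<close>; then the exemption of
  \<open>X\<close> is removed. The constant is 64 from switching plus 8 from
  \<open>X\<close>.\<close>

lemma pinned_avoiding_approx:
  assumes W: "W \<subseteq> {..<n}" and E: "sparse E" and Xm: "X \<subseteq> {..<m}" and cX: "card X \<le> card W"
    and X: "\<And>i. i < m \<Longrightarrow> i \<notin> X \<Longrightarrow> \<not> (i \<in> W \<and> Suc i \<in> W)" and v: "4 * (card W + 1) \<le> n"
    and p: "inj_on p W" "p ` W \<subseteq> {..<n}"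
  shows "\<bar>real (card (pinned W p \<inter> avoiding E X)) - free_prob E * fact (n - card W)\<bar>
    \<le> 72 * (real (card W) + 1) ^ 2 / real n * fact (n - card W)"
proof -
  let ?P = "{p\<in>W \<rightarrow>\<^sub>E {..<n}. inj_on p W}" and ?f = "fact (n - card W) :: real" and ?c = "real (card W)"
  let ?R = "64 * (?c + 1) / real n * ?f"
  define F where "F p = real (card (pinned W p \<inter> avoiding E X))" for p
  have fW: "finite W" using W finite_subset by auto
  have R0: "0 \<le> ?R" by simp
  have diff: "\<bar>F p - F q\<bar> \<le> ?c * ?R" if "q \<in> ?P" for q
    unfolding F_def
    by (rule card_pinned_avoiding_diff[OF W E X v p]) (use that fW in \<open>auto intro: card_mono\<close>)
  have cp: "card (pinned W q) = fact (n - card W)" if q: "q \<in> ?P" for q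
  proof -
    have "bij_betw q W (q ` W)" using q by (auto simp: bij_betw_def)
    moreover have "card ({..<n} - W) = card ({..<n} - q ` W)"
      using W q fW card_image[of q W] by (subst (1 2) card_Diff_subset) auto
    then obtain h where h: "bij_betw h ({..<n} - W) ({..<n} - q ` W)"
      using finite_same_card_bij[of "{..<n} - W" "{..<n} - q ` W"] by auto
    define a0 where "a0 i = (if i \<in> W then q i else if i < n then h i else i)" for i
    have 1: "bij_betw a0 W (q ` W)" using \<open>bij_betw q W (q ` W)\<close> by (rule bij_betw_cong[THEN iffD1, rotated]) (simp add: a0_def)
    have 2: "bij_betw a0 ({..<n} - W) ({..<n} - q ` W)" using h by (rule bij_betw_cong[THEN iffD1, rotated]) (simp add: a0_def)
    have "bij_betw a0 (W \<union> ({..<n} - W)) (q ` W \<union> ({..<n} - q ` W))" using 1 2 by (rule bij_betw_combine) auto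
    moreover have "W \<union> ({..<n} - W) = {..<n}" "q ` W \<union> ({..<n} - q ` W) = {..<n}" using W q by auto
    ultimately have "bij_betw a0 {..<n} {..<n}" by simp
    moreover have "a0 i = i" if "i \<notin> {..<n}" for i using that W by (auto simp: a0_def)
    ultimately have "a0 permutes {..<n}" by (rule bij_imp_permutes)
    then have a0: "a0 \<in> paths" by (simp add: paths_def)
    have "pinned W q = {a\<in>paths. \<forall>u\<in>W. a u = a0 u}" by (auto simp: pinned_def a0_def)
    then show ?thesis using card_pinned[OF a0 W] by simp
  qed
  define N where "N = real (card ?P)"
  have Nf: "N * ?f = fact n"
  proof -
    have "card paths = (\<Sum>q\<in>?P. card (pinned W q \<inter> paths))" by (rule sum_pins[OF W]) simp
    also have "\<dots> = (\<Sum>q\<in>?P. fact (n - card W))"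
      by (intro sum.cong refl) (simp add: cp[symmetric] pinned_def Int_absorb2)
    finally have "real (fact n) = real (card ?P * fact (n - card W))" by (simp only: card_paths sum_constant of_nat_id)
    then show ?thesis by (simp add: N_def)
  qed
  have "0 < N * ?f" unfolding Nf by simp
  then have Np: "0 < N" by (simp add: zero_less_mult_iff)
  define A where "A = real (card (avoiding E X))"
  have "A = (\<Sum>q\<in>?P. F q)"
    unfolding A_def F_def using sum_pins[OF W, of "avoiding E X"] by (simp add: avoiding_def)
  then have "N * F p - A = (\<Sum>q\<in>?P. F p - F q)" by (simp add: sum_subtractf N_def)
  then have "\<bar>N * F p - A\<bar> \<le> (\<Sum>q\<in>?P. \<bar>F p - F q\<bar>)" by simp
  also have "\<dots> \<le> (\<Sum>q\<in>?P. ?c * ?R)" by (intro sum_mono diff)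
  finally have b1: "\<bar>N * F p - A\<bar> \<le> N * (?c * ?R)" by (simp add: N_def)
  have b2: "\<bar>A - free_prob E * fact n\<bar> \<le> 8 * real (card X) / real n * fact n"
    using card_avoiding_diff[OF E Xm] by (simp add: A_def free_prob_def)
  also have "\<dots> \<le> 8 * ?c / real n * fact n" using cX by (intro mult_right_mono divide_right_mono) auto
  finally have b3: "\<bar>A - free_prob E * fact n\<bar> \<le> 8 * ?c / real n * fact n" .
  have "\<bar>N * (F p - free_prob E * ?f)\<bar> = \<bar>(N * F p - A) + (A - free_prob E * fact n)\<bar>"
    by (simp add: algebra_simps flip: Nf)
  also have "\<dots> \<le> N * (?c * ?R) + 8 * ?c / real n * fact n" using b1 b3 by linarith
  also have "\<dots> = N * (?c * ?R + 8 * ?c / real n * ?f)" unfolding Nf[symmetric] by (simp add: algebra_simps)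
  finally have "\<bar>F p - free_prob E * ?f\<bar> \<le> ?c * ?R + 8 * ?c / real n * ?f"
    using Np by (simp add: abs_mult)
  also have "\<dots> = (64 * ?c * (?c + 1) + 8 * ?c) / real n * ?f" using n2 by (simp add: field_simps)
  also have "\<dots> \<le> 72 * (?c + 1) ^ 2 / real n * ?f"
    by (intro mult_right_mono divide_right_mono) (auto simp: power2_eq_square algebra_simps)
  finally show ?thesis by (simp add: F_def)
qed

end

definition diff_run :: "nat set \<Rightarrow> nat \<Rightarrow> nat \<Rightarrow> bool" where
  "diff_run J i j \<longleftrightarrow> (\<exists>k. k \<notin> J \<and> (i < k \<and> k < j \<or> j < k \<and> k < i))"

section \<open>Uniform approximation of powers and factorials\<close>

lemma power_diff_le:
  fixes x y :: real
  assumes "0 \<le> y" "y \<le> x" 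
  shows "x ^ M - y ^ M \<le> real M * (x - y) * x ^ (M - 1)"
proof (induction M)
  case (Suc M)
  have x0: "0 \<le> x" using assms by simp
  have "x ^ Suc M - y ^ Suc M = x * (x ^ M - y ^ M) + (x - y) * y ^ M" by (simp add: algebra_simps)
  also have "\<dots> \<le> x * (real M * (x - y) * x ^ (M - 1)) + (x - y) * x ^ M"
    using assms x0 Suc by (intro add_mono mult_left_mono power_mono) auto
  also have "\<dots> = real (Suc M) * (x - y) * x ^ (Suc M - 1)"
    by (cases M) (auto simp: algebra_simps)
  finally show ?case .
qed simp

text \<open>Uniformly in \<open>z\<close>: the difference is at most
  \<open>M * z ^ 2 / 2 * exp (- y)\<close> with \<open>y = (M - 1) * z\<close>, and since
  \<open>M * z \<le> 2 * y\<close> the bounded function \<open>y ^ 2 * exp (- y)\<close> leaves only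
  \<open>1 / M\<close>.\<close>

lemma exp_minus_pow_le:
  fixes z :: real
  assumes z: "0 \<le> z" "z \<le> 1" and M: "2 \<le> M"
  shows "exp (- z) ^ M - (1 - z) ^ M \<le> 4 / real M"
proof -
  have le: "1 - z \<le> exp (- z)" using exp_ge_add_one_self[of "-z"] by simp
  have e2: "exp (- z) - (1 - z) \<le> z ^ 2 / 2"
  proof -
    have "exp z * (1 - z + z ^ 2 / 2) \<ge> 1"
    proof -
      have "1 + z + z ^ 2 / 2 \<le> exp z" by (rule exp_lower_Taylor_quadratic[OF z(1)])
      moreover have "0 \<le> 1 - z + z ^ 2 / 2" using z by simp
      ultimately have "(1 + z + z ^ 2 / 2) * (1 - z + z ^ 2 / 2) \<le> exp z * (1 - z + z ^ 2 / 2)" by (intro mult_right_mono)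
      moreover have "(1 + z + z ^ 2 / 2) * (1 - z + z ^ 2 / 2) = 1 + z ^ 4 / 4"
        by (simp add: algebra_simps power2_eq_square power4_eq_xxxx)
      moreover have "(0::real) \<le> z ^ 4 / 4" by simp
      ultimately show ?thesis by linarith
    qed
    then have "exp (- z) \<le> 1 - z + z ^ 2 / 2" by (simp add: exp_minus field_simps)
    then show ?thesis by simp
  qed
  define y where "y = real (M - 1) * z"
  have y0: "0 \<le> y" using z by (simp add: y_def)
  have "exp (- z) ^ M - (1 - z) ^ M \<le> real M * (exp (- z) - (1 - z)) * exp (- z) ^ (M - 1)"
    using z le by (intro power_diff_le) auto
  also have "\<dots> \<le> real M * (z ^ 2 / 2) * exp (- z) ^ (M - 1)"
    using e2 by (intro mult_right_mono mult_left_mono) auto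
  also have "exp (- z) ^ (M - 1) = exp (- y)" unfolding y_def by (simp flip: exp_of_nat_mult)
  also have "real M * (z ^ 2 / 2) * exp (- y) \<le> 4 / real M"
  proof -
    have "y ^ 2 / 2 \<le> exp y" using exp_lower_Taylor_quadratic[OF y0] y0 by linarith
    then have "y ^ 2 / 2 * exp (- y) \<le> 1" by (simp add: exp_minus field_simps)
    moreover have "real M ^ 2 * z ^ 2 \<le> 4 * y ^ 2"
    proof -
      have "real M * z \<le> 2 * y" using z M by (simp add: y_def of_nat_diff algebra_simps)
        (use mult_right_mono[of 2 "real M" z] z M in \<open>simp add: mult.commute\<close>)
      then have "(real M * z) ^ 2 \<le> (2 * y) ^ 2" using z by (intro power_mono) auto
      then show ?thesis by (simp add: power_mult_distrib)
    qed
    then have "real M ^ 2 * z ^ 2 * exp (- y) \<le> 4 * y ^ 2 * exp (- y)" by (intro mult_right_mono) auto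
    moreover have "4 * y ^ 2 * exp (- y) = 8 * (y ^ 2 / 2 * exp (- y))" by simp
    ultimately have "real M ^ 2 * z ^ 2 * exp (- y) \<le> 8" by linarith
    then show ?thesis using M by (simp add: field_simps power2_eq_square)
  qed
  finally show ?thesis .
qed

text \<open>The left side is the normalised number of choices of \<open>M\<close> labels outside
  \<open>s + r\<close> forbidden values. It is compared with \<open>(1 - s / Q) ^ M\<close>, then
  with \<open>exp (- M * s / Q)\<close>, then with \<open>n\<close> in place of \<open>M\<close>.
  All errors are uniform in \<open>s\<close>, which may be as large as \<open>Q\<close>.\<close>

lemma falling_approx:
  fixes Q M k r s n :: nat
  assumes s: "s + r \<le> Q" and M2: "2 \<le> M" and n: "n = M + k + 1" and Q: "1 \<le> Q"
  shows "\<bar>fact M * real ((Q - (s + r)) choose M) / real Q ^ M - exp (- (real n * real s / real Q))\<bar>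
    \<le> (real k + 5) / real M + real M * (real r + real M) / real Q"
proof -
  define P where "P = fact M * real ((Q - (s + r)) choose M) / real Q ^ M"
  define z where "z = real s / real Q"
  have Qp: "0 < real Q" using Q by simp
  have Mp: "0 < real M" using M2 by simp
  have z: "0 \<le> z" "z \<le> 1" using s Qp by (auto simp: z_def)
  have ez: "exp (- z) ^ M = exp (- (real M * z))" by (simp flip: exp_of_nat_mult)
  have nz: "real n * real s / real Q = real n * z" by (simp add: z_def)
  have up: "P \<le> exp (- z) ^ M"
  proof -
    have "((Q - (s + r)) choose M) * fact M \<le> (Q - (s + r)) ^ M" by (rule binomial_fact_pow)
    also have "\<dots> \<le> (Q - s) ^ M" by (rule power_mono) auto
    finally have "real (((Q - (s + r)) choose M) * fact M) \<le> real ((Q - s) ^ M)" by (simp only: of_nat_le_iff)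
    then have "P \<le> (real (Q - s) / real Q) ^ M" using Qp
      by (simp add: P_def power_divide divide_right_mono mult.commute)
    also have "real (Q - s) / real Q = 1 - z" using s Qp by (simp add: z_def of_nat_diff field_simps)
    also have "(1 - z) ^ M \<le> exp (- z) ^ M" using z exp_ge_add_one_self[of "-z"] by (intro power_mono) auto
    finally show ?thesis .
  qed
  have mono: "exp (- (real n * z)) \<le> exp (- z) ^ M" unfolding ez using z n by (simp add: mult_right_mono)
  have diff: "exp (- z) ^ M - exp (- (real n * z)) \<le> (real k + 1) / real M"
  proof -
    have "exp (- (real n * z)) = exp (- (real M * z)) * exp (- ((real k + 1) * z))"
      unfolding n by (simp add: algebra_simps flip: exp_add)
    moreover have "1 - (real k + 1) * z \<le> exp (- ((real k + 1) * z))" using exp_ge_add_one_self[of "- ((real k + 1) * z)"] by simp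
    then have "exp (- (real M * z)) * (1 - exp (- ((real k + 1) * z))) \<le> exp (- (real M * z)) * ((real k + 1) * z)"
      by (intro mult_left_mono) auto
    moreover have "exp (- (real M * z)) * ((real k + 1) * z) \<le> (real k + 1) / real M"
    proof -
      have "real M * z \<le> exp (real M * z)" using exp_ge_add_one_self[of "real M * z"] by linarith
      then have "exp (- (real M * z)) * (real M * z) \<le> 1" by (simp add: exp_minus field_simps)
      then have "(real k + 1) * (exp (- (real M * z)) * (real M * z)) \<le> (real k + 1) * 1" by (intro mult_left_mono) auto
      then show ?thesis using Mp by (simp add: field_simps)
    qed
    ultimately show ?thesis unfolding ez by (simp add: algebra_simps)
  qed
  have lo: "(1 - z) ^ M - real M * (real r + real M) / real Q \<le> P"
  proof -
    define y where "y = real (Q - (s + r) - M) / real Q"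
    have y0: "0 \<le> y" by (simp add: y_def)
    have xy: "1 - z - y \<le> (real r + real M) / real Q"
    proof -
      have "real Q - real s - real (Q - (s + r) - M) \<le> real r + real M" by linarith
      then have "(real Q - real s - real (Q - (s + r) - M)) / real Q \<le> (real r + real M) / real Q" by (intro divide_right_mono) auto
      then show ?thesis using Qp by (simp add: z_def y_def diff_divide_distrib)
    qed
    have yx: "y \<le> 1 - z"
    proof -
      have "real (Q - (s + r) - M) \<le> real Q - real s" using s by linarith
      then have "real (Q - (s + r) - M) / real Q \<le> (real Q - real s) / real Q" by (intro divide_right_mono) auto
      then show ?thesis using Qp by (simp add: z_def y_def diff_divide_distrib)
    qed
    have yP: "y ^ M \<le> P"
    proof (cases "M \<le> Q - (s + r)")
      case True
      define A where "A = Q - (s + r) - M"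
      have eq: "Q - (s + r) = A + M" using True by (simp add: A_def)
      have "real A ^ M * fact A \<le> fact (A + M)" by (rule fact_add_ge) auto
      moreover have "fact M * real ((A + M) choose M) = fact (A + M) / fact A"
        using binomial_fact[of M "A + M", where 'a = real] by simp
      ultimately have "fact A * real A ^ M \<le> fact A * (fact M * real ((A + M) choose M))" by (simp add: mult.commute)
      then have "real A ^ M \<le> fact M * real ((A + M) choose M)" by (simp only: mult_le_cancel_left_pos fact_gt_zero)
      then show ?thesis unfolding P_def y_def power_divide eq using Qp by (simp add: divide_right_mono)
    next
      case False
      then have "y = 0" by (simp add: y_def)
      then show ?thesis using M2 by (simp add: P_def power_0_left)
    qed
    have "(1 - z) ^ M - y ^ M \<le> real M * (1 - z - y) * (1 - z) ^ (M - 1)" by (rule power_diff_le[OF y0 yx])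
    also have "\<dots> \<le> real M * (1 - z - y) * 1"
      using z yx by (intro mult_left_mono power_le_one) auto
    also have "\<dots> \<le> real M * ((real r + real M) / real Q)" unfolding mult_1_right by (rule mult_left_mono[OF xy]) simp
    finally show ?thesis using yP by simp
  qed
  have e4: "exp (- z) ^ M - (1 - z) ^ M \<le> 4 / real M" by (rule exp_minus_pow_le[OF z M2])
  have nn: "0 \<le> real M * (real r + real M) / real Q" "0 \<le> (real k + 1) / real M" "0 \<le> 4 / real M" by auto
  have s5: "(real k + 5) / real M = (real k + 1) / real M + 4 / real M" by (simp flip: add_divide_distrib)
  show ?thesis unfolding P_def[symmetric] nz using up mono diff lo e4 nn s5 unfolding abs_le_iff by linarith
qed

text \<open>For \<open>r \<ge> 1\<close> the two factorials differ by \<open>r - 1\<close> factors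
  between \<open>n - 2 * k\<close> and \<open>n\<close>. The equivalence of \<open>r = 0\<close> and
  \<open>k = 0\<close> covers the empty pattern, where the quotient is
  \<open>fact n / fact (n - 1) = n\<close>.\<close>

lemma fact_quotient_approx:
  fixes n k r M :: nat
  assumes M: "M = n - 1 - k" and r: "r \<le> k" and rk: "r = 0 \<longleftrightarrow> k = 0" and n: "16 * (k + 1) ^ 2 \<le> n"
  shows "real n * (1 / real n) ^ r \<le> fact (n - (k + r)) / fact M"
    "fact (n - (k + r)) / fact M \<le> (1 + 8 * real k ^ 2 / real n) * (real n * (1 / real n) ^ r)"
proof -
  have "16 * (k + 1) \<le> 16 * (k + 1) ^ 2" by (simp add: power2_eq_square)
  then have n1: "16 * (k + 1) \<le> n" using n by linarith
  have np: "0 < real n" using n1 by simp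
  have "real n * (1 / real n) ^ r \<le> fact (n - (k + r)) / fact M \<and>
    fact (n - (k + r)) / fact M \<le> (1 + 8 * real k ^ 2 / real n) * (real n * (1 / real n) ^ r)"
  proof (cases r)
    case 0
    then have k0: "k = 0" using rk by simp
    obtain q where "n = Suc q" using n1 by (cases n) auto
    then have "fact n / fact (n - 1) = real n" by simp
    then show ?thesis using 0 k0 M by simp
  next
    case (Suc q)
    define A where "A = n - (k + r)"
    have Mq: "M = A + q" using M Suc r n1 by (simp add: A_def)
    have A: "real n - 2 * real k \<le> real (Suc A)" using r n1 by (simp add: A_def)
    have lowb: "(real n - 2 * real k) ^ q * fact A \<le> fact M" unfolding Mq using A n1 by (intro fact_add_ge) auto
    have upb: "fact M \<le> real n ^ q * (fact A :: real)"
    proof -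
      have "fact (A + i) \<le> real n ^ i * (fact A :: real)" if "i \<le> q" for i using that
      proof (induction i)
        case (Suc i)
        have "fact (A + Suc i) = real (Suc (A + i)) * (fact (A + i) :: real)" by simp
        also have "\<dots> \<le> real n * (real n ^ i * fact A)"
          using Suc Mq M n1 by (intro mult_mono) auto
        finally show ?case by simp
      qed simp
      then show ?thesis unfolding Mq by simp
    qed
    have pn: "real n * (1 / real n) ^ r = 1 / real n ^ q" using Suc np by (simp add: power_divide)
    have pos: "0 < real n - 2 * real k" using n1 by simp
    have 1: "1 / real n ^ q \<le> fact A / fact M" using upb np by (simp add: field_simps)
    have 2: "fact A / fact M \<le> 1 / (real n - 2 * real k) ^ q" using lowb pos by (simp add: field_simps)
    also have "\<dots> = (real n / (real n - 2 * real k)) ^ q * (1 / real n ^ q)" using np by (simp add: power_divide)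
    finally have 3: "fact A / fact M \<le> (real n / (real n - 2 * real k)) ^ q * (1 / real n ^ q)" .
    have b2: "(real n / (real n - 2 * real k)) ^ q \<le> 1 + 8 * real k ^ 2 / real n"
    proof -
      have b1: "real n / (real n - 2 * real k) \<le> 1 + 4 * real k / real n"
      proof -
        have "real n * real n \<le> (real n + 4 * real k) * (real n - 2 * real k)"
          using mult_right_mono[of "8 * real k" "2 * real n" "real k"] n1 by (simp add: algebra_simps)
        then show ?thesis using pos np by (simp add: field_simps)
      qed
      have "(real n / (real n - 2 * real k)) ^ q \<le> (1 + 4 * real k / real n) ^ q"
        using b1 pos by (intro power_mono) auto
      also have "\<dots> \<le> exp (4 * real k / real n) ^ q" by (intro power_mono exp_ge_add_one_self) auto
      also have "\<dots> = exp (real q * (4 * real k / real n))" by (rule exp_of_nat_mult[symmetric])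
      also have "\<dots> \<le> exp (4 * real k ^ 2 / real n)"
      proof -
        have "real q * (4 * real k) \<le> real k * (4 * real k)" using Suc r by (intro mult_right_mono) auto
        then show ?thesis using np by (simp add: power2_eq_square divide_right_mono)
      qed
      also have "\<dots> \<le> 1 + 2 * (4 * real k ^ 2 / real n)"
      proof (rule real_exp_bound_lemma)
        have "8 * k ^ 2 \<le> 16 * (k + 1) ^ 2" by (simp add: power2_eq_square)
        then have "8 * k ^ 2 \<le> n" using n by linarith
        then have "real (8 * k ^ 2) \<le> real n" by (simp only: of_nat_le_iff)
        then show "4 * real k ^ 2 / real n \<le> 1 / 2" using np by (simp add: field_simps)
      qed auto
      finally show ?thesis by simp
    qed
    have "(real n / (real n - 2 * real k)) ^ q * (1 / real n ^ q) \<le> (1 + 8 * real k ^ 2 / real n) * (1 / real n ^ q)"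
      by (rule mult_right_mono[OF b2]) simp
    with 3 have "fact A / fact M \<le> (1 + 8 * real k ^ 2 / real n) * (1 / real n ^ q)" by (rule order.trans)
    then show ?thesis using 1 unfolding pn A_def[symmetric] by simp
  qed
  then show "real n * (1 / real n) ^ r \<le> fact (n - (k + r)) / fact M"
    "fact (n - (k + r)) / fact M \<le> (1 + 8 * real k ^ 2 / real n) * (real n * (1 / real n) ^ r)" by auto
qed

text \<open>Labels of different runs are so far apart that a typical path has several other labels
  between them, which keeps the places of the runs apart as well.\<close>

locale sep_pattern = pattern +
  fixes h :: nat
  assumes sp: "sparse E"
    and sep: "\<And>i j. i \<in> J \<Longrightarrow> j \<in> J \<Longrightarrow> diff_run J i j \<Longrightarrow> x i < x j \<Longrightarrow> x i + 2 * h + 2 \<le> x j"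
    and n_large: "16 * (card J + 1) ^ 2 \<le> n" and h_le: "h \<le> Q"
begin

text \<open>Two labels in between put the slots of different runs at distance at least 3. At
  distance 1 two runs would share a vertex place; at distance 2 the edge joining them would have
  both ends pinned, and switching could not control whether it lies in \<open>E\<close>.\<close>

definition good_TJ :: "(nat \<Rightarrow> nat) set" where
  "good_TJ = {t\<in>TJ. \<forall>i\<in>J. \<forall>j\<in>J. diff_run J i j \<longrightarrow> x i < x j \<longrightarrow> 2 \<le> card (t ` {..<m} \<inter> {x i<..<x j})}"

lemma same_run_slot:
  assumes t: "t \<in> TJ" and i: "i \<in> J" and j: "j \<in> J" and ij: "i \<le> j" and s: "\<not> diff_run J i j"
  shows "slot t j = slot t i + (j - i)"
proof -
  have run: "k \<in> J" if "i \<le> k" "k \<le> j" for k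
  proof (cases "k = i \<or> k = j")
    case False
    then have "i < k" "k < j" using that by auto
    then show ?thesis using s by (auto simp: diff_run_def)
  qed (use i j in auto)
  have "i + q \<le> j \<Longrightarrow> slot t (i + q) = slot t i + q" for q
  proof (induction q)
    case (Suc q)
    then show ?case using slot_Suc[OF t run[of "i + q"]] run[of "Suc (i + q)"] by simp
  qed simp
  from this[of "j - i"] ij show ?thesis by simp
qed

lemma between_slots:
  assumes t: "t \<in> TJ" and i: "i \<in> J" and j: "j \<in> J"
  shows "card (t ` {..<m} \<inter> {x i<..<x j}) \<le> slot t j - slot t i - 1"
proof -
  have ti: "t \<in> incs" using t by (simp add: TJ_def)
  note si = slot_TJ[OF t i] and sj = slot_TJ[OF t j]
  have "t ` {..<m} \<inter> {x i<..<x j} \<subseteq> t ` {slot t i<..<slot t j}"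
  proof
    fix y assume "y \<in> t ` {..<m} \<inter> {x i<..<x j}"
    then obtain k where k: "k < m" "y = t k" "x i < t k" "t k < x j" by auto
    have "slot t i < k" "k < slot t j"
      using incs_less_iff[OF ti si(1) k(1)] incs_less_iff[OF ti k(1) sj(1)] si sj k by auto
    then show "y \<in> t ` {slot t i<..<slot t j}" using k by auto
  qed
  then have "card (t ` {..<m} \<inter> {x i<..<x j}) \<le> card (t ` {slot t i<..<slot t j})" by (intro card_mono) auto
  also have "\<dots> \<le> card {slot t i<..<slot t j}" by (rule card_image_le) simp
  finally show ?thesis by simp
qed

lemma good_slot:
  assumes t: "t \<in> good_TJ" and i: "i \<in> J" and j: "j \<in> J" and lt: "slot t i < slot t j"
  shows "(i < j \<and> slot t j = slot t i + (j - i) \<and> \<not> diff_run J i j) \<or> slot t i + 3 \<le> slot t j"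
proof (cases "diff_run J i j")
  case True
  have tT: "t \<in> TJ" using t by (simp add: good_TJ_def)
  have "x i < x j" using slot_less_iff[OF tT i j] lt by simp
  then have "2 \<le> card (t ` {..<m} \<inter> {x i<..<x j})" using t i j True by (simp add: good_TJ_def)
  then show ?thesis using between_slots[OF tT i j] by linarith
next
  case False
  have tT: "t \<in> TJ" using t by (simp add: good_TJ_def)
  have F: "\<not> diff_run J j i" using False by (auto simp: diff_run_def)
  have "i < j"
  proof (rule ccontr)
    assume "\<not> i < j"
    then show False using same_run_slot[OF tT j i _ F] lt by simp
  qed
  then show ?thesis using same_run_slot[OF tT i j _ False] False by simp
qed

lemma vslot_inj:
  assumes t: "t \<in> good_TJ"
  shows "inj_on (vslot t) (covered J)"
proof -
  have tT: "t \<in> TJ" using t by (simp add: good_TJ_def)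
  have key: False if u: "u \<in> J" and j: "j \<in> J" "Suc j \<notin> J" and eq: "slot t u = Suc (slot t j)" for u j
  proof -
    from good_slot[OF t j(1) u] eq have "j < u" "u = Suc j" by auto
    then show False using u j by simp
  qed
  show ?thesis
  proof (rule inj_onI)
    fix u v assume uv: "u \<in> covered J" "v \<in> covered J" "vslot t u = vslot t v"
    show "u = v"
    proof (cases "u \<in> J")
      case u: True
      show ?thesis
      proof (cases "v \<in> J")
        case True
        then show ?thesis using u uv(3) slot_inj[OF tT] by (auto simp: vslot_def inj_on_def)
      next
        case False
        then obtain j where "v = Suc j" "j \<in> J" using uv by (auto simp: covered_def)
        then show ?thesis using key[of u j] u uv(3) False by (auto simp: vslot_def)
      qed
    next
      case u: False
      then obtain i where i: "u = Suc i" "i \<in> J" using uv by (auto simp: covered_def)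
      show ?thesis
      proof (cases "v \<in> J")
        case True
        then show ?thesis using key[of v i] i u uv(3) by (auto simp: vslot_def)
      next
        case False
        then obtain j where j: "v = Suc j" "j \<in> J" using uv by (auto simp: covered_def)
        have "slot t i = slot t j" using i j u False uv(3) by (auto simp: vslot_def)
        then show ?thesis using slot_inj[OF tT] i j by (auto simp: inj_on_def)
      qed
    qed
  qed
qed

lemma slots_apart:
  assumes t: "t \<in> good_TJ" and i: "i \<notin> slot t ` J"
  shows "\<not> (i \<in> vslot t ` covered J \<and> Suc i \<in> vslot t ` covered J)"
proof
  assume a: "i \<in> vslot t ` covered J \<and> Suc i \<in> vslot t ` covered J"
  have tT: "t \<in> TJ" using t by (simp add: good_TJ_def)
  have cov: "\<exists>j\<in>J. y = slot t j \<or> y = Suc (slot t j)" if "y \<in> vslot t ` covered J" for y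
    using that vslot_Suc[OF tT] by (auto simp: covered_def)
  obtain j where j: "j \<in> J" "i = Suc (slot t j)" using cov[of i] a i by auto
  obtain j' where j': "j' \<in> J" "Suc i = slot t j'" using cov[of "Suc i"] a i by auto
  have "slot t j < slot t j'" using j j' by simp
  from good_slot[OF t j(1) j'(1) this] j j' have g: "j < j'" "j' - j = 2" "\<not> diff_run J j j'" by auto
  then have "Suc j \<in> J" by (auto simp: diff_run_def)
  then have "slot t (Suc j) = i" using slot_Suc[OF tT j(1)] j by simp
  then show False using i \<open>Suc j \<in> J\<close> by blast
qed

text \<open>An orientation maps \<open>covered J\<close> onto the vertices of the pattern, a set of
  the same cardinality.\<close>

lemma orientation_inj:
  assumes g: "g \<in> orientations d J"
  shows "inj_on g (covered J)" "g ` covered J \<subseteq> {..<n}"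
proof -
  have "g ` covered J = (\<Union>j\<in>J. edge g j)" by (auto simp: covered_def edge_def)
  also have "\<dots> = (\<Union>j\<in>J. edge d j)" using g by (auto simp: orientations_def)
  finally have im: "g ` covered J = \<Union>S" by simp
  have "card (g ` covered J) = card (covered J)"
    unfolding im card_Union_S by (simp add: card_covered finJ)
  then show "inj_on g (covered J)" using finite_patterns(4)[OF finJ] by (rule eq_card_imp_inj_on[rotated])
  show "g ` covered J \<subseteq> {..<n}" unfolding im using SE EK by (auto simp: K_edges_def)
qed

lemma card_fits_approx:
  assumes t: "t \<in> good_TJ"
  shows "\<bar>real (card (fits t)) - 2 ^ card (singles J) * free_prob E * fact (n - card (covered J))\<bar>
    \<le> 2 ^ card (singles J) * (72 * (real (card (covered J)) + 1) ^ 2 / real n * fact (n - card (covered J)))"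
proof -
  have tT: "t \<in> TJ" using t by (simp add: good_TJ_def)
  define W where "W = vslot t ` covered J"
  define X where "X = slot t ` J"
  let ?v = "card (covered J)"
  let ?err = "72 * (real ?v + 1) ^ 2 / real n * fact (n - ?v)"
  have cW: "card W = ?v" unfolding W_def by (rule card_image[OF vslot_inj[OF t]])
  have Wn: "W \<subseteq> {..<n}" using vslot_n[OF tT] by (auto simp: W_def)
  have Xm: "X \<subseteq> {..<m}" using slot_TJ(1)[OF tT] by (auto simp: X_def)
  have cX: "card X \<le> card W" unfolding cW X_def card_covered[OF finJ] using card_image_le[OF finJ, of "slot t"] by linarith
  have cv: "?v \<le> 2 * card J" using card_covered[OF finJ] card_starts_le[OF finJ] by linarith
  have "16 * (card J + 1) \<le> 16 * (card J + 1) ^ 2" by (simp add: power2_eq_square)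
  then have "16 * card J + 16 \<le> n" using n_large by simp
  moreover have "4 * (card W + 1) = 4 * card W + 4" by simp
  ultimately have v4: "4 * (card W + 1) \<le> n" using cv cW by linarith
  have one: "\<bar>real (card {a\<in>paths. (\<forall>u\<in>covered J. a (vslot t u) = g u) \<and> (\<forall>i<m. i \<notin> slot t ` J \<longrightarrow> edge a i \<notin> E)})
      - free_prob E * fact (n - ?v)\<bar> \<le> ?err" if g: "g \<in> orientations d J" for g
  proof -
    define p where "p v = g (inv_into (covered J) (vslot t) v)" for v
    have pv: "p (vslot t u) = g u" if "u \<in> covered J" for u
      unfolding p_def using inv_into_f_f[OF vslot_inj[OF t] that] by simp
    have pinj: "inj_on p W"
    proof (rule inj_onI)
      fix y z assume yz: "y \<in> W" "z \<in> W" "p y = p z"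
      then obtain u v where uv: "u \<in> covered J" "v \<in> covered J" "y = vslot t u" "z = vslot t v" by (auto simp: W_def)
      then have "g u = g v" using yz pv by simp
      then show "y = z" using orientation_inj(1)[OF g] uv by (auto simp: inj_on_def)
    qed
    have pn: "p ` W \<subseteq> {..<n}" using pv orientation_inj(2)[OF g] by (auto simp: W_def)
    have eq: "{a\<in>paths. (\<forall>u\<in>covered J. a (vslot t u) = g u) \<and> (\<forall>i<m. i \<notin> slot t ` J \<longrightarrow> edge a i \<notin> E)} = pinned W p \<inter> avoiding E X"
      by (auto simp: pinned_def avoiding_def W_def X_def pv)
    have "\<bar>real (card (pinned W p \<inter> avoiding E X)) - free_prob E * fact (n - card W)\<bar>
      \<le> 72 * (real (card W) + 1) ^ 2 / real n * fact (n - card W)"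
      by (rule pinned_avoiding_approx[OF Wn sp Xm cX _ v4 pinj pn]) (use slots_apart[OF t] in \<open>auto simp: W_def X_def\<close>)
    then show ?thesis unfolding eq cW .
  qed
  have "\<bar>real (card (fits t)) - 2 ^ card (singles J) * free_prob E * fact (n - ?v)\<bar>
    = \<bar>\<Sum>g\<in>orientations d J. (real (card {a\<in>paths. (\<forall>u\<in>covered J. a (vslot t u) = g u) \<and> (\<forall>i<m. i \<notin> slot t ` J \<longrightarrow> edge a i \<notin> E)})
      - free_prob E * fact (n - ?v))\<bar>"
    unfolding card_fits_sum[OF tT] sum_subtractf by (simp add: card_orientations[OF finJ inj])
  also have "\<dots> \<le> (\<Sum>g\<in>orientations d J. ?err)" by (rule order.trans[OF sum_abs sum_mono[OF one]])
  also have "\<dots> = 2 ^ card (singles J) * ?err" by (simp add: card_orientations[OF finJ inj])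
  finally show ?thesis .
qed

lemma card_empty_window_le:
  assumes A: "A \<subseteq> {..<Q}" and cA: "card A = h"
  shows "real (card {t\<in>incs. x ` J \<subseteq> t ` {..<m} \<and> t ` {..<m} \<inter> A = {}}) \<le> real (Q - h) ^ (m - card J) / fact (m - card J)"
proof (cases "x ` J \<inter> A = {}")
  case True
  have X: "x ` J \<subseteq> {..<Q}" using xQ by auto
  have cX: "card (x ` J) = card J" using x_inj by (simp add: card_image)
  have "card {t\<in>incs. x ` J \<subseteq> t ` {..<m} \<and> t ` {..<m} \<inter> A = {}} = (Q - card J - h) choose (m - card J)"
    using card_incs_image[of "\<lambda>B. x ` J \<subseteq> B \<and> B \<inter> A = {}"] card_subsets_between[OF _ X A True, of m] card_J
    by (simp add: cX cA)
  also have "\<dots> \<le> (Q - h) choose (m - card J)" by (rule binomial_right_mono) simp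
  finally have "real (card {t\<in>incs. x ` J \<subseteq> t ` {..<m} \<and> t ` {..<m} \<inter> A = {}}) \<le> real ((Q - h) choose (m - card J))"
    by (simp only: of_nat_le_iff)
  also have "\<dots> \<le> real (Q - h) ^ (m - card J) / fact (m - card J)" by (rule choose_le_pow)
  finally show ?thesis .
next
  case False
  then have e: "{t\<in>incs. x ` J \<subseteq> t ` {..<m} \<and> t ` {..<m} \<inter> A = {}} = {}" by auto
  show ?thesis unfolding e by simp
qed

text \<open>The \<open>2 * h\<close> values above the smaller label form two windows of length
  \<open>h\<close>. If \<open>t\<close> takes values in both, it has two labels between the runs; so
  a bad \<open>t\<close> misses a whole window for one of at most \<open>card J ^ 2\<close>
  pairs.\<close>

lemma card_bad_TJ_le:
  "real (card (TJ - good_TJ)) \<le> 2 * real (card J) ^ 2 * (real (Q - h) ^ (m - card J) / fact (m - card J))"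
proof -
  define B where "B A = {t\<in>incs. x ` J \<subseteq> t ` {..<m} \<and> t ` {..<m} \<inter> A = {}}" for A
  let ?R = "real (Q - h) ^ (m - card J) / fact (m - card J)"
  define PP where "PP = {(i,j)\<in>J \<times> J. x i + 2 * h + 2 \<le> x j}"
  have fPP: "finite PP" using finJ by (auto simp: PP_def intro: finite_subset[of _ "J \<times> J"])
  have fB: "finite (B A)" for A using finite_incs by (simp add: B_def)
  have cPP: "card PP \<le> card J ^ 2"
    using card_mono[of "J \<times> J" PP] finJ by (auto simp: PP_def card_cartesian_product power2_eq_square)
  have sub: "TJ - good_TJ \<subseteq> (\<Union>(i,j)\<in>PP. B {x i<..x i + h} \<union> B {x i + h<..x i + 2 * h})"
  proof
    fix t assume t: "t \<in> TJ - good_TJ"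
    then obtain i j where ij: "i \<in> J" "j \<in> J" "diff_run J i j" "x i < x j" and c: "card (t ` {..<m} \<inter> {x i<..<x j}) < 2"
      by (auto simp: good_TJ_def not_le)
    have s: "x i + 2 * h + 2 \<le> x j" by (rule sep[OF ij])
    have "t ` {..<m} \<inter> {x i<..x i + h} = {} \<or> t ` {..<m} \<inter> {x i + h<..x i + 2 * h} = {}"
    proof (rule ccontr)
      assume "\<not> ?thesis"
      then obtain y z where y: "y \<in> t ` {..<m}" "y \<in> {x i<..x i + h}" and z: "z \<in> t ` {..<m}" "z \<in> {x i + h<..x i + 2 * h}" by blast
      have "{y, z} \<subseteq> t ` {..<m} \<inter> {x i<..<x j}" using y z s by auto
      then have "card {y, z} \<le> card (t ` {..<m} \<inter> {x i<..<x j})" by (intro card_mono) auto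
      moreover have "y \<noteq> z" using y z by auto
      ultimately show False using c by simp
    qed
    then show "t \<in> (\<Union>(i,j)\<in>PP. B {x i<..x i + h} \<union> B {x i + h<..x i + 2 * h})"
      using t ij s by (auto simp: PP_def B_def TJ_def)
  qed
  have "card (TJ - good_TJ) \<le> card (\<Union>(i,j)\<in>PP. B {x i<..x i + h} \<union> B {x i + h<..x i + 2 * h})"
    by (rule card_mono[OF _ sub]) (use fPP fB in auto)
  also have "\<dots> \<le> (\<Sum>(i,j)\<in>PP. card (B {x i<..x i + h} \<union> B {x i + h<..x i + 2 * h}))"
    using card_UN_le[OF fPP, of "\<lambda>(i,j). B {x i<..x i + h} \<union> B {x i + h<..x i + 2 * h}"] by (simp add: case_prod_unfold)
  finally have "real (card (TJ - good_TJ)) \<le> real (\<Sum>(i,j)\<in>PP. card (B {x i<..x i + h} \<union> B {x i + h<..x i + 2 * h}))"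
    by (simp only: of_nat_le_iff)
  also have "\<dots> = (\<Sum>(i,j)\<in>PP. real (card (B {x i<..x i + h} \<union> B {x i + h<..x i + 2 * h})))" by (simp add: case_prod_unfold)
  also have "\<dots> \<le> (\<Sum>(i,j)\<in>PP. 2 * ?R)"
  proof (rule sum_mono, clarify)
    fix i j assume ij: "(i, j) \<in> PP"
    then have q: "x i + 2 * h < Q" using xQ[of j] by (auto simp: PP_def)
    have w: "real (card (B {x i<..x i + h})) \<le> ?R" "real (card (B {x i + h<..x i + 2 * h})) \<le> ?R"
      unfolding B_def by (rule card_empty_window_le; use q in auto)+
    have "real (card (B {x i<..x i + h} \<union> B {x i + h<..x i + 2 * h})) \<le> real (card (B {x i<..x i + h}) + card (B {x i + h<..x i + 2 * h}))"
      by (intro of_nat_mono card_Un_le)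
    then show "real (card (B {x i<..x i + h} \<union> B {x i + h<..x i + 2 * h})) \<le> 2 * ?R" using w by simp
  qed
  also have "\<dots> = real (card PP) * (2 * ?R)" by (simp add: case_prod_unfold)
  also have "\<dots> \<le> real (card J ^ 2) * (2 * ?R)" using cPP by (intro mult_right_mono of_nat_mono) auto
  finally show ?thesis by (simp add: mult_ac)
qed

definition pat_weight :: real where
  "pat_weight = 2 ^ card (singles J) * (real n * (1 / real n) ^ card (starts J)) * exp (- (real n * real (spread x J) / real Q))"

text \<open>The error is stated relative to the natural size
  \<open>n * (1 / n) ^ card (starts J)\<close>, so that it can be summed over all patterns. It
  collects the switching error, the bad sequences, and the approximations of the factorial quotient
  and of the number of label sets.\<close>

lemma sum_pw_pattern_approx:
  "\<bar>(\<Sum>a\<in>{a\<in>paths. path_set a \<inter> E = S}. pw E l a) - free_prob E * pat_weight\<bar>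
    \<le> 2 ^ card J * (real n * (1 / real n) ^ card (starts J)) *
      (2 * (72 * (2 * real (card J) + 1) ^ 2 / real n + 2 * real (card J) ^ 2 * (1 - real h / real Q) ^ (m - card J))
       + 8 * real (card J) ^ 2 / real n + (real (card J) + 5) / real (m - card J) + real (m - card J) * (real (card J) + real (m - card J)) / real Q)"
proof -
  define k r s where "k = card J" and "r = card (starts J)" and "s = card (singles J)"
  define M where "M = m - k"
  define \<rho> where "\<rho> = real n * (1 / real n) ^ r"
  define f where "f = (fact (n - (k + r)) :: real)"
  define P where "P = fact M * real ((Q - (spread x J + r)) choose M) / real Q ^ M"
  define ee where "ee = exp (- (real n * real (spread x J) / real Q))"
  define err where "err = (real k + 5) / real M + real M * (real k + real M) / real Q"
  let ?v = "card (covered J)"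
  have v: "?v = k + r" using card_covered[OF finJ] by (simp add: k_def r_def)
  have rk: "r \<le> k" and sr: "s \<le> r" using card_starts_le[OF finJ] card_singles_le[OF finJ] by (auto simp: k_def r_def s_def)
  have r0: "r = 0 \<longleftrightarrow> k = 0"
    using starts_nonempty[of J] finJ finite_patterns(1)[OF finJ] by (auto simp: k_def r_def starts_def)
  have nl: "16 * (k + 1) ^ 2 \<le> n" using n_large by (simp add: k_def)
  have "16 * (k + 1) \<le> 16 * (k + 1) ^ 2" by (simp add: power2_eq_square)
  then have n1: "16 * k + 16 \<le> n" using nl by simp
  have M2: "2 \<le> M" and nM: "n = M + k + 1" and Mn: "M = n - 1 - k" using n1 Suc_m by (auto simp: M_def)
  have np: "0 < real n" and Qp: "0 < real Q" using n2 Q1 by auto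
  have Ple: "0 \<le> P" "P \<le> 1"
  proof -
    show "0 \<le> P" by (simp add: P_def)
    have "((Q - (spread x J + r)) choose M) * fact M \<le> (Q - (spread x J + r)) ^ M" by (rule binomial_fact_pow)
    also have "\<dots> \<le> Q ^ M" by (rule power_mono) auto
    finally have "real (((Q - (spread x J + r)) choose M) * fact M) \<le> real (Q ^ M)" by (simp only: of_nat_le_iff)
    then show "P \<le> 1" using Qp by (simp add: P_def mult.commute divide_le_eq)
  qed
  have P_err: "\<bar>P - ee\<bar> \<le> err"
  proof -
    have "\<bar>P - ee\<bar> \<le> (real k + 5) / real M + real M * (real r + real M) / real Q"
      unfolding P_def ee_def by (rule falling_approx[OF _ M2 nM Q1]) (use spread_le in \<open>simp add: r_def\<close>)
    also have "\<dots> \<le> err" unfolding err_def using rk by (intro add_mono divide_right_mono mult_left_mono) auto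
    finally show ?thesis .
  qed
  have fM: "\<rho> \<le> f / fact M" "f / fact M \<le> (1 + 8 * real k ^ 2 / real n) * \<rho>"
    unfolding f_def \<rho>_def by (rule fact_quotient_approx[OF Mn rk r0 nl])+
  have rho0: "0 \<le> \<rho>" by (simp add: \<rho>_def)
  have k8: "8 * real k ^ 2 / real n \<le> 1"
  proof -
    have "8 * k ^ 2 \<le> 16 * (k + 1) ^ 2" by (simp add: power2_eq_square)
    then have "8 * k ^ 2 \<le> n" using nl by linarith
    then have "real (8 * k ^ 2) \<le> real n" by (simp only: of_nat_le_iff)
    then show ?thesis using np by simp
  qed
  have fM2: "f / fact M \<le> 2 * \<rho>"
  proof -
    have "(1 + 8 * real k ^ 2 / real n) * \<rho> \<le> 2 * \<rho>" using k8 rho0 by (intro mult_right_mono) auto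
    then show ?thesis using fM(2) by linarith
  qed
  have fMP: "\<bar>f / fact M * P - \<rho> * ee\<bar> \<le> \<rho> * (8 * real k ^ 2 / real n + err)"
  proof -
    have "f / fact M * P - \<rho> * ee = (f / fact M - \<rho>) * P + \<rho> * (P - ee)" by (simp add: algebra_simps)
    also have "\<bar>\<dots>\<bar> \<le> \<bar>(f / fact M - \<rho>) * P\<bar> + \<bar>\<rho> * (P - ee)\<bar>" by (rule abs_triangle_ineq)
    also have "\<bar>(f / fact M - \<rho>) * P\<bar> \<le> (8 * real k ^ 2 / real n * \<rho>) * 1"
      unfolding abs_mult using fM Ple rho0 by (intro mult_mono) (auto simp: algebra_simps)
    also have "\<bar>\<rho> * (P - ee)\<bar> \<le> \<rho> * err" unfolding abs_mult using P_err rho0 by (simp add: mult_left_mono)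
    finally show ?thesis by (simp add: algebra_simps)
  qed
  have cT: "real (card TJ) * f * (real Q ^ k / real Q ^ m) = f / fact M * P"
  proof -
    have "real Q ^ m = real Q ^ k * real Q ^ M" using card_J by (simp add: M_def k_def flip: power_add)
    then show ?thesis unfolding P_def card_TJ M_def k_def[symmetric] r_def[symmetric] using Qp by simp
  qed
  define \<eta> where "\<eta> = 72 * (2 * real k + 1) ^ 2 / real n"
  have eta0: "0 \<le> \<eta>" by (simp add: \<eta>_def)
  \<comment> \<open>For a bad \<open>t\<close> only the crude bound is available, at the cost of a
    full unit of relative error; their scarcity is used afterwards.\<close>
  have each: "\<bar>real (card (fits t)) - 2 ^ s * free_prob E * f\<bar> \<le> 2 ^ s * f * (\<eta> + of_bool (t \<notin> good_TJ))" if t: "t \<in> TJ" for t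
  proof (cases "t \<in> good_TJ")
    case True
    have "\<bar>real (card (fits t)) - 2 ^ s * free_prob E * f\<bar> \<le> 2 ^ s * (72 * (real ?v + 1) ^ 2 / real n * f)"
      using card_fits_approx[OF True] by (simp add: s_def f_def v)
    also have "\<dots> \<le> 2 ^ s * (72 * (2 * real k + 1) ^ 2 / real n * f)"
      using v rk by (intro mult_left_mono mult_right_mono divide_right_mono power_mono) (auto simp: f_def)
    finally show ?thesis using True by (simp add: \<eta>_def mult_ac)
  next
    case False
    have "card (fits t) \<le> 2 ^ s * fact (n - (k + r))" using card_fits_le[OF t] by (simp add: s_def v)
    then have "real (card (fits t)) \<le> real (2 ^ s * fact (n - (k + r)))" by (simp only: of_nat_le_iff)
    then have 1: "real (card (fits t)) \<le> 2 ^ s * f" by (simp add: f_def)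
    have 2: "2 ^ s * free_prob E * f \<le> 2 ^ s * f" "0 \<le> 2 ^ s * free_prob E * f"
      using free_prob_bounds[of E] by (auto simp: f_def mult_left_le)
    have "\<bar>real (card (fits t)) - 2 ^ s * free_prob E * f\<bar> \<le> 2 ^ s * f * 1" using 1 2 unfolding abs_le_iff mult_1_right by linarith
    also have "\<dots> \<le> 2 ^ s * f * (\<eta> + of_bool (t \<notin> good_TJ))" using eta0 False by (intro mult_left_mono) (auto simp: f_def)
    finally show ?thesis .
  qed
  have sumT: "\<bar>(\<Sum>t\<in>TJ. real (card (fits t))) - real (card TJ) * (2 ^ s * free_prob E * f)\<bar>
     \<le> 2 ^ s * f * (real (card TJ) * \<eta> + real (card (TJ - good_TJ)))"
  proof -
    have "(\<Sum>t\<in>TJ. real (card (fits t))) - real (card TJ) * (2 ^ s * free_prob E * f)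
      = (\<Sum>t\<in>TJ. real (card (fits t)) - 2 ^ s * free_prob E * f)" by (simp add: sum_subtractf)
    also have "\<bar>\<dots>\<bar> \<le> (\<Sum>t\<in>TJ. 2 ^ s * f * (\<eta> + of_bool (t \<notin> good_TJ)))"
      by (rule order.trans[OF sum_abs sum_mono[OF each]])
    also have "\<dots> = 2 ^ s * f * (real (card TJ) * \<eta> + (\<Sum>t\<in>TJ. of_bool (t \<notin> good_TJ)))"
      by (simp add: sum_distrib_left[symmetric] sum.distrib)
    also have "(\<Sum>t\<in>TJ. of_bool (t \<notin> good_TJ)) = real (card (TJ - good_TJ))"
      using finite_TJ by (simp add: of_bool_def sum.If_cases set_diff_eq Int_def)
    finally show ?thesis .
  qed
  define q where "q = real Q ^ k / real Q ^ m"
  have q0: "0 \<le> q" by (simp add: q_def)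
  define H where "H = (\<Sum>a\<in>{a\<in>paths. path_set a \<inter> E = S}. pw E l a)"
  have H: "H = q * (\<Sum>t\<in>TJ. real (card (fits t)))" unfolding H_def q_def k_def by (rule sum_pw_fits)
  have bad: "real (card (TJ - good_TJ)) * f * q \<le> 2 * \<rho> * (2 * real k ^ 2 * (1 - real h / real Q) ^ M)"
  proof -
    have hQ: "h \<le> Q" by (rule h_le)
    have "real (card (TJ - good_TJ)) * f * q \<le> (2 * real k ^ 2 * (real (Q - h) ^ M / fact M)) * f * q"
      using card_bad_TJ_le q0 unfolding M_def k_def by (intro mult_right_mono) (auto simp: f_def)
    also have "\<dots> = f / fact M * (2 * real k ^ 2 * (real (Q - h) ^ M * q))" by simp
    also have "real (Q - h) ^ M * q = (1 - real h / real Q) ^ M"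
    proof -
      have "real Q ^ m = real Q ^ k * real Q ^ M" using card_J by (simp add: M_def k_def flip: power_add)
      then have "real (Q - h) ^ M * q = (real (Q - h) / real Q) ^ M" using Qp by (simp add: q_def power_divide)
      also have "real (Q - h) / real Q = 1 - real h / real Q" using hQ Qp by (simp add: of_nat_diff diff_divide_distrib)
      finally show ?thesis .
    qed
    also have "f / fact M * (2 * real k ^ 2 * (1 - real h / real Q) ^ M) \<le> 2 * \<rho> * (2 * real k ^ 2 * (1 - real h / real Q) ^ M)"
      using fM2 hQ Qp by (intro mult_right_mono mult_nonneg_nonneg zero_le_power) auto
    finally show ?thesis .
  qed
  have "\<bar>H - free_prob E * (2 ^ s * \<rho> * ee)\<bar>
    = \<bar>q * ((\<Sum>t\<in>TJ. real (card (fits t))) - real (card TJ) * (2 ^ s * free_prob E * f)) + 2 ^ s * free_prob E * (real (card TJ) * f * q - \<rho> * ee)\<bar>"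
    unfolding H by (simp add: algebra_simps)
  also have "\<dots> \<le> \<bar>q * ((\<Sum>t\<in>TJ. real (card (fits t))) - real (card TJ) * (2 ^ s * free_prob E * f))\<bar>
     + \<bar>2 ^ s * free_prob E * (real (card TJ) * f * q - \<rho> * ee)\<bar>" by (rule abs_triangle_ineq)
  also have "\<bar>q * ((\<Sum>t\<in>TJ. real (card (fits t))) - real (card TJ) * (2 ^ s * free_prob E * f))\<bar>
    \<le> q * (2 ^ s * f * (real (card TJ) * \<eta> + real (card (TJ - good_TJ))))"
    unfolding abs_mult using q0 sumT by (simp add: mult_left_mono)
  also have "\<dots> = 2 ^ s * ((real (card TJ) * f * q) * \<eta> + real (card (TJ - good_TJ)) * f * q)" by (simp add: algebra_simps)
  also have "\<dots> \<le> 2 ^ s * (2 * \<rho> * \<eta> + 2 * \<rho> * (2 * real k ^ 2 * (1 - real h / real Q) ^ M))"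
  proof (intro mult_left_mono add_mono mult_right_mono bad eta0)
    have "f / fact M * P \<le> f / fact M * 1" using Ple by (intro mult_left_mono) (auto simp: f_def)
    then show "real (card TJ) * f * q \<le> 2 * \<rho>" using cT fM2 by (simp add: q_def)
  qed auto
  also have "\<bar>2 ^ s * free_prob E * (real (card TJ) * f * q - \<rho> * ee)\<bar> \<le> 2 ^ s * (1 * (\<rho> * (8 * real k ^ 2 / real n + err)))"
    unfolding abs_mult mult.assoc using fMP free_prob_bounds[of E] cT rho0
    by (intro mult_mono) (auto simp: q_def)
  finally have fin: "\<bar>H - free_prob E * (2 ^ s * \<rho> * ee)\<bar> \<le> 2 ^ s * (\<rho> * (2 * (\<eta> + 2 * real k ^ 2 * (1 - real h / real Q) ^ M) + 8 * real k ^ 2 / real n + err))"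
    by (simp add: algebra_simps)
  define Z where "Z = \<rho> * (2 * (\<eta> + 2 * real k ^ 2 * (1 - real h / real Q) ^ M) + 8 * real k ^ 2 / real n + err)"
  have fZ: "\<bar>H - free_prob E * (2 ^ s * \<rho> * ee)\<bar> \<le> 2 ^ s * Z" using fin by (simp only: Z_def)
  have "0 \<le> 2 ^ s * Z" by (rule order.trans[OF abs_ge_zero fZ])
  then have nn: "0 \<le> Z" by (rule contrapos_pp) (simp add: not_le mult_pos_neg)
  have "2 ^ s \<le> (2::real) ^ k" using sr rk by (intro power_increasing) auto
  then have "2 ^ s * Z \<le> 2 ^ k * Z" by (rule mult_right_mono[OF _ nn])
  with fZ have "\<bar>H - free_prob E * (2 ^ s * \<rho> * ee)\<bar> \<le> 2 ^ k * Z" by (rule order.trans)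
  moreover have "free_prob E * (2 ^ s * \<rho> * ee) = free_prob E * pat_weight"
    by (simp only: pat_weight_def \<rho>_def ee_def s_def r_def)
  ultimately show ?thesis
    unfolding Z_def H_def \<eta>_def err_def M_def \<rho>_def k_def r_def by (simp only: mult.assoc add.assoc)
qed

end

section \<open>Weights cancelling small overlaps\<close>

lemma sum_UN_le:
  fixes f :: "'b \<Rightarrow> real"
  assumes fI: "finite I" and fB: "\<And>i. i \<in> I \<Longrightarrow> finite (B i)" and f: "\<And>x. 0 \<le> f x"
  shows "(\<Sum>x\<in>(\<Union>i\<in>I. B i). f x) \<le> (\<Sum>i\<in>I. \<Sum>x\<in>B i. f x)"
  using fI fB
proof (induction I rule: finite_induct)
  case (insert i I)
  have "(\<Sum>x\<in>(\<Union>i\<in>insert i I. B i). f x) = (\<Sum>x\<in>B i \<union> (\<Union>i\<in>I. B i). f x)" by simp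
  also have "\<dots> \<le> (\<Sum>x\<in>B i. f x) + (\<Sum>x\<in>(\<Union>i\<in>I. B i). f x)"
  proof -
    have "(\<Sum>x\<in>B i \<union> (\<Union>i\<in>I. B i). f x) + (\<Sum>x\<in>B i \<inter> (\<Union>i\<in>I. B i). f x) = (\<Sum>x\<in>B i. f x) + (\<Sum>x\<in>(\<Union>i\<in>I. B i). f x)"
      by (rule sum.union_inter) (use insert in auto)
    moreover have "0 \<le> (\<Sum>x\<in>B i \<inter> (\<Union>i\<in>I. B i). f x)" by (intro sum_nonneg f)
    ultimately show ?thesis by linarith
  qed
  finally show ?case using insert by simp
qed simp

section \<open>Weighted sums over small patterns\<close>

definition patterns :: "nat \<Rightarrow> nat \<Rightarrow> nat set set" where
  "patterns M K = {J. J \<subseteq> {..<M} \<and> card J \<le> K}"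

lemma finite_patterns_set: "finite (patterns M K)"
  unfolding patterns_def by (rule finite_subset[of _ "Pow {..<M}"]) auto

lemma run_start:
  assumes "finite J" "j \<in> J"
  obtains a where "a \<in> starts J" "a \<le> j" "{a..j} \<subseteq> J"
  using assms(2)
proof (induction j arbitrary: thesis)
  case 0
  then show ?case using 0(1)[of 0] by (auto simp: starts_def)
next
  case (Suc j)
  show ?case
  proof (cases "j \<in> J")
    case True
    obtain a where a: "a \<in> starts J" "a \<le> j" "{a..j} \<subseteq> J" by (rule Suc.IH[OF _ True])
    have "{a..Suc j} = insert (Suc j) {a..j}" using a by auto
    then show ?thesis using Suc(2)[of a] a Suc(3) by auto
  next
    case False
    then have "Suc j \<in> starts J" using Suc(3) by (auto simp: starts_def)
    then show ?thesis using Suc(2)[of "Suc j"] Suc(3) by auto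
  qed
qed

lemma run_start_near:
  assumes J: "J \<in> patterns M K" and j: "j \<in> J"
  obtains a where "a \<in> starts J" "a \<le> j" "j < a + K" "{a..j} \<subseteq> J"
proof -
  have f: "finite J" using J finite_subset by (auto simp: patterns_def)
  obtain a where a: "a \<in> starts J" "a \<le> j" "{a..j} \<subseteq> J" using run_start[OF f j] by blast
  have "card {a..j} \<le> card J" by (rule card_mono[OF f a(3)])
  then have "j < a + K" using J a by (auto simp: patterns_def)
  then show thesis using that a by blast
qed

lemma sum_Pow_power:
  assumes "finite S"
  shows "(\<Sum>A\<in>Pow S. z ^ card A) = (1 + z :: real) ^ card S"
  using prod_add[OF assms, of "\<lambda>_. z" "\<lambda>_. 1"] by (simp add: add.commute)

lemma sum_supersets_le:
  assumes S: "finite S" and z: "0 \<le> (z::real)"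
  shows "(\<Sum>A\<in>{A\<in>Pow S. B \<subseteq> A}. z ^ card A) \<le> z ^ card B * (1 + z) ^ card S"
proof -
  let ?D = "{A\<in>Pow S. B \<subseteq> A}"
  have "(\<Sum>A\<in>?D. z ^ card A) = (\<Sum>A\<in>?D. z ^ card B * z ^ card (A - B))"
  proof (intro sum.cong refl)
    fix A assume A: "A \<in> ?D"
    have f: "finite A" using A S finite_subset by auto
    have "card A = card B + card (A - B)"
    proof -
      have "B \<subseteq> A" using A by simp
      then show ?thesis using card_mono[OF f, of B] card_Diff_subset[of B A] finite_subset[OF _ f, of B] by simp
    qed
    then show "z ^ card A = z ^ card B * z ^ card (A - B)" by (simp add: power_add)
  qed
  also have "\<dots> = z ^ card B * (\<Sum>A\<in>?D. z ^ card (A - B))" by (simp add: sum_distrib_left)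
  also have "(\<Sum>A\<in>?D. z ^ card (A - B)) = (\<Sum>A\<in>(\<lambda>A. A - B) ` ?D. z ^ card A)"
    by (subst sum.reindex) (auto simp: inj_on_def)
  also have "\<dots> \<le> (\<Sum>A\<in>Pow S. z ^ card A)" using S z by (intro sum_mono2) auto
  also have "\<dots> = (1 + z) ^ card S" by (rule sum_Pow_power[OF S])
  finally show ?thesis using z by (simp add: mult_left_mono)
qed

text \<open>A pattern lies within distance \<open>K\<close> to the right of its run starts, so at most
  \<open>2 ^ (K * r)\<close> patterns share the same \<open>r\<close> starts.\<close>

lemma sum_patterns_starts_le:
  assumes y: "0 \<le> (y::real)" and P: "\<And>J. J \<in> patterns M K \<Longrightarrow> P J \<Longrightarrow> R (starts J)"
  shows "(\<Sum>J\<in>{J\<in>patterns M K. P J}. y ^ card (starts J)) \<le> (\<Sum>A\<in>{A\<in>Pow {..<M}. R A}. (2 ^ K * y) ^ card A)"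
proof -
  let ?D = "{J\<in>patterns M K. P J}" and ?A = "{A\<in>Pow {..<M}. R A}"
  have fD: "finite ?D" using finite_patterns_set by simp
  have "(\<Sum>J\<in>?D. y ^ card (starts J)) = (\<Sum>A\<in>?A. \<Sum>J\<in>{J\<in>?D. starts J = A}. y ^ card (starts J))"
    by (rule sum.group[symmetric, OF fD]) (use P in \<open>auto simp: patterns_def starts_def\<close>)
  also have "\<dots> = (\<Sum>A\<in>?A. real (card {J\<in>?D. starts J = A}) * y ^ card A)" by simp
  also have "\<dots> \<le> (\<Sum>A\<in>?A. (2 ^ K) ^ card A * y ^ card A)"
  proof (intro sum_mono mult_right_mono)
    fix A assume A: "A \<in> ?A"
    have fA: "finite A" using A finite_subset by auto
    define U where "U = (\<Union>a\<in>A. {a..<a + K})"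
    have fU: "finite U" using fA by (simp add: U_def)
    have cU: "card U \<le> K * card A"
    proof -
      have "card U \<le> (\<Sum>a\<in>A. card {a..<a + K})" unfolding U_def by (rule card_UN_le[OF fA])
      then show ?thesis by (simp add: mult.commute)
    qed
    have "{J\<in>?D. starts J = A} \<subseteq> Pow U"
    proof
      fix J assume J: "J \<in> {J\<in>?D. starts J = A}"
      show "J \<in> Pow U"
      proof
        show "J \<subseteq> U"
        proof
          fix j assume "j \<in> J"
          then obtain a where "a \<in> starts J" "a \<le> j" "j < a + K" using J run_start_near[of J M K j] by blast
          then show "j \<in> U" using J by (auto simp: U_def)
        qed
      qed
    qed
    then have "card {J\<in>?D. starts J = A} \<le> card (Pow U)" using fU by (intro card_mono) auto
    also have "\<dots> = 2 ^ card U" by (rule card_Pow[OF fU])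
    also have "\<dots> \<le> 2 ^ (K * card A)" using cU by (intro power_increasing) auto
    finally have "real (card {J\<in>?D. starts J = A}) \<le> real (2 ^ (K * card A))" by (simp only: of_nat_le_iff)
    then show "real (card {J\<in>?D. starts J = A}) \<le> (2 ^ K) ^ card A" by (simp add: power_mult)
  qed (use y in auto)
  finally show ?thesis by (simp add: power_mult_distrib)
qed

text \<open>\<open>exp (2 ^ K)\<close> bounds \<open>(1 + 2 ^ K / n) ^ n\<close>, the sum over free
  choices of run starts with weight \<open>2 ^ K / n\<close> each. In \<open>pat_C1\<close> and
  \<open>pat_C2\<close> one or two of the starts are confined to windows of length \<open>K\<close>,
  each giving a factor \<open>K * 2 ^ K\<close>.\<close>

definition pat_C0 :: "nat \<Rightarrow> real" where "pat_C0 K = exp (2 ^ K)"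
definition pat_C1 :: "nat \<Rightarrow> real" where "pat_C1 K = real K * 2 ^ K * pat_C0 K"
definition pat_C2 :: "nat \<Rightarrow> real" where "pat_C2 K = (real K * 2 ^ K) ^ 2 * pat_C0 K"

lemma pat_C_nonneg: "0 \<le> pat_C0 K" "0 \<le> pat_C1 K" "0 \<le> pat_C2 K"
  by (auto simp: pat_C0_def pat_C1_def pat_C2_def)

lemma pat_power_le:
  assumes "M \<le> n" "0 < n"
  shows "(1 + 2 ^ K * (1 / real n)) ^ M \<le> pat_C0 K"
proof -
  have "(1 + 2 ^ K * (1 / real n)) ^ M \<le> exp (2 ^ K * (1 / real n)) ^ M"
    by (intro power_mono exp_ge_add_one_self) auto
  also have "\<dots> = exp (real M * (2 ^ K * (1 / real n)))" by (rule exp_of_nat_mult[symmetric])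
  also have "\<dots> \<le> exp (2 ^ K)"
  proof -
    have "real M * (2 ^ K * (1 / real n)) \<le> real n * (2 ^ K * (1 / real n))" using assms by (intro mult_right_mono) auto
    then show ?thesis using assms by simp
  qed
  finally show ?thesis by (simp add: pat_C0_def)
qed

lemma sum_patterns_le:
  assumes M: "M \<le> n" "0 < n"
  shows "(\<Sum>J\<in>patterns M K. (1 / real n) ^ card (starts J)) \<le> pat_C0 K"
proof -
  have "(\<Sum>J\<in>{J\<in>patterns M K. True}. (1 / real n) ^ card (starts J)) \<le> (\<Sum>A\<in>{A\<in>Pow {..<M}. True}. (2 ^ K * (1 / real n)) ^ card A)"
    by (rule sum_patterns_starts_le) auto
  also have "\<dots> = (1 + 2 ^ K * (1 / real n)) ^ M" using sum_Pow_power[of "{..<M}" "2 ^ K * (1 / real n)"] by (simp add: Pow_def)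
  also have "\<dots> \<le> pat_C0 K" by (rule pat_power_le[OF M])
  finally show ?thesis by simp
qed

text \<open>The run through \<open>i\<close> starts at one of the \<open>K\<close> positions ending
  at \<open>i\<close>; prescribing a start costs \<open>1 / n\<close>.\<close>

lemma sum_patterns_mem_le:
  assumes M: "M \<le> n" "0 < n"
  shows "(\<Sum>J\<in>{J\<in>patterns M K. i \<in> J}. (1 / real n) ^ card (starts J)) \<le> pat_C1 K / real n"
proof -
  let ?z = "2 ^ K * (1 / real n) :: real"
  define W where "W = {Suc i - K..i}"
  have cW: "card W \<le> K" by (simp add: W_def)
  have "(\<Sum>J\<in>{J\<in>patterns M K. i \<in> J}. (1 / real n) ^ card (starts J)) \<le> (\<Sum>A\<in>{A\<in>Pow {..<M}. A \<inter> W \<noteq> {}}. ?z ^ card A)"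
  proof (rule sum_patterns_starts_le)
    fix J assume J: "J \<in> patterns M K" "i \<in> J"
    obtain a where "a \<in> starts J" "a \<le> i" "i < a + K" by (rule run_start_near[OF J])
    then have "a \<in> starts J \<inter> W" by (auto simp: W_def)
    then show "starts J \<inter> W \<noteq> {}" by auto
  qed simp
  also have "\<dots> \<le> (\<Sum>A\<in>(\<Union>a\<in>W. {A\<in>Pow {..<M}. {a} \<subseteq> A}). ?z ^ card A)"
    by (rule sum_mono2) (auto simp: W_def)
  also have "\<dots> \<le> (\<Sum>a\<in>W. \<Sum>A\<in>{A\<in>Pow {..<M}. {a} \<subseteq> A}. ?z ^ card A)"
    by (rule sum_UN_le) (auto simp: W_def)
  also have "\<dots> \<le> (\<Sum>a\<in>W. ?z ^ card {a} * (1 + ?z) ^ card {..<M})"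
    by (intro sum_mono sum_supersets_le) auto
  also have "\<dots> = real (card W) * (?z * (1 + ?z) ^ M)" by simp
  also have "\<dots> \<le> real K * (?z * pat_C0 K)"
    using cW pat_power_le[OF M] by (intro mult_mono) auto
  finally show ?thesis by (simp add: pat_C1_def)
qed

text \<open>Positions in different runs have different run starts, each confined to a window of
  length \<open>K\<close> and each costing \<open>1 / n\<close>.\<close>

lemma sum_patterns_mem2_le:
  assumes M: "M \<le> n" "0 < n"
  shows "(\<Sum>J\<in>{J\<in>patterns M K. i \<in> J \<and> j \<in> J \<and> diff_run J i j}. (1 / real n) ^ card (starts J)) \<le> pat_C2 K / real n ^ 2"
proof -
  let ?z = "2 ^ K * (1 / real n) :: real"
  define W where "W i = {Suc i - K..i}" for i
  have cW: "card (W i) \<le> K" for i by (simp add: W_def)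
  let ?PP = "{(a,a'). a \<in> W i \<and> a' \<in> W j \<and> a \<noteq> a'}"
  have sub: "?PP \<subseteq> W i \<times> W j" by auto
  have fPP: "finite ?PP" by (rule finite_subset[OF sub]) (simp add: W_def)
  have cPP: "card ?PP \<le> K ^ 2"
  proof -
    have "card ?PP \<le> card (W i \<times> W j)" by (rule card_mono[OF _ sub]) (simp add: W_def)
    also have "\<dots> = card (W i) * card (W j)" by (rule card_cartesian_product)
    also have "\<dots> \<le> K * K" by (intro mult_le_mono cW)
    finally show ?thesis by (simp add: power2_eq_square)
  qed
  have "(\<Sum>J\<in>{J\<in>patterns M K. i \<in> J \<and> j \<in> J \<and> diff_run J i j}. (1 / real n) ^ card (starts J))
    \<le> (\<Sum>A\<in>{A\<in>Pow {..<M}. \<exists>(a,a')\<in>?PP. {a,a'} \<subseteq> A}. ?z ^ card A)"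
  proof (rule sum_patterns_starts_le)
    fix J assume J: "J \<in> patterns M K" "i \<in> J \<and> j \<in> J \<and> diff_run J i j"
    obtain a where a: "a \<in> starts J" "a \<le> i" "i < a + K" "{a..i} \<subseteq> J" using run_start_near[OF J(1), of i] J(2) by blast
    obtain a' where a': "a' \<in> starts J" "a' \<le> j" "j < a' + K" "{a'..j} \<subseteq> J" using run_start_near[OF J(1), of j] J(2) by blast
    have "a \<noteq> a'"
    proof
      assume e: "a = a'"
      obtain k where k: "k \<notin> J" "i < k \<and> k < j \<or> j < k \<and> k < i" using J(2) by (auto simp: diff_run_def)
      then have "k \<in> {a..i} \<or> k \<in> {a'..j}" using a a' e by auto
      then show False using k a a' by blast
    qed
    then have "(a, a') \<in> ?PP" using a a' by (auto simp: W_def)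
    then show "\<exists>(a,a')\<in>?PP. {a,a'} \<subseteq> starts J" using a a' by blast
  qed simp
  also have "\<dots> \<le> (\<Sum>A\<in>(\<Union>p\<in>?PP. {A\<in>Pow {..<M}. {fst p, snd p} \<subseteq> A}). ?z ^ card A)"
    by (rule sum_mono2) (use fPP in auto)
  also have "\<dots> \<le> (\<Sum>p\<in>?PP. \<Sum>A\<in>{A\<in>Pow {..<M}. {fst p, snd p} \<subseteq> A}. ?z ^ card A)"
    by (rule sum_UN_le) (use fPP in auto)
  also have "\<dots> \<le> (\<Sum>p\<in>?PP. ?z ^ card {fst p, snd p} * (1 + ?z) ^ card {..<M})"
    by (intro sum_mono sum_supersets_le) auto
  also have "\<dots> = (\<Sum>p\<in>?PP. ?z ^ 2 * (1 + ?z) ^ M)"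
    by (intro sum.cong refl) (auto simp: card_insert_if power2_eq_square)
  also have "\<dots> = real (card ?PP) * (?z ^ 2 * (1 + ?z) ^ M)" by simp
  also have "\<dots> \<le> real (K ^ 2) * (?z ^ 2 * pat_C0 K)"
    using cPP pat_power_le[OF M] by (intro mult_mono of_nat_mono) auto
  finally show ?thesis by (simp add: pat_C2_def power_mult_distrib power_divide)
qed

text \<open>The negation, for either order of the two labels, of the distance required in
  \<open>sep_pattern\<close>.\<close>

definition close :: "nat \<Rightarrow> nat \<Rightarrow> nat \<Rightarrow> bool" where
  "close h y z \<longleftrightarrow> y < z + 2 * h + 2 \<and> z < y + 2 * h + 2"

section \<open>Overlap weights with vanishing mean\<close>

context labelling begin

text \<open>Goodness keeps the number of pairs of clashing labels on two paths of order \<open>n * G\<close> instead of \<open>n ^ 2\<close>.\<close>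

definition good :: "nat \<Rightarrow> nat \<Rightarrow> (nat \<Rightarrow> nat) \<Rightarrow> bool" where
  "good h G t \<longleftrightarrow> inc t \<and> (\<forall>y<Q. card {i\<in>{..<m}. close h (t i) y} \<le> G)"

text \<open>For a path with labels \<open>t\<close>, \<open>pattern_mass t J\<close> approximates the number of increasing paths meeting it exactly in
  the edges at \<open>J\<close>, relative to the number of increasing paths disjoint from it.\<close>

definition pattern_mass :: "(nat \<Rightarrow> nat) \<Rightarrow> nat set \<Rightarrow> real" where
  "pattern_mass t J = 2 ^ card (singles J) * (1 / real n) ^ card (starts J) * exp (- (real n * real (spread t J) / real Q))"

definition total_mass :: "nat \<Rightarrow> (nat \<Rightarrow> nat) \<Rightarrow> real" where
  "total_mass K t = (\<Sum>J\<in>patterns m K. pattern_mass t J)"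

text \<open>At \<open>k = 0\<close> this is minus the mass of the nonempty patterns, since the empty
  pattern has mass 1. The weight depends on the labels \<open>t\<close> of the path being
  overlapped.\<close>

definition overlap_weight :: "nat \<Rightarrow> (nat \<Rightarrow> nat) \<Rightarrow> nat \<Rightarrow> real" where
  "overlap_weight K t k = of_bool (k \<le> K) - total_mass K t * of_bool (k = 0)"

lemma mn: "m \<le> n" "0 < n" using Suc_m by auto

lemma pattern_mass_nonneg: "0 \<le> pattern_mass t J" by (simp add: pattern_mass_def)

lemma pattern_mass_le: "J \<in> patterns m K \<Longrightarrow> pattern_mass t J \<le> 2 ^ K * (1 / real n) ^ card (starts J)"
proof -
  assume J: "J \<in> patterns m K"
  have f: "finite J" using J finite_subset by (auto simp: patterns_def)
  have "card (singles J) \<le> K" using card_singles_le[OF f] card_starts_le[OF f] J by (auto simp: patterns_def)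
  then have "(2::real) ^ card (singles J) \<le> 2 ^ K" by (intro power_increasing) auto
  then have "2 ^ card (singles J) * (1 / real n) ^ card (starts J) * exp (- (real n * real (spread t J) / real Q))
    \<le> 2 ^ K * (1 / real n) ^ card (starts J) * 1" by (intro mult_mono) auto
  then show ?thesis by (simp add: pattern_mass_def)
qed

lemma total_mass_bounds: "0 \<le> total_mass K t" "total_mass K t \<le> 2 ^ K * pat_C0 K"
proof -
  show "0 \<le> total_mass K t" unfolding total_mass_def by (intro sum_nonneg pattern_mass_nonneg)
  have "total_mass K t \<le> (\<Sum>J\<in>patterns m K. 2 ^ K * (1 / real n) ^ card (starts J))"
    unfolding total_mass_def by (intro sum_mono pattern_mass_le)
  also have "\<dots> \<le> 2 ^ K * pat_C0 K" unfolding sum_distrib_left[symmetric]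
    by (intro mult_left_mono sum_patterns_le mn) auto
  finally show "total_mass K t \<le> 2 ^ K * pat_C0 K" .
qed

definition weight_bound :: "nat \<Rightarrow> real" where "weight_bound K = 1 + 2 ^ K * pat_C0 K"

lemma overlap_weight_bound: "\<bar>overlap_weight K t k\<bar> \<le> weight_bound K" "K < k \<Longrightarrow> overlap_weight K t k = 0"
  using total_mass_bounds[of K t] by (auto simp: overlap_weight_def weight_bound_def abs_le_iff pat_C0_def)

lemma sum_overlap_weight_pattern_mass: "(\<Sum>J\<in>patterns m K. overlap_weight K t (card J) * pattern_mass t J) = 0"
proof -
  have f: "finite J" if "J \<in> patterns m K" for J using that finite_subset by (auto simp: patterns_def)
  have "(\<Sum>J\<in>patterns m K. overlap_weight K t (card J) * pattern_mass t J) = (\<Sum>J\<in>patterns m K. pattern_mass t J - total_mass K t * (of_bool (J = {}) * pattern_mass t J))"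
  proof (intro sum.cong refl)
    fix J assume J: "J \<in> patterns m K"
    have "card J \<le> K" "card J = 0 \<longleftrightarrow> J = {}" using J f[OF J] by (auto simp: patterns_def)
    then show "overlap_weight K t (card J) * pattern_mass t J = pattern_mass t J - total_mass K t * (of_bool (J = {}) * pattern_mass t J)"
      by (simp add: overlap_weight_def left_diff_distrib)
  qed
  also have "\<dots> = total_mass K t - total_mass K t * (\<Sum>J\<in>patterns m K. of_bool (J = {}) * pattern_mass t J)"
    by (simp add: sum_subtractf sum_distrib_left total_mass_def)
  also have "(\<Sum>J\<in>patterns m K. of_bool (J = {}) * pattern_mass t J) = (\<Sum>J\<in>{{}}. of_bool (J = {}) * pattern_mass t J)"
    by (rule sum.mono_neutral_right) (auto simp: finite_patterns_set patterns_def)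
  also have "\<dots> = 1" by (simp add: pattern_mass_def singles_def starts_def spread_def joints_def)
  finally show ?thesis by simp
qed

end

section \<open>Joint patterns in two paths\<close>

context labelling begin

text \<open>An edge common to all three paths is included. Without touching, the parts of
  \<open>a\<close> shared with \<open>b\<close> and with \<open>c\<close> have no vertex in
  common.\<close>

definition touch :: "(nat \<Rightarrow> nat) \<Rightarrow> (nat \<Rightarrow> nat) \<Rightarrow> (nat \<Rightarrow> nat) \<Rightarrow> bool" where
  "touch a b c \<longleftrightarrow> (\<exists>e\<in>path_set a \<inter> path_set b. \<exists>f\<in>path_set a \<inter> path_set c. e \<inter> f \<noteq> {})"

text \<open>The relative error of \<open>sum_pw_pattern_approx\<close>, with the pattern size
  replaced by its bound \<open>2 * K\<close> and the remaining factors by larger ones.\<close>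

definition perr :: "nat \<Rightarrow> nat \<Rightarrow> real" where
  "perr h K = 4 ^ K * (2 * (72 * (4 * real K + 1) ^ 2 / real n + 8 * real K ^ 2 * (1 - real h / real Q) ^ (m - 2 * K))
    + 32 * real K ^ 2 / real n + (2 * real K + 5) / real (m - 2 * K) + real n ^ 2 / real Q)"

end

locale two_paths = labelling +
  fixes b c :: "nat \<Rightarrow> nat" and l :: "nat set \<Rightarrow> nat" and h G K K2 :: nat
  assumes b: "b \<in> paths" and c: "c \<in> paths" and l: "l \<in> labels"
    and gb: "good h G (lab l b)" and gc: "good h G (lab l c)"
    and ov: "card (path_set b \<inter> path_set c) \<le> K2"
    and nl: "16 * (2 * K + 1) ^ 2 \<le> n" and hQ: "h \<le> Q"
begin

abbreviation "E \<equiv> path_set b \<union> path_set c"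
abbreviation "xb i \<equiv> l (edge b i)"
abbreviation "xc i \<equiv> l (edge c i)"

text \<open>A pattern in \<open>b\<close> and a pattern in \<open>c\<close> are treated as a single pattern in the concatenated vertex sequence.\<close>

definition dd :: "nat \<Rightarrow> nat" where "dd i = (if i < n then b i else c (i - n))"

text \<open>Edge positions on \<open>b\<close> end at \<open>n - 2\<close>. Position
  \<open>n - 1\<close>, which would link the end of \<open>b\<close> to the start of
  \<open>c\<close>, therefore never occurs, and runs from the two halves cannot merge.\<close>

definition comb :: "nat set \<Rightarrow> nat set \<Rightarrow> nat set" where
  "comb J1 J2 = J1 \<union> (\<lambda>i. i + n) ` J2"

lemma incs_b: "lab l b \<in> incs" and incs_c: "lab l c \<in> incs"
  using gb gc inc_iff_incs[OF b l] inc_iff_incs[OF c l] by (auto simp: good_def)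

lemma xb_less: "i < m \<Longrightarrow> j < m \<Longrightarrow> xb i < xb j \<longleftrightarrow> i < j"
  using incs_less_iff[OF incs_b, of i j] by (simp add: lab_def)

lemma xc_less: "i < m \<Longrightarrow> j < m \<Longrightarrow> xc i < xc j \<longleftrightarrow> i < j"
  using incs_less_iff[OF incs_c, of i j] by (simp add: lab_def)

lemma edge_dd: "i < m \<Longrightarrow> edge dd i = edge b i" "edge dd (i + n) = edge c i"
  using lt_m[of i] by (auto simp: edge_def dd_def)

context
  fixes J1 J2 assumes J1: "J1 \<in> patterns m K" and J2: "J2 \<in> patterns m K"
begin

lemma fJ: "finite J1" "finite J2" and Jm: "\<And>i. i \<in> J1 \<Longrightarrow> i < m" "\<And>i. i \<in> J2 \<Longrightarrow> i < m"
  using J1 J2 finite_subset by (auto simp: patterns_def)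

lemma starts_comb: "starts (comb J1 J2) = starts J1 \<union> (\<lambda>i. i + n) ` starts J2"
proof -
  have 1: "Suc ` comb J1 J2 = Suc ` J1 \<union> (\<lambda>i. i + n) ` (Suc ` J2)" by (auto simp: comb_def image_iff)
  have 2: "(\<lambda>i. i + n) ` starts J2 = (\<lambda>i. i + n) ` J2 - (\<lambda>i. i + n) ` (Suc ` J2)"
    unfolding starts_def by (rule image_set_diff) (simp add: inj_def)
  have "i + n \<notin> Suc ` J1" for i using Jm(1) lt_m by fastforce
  moreover have "i \<notin> (\<lambda>i. i + n) ` A" if "i \<in> J1" for i A using Jm(1)[OF that] lt_m by fastforce
  moreover have "i + n \<notin> J1" "Suc (i + n) \<notin> J1" for i
    using Jm(1)[of "i + n"] lt_m(1)[of "i + n"] Jm(1)[of "Suc (i + n)"] lt_m(1)[of "Suc (i + n)"] by auto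
  ultimately show ?thesis unfolding starts_def[of "comb J1 J2"] 1 2 starts_def[of J1] by (auto simp: comb_def)
qed

lemma joints_comb: "joints (comb J1 J2) = joints J1 \<union> (\<lambda>i. i + n) ` joints J2"
proof -
  have "Suc i \<notin> (\<lambda>i. i + n) ` A" if "i \<in> J1" for i A using lt_m(2)[OF Jm(1)[OF that]] by auto
  moreover have "Suc (i + n) \<notin> J1" for i using Jm(1)[of "Suc (i + n)"] lt_m(1)[of "Suc (i + n)"] by auto
  ultimately show ?thesis by (auto simp: joints_def comb_def image_iff)
qed

lemma disj_comb: "A \<subseteq> J1 \<Longrightarrow> A \<inter> (\<lambda>i. i + n) ` B = {}"
  using Jm(1) lt_m by fastforce

lemma card_shift: "card ((\<lambda>i. i + n) ` A) = card A"
  by (rule card_image) (simp add: inj_on_def)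

lemma card_comb: "card (comb J1 J2) = card J1 + card J2"
  unfolding comb_def using fJ disj_comb[of J1 J2] by (subst card_Un_disjoint) (auto simp: card_shift)

lemma finite_comb: "finite (comb J1 J2)" using fJ by (simp add: comb_def)

lemma card_starts_comb: "card (starts (comb J1 J2)) = card (starts J1) + card (starts J2)"
  unfolding starts_comb using fJ disj_comb[of "starts J1" "starts J2"]
  by (subst card_Un_disjoint) (auto simp: card_shift starts_def)

lemma card_singles_comb: "card (singles (comb J1 J2)) = card (singles J1) + card (singles J2)"
proof -
  have "singles (comb J1 J2) = singles J1 \<union> (\<lambda>i. i + n) ` singles J2"
  proof -
    have 1: "starts J1 \<inter> (\<lambda>i. i + n) ` A = {}" for A by (rule disj_comb) (auto simp: starts_def)
    have 2: "joints J1 \<inter> (\<lambda>i. i + n) ` A = {}" for A by (rule disj_comb) (auto simp: joints_def)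
    have 3: "(\<lambda>i. i + n) ` singles J2 = (\<lambda>i. i + n) ` starts J2 - (\<lambda>i. i + n) ` joints J2"
      unfolding singles_def by (rule image_set_diff) (simp add: inj_def)
    show ?thesis unfolding singles_def[of "comb J1 J2"] singles_def[of J1] starts_comb joints_comb 3 using 1 2 by blast
  qed
  moreover have "singles J1 \<inter> (\<lambda>i. i + n) ` singles J2 = {}"
    by (rule disj_comb) (auto simp: singles_def starts_def)
  ultimately show ?thesis using fJ by (simp add: card_Un_disjoint finite_patterns card_shift)
qed

lemma spread_comb: "spread (\<lambda>j. l (edge dd j)) (comb J1 J2) = spread (lab l b) J1 + spread (lab l c) J2"
proof -
  have 1: "joints J1 \<inter> (\<lambda>i. i + n) ` joints J2 = {}" by (rule disj_comb) (auto simp: joints_def)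
  have "spread (\<lambda>j. l (edge dd j)) (comb J1 J2)
    = (\<Sum>j\<in>joints J1. l (edge dd (Suc j)) - l (edge dd j)) + (\<Sum>j\<in>(\<lambda>i. i + n) ` joints J2. l (edge dd (Suc j)) - l (edge dd j))"
    unfolding spread_def joints_comb using fJ 1 by (intro sum.union_disjoint) (auto simp: finite_patterns)
  also have "(\<Sum>j\<in>joints J1. l (edge dd (Suc j)) - l (edge dd j)) = spread (lab l b) J1"
    unfolding spread_def by (intro sum.cong refl) (auto simp: joints_def edge_dd Jm lab_def)
  also have "(\<Sum>j\<in>(\<lambda>i. i + n) ` joints J2. l (edge dd (Suc j)) - l (edge dd j)) = (\<Sum>j\<in>joints J2. l (edge dd (Suc j + n)) - l (edge dd (j + n)))"
    by (subst sum.reindex) (auto simp: inj_on_def)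
  also have "\<dots> = spread (lab l c) J2"
    unfolding spread_def edge_dd(2) by (intro sum.cong refl) (auto simp: joints_def Jm lab_def)
  finally show ?thesis .
qed

text \<open>Necessary for a carrier to exist, and enough to make \<open>dd\<close> injective on the
  joint pattern and to read the two patterns off the intersection with \<open>E\<close>.\<close>

definition valid :: bool where
  "valid \<longleftrightarrow> (\<forall>i\<in>J1. \<forall>j\<in>J2. edge b i \<inter> edge c j = {}) \<and> (\<forall>i\<in>J1. edge b i \<notin> path_set c) \<and> (\<forall>j\<in>J2. edge c j \<notin> path_set b)"

definition carriers :: "(nat \<Rightarrow> nat) set" where
  "carriers = {a\<in>paths. \<not> touch a b c \<and> {i\<in>{..<m}. edge b i \<in> path_set a} = J1 \<and> {i\<in>{..<m}. edge c i \<in> path_set a} = J2}"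

lemma edge_comb: "edge dd ` comb J1 J2 = edge b ` J1 \<union> edge c ` J2"
proof -
  have "edge dd ` J1 = edge b ` J1" using Jm edge_dd by (intro image_cong) auto
  moreover have "edge dd ` (\<lambda>i. i + n) ` J2 = edge c ` J2" by (simp add: image_image edge_dd)
  ultimately show ?thesis by (simp add: comb_def image_Un)
qed

lemma carriers_invalid: "\<not> valid \<Longrightarrow> carriers = {}"
proof (rule ccontr)
  assume nv: "\<not> valid" and "carriers \<noteq> {}"
  then obtain a where a: "a \<in> carriers" by auto
  have bE: "edge b i \<in> path_set a \<inter> path_set b" if "i \<in> J1" for i
    using a that Jm by (auto simp: carriers_def path_set_def)
  have cE: "edge c j \<in> path_set a \<inter> path_set c" if "j \<in> J2" for j
    using a that Jm by (auto simp: carriers_def path_set_def)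
  have ne: "edge q i \<noteq> {}" for q i by (simp add: edge_def)
  have nt: "\<not> touch a b c" using a by (simp add: carriers_def)
  have nt': "e \<inter> f = {}" if "e \<in> path_set a \<inter> path_set b" "f \<in> path_set a \<inter> path_set c" for e f
    using nt that unfolding touch_def by blast
  have "valid" unfolding valid_def
  proof (intro conjI ballI)
    show "edge b i \<inter> edge c j = {}" if "i \<in> J1" "j \<in> J2" for i j by (rule nt'[OF bE[OF that(1)] cE[OF that(2)]])
    show "edge b i \<notin> path_set c" if "i \<in> J1" for i
    proof
      assume "edge b i \<in> path_set c"
      then have "edge b i \<inter> edge b i = {}" using bE[OF that] by (intro nt') auto
      then show False using ne by simp
    qed
    show "edge c j \<notin> path_set b" if "j \<in> J2" for j
    proof
      assume "edge c j \<in> path_set b"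
      then have "edge c j \<inter> edge c j = {}" using cE[OF that] by (intro nt') auto
      then show False using ne by simp
    qed
  qed
  then show False using nv by simp
qed

lemma carriers_valid:
  assumes v: "valid"
  shows "carriers = {a\<in>paths. path_set a \<inter> E = edge dd ` comb J1 J2}"
proof -
  have "(\<not> touch a b c \<and> {i\<in>{..<m}. edge b i \<in> path_set a} = J1 \<and> {i\<in>{..<m}. edge c i \<in> path_set a} = J2)
    \<longleftrightarrow> path_set a \<inter> E = edge dd ` comb J1 J2" (is "?L \<longleftrightarrow> ?R") for a
  proof
    assume L: ?L
    have "path_set a \<inter> path_set b = edge b ` {i\<in>{..<m}. edge b i \<in> path_set a}" by (auto simp: path_set_def)
    moreover have "path_set a \<inter> path_set c = edge c ` {i\<in>{..<m}. edge c i \<in> path_set a}" by (auto simp: path_set_def)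
    ultimately show ?R using L edge_comb by (simp add: Int_Un_distrib)
  next
    assume R: ?R
    have sb: "edge b ` J1 \<subseteq> path_set b" "edge c ` J2 \<subseteq> path_set c" using Jm by (auto simp: path_set_def)
    have R': "path_set a \<inter> E = edge b ` J1 \<union> edge c ` J2" using R edge_comb by simp
    have nb: "edge c ` J2 \<inter> path_set b = {}" and nc: "edge b ` J1 \<inter> path_set c = {}" using v by (auto simp: valid_def)
    have "path_set a \<inter> path_set b = (path_set a \<inter> E) \<inter> path_set b" by blast
    also have "\<dots> = edge b ` J1" unfolding R' using sb(1) nb by (simp add: Int_Un_distrib2 Int_absorb2)
    finally have ab: "path_set a \<inter> path_set b = edge b ` J1" .
    have "path_set a \<inter> path_set c = (path_set a \<inter> E) \<inter> path_set c" by blast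
    also have "\<dots> = edge c ` J2" unfolding R' using sb(2) nc by (simp add: Int_Un_distrib2 Int_absorb2)
    finally have ac: "path_set a \<inter> path_set c = edge c ` J2" .
    have "\<not> touch a b c" unfolding touch_def ab ac using v by (simp add: valid_def)
    moreover have "{i\<in>{..<m}. edge b i \<in> path_set a} = J1"
    proof -
      have "i \<in> J1 \<longleftrightarrow> edge b i \<in> path_set a" if "i < m" for i
      proof -
        have "edge b i \<in> path_set a \<longleftrightarrow> edge b i \<in> edge b ` J1" unfolding ab[symmetric] using that by (auto simp: path_set_def)
        also have "\<dots> \<longleftrightarrow> i \<in> J1" using edge_eq_iff[OF b] by auto
        finally show ?thesis by simp
      qed
      then show ?thesis using Jm by auto
    qed
    moreover have "{i\<in>{..<m}. edge c i \<in> path_set a} = J2"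
    proof -
      have "i \<in> J2 \<longleftrightarrow> edge c i \<in> path_set a" if "i < m" for i
      proof -
        have "edge c i \<in> path_set a \<longleftrightarrow> edge c i \<in> edge c ` J2" unfolding ac[symmetric] using that by (auto simp: path_set_def)
        also have "\<dots> \<longleftrightarrow> i \<in> J2" using edge_eq_iff[OF c] by auto
        finally show ?thesis by simp
      qed
      then show ?thesis using Jm by auto
    qed
    ultimately show ?L by blast
  qed
  then show ?thesis by (auto simp: carriers_def)
qed

lemma inj_dd: "valid \<Longrightarrow> inj_on dd (covered (comb J1 J2))"
proof (rule inj_onI)
  fix u v assume v: "valid" and uv: "u \<in> covered (comb J1 J2)" "v \<in> covered (comb J1 J2)" "dd u = dd v"
  have cov: "(u < n \<and> (\<exists>i\<in>J1. b u \<in> edge b i)) \<or> (\<exists>u'. u = u' + n \<and> (\<exists>j\<in>J2. c u' \<in> edge c j))"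
    if "u \<in> covered (comb J1 J2)" for u
  proof -
    from that consider i where "i \<in> J1" "u = i \<or> u = Suc i" | j where "j \<in> J2" "u = j + n \<or> u = Suc j + n"
      by (auto simp: covered_def comb_def)
    then show ?thesis
    proof cases
      case 1 then show ?thesis using lt_m Jm(1)[OF 1(1)] by (auto simp: edge_def)
    next
      case 2
      then have "\<exists>j\<in>J2. c j' \<in> edge c j" if "j' = j \<or> j' = Suc j" for j' using that by (auto simp: edge_def)
      then show ?thesis using 2 by blast
    qed
  qed
  have meet: False if "i \<in> J1" "b p \<in> edge b i" "j \<in> J2" "c q \<in> edge c j" "b p = c q" for i j p q
  proof -
    have "edge b i \<inter> edge c j = {}" using v that(1,3) by (simp add: valid_def)
    moreover have "b p \<in> edge b i \<inter> edge c j" using that by simp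
    ultimately show False by simp
  qed
  from cov[OF uv(1)] cov[OF uv(2)] show "u = v"
  proof (elim disjE)
    assume A: "u < n \<and> (\<exists>i\<in>J1. b u \<in> edge b i)" "v < n \<and> (\<exists>i\<in>J1. b v \<in> edge b i)"
    then show ?thesis using uv(3) path_inj[OF b] by (simp add: dd_def)
  next
    assume A: "u < n \<and> (\<exists>i\<in>J1. b u \<in> edge b i)" "\<exists>u'. v = u' + n \<and> (\<exists>j\<in>J2. c u' \<in> edge c j)"
    then show ?thesis using uv(3) meet by (auto simp: dd_def)
  next
    assume A: "\<exists>u'. u = u' + n \<and> (\<exists>j\<in>J2. c u' \<in> edge c j)" "v < n \<and> (\<exists>i\<in>J1. b v \<in> edge b i)"
    then obtain u' j where u': "u = u' + n" "j \<in> J2" "c u' \<in> edge c j" by auto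
    obtain i where i: "i \<in> J1" "b v \<in> edge b i" using A by auto
    show ?thesis using uv(3) meet[OF i u'(2,3)] A(2) u'(1) by (simp add: dd_def)
  next
    assume A: "\<exists>u'. u = u' + n \<and> (\<exists>j\<in>J2. c u' \<in> edge c j)" "\<exists>u'. v = u' + n \<and> (\<exists>j\<in>J2. c u' \<in> edge c j)"
    then show ?thesis using uv(3) path_inj[OF c] by (auto simp: dd_def)
  qed
qed

text \<open>The natural order of magnitude of the conditional mean number of increasing
  carriers.\<close>

definition rho :: real where "rho = real n * (1 / real n) ^ (card (starts J1) + card (starts J2))"

lemma rho_nonneg: "0 \<le> rho" by (simp add: rho_def)

lemma comb_size: "card (comb J1 J2) \<le> 2 * K" using J1 J2 card_comb by (simp add: patterns_def)

lemma n_large_comb: "16 * (card (comb J1 J2) + 1) ^ 2 \<le> n"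
proof -
  have "(card (comb J1 J2) + 1) ^ 2 \<le> (2 * K + 1) ^ 2" using comb_size by (intro power_mono) auto
  then show ?thesis using nl by linarith
qed

lemma n_2K: "2 * K + 15 \<le> m"
proof -
  have "16 * (2 * K + 1) \<le> 16 * (2 * K + 1) ^ 2" by (simp add: power2_eq_square)
  then have "16 * (2 * K + 1) \<le> n" using nl by linarith
  then show ?thesis using Suc_m by simp
qed

lemma H_crude:
  assumes v: "valid"
  shows "(\<Sum>a\<in>carriers. pw E l a) \<le> 2 * 4 ^ K * rho"
proof -
  let ?J = "comb J1 J2" and ?k = "card (comb J1 J2)" and ?r = "card (starts (comb J1 J2))"
  have S: "edge dd ` ?J \<subseteq> E" unfolding edge_comb using Jm by (auto simp: path_set_def)
  have EK: "E \<subseteq> K_edges n" using path_set_K b c by auto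
  have "inj_on (edge dd) ?J"
  proof (rule inj_onI)
    fix i j assume ij: "i \<in> ?J" "j \<in> ?J" "edge dd i = edge dd j"
    have cov: "i \<in> covered ?J" "Suc i \<in> covered ?J" "j \<in> covered ?J" "Suc j \<in> covered ?J" using ij by (auto simp: covered_def)
    have "dd i = dd j \<or> (dd i = dd (Suc j) \<and> dd (Suc i) = dd j)" using ij(3) by (auto simp: edge_def doubleton_eq_iff)
    then show "i = j"
    proof
      assume "dd i = dd j" then show ?thesis using inj_dd[OF v] cov by (auto simp: inj_on_def)
    next
      assume "dd i = dd (Suc j) \<and> dd (Suc i) = dd j"
      then have "i = Suc j" "Suc i = j" using inj_dd[OF v] cov by (auto simp: inj_on_def)
      then show ?thesis by simp
    qed
  qed
  then have cS: "card (edge dd ` ?J) = ?k" by (rule card_image)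
  have "\<Union>(edge dd ` ?J) = dd ` covered ?J" by (auto simp: edge_def covered_def)
  then have cU: "card (\<Union>(edge dd ` ?J)) = ?k + ?r" using inj_dd[OF v] by (simp add: card_image card_covered finite_comb)
  have km: "?k \<le> m" using comb_size n_2K by linarith
  have np: "0 < real n" using n2 by simp
  have r0: "?r = 0 \<longleftrightarrow> ?k = 0"
    using starts_nonempty[of ?J] finite_comb finite_patterns(1)[OF finite_comb] by (auto simp: starts_def)
  have "(\<Sum>a\<in>carriers. pw E l a) \<le> 2 ^ ?k * fact (n - (?k + ?r)) / fact (m - ?k)"
    unfolding carriers_valid[OF v] using sum_pw_le[OF l order.trans[OF S EK], of E] km by (simp add: cS cU)
  also have "\<dots> = 2 ^ ?k * (fact (n - (?k + ?r)) / fact (m - ?k))" by simp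
  also have "\<dots> \<le> 2 ^ ?k * (2 * rho)"
  proof (rule mult_left_mono)
    have "fact (n - (?k + ?r)) / fact (m - ?k) \<le> (1 + 8 * real ?k ^ 2 / real n) * (real n * (1 / real n) ^ ?r)"
      by (rule fact_quotient_approx(2)[OF _ card_starts_le[OF finite_comb] r0 n_large_comb]) (simp add: m_def)
    also have "\<dots> \<le> 2 * rho"
    proof -
      have "8 * ?k ^ 2 \<le> 16 * (?k + 1) ^ 2" by (simp add: power2_eq_square)
      then have "8 * ?k ^ 2 \<le> n" using n_large_comb by linarith
      then have "real (8 * ?k ^ 2) \<le> real n" by (simp only: of_nat_le_iff)
      then have "8 * real ?k ^ 2 / real n \<le> 1" using np by simp
      then show ?thesis unfolding rho_def card_starts_comb by (intro mult_right_mono) auto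
    qed
    finally show "fact (n - (?k + ?r)) / fact (m - ?k) \<le> 2 * rho" .
  qed simp
  also have "\<dots> \<le> 2 ^ (2 * K) * (2 * rho)"
    using comb_size rho_nonneg by (intro mult_right_mono power_increasing) auto
  finally show ?thesis by (simp add: power_mult)
qed

text \<open>Besides vertex-disjointness, labels in different runs are far apart, and no label of one
  pattern falls between the label of a pattern edge and the next label on the other path; the joined
  runs then satisfy \<open>no_between\<close>.\<close>

definition nice :: bool where
  "nice \<longleftrightarrow> valid
    \<and> (\<forall>i\<in>J1. \<forall>j\<in>J2. \<not> close h (xb i) (xc j) \<and> \<not> (Suc i < m \<and> xb i < xc j \<and> xc j < xb (Suc i)) \<and> \<not> (Suc j < m \<and> xc j < xb i \<and> xb i < xc (Suc j)))
    \<and> (\<forall>i\<in>J1. \<forall>j\<in>J1. diff_run J1 i j \<longrightarrow> \<not> close h (xb i) (xb j))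
    \<and> (\<forall>i\<in>J2. \<forall>j\<in>J2. diff_run J2 i j \<longrightarrow> \<not> close h (xc i) (xc j))"

lemma not_close: "\<not> close h y z \<Longrightarrow> y < z \<Longrightarrow> y + 2 * h + 2 \<le> z" "\<not> close h y z \<Longrightarrow> z < y \<Longrightarrow> z + 2 * h + 2 \<le> y" "\<not> close h y z \<Longrightarrow> y \<noteq> z"
  by (auto simp: close_def)

lemma diff_run_comb:
  shows "i \<in> J1 \<Longrightarrow> j \<in> J1 \<Longrightarrow> diff_run (comb J1 J2) i j \<Longrightarrow> diff_run J1 i j"
    "i \<in> J2 \<Longrightarrow> j \<in> J2 \<Longrightarrow> diff_run (comb J1 J2) (i + n) (j + n) \<Longrightarrow> diff_run J2 i j"
proof -
  assume ij: "i \<in> J1" "j \<in> J1" "diff_run (comb J1 J2) i j"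
  then obtain k where "k \<notin> comb J1 J2" "i < k \<and> k < j \<or> j < k \<and> k < i" by (auto simp: diff_run_def)
  then show "diff_run J1 i j" unfolding diff_run_def by (intro exI[of _ k]) (auto simp: comb_def)
next
  assume ij: "i \<in> J2" "j \<in> J2" "diff_run (comb J1 J2) (i + n) (j + n)"
  then obtain k where k: "k \<notin> comb J1 J2" "i + n < k \<and> k < j + n \<or> j + n < k \<and> k < i + n" by (auto simp: diff_run_def)
  then have "k = (k - n) + n" by auto
  then have "k - n \<notin> J2" using k(1) unfolding comb_def by (metis UnCI imageI)
  then show "diff_run J2 i j" unfolding diff_run_def using k(2) by (intro exI[of _ "k - n"]) auto
qed

lemma sep_pattern_comb:
  assumes ni: "nice"
  shows "sep_pattern n Q dd (comb J1 J2) l E h"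
proof -
  have v: "valid" using ni by (simp add: nice_def)
  have cl: "\<not> close h (xb i) (xc j)" "\<not> (Suc i < m \<and> xb i < xc j \<and> xc j < xb (Suc i))" "\<not> (Suc j < m \<and> xc j < xb i \<and> xb i < xc (Suc j))"
    if "i \<in> J1" "j \<in> J2" for i j using ni that by (auto simp: nice_def)
  have mem: "(i \<in> J1 \<and> edge dd i = edge b i) \<or> (\<exists>j. i = j + n \<and> j \<in> J2 \<and> edge dd i = edge c j)" if "i \<in> comb J1 J2" for i
    using that edge_dd Jm by (auto simp: comb_def)
  have sucmem1: "Suc i \<in> J1 \<and> edge dd (Suc i) = edge b (Suc i)" if "i \<in> J1" "Suc i \<in> comb J1 J2" for i
    using that lt_m(2)[OF Jm(1)[OF that(1)]] edge_dd Jm by (auto simp: comb_def)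
  have sucmem2: "Suc j \<in> J2 \<and> edge dd (Suc (j + n)) = edge c (Suc j)" if "j \<in> J2" "Suc (j + n) \<in> comb J1 J2" for j
  proof -
    have "Suc (j + n) \<notin> J1" using Jm(1)[of "Suc (j + n)"] lt_m(1)[of "Suc (j + n)"] by auto
    then have "Suc j \<in> J2" using that by (auto simp: comb_def)
    moreover have "edge dd (Suc j + n) = edge c (Suc j)" by (rule edge_dd)
    ultimately show ?thesis by simp
  qed
  show ?thesis
  proof
    show "finite (comb J1 J2)" by (rule finite_comb)
    show "inj_on dd (covered (comb J1 J2))" by (rule inj_dd[OF v])
    show "l \<in> labels" by (rule l)
    show "E \<subseteq> K_edges n" using path_set_K b c by auto
    show "edge dd ` comb J1 J2 \<subseteq> E" unfolding edge_comb using Jm by (auto simp: path_set_def)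
    show "inj_on (\<lambda>j. l (edge dd j)) (comb J1 J2)"
    proof (rule inj_onI)
      fix i j assume ij: "i \<in> comb J1 J2" "j \<in> comb J1 J2" and eq: "l (edge dd i) = l (edge dd j)"
      have bb: "i = j" if "i \<in> J1" "j \<in> J1" "xb i = xb j" for i j
        using xb_less[OF Jm(1)[OF that(1)] Jm(1)[OF that(2)]] xb_less[OF Jm(1)[OF that(2)] Jm(1)[OF that(1)]] that(3) by auto
      have cc: "i = j" if "i \<in> J2" "j \<in> J2" "xc i = xc j" for i j
        using xc_less[OF Jm(2)[OF that(1)] Jm(2)[OF that(2)]] xc_less[OF Jm(2)[OF that(2)] Jm(2)[OF that(1)]] that(3) by auto
      have bc: False if "i \<in> J1" "j \<in> J2" "xb i = xc j" for i j using not_close(3)[OF cl(1)[OF that(1,2)]] that(3) by simp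
      from mem[OF ij(1)] mem[OF ij(2)] show "i = j"
      proof (elim disjE exE conjE)
        assume "i \<in> J1" "edge dd i = edge b i" "j \<in> J1" "edge dd j = edge b j"
        then show ?thesis using bb eq by simp
      next
        fix j' assume "i \<in> J1" "edge dd i = edge b i" "j' \<in> J2" "edge dd j = edge c j'"
        then show ?thesis using bc[of i j'] eq by simp
      next
        fix i' assume "i' \<in> J2" "edge dd i = edge c i'" "j \<in> J1" "edge dd j = edge b j"
        then show ?thesis using bc[of j i'] eq by simp
      next
        fix i' j' assume "i = i' + n" "i' \<in> J2" "edge dd i = edge c i'" "j = j' + n" "j' \<in> J2" "edge dd j = edge c j'"
        then show ?thesis using cc[of i' j'] eq by simp
      qed
    qed
    show "l (edge dd j) < l (edge dd (Suc j))" if j: "j \<in> comb J1 J2" "Suc j \<in> comb J1 J2" for j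
      using mem[OF j(1)]
    proof (elim disjE exE conjE)
      assume "j \<in> J1" "edge dd j = edge b j"
      then show ?thesis using sucmem1[OF _ j(2)] xb_less[of j "Suc j"] Jm by simp
    next
      fix j' assume "j = j' + n" "j' \<in> J2" "edge dd j = edge c j'"
      then show ?thesis using sucmem2[of j'] j(2) xc_less[of j' "Suc j'"] Jm by simp
    qed
    show "\<not> l (edge dd j) < l (edge dd (Suc i))"
      if i: "i \<in> comb J1 J2" "Suc i \<in> comb J1 J2" and j: "j \<in> comb J1 J2" and lt: "l (edge dd i) < l (edge dd j)" for i j
      using mem[OF i(1)] mem[OF j]
    proof (elim disjE exE conjE)
      assume A: "i \<in> J1" "edge dd i = edge b i" "j \<in> J1" "edge dd j = edge b j"
      then have S: "Suc i \<in> J1" "edge dd (Suc i) = edge b (Suc i)" using sucmem1[OF _ i(2)] by auto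
      show ?thesis using A S lt xb_less[of i j] xb_less[of j "Suc i"] Jm by auto
    next
      fix j' assume A: "i \<in> J1" "edge dd i = edge b i" "j' \<in> J2" "edge dd j = edge c j'"
      then have S: "Suc i \<in> J1" "edge dd (Suc i) = edge b (Suc i)" using sucmem1[OF _ i(2)] by auto
      show ?thesis using A S lt cl(2)[OF A(1,3)] Jm by auto
    next
      fix i' assume A: "i = i' + n" "i' \<in> J2" "edge dd i = edge c i'" "j \<in> J1" "edge dd j = edge b j"
      then have S: "Suc i' \<in> J2" "edge dd (Suc i) = edge c (Suc i')" using sucmem2[of i'] i(2) by auto
      show ?thesis using A S lt cl(3)[OF A(4,2)] Jm by auto
    next
      fix i' j' assume A: "i = i' + n" "i' \<in> J2" "edge dd i = edge c i'" "j' \<in> J2" "edge dd j = edge c j'"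
      then have S: "Suc i' \<in> J2" "edge dd (Suc i) = edge c (Suc i')" using sucmem2[of i'] i(2) by auto
      show ?thesis using A S lt xc_less[of i' j'] xc_less[of j' "Suc i'"] Jm by auto
    qed
    show "card (comb J1 J2) \<le> m" using comb_size n_2K by linarith
    show "sparse E" by (rule sparse_Un[OF b c])
    show "l (edge dd i) + 2 * h + 2 \<le> l (edge dd j)"
      if ij: "i \<in> comb J1 J2" "j \<in> comb J1 J2" and dr: "diff_run (comb J1 J2) i j" and lt: "l (edge dd i) < l (edge dd j)" for i j
      using mem[OF ij(1)] mem[OF ij(2)]
    proof (elim disjE exE conjE)
      assume A: "i \<in> J1" "edge dd i = edge b i" "j \<in> J1" "edge dd j = edge b j"
      then have "\<not> close h (xb i) (xb j)" using ni diff_run_comb(1)[OF A(1,3) dr] by (auto simp: nice_def)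
      then show ?thesis using not_close(1) A lt by simp
    next
      fix j' assume A: "i \<in> J1" "edge dd i = edge b i" "j' \<in> J2" "edge dd j = edge c j'"
      then show ?thesis using not_close(1)[OF cl(1)[OF A(1,3)]] lt by simp
    next
      fix i' assume A: "i' \<in> J2" "edge dd i = edge c i'" "j \<in> J1" "edge dd j = edge b j"
      then show ?thesis using not_close(2)[OF cl(1)[OF A(3,1)]] lt by simp
    next
      fix i' j' assume A: "i = i' + n" "i' \<in> J2" "edge dd i = edge c i'" "j = j' + n" "j' \<in> J2" "edge dd j = edge c j'"
      then have "\<not> close h (xc i') (xc j')" using ni diff_run_comb(2)[of i' j'] dr by (auto simp: nice_def)
      then show ?thesis using not_close(1) A lt by simp
    qed
    show "16 * (card (comb J1 J2) + 1) ^ 2 \<le> n" by (rule n_large_comb)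
    show "h \<le> Q" by (rule hQ)
  qed
qed

lemma perr_nonneg: "0 \<le> perr h K"
proof -
  have "0 \<le> 1 - real h / real Q" using hQ Q1 by simp
  then show ?thesis unfolding perr_def by (intro mult_nonneg_nonneg add_nonneg_nonneg divide_nonneg_nonneg zero_le_power) auto
qed

text \<open>\<open>pat_weight\<close> is multiplicative under joining, because run starts, single
  edges and spreads all add up. This product form is the asymptotic independence of the two
  overlaps.\<close>

lemma H_nice:
  assumes ni: "nice"
  shows "\<bar>(\<Sum>a\<in>carriers. pw E l a) - free_prob E * (real n * (pattern_mass (lab l b) J1 * pattern_mass (lab l c) J2))\<bar> \<le> rho * perr h K"
proof -
  interpret sp: sep_pattern n Q dd "comb J1 J2" l E h by (rule sep_pattern_comb[OF ni])
  let ?k = "card (comb J1 J2)"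
  have v: "valid" using ni by (simp add: nice_def)
  have pwt: "sp.pat_weight = real n * (pattern_mass (lab l b) J1 * pattern_mass (lab l c) J2)"
    unfolding sp.pat_weight_def spread_comb card_starts_comb card_singles_comb pattern_mass_def
    by (simp add: power_add add_divide_distrib distrib_left exp_add[symmetric] algebra_simps flip: exp_add)
  have Qp: "0 < real Q" using Q1 by simp
  have base: "0 \<le> 1 - real h / real Q" "1 - real h / real Q \<le> 1" using hQ Qp by auto
  have kK: "real ?k \<le> 2 * real K" using comb_size by linarith
  have km: "real (m - ?k) * (real ?k + real (m - ?k)) \<le> real n ^ 2"
  proof -
    have "?k \<le> m" using comb_size n_2K by linarith
    then have "(m - ?k) * (?k + (m - ?k)) \<le> n * n" using Suc_m by (intro mult_le_mono) auto
    then have "real ((m - ?k) * (?k + (m - ?k))) \<le> real (n * n)" by (simp only: of_nat_le_iff)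
    then show ?thesis by (simp add: power2_eq_square)
  qed
  have M0: "0 < real (m - 2 * K)" using n_2K by simp
  have "\<bar>(\<Sum>a\<in>carriers. pw E l a) - free_prob E * (real n * (pattern_mass (lab l b) J1 * pattern_mass (lab l c) J2))\<bar>
    \<le> 2 ^ ?k * rho *
      (2 * (72 * (2 * real ?k + 1) ^ 2 / real n + 2 * real ?k ^ 2 * (1 - real h / real Q) ^ (m - ?k))
       + 8 * real ?k ^ 2 / real n + (real ?k + 5) / real (m - ?k) + real (m - ?k) * (real ?k + real (m - ?k)) / real Q)"
    using sp.sum_pw_pattern_approx unfolding carriers_valid[OF v] pwt card_starts_comb rho_def .
  also have "\<dots> \<le> 4 ^ K * rho * (2 * (72 * (4 * real K + 1) ^ 2 / real n + 8 * real K ^ 2 * (1 - real h / real Q) ^ (m - 2 * K))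
    + 32 * real K ^ 2 / real n + (2 * real K + 5) / real (m - 2 * K) + real n ^ 2 / real Q)"
  proof -
    have a1: "2 ^ ?k * rho \<le> 4 ^ K * rho"
    proof -
      have "(2::real) ^ ?k \<le> 2 ^ (2 * K)" using comb_size by (intro power_increasing) auto
      then show ?thesis using rho_nonneg by (intro mult_right_mono) (auto simp: power_mult)
    qed
    have "(2 * real ?k + 1) ^ 2 \<le> (4 * real K + 1) ^ 2" using kK by (intro power_mono) auto
    then have t1: "72 * (2 * real ?k + 1) ^ 2 / real n \<le> 72 * (4 * real K + 1) ^ 2 / real n"
      by (intro divide_right_mono mult_left_mono) auto
    have "real ?k ^ 2 \<le> (2 * real K) ^ 2" using kK by (intro power_mono) auto
    then have k2: "2 * real ?k ^ 2 \<le> 8 * real K ^ 2" "8 * real ?k ^ 2 \<le> 32 * real K ^ 2" by (simp_all add: power_mult_distrib)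
    have "(1 - real h / real Q) ^ (m - ?k) \<le> (1 - real h / real Q) ^ (m - 2 * K)"
      using base comb_size by (intro power_decreasing) auto
    then have t2: "2 * real ?k ^ 2 * (1 - real h / real Q) ^ (m - ?k) \<le> 8 * real K ^ 2 * (1 - real h / real Q) ^ (m - 2 * K)"
      using base by (intro mult_mono[OF k2(1)]) auto
    have t3: "8 * real ?k ^ 2 / real n \<le> 32 * real K ^ 2 / real n" using k2(2) by (rule divide_right_mono) simp
    have t4: "(real ?k + 5) / real (m - ?k) \<le> (2 * real K + 5) / real (m - 2 * K)"
      using kK M0 comb_size by (intro frac_le) auto
    have t5: "real (m - ?k) * (real ?k + real (m - ?k)) / real Q \<le> real n ^ 2 / real Q" by (rule divide_right_mono[OF km]) simp
    show ?thesis
    proof (rule mult_mono[OF a1])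
      show "2 * (72 * (2 * real ?k + 1) ^ 2 / real n + 2 * real ?k ^ 2 * (1 - real h / real Q) ^ (m - ?k))
       + 8 * real ?k ^ 2 / real n + (real ?k + 5) / real (m - ?k) + real (m - ?k) * (real ?k + real (m - ?k)) / real Q
       \<le> 2 * (72 * (4 * real K + 1) ^ 2 / real n + 8 * real K ^ 2 * (1 - real h / real Q) ^ (m - 2 * K))
    + 32 * real K ^ 2 / real n + (2 * real K + 5) / real (m - 2 * K) + real n ^ 2 / real Q"
        by (rule add_mono[OF add_mono[OF add_mono[OF mult_left_mono[OF add_mono[OF t1 t2]] t3] t4] t5]) simp
    qed (use base rho_nonneg in auto)
  qed
  finally show ?thesis by (simp add: perr_def mult_ac)
qed

lemma pattern_mass_prod_le: "pattern_mass (lab l b) J1 * pattern_mass (lab l c) J2 \<le> 4 ^ K * (1 / real n) ^ (card (starts J1) + card (starts J2))"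
proof -
  have "pattern_mass (lab l b) J1 * pattern_mass (lab l c) J2 \<le> (2 ^ K * (1 / real n) ^ card (starts J1)) * (2 ^ K * (1 / real n) ^ card (starts J2))"
    using J1 J2 by (intro mult_mono pattern_mass_le pattern_mass_nonneg) auto
  also have "\<dots> = (2 * 2) ^ K * (1 / real n) ^ (card (starts J1) + card (starts J2))"
    by (simp only: power_mult_distrib power_add mult_ac)
  finally show ?thesis by simp
qed

text \<open>When the patterns are not nice, the count and the main term are both at most
  \<open>2 * 4 ^ K * rho\<close>, which suffices because such pairs of patterns carry little
  weight.\<close>

lemma H_approx:
  "\<bar>(\<Sum>a\<in>carriers. pw E l a) - free_prob E * (real n * (pattern_mass (lab l b) J1 * pattern_mass (lab l c) J2))\<bar>
    \<le> rho * (perr h K + 2 * 4 ^ K * of_bool (\<not> nice))"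
proof (cases "nice")
  case True then show ?thesis using H_nice by simp
next
  case False
  have 1: "0 \<le> free_prob E * (real n * (pattern_mass (lab l b) J1 * pattern_mass (lab l c) J2))"
    using free_prob_bounds[of E] pattern_mass_nonneg by auto
  have "free_prob E * (real n * (pattern_mass (lab l b) J1 * pattern_mass (lab l c) J2)) \<le> 1 * (real n * (4 ^ K * (1 / real n) ^ (card (starts J1) + card (starts J2))))"
    by (rule mult_mono[OF free_prob_bounds(2) mult_left_mono[OF pattern_mass_prod_le]]) (use pattern_mass_nonneg in auto)
  then have 2: "free_prob E * (real n * (pattern_mass (lab l b) J1 * pattern_mass (lab l c) J2)) \<le> 4 ^ K * rho" by (simp add: rho_def mult_ac)
  have 3: "0 \<le> (\<Sum>a\<in>carriers. pw E l a)" by (intro sum_nonneg pw_nonneg)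
  have 4: "(\<Sum>a\<in>carriers. pw E l a) \<le> 2 * 4 ^ K * rho"
    using H_crude carriers_invalid rho_nonneg by (cases valid) auto
  have 5: "4 ^ K * rho \<le> 2 * 4 ^ K * rho" using rho_nonneg by simp
  have "\<bar>(\<Sum>a\<in>carriers. pw E l a) - free_prob E * (real n * (pattern_mass (lab l b) J1 * pattern_mass (lab l c) J2))\<bar> \<le> 2 * 4 ^ K * rho"
    using 1 2 3 4 5 unfolding abs_le_iff by linarith
  also have "\<dots> \<le> rho * (perr h K + 2 * 4 ^ K * of_bool (\<not> nice))"
    using False rho_nonneg perr_nonneg by (simp add: algebra_simps)
  finally show ?thesis .
qed

end

end

section \<open>Error terms summed over pairs of patterns\<close>

lemma sum_product_swap:
  fixes w :: "'a \<Rightarrow> real" and w' :: "'b \<Rightarrow> real"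
  shows "(\<Sum>x\<in>A. \<Sum>y\<in>B. w x * w' y * (\<Sum>p\<in>P. f p x * g p y)) = (\<Sum>p\<in>P. (\<Sum>x\<in>A. w x * f p x) * (\<Sum>y\<in>B. w' y * g p y))"
proof -
  have "(\<Sum>x\<in>A. \<Sum>y\<in>B. w x * w' y * (\<Sum>p\<in>P. f p x * g p y)) = (\<Sum>x\<in>A. \<Sum>y\<in>B. \<Sum>p\<in>P. (w x * f p x) * (w' y * g p y))"
    by (simp add: sum_distrib_left mult_ac)
  also have "\<dots> = (\<Sum>x\<in>A. \<Sum>p\<in>P. \<Sum>y\<in>B. (w x * f p x) * (w' y * g p y))"
    by (intro sum.cong refl sum.swap)
  also have "\<dots> = (\<Sum>p\<in>P. \<Sum>x\<in>A. \<Sum>y\<in>B. (w x * f p x) * (w' y * g p y))" by (rule sum.swap)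
  finally show ?thesis by (simp add: sum_product)
qed

lemma card_pairs_le:
  fixes R :: "nat \<Rightarrow> nat \<Rightarrow> bool"
  assumes "\<And>i. i < M \<Longrightarrow> card {j\<in>{..<M}. R i j} \<le> q"
  shows "card {(i,j). i < M \<and> j < M \<and> R i j} \<le> M * q"
proof -
  have "{(i,j). i < M \<and> j < M \<and> R i j} = Sigma {..<M} (\<lambda>i. {j\<in>{..<M}. R i j})" by auto
  then have "card {(i,j). i < M \<and> j < M \<and> R i j} = (\<Sum>i<M. card {j\<in>{..<M}. R i j})" by simp
  also have "\<dots> \<le> (\<Sum>i<M. q)" by (intro sum_mono assms) auto
  finally show ?thesis by simp
qed

lemma finite_pairs_lt: "finite {(i,j). i < (M::nat) \<and> j < M \<and> R i j}"
  by (rule finite_subset[of _ "{..<M} \<times> {..<M}"]) auto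

context two_paths begin

abbreviation "wt J \<equiv> (1 / real n) ^ card (starts J)"

definition cross :: "nat \<Rightarrow> nat \<Rightarrow> bool" where
  "cross i j \<longleftrightarrow> edge b i \<inter> edge c j \<noteq> {} \<or> close h (xb i) (xc j)
     \<or> (Suc i < m \<and> xb i < xc j \<and> xc j < xb (Suc i)) \<or> (Suc j < m \<and> xc j < xb i \<and> xb i < xc (Suc j))"

definition Conf where "Conf = {(i,j). i < m \<and> j < m \<and> cross i j}"
definition Closeb where "Closeb = {(i,j). i < m \<and> j < m \<and> close h (xb i) (xb j)}"
definition Closec where "Closec = {(i,j). i < m \<and> j < m \<and> close h (xc i) (xc j)}"
definition Sharedb where "Sharedb = {i\<in>{..<m}. edge b i \<in> path_set c}"
definition Sharedc where "Sharedc = {i\<in>{..<m}. edge c i \<in> path_set b}"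

lemma finite_conf: "finite Conf" "finite Closeb" "finite Closec" "finite Sharedb" "finite Sharedc"
  unfolding Conf_def Closeb_def Closec_def Sharedb_def Sharedc_def by (rule finite_pairs_lt | simp)+

lemma close_sym: "close h y z \<longleftrightarrow> close h z y" by (auto simp: close_def)

lemma window_b: "y < Q \<Longrightarrow> card {i\<in>{..<m}. close h (xb i) y} \<le> G"
proof -
  assume y: "y < Q"
  have "{i\<in>{..<m}. close h (xb i) y} = {i\<in>{..<m}. close h (lab l b i) y}" by (auto simp: lab_def)
  then show ?thesis using gb y by (simp add: good_def)
qed

lemma window_c: "y < Q \<Longrightarrow> card {i\<in>{..<m}. close h (xc i) y} \<le> G"
proof -
  assume y: "y < Q"
  have "{i\<in>{..<m}. close h (xc i) y} = {i\<in>{..<m}. close h (lab l c i) y}" by (auto simp: lab_def)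
  then show ?thesis using gc y by (simp add: good_def)
qed

lemma xQ: "i < m \<Longrightarrow> xb i < Q" "i < m \<Longrightarrow> xc i < Q"
  using incs_bound[OF incs_b] incs_bound[OF incs_c] by (auto simp: lab_def)

lemma card_Closeb: "card Closeb \<le> n * G" and card_Closec: "card Closec \<le> n * G"
proof -
  have "card Closeb \<le> m * G" unfolding Closeb_def
    by (rule card_pairs_le) (use window_b xQ close_sym in simp)
  then show "card Closeb \<le> n * G" using Suc_m by (meson le_trans mn(1) mult_le_mono1)
  have "card Closec \<le> m * G" unfolding Closec_def
    by (rule card_pairs_le) (use window_c xQ close_sym in simp)
  then show "card Closec \<le> n * G" using Suc_m by (meson le_trans mn(1) mult_le_mono1)
qed

lemma card_Shared: "card Sharedb \<le> K2" "card Sharedc \<le> K2"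
proof -
  have "edge b ` Sharedb \<subseteq> path_set b \<inter> path_set c" "edge c ` Sharedc \<subseteq> path_set b \<inter> path_set c"
    by (auto simp: Sharedb_def Sharedc_def path_set_def)
  then have "card (edge b ` Sharedb) \<le> K2" "card (edge c ` Sharedc) \<le> K2"
    using ov card_mono[of "path_set b \<inter> path_set c"] finite_path_set by (meson finite_Int le_trans)+
  then show "card Sharedb \<le> K2" "card Sharedc \<le> K2" by (simp_all add: card_image inj_edge b c)
qed

text \<open>For each position of \<open>b\<close>, at most 8 edges of \<open>c\<close> meet its
  edge, at most \<open>G\<close> have a close label, and at most one pair of consecutive labels of
  \<open>c\<close> encloses its label. Conversely each label of \<open>c\<close> is enclosed by at
  most one consecutive pair of \<open>b\<close>. This totals \<open>G + 10\<close>.\<close>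

lemma card_Conf: "card Conf \<le> n * (G + 10)"
proof -
  have gap_c: "card {j\<in>{..<m}. Suc j < m \<and> xc j < y \<and> y < xc (Suc j)} \<le> 1" for y
  proof (rule card_le_Suc0_iff_eq[THEN iffD2, unfolded One_nat_def[symmetric]])
    show "\<forall>j\<in>{j\<in>{..<m}. Suc j < m \<and> xc j < y \<and> y < xc (Suc j)}. \<forall>j'\<in>{j\<in>{..<m}. Suc j < m \<and> xc j < y \<and> y < xc (Suc j)}. j = j'"
    proof (intro ballI)
      fix j j' assume "j \<in> {j\<in>{..<m}. Suc j < m \<and> xc j < y \<and> y < xc (Suc j)}" "j' \<in> {j\<in>{..<m}. Suc j < m \<and> xc j < y \<and> y < xc (Suc j)}"
      then have "j < m" "j' < m" "Suc j < m" "Suc j' < m" "xc j < xc (Suc j')" "xc j' < xc (Suc j)" by auto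
      then show "j = j'" using xc_less[of j "Suc j'"] xc_less[of j' "Suc j"] by simp
    qed
  qed simp
  have gap_b: "card {i\<in>{..<m}. Suc i < m \<and> xb i < y \<and> y < xb (Suc i)} \<le> 1" for y
  proof (rule card_le_Suc0_iff_eq[THEN iffD2, unfolded One_nat_def[symmetric]])
    show "\<forall>j\<in>{j\<in>{..<m}. Suc j < m \<and> xb j < y \<and> y < xb (Suc j)}. \<forall>j'\<in>{j\<in>{..<m}. Suc j < m \<and> xb j < y \<and> y < xb (Suc j)}. j = j'"
    proof (intro ballI)
      fix j j' assume "j \<in> {j\<in>{..<m}. Suc j < m \<and> xb j < y \<and> y < xb (Suc j)}" "j' \<in> {j\<in>{..<m}. Suc j < m \<and> xb j < y \<and> y < xb (Suc j)}"
      then have "j < m" "j' < m" "Suc j < m" "Suc j' < m" "xb j < xb (Suc j')" "xb j' < xb (Suc j)" by auto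
      then show "j = j'" using xb_less[of j "Suc j'"] xb_less[of j' "Suc j"] by simp
    qed
  qed simp
  define C1 where "C1 = {(i,j). i < m \<and> j < m \<and> (edge b i \<inter> edge c j \<noteq> {} \<or> close h (xb i) (xc j) \<or> (Suc j < m \<and> xc j < xb i \<and> xb i < xc (Suc j)))}"
  define C2 where "C2 = {(j,i). j < m \<and> i < m \<and> (Suc i < m \<and> xb i < xc j \<and> xc j < xb (Suc i))}"
  have "card C1 \<le> m * (8 + G + 1)" unfolding C1_def
  proof (rule card_pairs_le)
    fix i assume i: "i < m"
    have m8: "card {j\<in>{..<m}. edge b i \<inter> edge c j \<noteq> {}} \<le> 8"
    proof -
      have "edge c ` {j\<in>{..<m}. edge b i \<inter> edge c j \<noteq> {}} \<subseteq> {f\<in>path_set c. edge b i \<inter> f \<noteq> {}}" by (auto simp: path_set_def)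
      then have "card (edge c ` {j\<in>{..<m}. edge b i \<inter> edge c j \<noteq> {}}) \<le> card {f\<in>path_set c. edge b i \<inter> f \<noteq> {}}"
        using finite_path_set by (intro card_mono) auto
      also have "\<dots> \<le> 8" by (rule sparse_meet[OF sparse_path[OF c] edge_in_K[OF b i]])
      finally show ?thesis by (simp add: card_image inj_edge c)
    qed
    have eq: "{j\<in>{..<m}. edge b i \<inter> edge c j \<noteq> {} \<or> close h (xb i) (xc j) \<or> (Suc j < m \<and> xc j < xb i \<and> xb i < xc (Suc j))}
      = {j\<in>{..<m}. edge b i \<inter> edge c j \<noteq> {}} \<union> {j\<in>{..<m}. close h (xc j) (xb i)} \<union> {j\<in>{..<m}. Suc j < m \<and> xc j < xb i \<and> xb i < xc (Suc j)}"
      using close_sym by blast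
    have "card {j\<in>{..<m}. edge b i \<inter> edge c j \<noteq> {} \<or> close h (xb i) (xc j) \<or> (Suc j < m \<and> xc j < xb i \<and> xb i < xc (Suc j))}
      \<le> card {j\<in>{..<m}. edge b i \<inter> edge c j \<noteq> {}} + card {j\<in>{..<m}. close h (xc j) (xb i)} + card {j\<in>{..<m}. Suc j < m \<and> xc j < xb i \<and> xb i < xc (Suc j)}"
      unfolding eq by (rule order_trans[OF card_Un_le add_right_mono[OF card_Un_le]])
    also have "\<dots> \<le> 8 + G + 1" using m8 window_c[OF xQ(1)[OF i]] gap_c[of "xb i"] by linarith
    finally show "card {j\<in>{..<m}. edge b i \<inter> edge c j \<noteq> {} \<or> close h (xb i) (xc j) \<or> (Suc j < m \<and> xc j < xb i \<and> xb i < xc (Suc j))} \<le> 8 + G + 1" .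
  qed
  moreover have "card C2 \<le> m * 1" unfolding C2_def
  proof (rule card_pairs_le)
    fix j assume "j < m"
    show "card {i\<in>{..<m}. Suc i < m \<and> xb i < xc j \<and> xc j < xb (Suc i)} \<le> 1" by (rule gap_b)
  qed
  moreover have "card Conf \<le> card C1 + card C2"
  proof -
    have f: "finite C1" "finite C2" unfolding C1_def C2_def by (rule finite_pairs_lt)+
    have "Conf \<subseteq> C1 \<union> prod.swap ` C2" by (auto simp: Conf_def cross_def C1_def C2_def image_iff)
    then have "card Conf \<le> card (C1 \<union> prod.swap ` C2)" using f by (intro card_mono) auto
    also have "\<dots> \<le> card C1 + card (prod.swap ` C2)" by (rule card_Un_le)
    also have "card (prod.swap ` C2) \<le> card C2" by (rule card_image_le[OF f(2)])
    finally show ?thesis by simp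
  qed
  ultimately have "card Conf \<le> m * (G + 10)" by (simp add: algebra_simps)
  also have "\<dots> \<le> n * (G + 10)" by (rule mult_le_mono1[OF mn(1)])
  finally show ?thesis .
qed

text \<open>A union bound for the failure of \<open>nice\<close>, written as sums of products of a
  function of \<open>J1\<close> and a function of \<open>J2\<close>, with factors 1 where one of
  them is absent, so that the double sum over patterns separates.\<close>

definition badness :: "nat set \<Rightarrow> nat set \<Rightarrow> real" where
  "badness J1 J2 = (\<Sum>p\<in>Conf. of_bool (fst p \<in> J1) * of_bool (snd p \<in> J2))
    + (\<Sum>i\<in>Sharedb. of_bool (i \<in> J1) * 1) + (\<Sum>i\<in>Sharedc. 1 * of_bool (i \<in> J2))
    + (\<Sum>p\<in>Closeb. of_bool (fst p \<in> J1 \<and> snd p \<in> J1 \<and> diff_run J1 (fst p) (snd p)) * 1)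
    + (\<Sum>p\<in>Closec. 1 * of_bool (fst p \<in> J2 \<and> snd p \<in> J2 \<and> diff_run J2 (fst p) (snd p)))"

lemma badness_nonneg: "0 \<le> badness J1 J2"
  unfolding badness_def by (intro add_nonneg_nonneg sum_nonneg) auto

lemma not_nice_badness:
  assumes J: "J1 \<in> patterns m K" "J2 \<in> patterns m K" and n: "\<not> nice J1 J2"
  shows "1 \<le> badness J1 J2"
proof -
  have Jm: "i < m" if "i \<in> J1 \<or> i \<in> J2" for i using that J by (auto simp: patterns_def)
  have mem: "1 \<le> (\<Sum>p\<in>P. f p)" if "finite P" "p \<in> P" "f p = 1" "\<And>p. 0 \<le> f p" for P p and f :: "'z \<Rightarrow> real"
    using member_le_sum[of p P f] that by simp
  have nn: "0 \<le> (\<Sum>p\<in>Conf. of_bool (fst p \<in> J1) * of_bool (snd p \<in> J2) :: real)"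
    "0 \<le> (\<Sum>i\<in>Sharedb. of_bool (i \<in> J1) * 1 :: real)" "0 \<le> (\<Sum>i\<in>Sharedc. 1 * of_bool (i \<in> J2) :: real)"
    "0 \<le> (\<Sum>p\<in>Closeb. of_bool (fst p \<in> J1 \<and> snd p \<in> J1 \<and> diff_run J1 (fst p) (snd p)) * 1 :: real)"
    "0 \<le> (\<Sum>p\<in>Closec. 1 * of_bool (fst p \<in> J2 \<and> snd p \<in> J2 \<and> diff_run J2 (fst p) (snd p)) :: real)"
    by (intro sum_nonneg; simp)+
  consider (A) i j where "i \<in> J1" "j \<in> J2" "cross i j" | (B) i where "i \<in> J1" "edge b i \<in> path_set c"
    | (C) i where "i \<in> J2" "edge c i \<in> path_set b"
    | (D) i j where "i \<in> J1" "j \<in> J1" "diff_run J1 i j" "close h (xb i) (xb j)"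
    | (F) i j where "i \<in> J2" "j \<in> J2" "diff_run J2 i j" "close h (xc i) (xc j)"
    using n unfolding nice_def[OF J] valid_def[OF J] cross_def by blast
  then show ?thesis
  proof cases
    case A
    have "1 \<le> (\<Sum>p\<in>Conf. of_bool (fst p \<in> J1) * of_bool (snd p \<in> J2) :: real)"
      by (rule mem[of _ "(i,j)"]) (use A Jm finite_conf in \<open>auto simp: Conf_def\<close>)
    then show ?thesis using nn unfolding badness_def by linarith
  next
    case B
    have "1 \<le> (\<Sum>i\<in>Sharedb. of_bool (i \<in> J1) * 1 :: real)"
      by (rule mem[of _ i]) (use B Jm finite_conf in \<open>auto simp: Sharedb_def\<close>)
    then show ?thesis using nn unfolding badness_def by linarith
  next
    case C
    have "1 \<le> (\<Sum>i\<in>Sharedc. 1 * of_bool (i \<in> J2) :: real)"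
      by (rule mem[of _ i]) (use C Jm finite_conf in \<open>auto simp: Sharedc_def\<close>)
    then show ?thesis using nn unfolding badness_def by linarith
  next
    case D
    have "1 \<le> (\<Sum>p\<in>Closeb. of_bool (fst p \<in> J1 \<and> snd p \<in> J1 \<and> diff_run J1 (fst p) (snd p)) * 1 :: real)"
      by (rule mem[of _ "(i,j)"]) (use D Jm finite_conf in \<open>auto simp: Closeb_def\<close>)
    then show ?thesis using nn unfolding badness_def by linarith
  next
    case F
    have "1 \<le> (\<Sum>p\<in>Closec. 1 * of_bool (fst p \<in> J2 \<and> snd p \<in> J2 \<and> diff_run J2 (fst p) (snd p)) :: real)"
      by (rule mem[of _ "(i,j)"]) (use F Jm finite_conf in \<open>auto simp: Closec_def\<close>)
    then show ?thesis using nn unfolding badness_def by linarith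
  qed
qed

text \<open>A conflict prescribes a position in each pattern, or two runs in one pattern, and so
  costs \<open>1 / n ^ 2\<close>, while there are of order \<open>n * G\<close> conflicts. A common
  edge of \<open>b\<close> and \<open>c\<close> costs only \<open>1 / n\<close>, but there are at
  most \<open>K2\<close> of these.\<close>

lemma sum_badness_le:
  "(\<Sum>J1\<in>patterns m K. \<Sum>J2\<in>patterns m K. wt J1 * wt J2 * badness J1 J2)
    \<le> ((real G + 10) * pat_C1 K ^ 2 + 2 * real K2 * pat_C1 K * pat_C0 K + 2 * real G * pat_C2 K * pat_C0 K) / real n"
proof -
  let ?P = "patterns m K"
  have np: "0 < real n" using n2 by simp
  have T0: "(\<Sum>J\<in>?P. wt J * 1) \<le> pat_C0 K" using sum_patterns_le[OF mn] by simp
  have T1: "(\<Sum>J\<in>?P. wt J * of_bool (i \<in> J)) \<le> pat_C1 K / real n" for i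
  proof -
    have "(\<Sum>J\<in>?P. wt J * of_bool (i \<in> J)) = (\<Sum>J\<in>{J\<in>?P. i \<in> J}. wt J)"
      by (rule sum.mono_neutral_cong_right) (auto simp: finite_patterns_set)
    then show ?thesis using sum_patterns_mem_le[OF mn, of K i] by simp
  qed
  have T2: "(\<Sum>J\<in>?P. wt J * of_bool (i \<in> J \<and> j \<in> J \<and> diff_run J i j)) \<le> pat_C2 K / real n ^ 2" for i j
  proof -
    have "(\<Sum>J\<in>?P. wt J * of_bool (i \<in> J \<and> j \<in> J \<and> diff_run J i j)) = (\<Sum>J\<in>{J\<in>?P. i \<in> J \<and> j \<in> J \<and> diff_run J i j}. wt J)"
      by (rule sum.mono_neutral_cong_right) (auto simp: finite_patterns_set)
    then show ?thesis using sum_patterns_mem2_le[OF mn, of K i j] by simp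
  qed
  have nn: "0 \<le> (\<Sum>J\<in>?P. wt J * f J)" if "\<And>J. 0 \<le> f J" for f using that by (intro sum_nonneg) simp
  have dist: "w * (a1 + a2 + a3 + a4 + a5) = w * a1 + w * a2 + w * a3 + w * a4 + w * a5" for w a1 a2 a3 a4 a5 :: real
    by (simp add: distrib_left)
  have "(\<Sum>J1\<in>?P. \<Sum>J2\<in>?P. wt J1 * wt J2 * badness J1 J2)
    = (\<Sum>p\<in>Conf. (\<Sum>J\<in>?P. wt J * of_bool (fst p \<in> J)) * (\<Sum>J\<in>?P. wt J * of_bool (snd p \<in> J)))
    + (\<Sum>i\<in>Sharedb. (\<Sum>J\<in>?P. wt J * of_bool (i \<in> J)) * (\<Sum>J\<in>?P. wt J * 1))
    + (\<Sum>i\<in>Sharedc. (\<Sum>J\<in>?P. wt J * 1) * (\<Sum>J\<in>?P. wt J * of_bool (i \<in> J)))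
    + (\<Sum>p\<in>Closeb. (\<Sum>J\<in>?P. wt J * of_bool (fst p \<in> J \<and> snd p \<in> J \<and> diff_run J (fst p) (snd p))) * (\<Sum>J\<in>?P. wt J * 1))
    + (\<Sum>p\<in>Closec. (\<Sum>J\<in>?P. wt J * 1) * (\<Sum>J\<in>?P. wt J * of_bool (fst p \<in> J \<and> snd p \<in> J \<and> diff_run J (fst p) (snd p))))"
    unfolding badness_def dist sum.distrib
    by (simp only: sum_product_swap)
  also have "\<dots> \<le> (\<Sum>p\<in>Conf. (pat_C1 K / real n) * (pat_C1 K / real n)) + (\<Sum>i\<in>Sharedb. (pat_C1 K / real n) * pat_C0 K)
    + (\<Sum>i\<in>Sharedc. pat_C0 K * (pat_C1 K / real n)) + (\<Sum>p\<in>Closeb. (pat_C2 K / real n ^ 2) * pat_C0 K) + (\<Sum>p\<in>Closec. pat_C0 K * (pat_C2 K / real n ^ 2))"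
    using pat_C_nonneg[of K] np by (intro add_mono sum_mono mult_mono T0 T1 T2 nn) auto
  also have "\<dots> = real (card Conf) * (pat_C1 K / real n * (pat_C1 K / real n)) + real (card Sharedb) * (pat_C1 K / real n * pat_C0 K)
    + real (card Sharedc) * (pat_C0 K * (pat_C1 K / real n)) + real (card Closeb) * (pat_C2 K / real n ^ 2 * pat_C0 K) + real (card Closec) * (pat_C0 K * (pat_C2 K / real n ^ 2))"
    by simp
  also have "\<dots> \<le> real (n * (G + 10)) * (pat_C1 K / real n * (pat_C1 K / real n)) + real K2 * (pat_C1 K / real n * pat_C0 K)
    + real K2 * (pat_C0 K * (pat_C1 K / real n)) + real (n * G) * (pat_C2 K / real n ^ 2 * pat_C0 K) + real (n * G) * (pat_C0 K * (pat_C2 K / real n ^ 2))"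
    using pat_C_nonneg[of K] np
    by (intro add_mono mult_right_mono of_nat_mono card_Conf card_Shared card_Closeb card_Closec) auto
  also have "\<dots> = ((real G + 10) * pat_C1 K ^ 2 + 2 * real K2 * pat_C1 K * pat_C0 K + 2 * real G * pat_C2 K * pat_C0 K) / real n"
    using np by (simp add: field_simps power2_eq_square)
  finally show ?thesis .
qed

lemma Phi_eq:
  "(\<Sum>a\<in>{a\<in>paths. \<not> touch a b c}. overlap_weight K (lab l b) (hits (path_set b) a) * overlap_weight K (lab l c) (hits (path_set c) a) * pw E l a)
   = (\<Sum>J1\<in>patterns m K. \<Sum>J2\<in>patterns m K. overlap_weight K (lab l b) (card J1) * overlap_weight K (lab l c) (card J2) * (\<Sum>a\<in>carriers J1 J2. pw E l a))"
proof -
  let ?P = "patterns m K"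
  define F where "F q a = {i\<in>{..<m}. edge q i \<in> path_set a}" for q a
  have cF: "card (F q a) = hits (path_set q) a" if "q \<in> paths" "a \<in> paths" for q a
  proof -
    have "edge q ` F q a = path_set a \<inter> path_set q" by (auto simp: F_def path_set_def)
    then show ?thesis using card_image[OF inj_edge[OF that(1)], of "F q a"] hits_eq_card[OF that(2)] by simp
  qed
  let ?f = "\<lambda>a. overlap_weight K (lab l b) (hits (path_set b) a) * overlap_weight K (lab l c) (hits (path_set c) a) * pw E l a"
  define A where "A = {a\<in>paths. \<not> touch a b c \<and> hits (path_set b) a \<le> K \<and> hits (path_set c) a \<le> K}"
  have fA: "finite A" using finite_paths by (simp add: A_def)
  have "(\<Sum>a\<in>{a\<in>paths. \<not> touch a b c}. ?f a) = (\<Sum>a\<in>A. ?f a)"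
  proof (rule sum.mono_neutral_right)
    show "\<forall>a\<in>{a\<in>paths. \<not> touch a b c} - A. ?f a = 0"
    proof
      fix a assume "a \<in> {a\<in>paths. \<not> touch a b c} - A"
      then have "K < hits (path_set b) a \<or> K < hits (path_set c) a" by (auto simp: A_def)
      then show "?f a = 0" using overlap_weight_bound(2) by auto
    qed
  qed (use finite_paths in \<open>auto simp: A_def\<close>)
  also have "\<dots> = (\<Sum>p\<in>?P \<times> ?P. \<Sum>a\<in>{a\<in>A. (F b a, F c a) = p}. ?f a)"
    by (rule sum.group[symmetric, OF fA]) (use cF b c in \<open>auto simp: finite_patterns_set A_def patterns_def, auto simp: F_def\<close>)
  also have "\<dots> = (\<Sum>(J1,J2)\<in>?P \<times> ?P. overlap_weight K (lab l b) (card J1) * overlap_weight K (lab l c) (card J2) * (\<Sum>a\<in>carriers J1 J2. pw E l a))"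
  proof (rule sum.cong[OF refl])
    fix p assume p: "p \<in> ?P \<times> ?P"
    obtain J1 J2 where J: "p = (J1, J2)" "J1 \<in> ?P" "J2 \<in> ?P" using p by auto
    have "{a\<in>A. (F b a, F c a) = p} = carriers J1 J2"
    proof -
      have "hits (path_set b) a \<le> K \<and> hits (path_set c) a \<le> K" if "a \<in> paths" "F b a = J1" "F c a = J2" for a
        using cF[OF b that(1)] cF[OF c that(1)] J that by (auto simp: patterns_def)
      then show ?thesis unfolding carriers_def[OF J(2,3)] A_def J(1) by (auto simp: F_def)
    qed
    moreover have u: "?f a = overlap_weight K (lab l b) (card J1) * overlap_weight K (lab l c) (card J2) * pw E l a" if "a \<in> carriers J1 J2" for a
    proof -
      have "a \<in> paths" "F b a = J1" "F c a = J2" using that unfolding carriers_def[OF J(2,3)] by (auto simp: F_def)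
      then show ?thesis using cF[OF b] cF[OF c] by metis
    qed
    ultimately have "(\<Sum>a\<in>{a\<in>A. (F b a, F c a) = p}. ?f a) = (\<Sum>a\<in>carriers J1 J2. ?f a)" by (simp only:)
    also have "\<dots> = (\<Sum>a\<in>carriers J1 J2. overlap_weight K (lab l b) (card J1) * overlap_weight K (lab l c) (card J2) * pw E l a)"
      by (intro sum.cong refl u)
    finally show "(\<Sum>a\<in>{a\<in>A. (F b a, F c a) = p}. ?f a) = (case p of (J1,J2) \<Rightarrow> overlap_weight K (lab l b) (card J1) * overlap_weight K (lab l c) (card J2) * (\<Sum>a\<in>carriers J1 J2. pw E l a))"
      by (simp only: J(1) prod.case sum_distrib_left)
  qed
  finally show ?thesis by (simp add: sum.cartesian_product)
qed

text \<open>The main term factors into a sum over \<open>J1\<close> times a sum over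
  \<open>J2\<close>, and the first sum vanishes by the choice of the weights. Only the errors from
  \<open>H_approx\<close> survive, with \<open>badness\<close> in place of the indicator of
  failure.\<close>

lemma Phi_bound:
  "\<bar>\<Sum>a\<in>{a\<in>paths. \<not> touch a b c}. overlap_weight K (lab l b) (hits (path_set b) a) * overlap_weight K (lab l c) (hits (path_set c) a) * pw E l a\<bar>
   \<le> weight_bound K ^ 2 * (real n * perr h K * pat_C0 K ^ 2
      + 2 * 4 ^ K * ((real G + 10) * pat_C1 K ^ 2 + 2 * real K2 * pat_C1 K * pat_C0 K + 2 * real G * pat_C2 K * pat_C0 K))"
    (is "\<bar>?Phi\<bar> \<le> ?B")
proof -
  let ?P = "patterns m K"
  define u1 u2 o1 o2 where "u1 J = overlap_weight K (lab l b) (card J)" and "u2 J = overlap_weight K (lab l c) (card J)"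
    and "o1 J = pattern_mass (lab l b) J" and "o2 J = pattern_mass (lab l c) J" for J
  define H where "H J1 J2 = (\<Sum>a\<in>carriers J1 J2. pw E l a)" for J1 J2
  let ?\<alpha> = "free_prob E"
  have np: "0 < real n" using n2 by simp
  have Um0: "0 \<le> weight_bound K" by (simp add: weight_bound_def pat_C0_def)
  have z: "(\<Sum>J1\<in>?P. \<Sum>J2\<in>?P. u1 J1 * u2 J2 * (?\<alpha> * (real n * (o1 J1 * o2 J2)))) = 0"
  proof -
    have "(\<Sum>J1\<in>?P. \<Sum>J2\<in>?P. u1 J1 * u2 J2 * (?\<alpha> * (real n * (o1 J1 * o2 J2))))
      = (\<Sum>J1\<in>?P. \<Sum>J2\<in>?P. ?\<alpha> * real n * ((u1 J1 * o1 J1) * (u2 J2 * o2 J2)))" by (simp add: mult_ac)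
    also have "\<dots> = ?\<alpha> * real n * ((\<Sum>J1\<in>?P. u1 J1 * o1 J1) * (\<Sum>J2\<in>?P. u2 J2 * o2 J2))"
      unfolding sum_product by (simp only: sum_distrib_left)
    also have "(\<Sum>J1\<in>?P. u1 J1 * o1 J1) = 0" unfolding u1_def o1_def by (rule sum_overlap_weight_pattern_mass)
    finally show ?thesis by simp
  qed
  have "?Phi = (\<Sum>J1\<in>?P. \<Sum>J2\<in>?P. u1 J1 * u2 J2 * H J1 J2)" unfolding Phi_eq u1_def u2_def H_def ..
  also have "\<dots> = (\<Sum>J1\<in>?P. \<Sum>J2\<in>?P. u1 J1 * u2 J2 * (H J1 J2 - ?\<alpha> * (real n * (o1 J1 * o2 J2))))"
    by (simp only: right_diff_distrib sum_subtractf z diff_zero)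
  finally have Phi: "?Phi = (\<Sum>J1\<in>?P. \<Sum>J2\<in>?P. u1 J1 * u2 J2 * (H J1 J2 - ?\<alpha> * (real n * (o1 J1 * o2 J2))))" .
  have "\<bar>?Phi\<bar> \<le> (\<Sum>J1\<in>?P. \<Sum>J2\<in>?P. \<bar>u1 J1 * u2 J2 * (H J1 J2 - ?\<alpha> * (real n * (o1 J1 * o2 J2)))\<bar>)"
    unfolding Phi by (rule order.trans[OF sum_abs sum_mono[OF sum_abs]])
  also have "\<dots> \<le> (\<Sum>J1\<in>?P. \<Sum>J2\<in>?P. weight_bound K ^ 2 * (real n * perr h K * (wt J1 * wt J2) + 2 * 4 ^ K * real n * (wt J1 * wt J2 * badness J1 J2)))"
  proof (intro sum_mono)
    fix J1 J2 assume J: "J1 \<in> ?P" "J2 \<in> ?P"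
    have "\<bar>u1 J1 * u2 J2\<bar> \<le> weight_bound K ^ 2"
      unfolding abs_mult power2_eq_square u1_def u2_def by (intro mult_mono overlap_weight_bound(1)) (auto simp: Um0)
    moreover have "\<bar>H J1 J2 - ?\<alpha> * (real n * (o1 J1 * o2 J2))\<bar> \<le> rho J1 J2 * (perr h K + 2 * 4 ^ K * of_bool (\<not> nice J1 J2))"
      unfolding H_def o1_def o2_def by (rule H_approx[OF J])
    moreover have "rho J1 J2 * (perr h K + 2 * 4 ^ K * of_bool (\<not> nice J1 J2)) \<le> rho J1 J2 * (perr h K + 2 * 4 ^ K * badness J1 J2)"
      using rho_nonneg[OF J] not_nice_badness[OF J] badness_nonneg[of J1 J2] by (intro mult_left_mono add_left_mono) auto
    ultimately have "\<bar>u1 J1 * u2 J2\<bar> * \<bar>H J1 J2 - ?\<alpha> * (real n * (o1 J1 * o2 J2))\<bar> \<le> weight_bound K ^ 2 * (rho J1 J2 * (perr h K + 2 * 4 ^ K * badness J1 J2))"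
      by (intro mult_mono) auto
    also have "rho J1 J2 = real n * (wt J1 * wt J2)" by (simp add: rho_def[OF J] power_add)
    finally show "\<bar>u1 J1 * u2 J2 * (H J1 J2 - ?\<alpha> * (real n * (o1 J1 * o2 J2)))\<bar>
      \<le> weight_bound K ^ 2 * (real n * perr h K * (wt J1 * wt J2) + 2 * 4 ^ K * real n * (wt J1 * wt J2 * badness J1 J2))"
      unfolding abs_mult by (simp only: distrib_left mult_ac)
  qed
  also have "\<dots> = weight_bound K ^ 2 * (real n * perr h K * (\<Sum>J1\<in>?P. \<Sum>J2\<in>?P. wt J1 * wt J2)
      + 2 * 4 ^ K * real n * (\<Sum>J1\<in>?P. \<Sum>J2\<in>?P. wt J1 * wt J2 * badness J1 J2))"
    by (simp only: sum_distrib_left[symmetric] sum.distrib)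
  also have "\<dots> \<le> ?B"
  proof (rule mult_left_mono[OF add_mono])
    have "(\<Sum>J1\<in>?P. \<Sum>J2\<in>?P. wt J1 * wt J2) = (\<Sum>J\<in>?P. wt J) * (\<Sum>J\<in>?P. wt J)" by (simp add: sum_product)
    also have "\<dots> \<le> pat_C0 K * pat_C0 K"
      using pat_C_nonneg[of K] by (intro mult_mono sum_patterns_le[OF mn] sum_nonneg) auto
    finally have s0: "(\<Sum>J1\<in>?P. \<Sum>J2\<in>?P. wt J1 * wt J2) \<le> pat_C0 K ^ 2" by (simp add: power2_eq_square)
    have "{} \<in> ?P" by (simp add: patterns_def)
    then have p0: "0 \<le> perr h K" using perr_nonneg by blast
    show "real n * perr h K * (\<Sum>J1\<in>?P. \<Sum>J2\<in>?P. wt J1 * wt J2) \<le> real n * perr h K * pat_C0 K ^ 2"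
      using p0 by (intro mult_left_mono s0) auto
    have "2 * 4 ^ K * real n * (\<Sum>J1\<in>?P. \<Sum>J2\<in>?P. wt J1 * wt J2 * badness J1 J2)
      \<le> 2 * 4 ^ K * real n * (((real G + 10) * pat_C1 K ^ 2 + 2 * real K2 * pat_C1 K * pat_C0 K + 2 * real G * pat_C2 K * pat_C0 K) / real n)"
      by (intro mult_left_mono sum_badness_le) auto
    also have "\<dots> = 2 * 4 ^ K * ((real G + 10) * pat_C1 K ^ 2 + 2 * real K2 * pat_C1 K * pat_C0 K + 2 * real G * pat_C2 K * pat_C0 K)"
      using np by simp
    finally show "2 * 4 ^ K * real n * (\<Sum>J1\<in>?P. \<Sum>J2\<in>?P. wt J1 * wt J2 * badness J1 J2)
      \<le> 2 * 4 ^ K * ((real G + 10) * pat_C1 K ^ 2 + 2 * real K2 * pat_C1 K * pat_C0 K + 2 * real G * pat_C2 K * pat_C0 K)" .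
  qed auto
  finally show ?thesis .
qed

end

section \<open>The second moment\<close>

text \<open>The right side is the probability that \<open>M\<close> independent labels are distinct;
  the bound is Bernoulli's inequality.\<close>

lemma falling_ge:
  fixes M Q :: nat
  assumes MQ: "M \<le> Q" and Q1: "1 \<le> Q"
  shows "1 - real M ^ 2 / real Q \<le> fact M * real (Q choose M) / real Q ^ M"
proof -
  have Qp: "0 < real Q" using Q1 by simp
  have "real (Suc (Q - M)) ^ M * fact (Q - M) \<le> fact ((Q - M) + M)" by (rule fact_add_ge) auto
  also have "fact ((Q - M) + M) = fact M * fact (Q - M) * real (Q choose M)"
    using binomial_fact_lemma[OF MQ] MQ by (metis le_add_diff_inverse2 of_nat_fact of_nat_mult)
  finally have "real (Suc (Q - M)) ^ M \<le> fact M * real (Q choose M)"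
    by (simp add: mult.assoc mult.left_commute)
  then have "(real (Suc (Q - M)) / real Q) ^ M \<le> fact M * real (Q choose M) / real Q ^ M"
    by (simp add: power_divide divide_right_mono)
  moreover have "1 - real M ^ 2 / real Q = 1 + real M * (- (real M / real Q))" by (simp add: power2_eq_square)
  moreover have "1 + real M * (- (real M / real Q)) \<le> (1 + (- (real M / real Q))) ^ M"
    by (rule Bernoulli_inequality) (use MQ Qp in simp)
  moreover have "(1 + (- (real M / real Q))) ^ M \<le> (real (Suc (Q - M)) / real Q) ^ M"
  proof (rule power_mono)
    have "1 + (- (real M / real Q)) = real (Q - M) / real Q" using MQ Qp by (simp add: field_simps of_nat_diff)
    then show "1 + (- (real M / real Q)) \<le> real (Suc (Q - M)) / real Q" "0 \<le> 1 + (- (real M / real Q))"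
      by (auto intro: divide_right_mono)
  qed
  ultimately show ?thesis by linarith
qed

section \<open>Paths with well-spread labels, and isolated paths\<close>

context labelling begin

text \<open>A window with more than \<open>G\<close> labels contains at least \<open>G ^ 2\<close>
  ordered pairs of distinct labels at distance below \<open>4 * h + 4\<close>. Such pairs are
  counted over all increasing sequences, and each pair of values is contained in few of
  them.\<close>

lemma card_not_good_le:
  assumes m2: "2 \<le> m"
  shows "real (card {t\<in>incs. \<not> good h G t}) * real G ^ 2 \<le> real (Q * (8 * h + 8)) * (real Q ^ (m - 2) / fact (m - 2))"
proof -
  define W where "W = 4 * h + 4"
  define P where "P = {(x,y). x < Q \<and> y < Q \<and> (x \<noteq> y \<and> x < y + W \<and> y < x + W)}"
  have fP: "finite P" unfolding P_def by (rule finite_pairs_lt)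
  have cP: "card P \<le> Q * (2 * W)" unfolding P_def
  proof (rule card_pairs_le)
    fix x assume "x < Q"
    have "{y\<in>{..<Q}. x \<noteq> y \<and> x < y + W \<and> y < x + W} \<subseteq> {x + 1 - W..<x + W}" by auto
    then have "card {y\<in>{..<Q}. x \<noteq> y \<and> x < y + W \<and> y < x + W} \<le> card {x + 1 - W..<x + W}" by (intro card_mono) auto
    then show "card {y\<in>{..<Q}. x \<noteq> y \<and> x < y + W \<and> y < x + W} \<le> 2 * W" by simp
  qed
  define N where "N t = {p\<in>P. {fst p, snd p} \<subseteq> t ` {..<m}}" for t
  have many: "G ^ 2 \<le> card (N t)" if t: "t \<in> incs" "\<not> good h G t" for t
  proof -
    obtain y where y: "G < card {i\<in>{..<m}. close h (t i) y}" using t by (auto simp: good_def incs_def not_le)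
    define S where "S = {i\<in>{..<m}. close h (t i) y}"
    define D where "D = Sigma S (\<lambda>i. S - {i})"
    have fS: "finite S" by (simp add: S_def)
    have "card D = (\<Sum>i\<in>S. card S - 1)" unfolding D_def using fS by simp
    also have "\<dots> = card S * (card S - 1)" by simp
    finally have cD: "card D = card S * (card S - 1)" .
    have "G ^ 2 \<le> card S * (card S - 1)" unfolding power2_eq_square
      by (rule mult_le_mono) (use y in \<open>simp_all add: S_def\<close>)
    also have "\<dots> = card ((\<lambda>(i,j). (t i, t j)) ` D)" unfolding cD[symmetric]
      by (rule card_image[symmetric]) (auto simp: inj_on_def D_def S_def incs_eq_iff[OF t(1)])
    also have "\<dots> \<le> card (N t)"
    proof (rule card_mono)
      show "finite (N t)" using fP by (simp add: N_def)
      show "(\<lambda>(i,j). (t i, t j)) ` D \<subseteq> N t"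
      proof
        fix p assume "p \<in> (\<lambda>(i,j). (t i, t j)) ` D"
        then obtain i j where ij: "p = (t i, t j)" "i < m" "j < m" "i \<noteq> j" "close h (t i) y" "close h (t j) y"
          by (auto simp: D_def S_def)
        then have "t i \<noteq> t j" using incs_eq_iff[OF t(1)] by simp
        then show "p \<in> N t" using ij incs_bound[OF t(1)] by (auto simp: N_def P_def close_def W_def)
      qed
    qed
    finally show ?thesis .
  qed
  define B where "B = {t\<in>incs. \<not> good h G t}"
  have fB: "finite B" using finite_incs by (simp add: B_def)
  have "real (card B) * real G ^ 2 = (\<Sum>t\<in>B. real (G ^ 2))" by simp
  also have "\<dots> \<le> (\<Sum>t\<in>B. real (card (N t)))" by (intro sum_mono of_nat_mono many) (auto simp: B_def)
  also have "\<dots> \<le> (\<Sum>t\<in>incs. real (card (N t)))" using finite_incs by (intro sum_mono2) (auto simp: B_def)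
  also have "\<dots> = (\<Sum>t\<in>incs. \<Sum>p\<in>P. of_bool ({fst p, snd p} \<subseteq> t ` {..<m}))"
    using fP by (simp add: N_def of_bool_def sum.If_cases Int_def)
  also have "\<dots> = (\<Sum>p\<in>P. \<Sum>t\<in>incs. of_bool ({fst p, snd p} \<subseteq> t ` {..<m}))" by (rule sum.swap)
  also have "\<dots> = (\<Sum>p\<in>P. real (card {t\<in>incs. {fst p, snd p} \<subseteq> t ` {..<m}}))"
    using finite_incs by (simp add: of_bool_def sum.If_cases Int_def)
  also have "\<dots> \<le> (\<Sum>p\<in>P. real Q ^ (m - 2) / fact (m - 2))"
  proof (intro sum_mono)
    fix p assume "p \<in> P"
    then have "{fst p, snd p} \<subseteq> {..<Q}" "card {fst p, snd p} = 2" by (auto simp: P_def)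
    then show "real (card {t\<in>incs. {fst p, snd p} \<subseteq> t ` {..<m}}) \<le> real Q ^ (m - 2) / fact (m - 2)"
      using card_incs_containing[of "{fst p, snd p}"] m2 by simp
  qed
  also have "\<dots> = real (card P) * (real Q ^ (m - 2) / fact (m - 2))" by simp
  also have "\<dots> \<le> real (Q * (2 * W)) * (real Q ^ (m - 2) / fact (m - 2))"
    by (intro mult_right_mono of_nat_mono cP) auto
  finally show ?thesis by (simp add: B_def W_def)
qed

text \<open>The relative loss in the mean number of good paths: the first term comes from coinciding
  labels, the second from bunched ones.\<close>

definition defect :: "nat \<Rightarrow> nat \<Rightarrow> real" where
  "defect h G = real n ^ 2 / real Q + (8 * real h + 8) * real n ^ 2 / (real Q * real G ^ 2)"

definition good_mean :: "nat \<Rightarrow> nat \<Rightarrow> real" where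
  "good_mean h G = real (card {t\<in>incs. good h G t}) / real Q ^ m"

lemma good_mean_ge:
  assumes m2: "2 \<le> m" and mQ: "m \<le> Q" and G: "1 \<le> G"
  shows "real n * (1 - defect h G) \<le> fact n * good_mean h G"
proof -
  have Qp: "0 < real Q" using Q1 by simp
  have fn: "fact n = real n * fact m" using Suc_m by (metis fact_Suc of_nat_fact of_nat_mult)
  define bad where "bad = real (card {t\<in>incs. \<not> good h G t})"
  have split: "real (card {t\<in>incs. good h G t}) = real (Q choose m) - bad"
  proof -
    have "card incs = card {t\<in>incs. good h G t} + card {t\<in>incs. \<not> good h G t}"
      using finite_incs by (subst card_Un_disjoint[symmetric]) (auto intro: arg_cong[where f = card])
    then show ?thesis using card_incs by (simp add: bad_def)
  qed
  have main: "1 - real n ^ 2 / real Q \<le> fact m * real (Q choose m) / real Q ^ m"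
  proof -
    have "real m ^ 2 / real Q \<le> real n ^ 2 / real Q" using mn Qp by (intro divide_right_mono power_mono) auto
    then show ?thesis using falling_ge[OF mQ Q1] by linarith
  qed
  have badle: "fact m * bad / real Q ^ m \<le> (8 * real h + 8) * real n ^ 2 / (real Q * real G ^ 2)"
  proof -
    obtain k where k: "m = k + 2" using m2 by (metis add.commute le_Suc_ex)
    have fm: "fact m = real m * real (m - 1) * fact (m - 2)" unfolding k by (simp add: numeral_2_eq_2)
    have Qm: "real Q ^ m = real Q ^ 2 * real Q ^ (m - 2)" unfolding k by (simp add: power_add power2_eq_square)
    have "bad * real G ^ 2 \<le> real Q * (8 * real h + 8) * (real Q ^ (m - 2) / fact (m - 2))"
      using card_not_good_le[OF m2, of h G] by (simp add: bad_def)
    then have "bad \<le> real Q * (8 * real h + 8) * (real Q ^ (m - 2) / fact (m - 2)) / real G ^ 2"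
      using G by (simp add: field_simps)
    then have "fact m * bad / real Q ^ m \<le> fact m * (real Q * (8 * real h + 8) * (real Q ^ (m - 2) / fact (m - 2)) / real G ^ 2) / real Q ^ m"
      by (intro divide_right_mono mult_left_mono) auto
    also have "\<dots> = (8 * real h + 8) * (real m * real (m - 1)) / (real Q * real G ^ 2)"
      unfolding fm Qm using Qp G by (simp add: field_simps power2_eq_square)
    also have "\<dots> \<le> (8 * real h + 8) * real n ^ 2 / (real Q * real G ^ 2)"
      unfolding power2_eq_square[of "real n"] using mn by (intro divide_right_mono mult_left_mono mult_mono) auto
    finally show ?thesis .
  qed
  have "fact n * good_mean h G = real n * (fact m * real (Q choose m) / real Q ^ m - fact m * bad / real Q ^ m)"
    unfolding good_mean_def split fn by (simp add: diff_divide_distrib right_diff_distrib)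
  also have "\<dots> \<ge> real n * (1 - defect h G)"
    using main badle unfolding defect_def by (intro mult_left_mono) auto
  finally show ?thesis .
qed

definition good_ind :: "nat \<Rightarrow> nat \<Rightarrow> (nat set \<Rightarrow> nat) \<Rightarrow> (nat \<Rightarrow> nat) \<Rightarrow> real" where
  "good_ind h G l a = of_bool (good h G (lab l a))"

lemma good_ind_bounds: "0 \<le> good_ind h G l a" "good_ind h G l a \<le> Inc l a" "good_ind h G l a \<le> 1"
  by (auto simp: good_ind_def Inc_def good_def)

lemma lab_dep: "\<forall>e\<in>path_set a. l e = l' e \<Longrightarrow> lab l a = lab l' a"
  by (intro ext) (auto simp: lab_def path_set_def)

lemma hits_sym: "a \<in> paths \<Longrightarrow> b \<in> paths \<Longrightarrow> hits (path_set a) b = hits (path_set b) a"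
  by (simp add: hits_eq_card Int_commute)

text \<open>Isolation of \<open>a\<close> depends only on labels off \<open>a\<close>, so it is
  independent of the goodness of \<open>a\<close>; and it holds automatically when no path is
  good.\<close>

lemma sum_good_isolated_ge:
  "ex (\<lambda>l. of_bool (\<forall>b\<in>paths. \<not> good h G (lab l b))) * (fact n * good_mean h G)
   \<le> ex (\<lambda>l. \<Sum>a\<in>paths. good_ind h G l a * of_bool (\<forall>b\<in>paths. hits (path_set a) b = 0 \<longrightarrow> \<not> good h G (lab l b)))"
proof -
  let ?q = "ex (\<lambda>l. of_bool (\<forall>b\<in>paths. \<not> good h G (lab l b)))"
  let ?Y = "\<lambda>l a. of_bool (\<forall>b\<in>paths. hits (path_set a) b = 0 \<longrightarrow> \<not> good h G (lab l b)) :: real"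
  have gm: "0 \<le> good_mean h G" by (simp add: good_mean_def)
  have each: "?q * good_mean h G \<le> ex (\<lambda>l. good_ind h G l a * ?Y l a)" if a: "a \<in> paths" for a
  proof -
    let ?E = "K_edges n - path_set a"
    have dep: "dep ?E (\<lambda>l. ?Y l a)"
    proof (intro ballI impI)
      fix l l' assume e: "\<forall>e\<in>?E. l e = (l' e :: nat)"
      have "lab l b = lab l' b" if "b \<in> paths" "hits (path_set a) b = 0" for b
      proof (rule lab_dep)
        have "path_set b \<inter> path_set a = {}" using that finite_path_set by (simp add: hits_eq_card)
        then show "\<forall>e\<in>path_set b. l e = l' e" using e path_set_K[OF that(1)] by blast
      qed
      then have "(\<forall>b\<in>paths. hits (path_set a) b = 0 \<longrightarrow> \<not> good h G (lab l b)) \<longleftrightarrow> (\<forall>b\<in>paths. hits (path_set a) b = 0 \<longrightarrow> \<not> good h G (lab l' b))"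
        by simp
      then show "?Y l a = ?Y l' a" by (simp only:)
    qed
    have h0: "hits ?E a = 0" by (simp add: hits_eq_card[OF a])
    have mt: "match ?E l a = seqs" for l by (auto simp: match_def path_set_def)
    have good_seqs: "(\<Sum>t\<in>seqs. of_bool (good h G t)) = real (card {t\<in>incs. good h G t})"
    proof -
      have "{t\<in>seqs. good h G t} = {t\<in>incs. good h G t}" by (auto simp: incs_def good_def)
      then show ?thesis using finite_seqs by (simp add: of_bool_def sum.If_cases Int_def)
    qed
    have "ex (\<lambda>l. good_ind h G l a * ?Y l a) = ex (\<lambda>l. ?Y l a * of_bool (good h G (lab l a)))"
      by (simp add: good_ind_def mult.commute)
    also have "\<dots> = ex (\<lambda>l. ?Y l a * (real Q ^ hits ?E a / real Q ^ m * (\<Sum>t\<in>match ?E l a. of_bool (good h G t))))"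
      by (rule ex_path[OF a _ dep]) simp
    also have "\<dots> = ex (\<lambda>l. good_mean h G * ?Y l a)"
      unfolding h0 mt good_seqs good_mean_def by (simp add: mult.commute)
    also have "\<dots> = good_mean h G * ex (\<lambda>l. ?Y l a)" by (rule ex_cmult)
    finally have "ex (\<lambda>l. good_ind h G l a * ?Y l a) = good_mean h G * ex (\<lambda>l. ?Y l a)" .
    moreover have "?q \<le> ex (\<lambda>l. ?Y l a)" by (intro ex_mono) auto
    ultimately show ?thesis using gm by (simp add: mult.commute mult_left_mono)
  qed
  have "?q * (fact n * good_mean h G) = (\<Sum>a\<in>paths. ?q * good_mean h G)" by (simp add: card_paths)
  also have "\<dots> \<le> (\<Sum>a\<in>paths. ex (\<lambda>l. good_ind h G l a * ?Y l a))" by (intro sum_mono each)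
  also have "\<dots> = ex (\<lambda>l. \<Sum>a\<in>paths. good_ind h G l a * ?Y l a)" by (rule ex_sum[symmetric])
  finally show ?thesis .
qed

definition V :: "nat \<Rightarrow> nat \<Rightarrow> nat \<Rightarrow> (nat set \<Rightarrow> nat) \<Rightarrow> (nat \<Rightarrow> nat) \<Rightarrow> real" where
  "V h G K l a = (\<Sum>b\<in>paths. good_ind h G l b * overlap_weight K (lab l b) (hits (path_set b) a))"

text \<open>Markov's inequality for the overlaps above \<open>K\<close> and Chebyshev's for
  \<open>V\<close>. On an isolated \<open>a\<close> the weight at overlap 0 never enters for good
  paths, so \<open>V\<close> is simply the number of good paths with overlap between 1 and
  \<open>K\<close>.\<close>

lemma isolated_le:
  assumes d: "0 < d"
  shows "(\<Sum>a\<in>paths. good_ind h G l a * of_bool (\<forall>b\<in>paths. hits (path_set a) b = 0 \<longrightarrow> \<not> good h G (lab l b)))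
    \<le> 2 * d + (\<Sum>a\<in>paths. Inc l a * (\<Sum>b\<in>{b\<in>paths. K < hits (path_set a) b}. Inc l b)) / d
      + (\<Sum>a\<in>paths. Inc l a * V h G K l a ^ 2) / d ^ 2"
proof -
  let ?Y = "\<lambda>a. of_bool (\<forall>b\<in>paths. hits (path_set a) b = 0 \<longrightarrow> \<not> good h G (lab l b)) :: real"
  let ?Z = "\<lambda>a. (\<Sum>b\<in>{b\<in>paths. K < hits (path_set a) b}. Inc l b)"
  let ?g = "good_ind h G l"
  have I0: "0 \<le> Inc l a" for a by (simp add: Inc_def)
  have Z0: "0 \<le> ?Z a" for a by (intro sum_nonneg I0)
  have nn: "0 \<le> (\<Sum>a\<in>paths. Inc l a * ?Z a) / d" "0 \<le> (\<Sum>a\<in>paths. Inc l a * V h G K l a ^ 2) / d ^ 2"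
    using d by (auto intro!: divide_nonneg_nonneg sum_nonneg mult_nonneg_nonneg I0)
  show ?thesis
  proof (cases "(\<Sum>a\<in>paths. ?g a) \<le> 2 * d")
    case True
    have "(\<Sum>a\<in>paths. ?g a * ?Y a) \<le> (\<Sum>a\<in>paths. ?g a)"
      by (intro sum_mono mult_left_le good_ind_bounds) auto
    then show ?thesis using True nn by linarith
  next
    case False
    have each: "?g a * ?Y a \<le> Inc l a * ?Z a / d + Inc l a * V h G K l a ^ 2 / d ^ 2" if a: "a \<in> paths" for a
    proof (cases "good h G (lab l a) \<and> (\<forall>b\<in>paths. hits (path_set a) b = 0 \<longrightarrow> \<not> good h G (lab l b))")
      case Z: False
      then have "?g a * ?Y a = 0" by (auto simp: good_ind_def)
      moreover have "0 \<le> Inc l a * ?Z a / d + Inc l a * V h G K l a ^ 2 / d ^ 2"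
        using d I0 Z0 by (intro add_nonneg_nonneg divide_nonneg_nonneg mult_nonneg_nonneg) auto
      ultimately show ?thesis by linarith
    next
      case T: True
      then have one: "?g a * ?Y a = 1" "Inc l a = 1" by (auto simp: good_ind_def Inc_def good_def)
      have "V h G K l a = (\<Sum>b\<in>{b\<in>paths. \<not> K < hits (path_set a) b}. ?g b)"
      proof -
        have "?g b * overlap_weight K (lab l b) (hits (path_set b) a) = (if \<not> K < hits (path_set a) b then ?g b else 0)"
          if b: "b \<in> paths" for b
          using T b hits_sym[OF a b] overlap_weight_bound(2)[of K] by (auto simp: overlap_weight_def good_ind_def)
        then show ?thesis unfolding V_def using finite_paths by (simp add: sum.If_cases Int_def)
      qed
      moreover have "(\<Sum>b\<in>paths. ?g b) = (\<Sum>b\<in>{b\<in>paths. K < hits (path_set a) b}. ?g b) + (\<Sum>b\<in>{b\<in>paths. \<not> K < hits (path_set a) b}. ?g b)"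
        using finite_paths by (subst sum.union_disjoint[symmetric]) (auto intro: sum.cong)
      moreover have "(\<Sum>b\<in>{b\<in>paths. K < hits (path_set a) b}. ?g b) \<le> ?Z a" by (intro sum_mono good_ind_bounds)
      ultimately have "d \<le> ?Z a \<or> d \<le> V h G K l a" using False by linarith
      then show ?thesis
      proof
        assume "d \<le> ?Z a"
        then have "1 \<le> ?Z a / d" using d by simp
        moreover have "0 \<le> V h G K l a ^ 2 / d ^ 2" by simp
        ultimately show ?thesis unfolding one mult_1 by linarith
      next
        assume "d \<le> V h G K l a"
        then have "d ^ 2 \<le> V h G K l a ^ 2" using d by (intro power_mono) auto
        then have "1 \<le> V h G K l a ^ 2 / d ^ 2" using d by simp
        moreover have "0 \<le> ?Z a / d" using d Z0[of a] by simp
        ultimately show ?thesis unfolding one mult_1 by linarith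
      qed
    qed
    have "(\<Sum>a\<in>paths. ?g a * ?Y a) \<le> (\<Sum>a\<in>paths. Inc l a * ?Z a / d + Inc l a * V h G K l a ^ 2 / d ^ 2)"
      by (intro sum_mono each)
    also have "\<dots> = (\<Sum>a\<in>paths. Inc l a * ?Z a) / d + (\<Sum>a\<in>paths. Inc l a * V h G K l a ^ 2) / d ^ 2"
      by (simp add: sum.distrib sum_divide_distrib)
    finally show ?thesis using d by linarith
  qed
qed

end

section \<open>Triples of paths and the second moment\<close>

context labelling begin

lemma dep_good_ind: "dep (path_set a) (\<lambda>l. good_ind h G l a)"
  using lab_dep by (metis good_ind_def)

lemma dep_overlap_weight: "dep (path_set b) (\<lambda>l. overlap_weight K (lab l b) k)"
  using lab_dep by metis

lemma dep_mult2:
  assumes "dep A F" "dep B F'"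
  shows "dep (A \<union> B) (\<lambda>l. F l * F' l)"
proof (intro ballI impI)
  fix l l' assume l: "l \<in> labels" "l' \<in> labels" and e: "\<forall>e\<in>A \<union> B. l e = (l' e :: nat)"
  have "F l = F l'" using assms(1) l e by blast
  moreover have "F' l = F' l'" using assms(2) l e by blast
  ultimately show "F l * F' l = F l' * F' l'" by simp
qed

lemma Inc_bounds: "0 \<le> Inc l a" "Inc l a \<le> 1" by (simp_all add: Inc_def)

lemma weight_bound_nonneg: "0 \<le> weight_bound K" by (simp add: weight_bound_def pat_C0_def)

lemma crude_nonneg: "0 \<le> crude k" by (simp add: crude_def)

lemma sum_Inc_le: "(\<Sum>a\<in>paths. ex (\<lambda>l. Inc l a)) \<le> real n"
proof -
  have "ex (\<lambda>l. Inc l a) = ex (\<lambda>l. pw {} l a)" if "a \<in> paths" for a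
    using ex_Inc[OF that, of "{}" "\<lambda>_. 1"] by simp
  then have "(\<Sum>a\<in>paths. ex (\<lambda>l. Inc l a)) = ex (\<lambda>l. \<Sum>a\<in>paths. pw {} l a)" by (simp add: ex_sum)
  also have "\<dots> \<le> ex (\<lambda>_. real n)"
  proof (rule ex_mono)
    fix l assume l: "l \<in> labels"
    have "{a\<in>paths. path_set a \<inter> {} = {}} = paths" by simp
    then have "(\<Sum>a\<in>paths. pw {} l a) \<le> fact n / fact m" using sum_pw_le[OF l, of "{}" "{}"] by simp
    also have "fact n / fact m = real n" using Suc_m by (metis fact_Suc fact_nonzero nonzero_mult_div_cancel_right of_nat_fact of_nat_mult)
    finally show "(\<Sum>a\<in>paths. pw {} l a) \<le> real n" .
  qed
  finally show ?thesis by (simp add: ex_const)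
qed

lemma sum_pairs_le:
  assumes K: "4 * K \<le> n"
  shows "(\<Sum>a\<in>paths. \<Sum>b\<in>{b\<in>paths. hits (path_set a) b \<le> K}. ex (\<lambda>l. Inc l a * Inc l b)) \<le> (1 + 2 * crude K) * real n ^ 2"
proof -
  have each: "(\<Sum>b\<in>{b\<in>paths. hits (path_set a) b \<le> K}. ex (\<lambda>l. Inc l a * Inc l b)) \<le> (1 + 2 * crude K) * real n * ex (\<lambda>l. Inc l a)"
    if a: "a \<in> paths" for a
  proof -
    let ?B = "{b\<in>paths. hits (path_set a) b \<le> K}"
    have "(\<Sum>b\<in>?B. ex (\<lambda>l. Inc l a * Inc l b)) = (\<Sum>b\<in>?B. ex (\<lambda>l. Inc l a * pw (path_set a) l b))"
      by (intro sum.cong refl ex_Inc path_set_K a dep_Inc) auto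
    also have "\<dots> = ex (\<lambda>l. Inc l a * (\<Sum>b\<in>?B. pw (path_set a) l b))" by (simp add: ex_sum sum_distrib_left)
    also have "\<dots> \<le> ex (\<lambda>l. (1 + 2 * crude K) * real n * Inc l a)"
    proof (rule ex_mono)
      fix l assume l: "l \<in> labels"
      have "Inc l a * (\<Sum>b\<in>?B. pw (path_set a) l b) \<le> Inc l a * ((1 + 2 * crude K) * real n)"
        by (intro mult_left_mono crude_bound_all l sparse_path a K Inc_bounds)
      then show "Inc l a * (\<Sum>b\<in>?B. pw (path_set a) l b) \<le> (1 + 2 * crude K) * real n * Inc l a" by (simp only: mult_ac)
    qed
    finally show ?thesis by (simp only: ex_cmult)
  qed
  have "(\<Sum>a\<in>paths. \<Sum>b\<in>{b\<in>paths. hits (path_set a) b \<le> K}. ex (\<lambda>l. Inc l a * Inc l b))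
    \<le> (\<Sum>a\<in>paths. (1 + 2 * crude K) * real n * ex (\<lambda>l. Inc l a))" by (intro sum_mono each)
  also have "\<dots> = (1 + 2 * crude K) * real n * (\<Sum>a\<in>paths. ex (\<lambda>l. Inc l a))" by (simp add: sum_distrib_left)
  also have "\<dots> \<le> (1 + 2 * crude K) * real n * real n"
    using crude_nonneg[of K] by (intro mult_left_mono sum_Inc_le) auto
  finally show ?thesis by (simp add: power2_eq_square mult.assoc)
qed

text \<open>The triples that escape the pattern asymptotics although all pairwise overlaps are
  small.\<close>

definition trip :: "nat \<Rightarrow> nat \<Rightarrow> (nat \<Rightarrow> nat) \<Rightarrow> (nat \<Rightarrow> nat) \<Rightarrow> (nat \<Rightarrow> nat) \<Rightarrow> bool" where
  "trip K K2 a b c \<longleftrightarrow> touch a b c \<and> hits (path_set a) b \<le> K \<and> hits (path_set a) c \<le> K \<and> hits (path_set b) c \<le> K2"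

text \<open>Given \<open>a\<close> and \<open>b\<close>, a touching \<open>c\<close> must use one of
  the edges of \<open>a\<close> that meet an edge common to \<open>a\<close> and \<open>b\<close>, a
  set of at most \<open>8 * K\<close> edges. By \<open>crude_bound\<close> this leaves a bounded
  mean number of \<open>c\<close>, so such triples are of order \<open>n ^ 2\<close> only.\<close>

lemma sum_touching_le:
  assumes K: "4 * (K + K2) \<le> n"
  shows "(\<Sum>b\<in>paths. \<Sum>c\<in>paths. \<Sum>a\<in>paths. of_bool (trip K K2 a b c) * ex (\<lambda>l. Inc l b * Inc l c * Inc l a))
    \<le> crude (K + K2) * (8 * real K) * ((1 + 2 * crude K) * real n ^ 2)"
proof -
  let ?C = "crude (K + K2) * (8 * real K)"
  have K4: "4 * K \<le> n" using K by simp
  have each: "(\<Sum>c\<in>paths. of_bool (trip K K2 a b c) * ex (\<lambda>l. Inc l b * Inc l c * Inc l a))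
      \<le> of_bool (hits (path_set a) b \<le> K) * (?C * ex (\<lambda>l. Inc l a * Inc l b))" if a: "a \<in> paths" and b: "b \<in> paths" for a b
  proof (cases "hits (path_set a) b \<le> K")
    case False
    then have "of_bool (trip K K2 a b c) = (0::real)" for c by (simp add: trip_def)
    then show ?thesis using False by simp
  next
    case True
    let ?E = "path_set a \<union> path_set b"
    define T where "T = {c\<in>paths. trip K K2 a b c}"
    define D where "D = (\<Union>e\<in>path_set b \<inter> path_set a. {f\<in>path_set a. e \<inter> f \<noteq> {}})"
    have fT: "finite T" using finite_paths by (simp add: T_def)
    have cD: "card D \<le> 8 * K"
    proof -
      have "card D \<le> (\<Sum>e\<in>path_set b \<inter> path_set a. card {f\<in>path_set a. e \<inter> f \<noteq> {}})"
        unfolding D_def using finite_path_set by (intro card_UN_le) auto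
      also have "\<dots> \<le> (\<Sum>e\<in>path_set b \<inter> path_set a. 8)"
        using path_set_K[OF b] by (intro sum_mono sparse_meet[OF sparse_path[OF a]]) auto
      also have "\<dots> \<le> 8 * K" using True by (simp add: hits_eq_card[OF b])
      finally show ?thesis .
    qed
    have TT: "T \<subseteq> {c\<in>paths. hits ?E c \<le> K + K2 \<and> path_set c \<inter> D \<noteq> {}}"
    proof
      fix c assume "c \<in> T"
      then have c: "c \<in> paths" and t: "touch a b c" "hits (path_set a) c \<le> K" "hits (path_set b) c \<le> K2"
        by (auto simp: T_def trip_def)
      have "path_set c \<inter> ?E = (path_set c \<inter> path_set a) \<union> (path_set c \<inter> path_set b)" by blast
      then have "hits ?E c \<le> hits (path_set a) c + hits (path_set b) c" by (simp add: hits_eq_card[OF c] card_Un_le)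
      moreover have "path_set c \<inter> D \<noteq> {}" using t(1) unfolding touch_def D_def by blast
      ultimately show "c \<in> {c\<in>paths. hits ?E c \<le> K + K2 \<and> path_set c \<inter> D \<noteq> {}}" using c t by simp
    qed
    have "(\<Sum>c\<in>paths. of_bool (trip K K2 a b c) * ex (\<lambda>l. Inc l b * Inc l c * Inc l a))
      = (\<Sum>c\<in>T. ex (\<lambda>l. (Inc l a * Inc l b) * Inc l c))"
      using finite_paths by (simp add: T_def of_bool_def if_distrib[of "\<lambda>x. x * _"] sum.If_cases Int_def mult_ac cong: if_cong)
    also have "\<dots> = (\<Sum>c\<in>T. ex (\<lambda>l. (Inc l a * Inc l b) * pw ?E l c))"
    proof (intro sum.cong refl ex_Inc dep_mult2 dep_Inc)
      fix c assume "c \<in> T" then show "c \<in> paths" by (simp add: T_def)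
    qed (use path_set_K a b in blast)
    also have "\<dots> = ex (\<lambda>l. (Inc l a * Inc l b) * (\<Sum>c\<in>T. pw ?E l c))" by (simp add: ex_sum sum_distrib_left)
    also have "\<dots> \<le> ex (\<lambda>l. ?C * (Inc l a * Inc l b))"
    proof (rule ex_mono)
      fix l assume l: "l \<in> labels"
      have "(\<Sum>c\<in>T. pw ?E l c) \<le> (\<Sum>c\<in>{c\<in>paths. hits ?E c \<le> K + K2 \<and> path_set c \<inter> D \<noteq> {}}. pw ?E l c)"
        using TT finite_paths by (intro sum_mono2 pw_nonneg) auto
      also have "\<dots> \<le> crude (K + K2) * real (card D)"
        by (rule crude_bound[OF l sparse_Un[OF a b] _ K]) (auto simp: D_def)
      also have "\<dots> \<le> crude (K + K2) * (8 * real K)"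
        using cD by (intro mult_left_mono crude_nonneg) linarith
      finally have "(Inc l a * Inc l b) * (\<Sum>c\<in>T. pw ?E l c) \<le> (Inc l a * Inc l b) * ?C"
        by (intro mult_left_mono mult_nonneg_nonneg Inc_bounds)
      then show "(Inc l a * Inc l b) * (\<Sum>c\<in>T. pw ?E l c) \<le> ?C * (Inc l a * Inc l b)" by (simp only: mult.commute)
    qed
    also have "\<dots> = ?C * ex (\<lambda>l. Inc l a * Inc l b)" by (rule ex_cmult)
    finally show ?thesis using True by simp
  qed
  have "(\<Sum>b\<in>paths. \<Sum>c\<in>paths. \<Sum>a\<in>paths. of_bool (trip K K2 a b c) * ex (\<lambda>l. Inc l b * Inc l c * Inc l a))
    = (\<Sum>b\<in>paths. \<Sum>a\<in>paths. \<Sum>c\<in>paths. of_bool (trip K K2 a b c) * ex (\<lambda>l. Inc l b * Inc l c * Inc l a))"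
    by (intro sum.cong refl sum.swap)
  also have "\<dots> = (\<Sum>a\<in>paths. \<Sum>b\<in>paths. \<Sum>c\<in>paths. of_bool (trip K K2 a b c) * ex (\<lambda>l. Inc l b * Inc l c * Inc l a))"
    by (rule sum.swap)
  also have "\<dots> \<le> (\<Sum>a\<in>paths. \<Sum>b\<in>paths. of_bool (hits (path_set a) b \<le> K) * (?C * ex (\<lambda>l. Inc l a * Inc l b)))"
    by (intro sum_mono each)
  also have "\<dots> = ?C * (\<Sum>a\<in>paths. \<Sum>b\<in>{b\<in>paths. hits (path_set a) b \<le> K}. ex (\<lambda>l. Inc l a * Inc l b))"
  proof -
    have "(\<Sum>b\<in>paths. of_bool (hits (path_set a) b \<le> K) * (?C * ex (\<lambda>l. Inc l a * Inc l b)))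
      = ?C * (\<Sum>b\<in>{b\<in>paths. hits (path_set a) b \<le> K}. ex (\<lambda>l. Inc l a * Inc l b))" for a
    proof -
      have "(\<Sum>b\<in>paths. of_bool (hits (path_set a) b \<le> K) * (?C * ex (\<lambda>l. Inc l a * Inc l b)))
        = (\<Sum>b\<in>{b\<in>paths. hits (path_set a) b \<le> K}. ?C * ex (\<lambda>l. Inc l a * Inc l b))"
        by (rule sum.mono_neutral_cong_right) (auto simp: finite_paths)
      then show ?thesis by (simp only: sum_distrib_left)
    qed
    then show ?thesis by (simp only: sum_distrib_left)
  qed
  also have "\<dots> \<le> ?C * ((1 + 2 * crude K) * real n ^ 2)"
    using crude_nonneg[of "K + K2"] by (intro mult_left_mono sum_pairs_le K4) auto
  finally show ?thesis .
qed

definition phi_err :: "nat \<Rightarrow> nat \<Rightarrow> nat \<Rightarrow> nat \<Rightarrow> real" where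
  "phi_err h G K K2 = real n * perr h K * pat_C0 K ^ 2
      + 2 * 4 ^ K * ((real G + 10) * pat_C1 K ^ 2 + 2 * real K2 * pat_C1 K * pat_C0 K + 2 * real G * pat_C2 K * pat_C0 K)"

text \<open>If \<open>b\<close> and \<open>c\<close> share more than \<open>K2\<close> edges, no
  cancellation is sought and absolute values are summed over the paths with overlap at most
  \<open>2 * K\<close>. Otherwise \<open>Phi_bound\<close> treats the paths \<open>a\<close> that do
  not touch, and the touching ones are kept for \<open>sum_touching_le\<close>. Goodness is relaxed
  to \<open>Inc\<close> on the right so that the pair bounds apply.\<close>

lemma V_pair_le:
  assumes b: "b \<in> paths" and c: "c \<in> paths" and l: "l \<in> labels"
    and K: "8 * K \<le> n" "16 * (2 * K + 1) ^ 2 \<le> n" and hQ: "h \<le> Q"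
  defines "S \<equiv> (\<Sum>a\<in>paths. overlap_weight K (lab l b) (hits (path_set b) a) * overlap_weight K (lab l c) (hits (path_set c) a) * pw (path_set b \<union> path_set c) l a)"
  shows "good_ind h G l b * good_ind h G l c * S \<le> weight_bound K ^ 2 * (of_bool (K2 < hits (path_set b) c) * (Inc l b * Inc l c) * ((1 + 2 * crude (2 * K)) * real n)
     + of_bool (hits (path_set b) c \<le> K2) * (Inc l b * Inc l c) * \<bar>phi_err h G K K2\<bar>
     + (\<Sum>a\<in>paths. of_bool (trip K K2 a b c) * (Inc l b * Inc l c * pw (path_set b \<union> path_set c) l a)))" (is "_ \<le> ?R")
proof (cases "good h G (lab l b) \<and> good h G (lab l c)")
  case False
  then have "good_ind h G l b * good_ind h G l c = 0" by (auto simp: good_ind_def)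
  moreover have "0 \<le> ?R"
    by (intro mult_nonneg_nonneg add_nonneg_nonneg sum_nonneg) (simp_all add: Inc_bounds pw_nonneg crude_nonneg)
  ultimately show ?thesis by (simp only: mult_zero_left)
next
  case True
  let ?E = "path_set b \<union> path_set c"
  let ?u = "\<lambda>a. overlap_weight K (lab l b) (hits (path_set b) a) * overlap_weight K (lab l c) (hits (path_set c) a)"
  have one: "good_ind h G l b = 1" "good_ind h G l c = 1" "Inc l b = 1" "Inc l c = 1"
    using True by (auto simp: good_ind_def Inc_def good_def)
  have u: "?u a \<le> weight_bound K ^ 2" "?u a * p \<le> weight_bound K ^ 2 * p" if "0 \<le> p" for a p
  proof -
    have "\<bar>?u a\<bar> \<le> weight_bound K ^ 2" unfolding abs_mult power2_eq_square
      by (rule mult_mono[OF overlap_weight_bound(1) overlap_weight_bound(1) weight_bound_nonneg abs_ge_zero])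
    then show "?u a \<le> weight_bound K ^ 2" by linarith
    then show "?u a * p \<le> weight_bound K ^ 2 * p" using that by (rule mult_right_mono)
  qed
  have Un: "hits ?E a \<le> hits (path_set b) a + hits (path_set c) a" if a: "a \<in> paths" for a
    by (simp add: hits_eq_card[OF a] Int_Un_distrib card_Un_le)
  have nn: "0 \<le> (\<Sum>a\<in>paths. of_bool (trip K K2 a b c) * (Inc l b * Inc l c * pw ?E l a))"
    by (intro sum_nonneg) (auto simp: Inc_bounds pw_nonneg)
  show ?thesis
  proof (cases "K2 < hits (path_set b) c")
    case True
    have "S \<le> (\<Sum>a\<in>{a\<in>paths. hits ?E a \<le> 2 * K}. weight_bound K ^ 2 * pw ?E l a)"
    proof -
      have "S = (\<Sum>a\<in>{a\<in>paths. hits ?E a \<le> 2 * K}. ?u a * pw ?E l a)" unfolding S_def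
      proof (rule sum.mono_neutral_right)
        show "\<forall>a\<in>paths - {a\<in>paths. hits ?E a \<le> 2 * K}. ?u a * pw ?E l a = 0"
        proof
          fix a assume "a \<in> paths - {a\<in>paths. hits ?E a \<le> 2 * K}"
          then have "K < hits (path_set b) a \<or> K < hits (path_set c) a" using Un[of a] by auto
          then show "?u a * pw ?E l a = 0" using overlap_weight_bound(2) by auto
        qed
      qed (auto simp: finite_paths)
      also have "\<dots> \<le> (\<Sum>a\<in>{a\<in>paths. hits ?E a \<le> 2 * K}. weight_bound K ^ 2 * pw ?E l a)"
        by (intro sum_mono u pw_nonneg)
      finally show ?thesis .
    qed
    also have "\<dots> = weight_bound K ^ 2 * (\<Sum>a\<in>{a\<in>paths. hits ?E a \<le> 2 * K}. pw ?E l a)" by (simp add: sum_distrib_left)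
    also have "\<dots> \<le> weight_bound K ^ 2 * ((1 + 2 * crude (2 * K)) * real n)"
      using K by (intro mult_left_mono crude_bound_all l sparse_Un b c) auto
    also have "\<dots> \<le> weight_bound K ^ 2 * ((1 + 2 * crude (2 * K)) * real n + (\<Sum>a\<in>paths. of_bool (trip K K2 a b c) * (Inc l b * Inc l c * pw ?E l a)))"
      using nn by (intro mult_left_mono) auto
    finally show ?thesis using True one by simp
  next
    case False
    interpret two_paths n Q b c l h G K K2
      using b c l \<open>good h G (lab l b) \<and> good h G (lab l c)\<close> False K(2) hQ hits_eq_card[OF c, of "path_set b"]
      by unfold_locales (auto simp: Int_commute)
    have "S = (\<Sum>a\<in>{a\<in>paths. \<not> touch a b c}. ?u a * pw ?E l a) + (\<Sum>a\<in>{a\<in>paths. touch a b c}. ?u a * pw ?E l a)"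
      unfolding S_def using finite_paths by (subst sum.union_disjoint[symmetric]) (auto intro!: sum.cong)
    moreover have "(\<Sum>a\<in>{a\<in>paths. \<not> touch a b c}. ?u a * pw ?E l a) \<le> weight_bound K ^ 2 * \<bar>phi_err h G K K2\<bar>"
    proof -
      have "(\<Sum>a\<in>{a\<in>paths. \<not> touch a b c}. ?u a * pw ?E l a) \<le> weight_bound K ^ 2 * phi_err h G K K2"
        using Phi_bound unfolding phi_err_def by linarith
      also have "\<dots> \<le> weight_bound K ^ 2 * \<bar>phi_err h G K K2\<bar>" by (intro mult_left_mono) auto
      finally show ?thesis .
    qed
    moreover have "(\<Sum>a\<in>{a\<in>paths. touch a b c}. ?u a * pw ?E l a) \<le> weight_bound K ^ 2 * (\<Sum>a\<in>paths. of_bool (trip K K2 a b c) * (Inc l b * Inc l c * pw ?E l a))"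
    proof -
      have "(\<Sum>a\<in>{a\<in>paths. touch a b c}. ?u a * pw ?E l a) = (\<Sum>a\<in>{a\<in>paths. trip K K2 a b c}. ?u a * pw ?E l a)"
      proof (rule sum.mono_neutral_right)
        show "\<forall>a\<in>{a\<in>paths. touch a b c} - {a\<in>paths. trip K K2 a b c}. ?u a * pw ?E l a = 0"
        proof
          fix a assume a: "a \<in> {a\<in>paths. touch a b c} - {a\<in>paths. trip K K2 a b c}"
          then have "K < hits (path_set b) a \<or> K < hits (path_set c) a"
            using False hits_sym[OF b, of a] hits_sym[OF c, of a] by (auto simp: trip_def)
          then show "?u a * pw ?E l a = 0" using overlap_weight_bound(2) by auto
        qed
      qed (auto simp: finite_paths trip_def)
      also have "\<dots> \<le> (\<Sum>a\<in>{a\<in>paths. trip K K2 a b c}. weight_bound K ^ 2 * pw ?E l a)" by (intro sum_mono u pw_nonneg)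
      also have "\<dots> = (\<Sum>a\<in>paths. weight_bound K ^ 2 * (of_bool (trip K K2 a b c) * (Inc l b * Inc l c * pw ?E l a)))"
        by (rule sum.mono_neutral_cong_left) (auto simp: finite_paths one)
      finally show ?thesis by (simp only: sum_distrib_left)
    qed
    ultimately have "S \<le> weight_bound K ^ 2 * \<bar>phi_err h G K K2\<bar> + weight_bound K ^ 2 * (\<Sum>a\<in>paths. of_bool (trip K K2 a b c) * (Inc l b * Inc l c * pw ?E l a))"
      by linarith
    then show ?thesis using False one by (simp add: distrib_left)
  qed
qed

text \<open>Expanding the square yields triples \<open>a\<close>, \<open>b\<close>,
  \<open>c\<close>. The weights depend only on labels on \<open>b\<close> and \<open>c\<close>, so
  given these labels the indicator of \<open>a\<close> may be replaced by \<open>pw\<close>, and the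
  sum over \<open>a\<close> becomes the one treated in \<open>V_pair_le\<close>.\<close>

lemma sum_V_le:
  assumes K: "8 * K \<le> n" "16 * (2 * K + 1) ^ 2 \<le> n" "4 * (K + K2) \<le> n" and hQ: "h \<le> Q" and Q: "2 * n ^ 2 \<le> Q"
  shows "ex (\<lambda>l. \<Sum>a\<in>paths. Inc l a * V h G K l a ^ 2)
    \<le> weight_bound K ^ 2 * ((1 + 2 * crude (2 * K)) * real n * overlap_tail n K2
        + \<bar>phi_err h G K K2\<bar> * ((1 + 2 * crude K2) * real n ^ 2)
        + crude (K + K2) * (8 * real K) * ((1 + 2 * crude K) * real n ^ 2))"
proof -
  let ?g = "\<lambda>l b. good_ind h G l b" and ?w = "\<lambda>l b a. overlap_weight K (lab l b) (hits (path_set b) a)"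
  let ?E = "\<lambda>b c. path_set b \<union> path_set c"
  let ?c1 = "(1 + 2 * crude (2 * K)) * real n" and ?c2 = "\<bar>phi_err h G K K2\<bar>"
  have dep: "dep (?E b c) (\<lambda>l. (?g l b * ?w l b a) * (?g l c * ?w l c a))" for a b c
  proof -
    have "dep (path_set b \<union> path_set b) (\<lambda>l. ?g l b * ?w l b a)" for b by (rule dep_mult2[OF dep_good_ind dep_overlap_weight])
    then have "dep (path_set b) (\<lambda>l. ?g l b * ?w l b a)" for b by (simp only: Un_absorb)
    then show ?thesis by (intro dep_mult2)
  qed
  have EK: "?E b c \<subseteq> K_edges n" if "b \<in> paths" "c \<in> paths" for b c using path_set_K that by blast
  have "ex (\<lambda>l. \<Sum>a\<in>paths. Inc l a * V h G K l a ^ 2)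
    = ex (\<lambda>l. \<Sum>a\<in>paths. \<Sum>b\<in>paths. \<Sum>c\<in>paths. (?g l b * ?w l b a) * (?g l c * ?w l c a) * Inc l a)"
    unfolding V_def power2_eq_square sum_product by (simp only: sum_distrib_left mult_ac)
  also have "\<dots> = (\<Sum>a\<in>paths. \<Sum>b\<in>paths. \<Sum>c\<in>paths. ex (\<lambda>l. (?g l b * ?w l b a) * (?g l c * ?w l c a) * Inc l a))"
    by (simp only: ex_sum)
  also have "\<dots> = (\<Sum>a\<in>paths. \<Sum>b\<in>paths. \<Sum>c\<in>paths. ex (\<lambda>l. (?g l b * ?w l b a) * (?g l c * ?w l c a) * pw (?E b c) l a))"
    by (intro sum.cong refl ex_Inc EK dep)
  also have "\<dots> = (\<Sum>b\<in>paths. \<Sum>c\<in>paths. \<Sum>a\<in>paths. ex (\<lambda>l. (?g l b * ?w l b a) * (?g l c * ?w l c a) * pw (?E b c) l a))"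
    by (rule trans[OF sum.swap]) (intro sum.cong refl sum.swap)
  also have "\<dots> = (\<Sum>b\<in>paths. \<Sum>c\<in>paths. ex (\<lambda>l. ?g l b * ?g l c * (\<Sum>a\<in>paths. ?w l b a * ?w l c a * pw (?E b c) l a)))"
  proof -
    have "(\<Sum>a\<in>paths. ex (\<lambda>l. (?g l b * ?w l b a) * (?g l c * ?w l c a) * pw (?E b c) l a))
      = ex (\<lambda>l. ?g l b * ?g l c * (\<Sum>a\<in>paths. ?w l b a * ?w l c a * pw (?E b c) l a))" for b c
      by (simp only: ex_sum sum_distrib_left mult_ac)
    then show ?thesis by (simp only:)
  qed
  also have "\<dots> \<le> (\<Sum>b\<in>paths. \<Sum>c\<in>paths. ex (\<lambda>l. weight_bound K ^ 2 * (of_bool (K2 < hits (path_set b) c) * (Inc l b * Inc l c) * ?c1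
     + of_bool (hits (path_set b) c \<le> K2) * (Inc l b * Inc l c) * ?c2
     + (\<Sum>a\<in>paths. of_bool (trip K K2 a b c) * (Inc l b * Inc l c * pw (?E b c) l a)))))"
    by (intro sum_mono ex_mono V_pair_le K hQ)
  also have "\<dots> = weight_bound K ^ 2 * (?c1 * (\<Sum>b\<in>paths. \<Sum>c\<in>paths. of_bool (K2 < hits (path_set b) c) * ex (\<lambda>l. Inc l b * Inc l c))
     + ?c2 * (\<Sum>b\<in>paths. \<Sum>c\<in>paths. of_bool (hits (path_set b) c \<le> K2) * ex (\<lambda>l. Inc l b * Inc l c))
     + (\<Sum>b\<in>paths. \<Sum>c\<in>paths. \<Sum>a\<in>paths. of_bool (trip K K2 a b c) * ex (\<lambda>l. Inc l b * Inc l c * pw (?E b c) l a)))"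
  proof -
    have "ex (\<lambda>l. weight_bound K ^ 2 * (of_bool (K2 < hits (path_set b) c) * (Inc l b * Inc l c) * ?c1
       + of_bool (hits (path_set b) c \<le> K2) * (Inc l b * Inc l c) * ?c2
       + (\<Sum>a\<in>paths. of_bool (trip K K2 a b c) * (Inc l b * Inc l c * pw (?E b c) l a))))
      = weight_bound K ^ 2 * (?c1 * (of_bool (K2 < hits (path_set b) c) * ex (\<lambda>l. Inc l b * Inc l c))
       + ?c2 * (of_bool (hits (path_set b) c \<le> K2) * ex (\<lambda>l. Inc l b * Inc l c))
       + (\<Sum>a\<in>paths. of_bool (trip K K2 a b c) * ex (\<lambda>l. Inc l b * Inc l c * pw (?E b c) l a)))" for b c
    proof -
      have m: "ex (\<lambda>l. z * F l * y) = y * (z * ex F)" for z y F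
        using ex_cmult[of "y * z" F] by (simp add: mult_ac)
      show ?thesis by (simp only: ex_cmult ex_add ex_sum m)
    qed
    then show ?thesis by (simp only: sum_distrib_left[symmetric] sum.distrib)
  qed
  also have "\<dots> \<le> weight_bound K ^ 2 * (?c1 * overlap_tail n K2 + ?c2 * ((1 + 2 * crude K2) * real n ^ 2)
      + crude (K + K2) * (8 * real K) * ((1 + 2 * crude K) * real n ^ 2))"
  proof (rule mult_left_mono[OF add_mono[OF add_mono]])
    have r: "(\<Sum>c\<in>paths. of_bool (R c) * ex (\<lambda>l. Inc l b * Inc l c)) = (\<Sum>c\<in>{c\<in>paths. R c}. ex (\<lambda>l. Inc l b * Inc l c))" for R b
      by (rule sum.mono_neutral_cong_right) (auto simp: finite_paths)
    have "(\<Sum>b\<in>paths. \<Sum>c\<in>{c\<in>paths. K2 < hits (path_set b) c}. ex (\<lambda>l. Inc l b * Inc l c)) \<le> overlap_tail n K2"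
      using overlap_tail_bound[OF Q, of K2] by (simp only: sum_distrib_left ex_sum)
    then show "?c1 * (\<Sum>b\<in>paths. \<Sum>c\<in>paths. of_bool (K2 < hits (path_set b) c) * ex (\<lambda>l. Inc l b * Inc l c)) \<le> ?c1 * overlap_tail n K2"
      unfolding r using crude_nonneg[of "2 * K"] by (intro mult_left_mono) auto
    show "?c2 * (\<Sum>b\<in>paths. \<Sum>c\<in>paths. of_bool (hits (path_set b) c \<le> K2) * ex (\<lambda>l. Inc l b * Inc l c)) \<le> ?c2 * ((1 + 2 * crude K2) * real n ^ 2)"
      unfolding r using K(3) by (intro mult_left_mono sum_pairs_le) auto
    have "(\<Sum>b\<in>paths. \<Sum>c\<in>paths. \<Sum>a\<in>paths. of_bool (trip K K2 a b c) * ex (\<lambda>l. Inc l b * Inc l c * pw (?E b c) l a))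
      = (\<Sum>b\<in>paths. \<Sum>c\<in>paths. \<Sum>a\<in>paths. of_bool (trip K K2 a b c) * ex (\<lambda>l. Inc l b * Inc l c * Inc l a))"
      by (intro sum.cong refl arg_cong2[where f = times] ex_Inc[symmetric] EK dep_mult2 dep_Inc)
    also have "\<dots> \<le> crude (K + K2) * (8 * real K) * ((1 + 2 * crude K) * real n ^ 2)" by (rule sum_touching_le[OF K(3)])
    finally show "(\<Sum>b\<in>paths. \<Sum>c\<in>paths. \<Sum>a\<in>paths. of_bool (trip K K2 a b c) * ex (\<lambda>l. Inc l b * Inc l c * pw (?E b c) l a))
      \<le> crude (K + K2) * (8 * real K) * ((1 + 2 * crude K) * real n ^ 2)" .
  qed simp
  finally show ?thesis .
qed

definition V_err :: "nat \<Rightarrow> nat \<Rightarrow> nat \<Rightarrow> nat \<Rightarrow> real" where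
  "V_err h G K K2 = weight_bound K ^ 2 * ((1 + 2 * crude (2 * K)) * real n * overlap_tail n K2
        + \<bar>phi_err h G K K2\<bar> * ((1 + 2 * crude K2) * real n ^ 2)
        + crude (K + K2) * (8 * real K) * ((1 + 2 * crude K) * real n ^ 2))"

lemma no_good_path_bound:
  assumes K: "8 * K \<le> n" "16 * (2 * K + 1) ^ 2 \<le> n" "4 * (K + K2) \<le> n" and hQ: "h \<le> Q" and Q: "2 * n ^ 2 \<le> Q"
    and d: "0 < d" and n3: "3 \<le> n" and G: "1 \<le> G"
  shows "ex (\<lambda>l. of_bool (\<forall>a\<in>paths. \<not> inc (lab l a))) * (real n * (1 - defect h G))
    \<le> 2 * d + overlap_tail n K / d + V_err h G K K2 / d ^ 2"
proof -
  let ?q = "ex (\<lambda>l. of_bool (\<forall>a\<in>paths. \<not> good h G (lab l a)))"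
  have m2: "2 \<le> m" using n3 Suc_m by linarith
  have "n \<le> 2 * n ^ 2" by (simp add: power2_eq_square)
  then have mQ: "m \<le> Q" using Q mn(1) by linarith
  have q0: "0 \<le> ?q" and p0: "0 \<le> ex (\<lambda>l. of_bool (\<forall>a\<in>paths. \<not> inc (lab l a)))" by (intro ex_nonneg; simp)+
  have pq: "ex (\<lambda>l. of_bool (\<forall>a\<in>paths. \<not> inc (lab l a))) \<le> ?q" by (intro ex_mono) (auto simp: good_def)
  have "ex (\<lambda>l. of_bool (\<forall>a\<in>paths. \<not> inc (lab l a))) * (real n * (1 - defect h G))
    \<le> ex (\<lambda>l. of_bool (\<forall>a\<in>paths. \<not> inc (lab l a))) * (fact n * good_mean h G)"
    by (intro mult_left_mono good_mean_ge m2 mQ G p0)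
  also have "\<dots> \<le> ?q * (fact n * good_mean h G)"
    by (intro mult_right_mono pq) (simp add: good_mean_def)
  also have "\<dots> \<le> ex (\<lambda>l. \<Sum>a\<in>paths. good_ind h G l a * of_bool (\<forall>b\<in>paths. hits (path_set a) b = 0 \<longrightarrow> \<not> good h G (lab l b)))"
    by (rule sum_good_isolated_ge)
  also have "\<dots> \<le> ex (\<lambda>l. 2 * d + (1 / d) * (\<Sum>a\<in>paths. Inc l a * (\<Sum>b\<in>{b\<in>paths. K < hits (path_set a) b}. Inc l b))
      + (1 / d ^ 2) * (\<Sum>a\<in>paths. Inc l a * V h G K l a ^ 2))"
    using isolated_le[OF d] by (intro ex_mono) simp
  also have "\<dots> = 2 * d + (1 / d) * (\<Sum>a\<in>paths. ex (\<lambda>l. Inc l a * (\<Sum>b\<in>{b\<in>paths. K < hits (path_set a) b}. Inc l b)))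
      + (1 / d ^ 2) * ex (\<lambda>l. \<Sum>a\<in>paths. Inc l a * V h G K l a ^ 2)"
    by (simp only: ex_add ex_cmult ex_const ex_sum)
  also have "\<dots> \<le> 2 * d + (1 / d) * overlap_tail n K + (1 / d ^ 2) * V_err h G K K2"
  proof (rule add_mono[OF add_left_mono])
    show "(1 / d) * (\<Sum>a\<in>paths. ex (\<lambda>l. Inc l a * (\<Sum>b\<in>{b\<in>paths. K < hits (path_set a) b}. Inc l b))) \<le> (1 / d) * overlap_tail n K"
      using d by (intro mult_left_mono overlap_tail_bound[OF Q]) auto
    show "(1 / d ^ 2) * ex (\<lambda>l. \<Sum>a\<in>paths. Inc l a * V h G K l a ^ 2) \<le> (1 / d ^ 2) * V_err h G K K2"
      unfolding V_err_def by (intro mult_left_mono sum_V_le K hQ Q) auto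
  qed
  finally show ?thesis by simp
qed

end

section \<open>From labellings to orderings\<close>

context labelling begin

definition rank :: "nat set rel \<Rightarrow> nat set \<Rightarrow> nat" where
  "rank r e = card {f\<in>K_edges n. f \<noteq> e \<and> (f, e) \<in> r}"

lemma rank_strict:
  assumes r: "r \<in> edge_orderings n" and ef: "e \<in> K_edges n" "f \<in> K_edges n" "(e, f) \<in> r" "e \<noteq> f"
  shows "rank r e < rank r f"
  unfolding rank_def
proof (rule psubset_card_mono)
  have t: "trans r" and a: "antisym r"
    using r by (auto simp: edge_orderings_def order_on_defs)
  show "{g\<in>K_edges n. g \<noteq> e \<and> (g, e) \<in> r} \<subset> {g\<in>K_edges n. g \<noteq> f \<and> (g, f) \<in> r}"
    using ef transD[OF t] antisymD[OF a] by blast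
qed (simp add: finite_K_edges)

lemma rank_lt: "e \<in> K_edges n \<Longrightarrow> rank r e < card (K_edges n)"
  unfolding rank_def by (rule psubset_card_mono) (auto simp: finite_K_edges)

lemma ordering_cases:
  assumes r: "r \<in> edge_orderings n" and ef: "e \<in> K_edges n" "f \<in> K_edges n"
  shows "(e, f) \<in> r \<or> (f, e) \<in> r \<and> e \<noteq> f" "(e, e) \<in> r"
proof -
  have t: "total_on (K_edges n) r" and r: "refl_on (K_edges n) r" using r by (auto simp: edge_orderings_def order_on_defs)
  show e: "(e, e) \<in> r" by (rule refl_onD[OF r ef(1)])
  show "(e, f) \<in> r \<or> (f, e) \<in> r \<and> e \<noteq> f"
  proof (cases "e = f")
    case True then show ?thesis using e by simp
  next
    case False then show ?thesis using t ef by (simp add: total_on_def)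
  qed
qed

lemma ordering_field: "r \<in> edge_orderings n \<Longrightarrow> r \<subseteq> K_edges n \<times> K_edges n"
  by (auto simp: edge_orderings_def order_on_defs)

definition order_of :: "(nat set \<Rightarrow> nat) \<Rightarrow> nat set rel" where
  "order_of l = {(e, f). e \<in> K_edges n \<and> f \<in> K_edges n \<and> l e \<le> l f}"

text \<open>Bijective labellings by an initial segment induce distinct orders, as the label of an
  edge is recovered as its rank. A lower bound on the number of orderings is what an upper bound on
  a probability takes.\<close>

lemma card_orderings_ge: "fact (card (K_edges n)) \<le> card (edge_orderings n)"
proof -
  let ?K = "K_edges n" and ?M = "card (K_edges n)"
  define L where "L = {l \<in> ?K \<rightarrow>\<^sub>E {..<?M}. inj_on l ?K}"
  have "card L = fact ?M"
    using card_inj_on_subset_funcset[OF finite_K_edges finite_lessThan subset_refl, of n ?M]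
    by (simp add: L_def fact_prod_rev)
  moreover have "card L \<le> card (edge_orderings n)"
  proof (rule card_inj_on_le[OF _ _ finite_edge_orderings])
    have val: "l e = rank (order_of l) e" if l: "l \<in> L" and e: "e \<in> ?K" for l e
    proof -
      have im: "l ` ?K = {..<?M}"
        using l finite_K_edges[of n] by (intro card_subset_eq) (auto simp: L_def card_image)
      have inj: "inj_on l ?K" using l by (simp add: L_def)
      have "l ` {f\<in>?K. f \<noteq> e \<and> (f, e) \<in> order_of l} = {..<l e}"
      proof
        show "l ` {f\<in>?K. f \<noteq> e \<and> (f, e) \<in> order_of l} \<subseteq> {..<l e}"
          using inj e by (auto simp: order_of_def inj_on_def less_le)
        show "{..<l e} \<subseteq> l ` {f\<in>?K. f \<noteq> e \<and> (f, e) \<in> order_of l}"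
        proof
          fix k assume k: "k \<in> {..<l e}"
          have "l e \<in> {..<?M}" using im e by blast
          then have "k \<in> l ` ?K" unfolding im using k by simp
          then show "k \<in> l ` {f\<in>?K. f \<noteq> e \<and> (f, e) \<in> order_of l}" using k e by (auto simp: order_of_def)
        qed
      qed
      moreover have "card (l ` {f\<in>?K. f \<noteq> e \<and> (f, e) \<in> order_of l}) = rank (order_of l) e"
        unfolding rank_def by (rule card_image) (rule inj_on_subset[OF inj], auto)
      ultimately show ?thesis by simp
    qed
    show "inj_on order_of L"
    proof (rule inj_onI)
      fix l l' assume *: "l \<in> L" "l' \<in> L" "order_of l = order_of l'"
      show "l = l'"
      proof (rule PiE_ext)
        show "l \<in> ?K \<rightarrow>\<^sub>E {..<?M}" "l' \<in> ?K \<rightarrow>\<^sub>E {..<?M}" using * by (auto simp: L_def)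
        show "l e = l' e" if "e \<in> ?K" for e using val * that by metis
      qed
    qed
    show "order_of ` L \<subseteq> edge_orderings n"
    proof
      fix r assume "r \<in> order_of ` L"
      then obtain l where "r = order_of l" "inj_on l ?K" by (auto simp: L_def)
      then show "r \<in> edge_orderings n"
        by (auto simp: edge_orderings_def order_on_defs order_of_def refl_on_def trans_def antisym_def total_on_def inj_on_def)
    qed
  qed
  ultimately show ?thesis by simp
qed

lemma no_path_bridge:
  assumes r: "r \<in> edge_orderings n" "num_increasing_paths n r = 0"
    and l: "\<And>e f. e \<in> K_edges n \<Longrightarrow> f \<in> K_edges n \<Longrightarrow> l e < l f \<Longrightarrow> (e, f) \<in> r - Id"
    and a: "a \<in> paths"
  shows "\<not> inc (lab l a)"
proof
  assume inc: "inc (lab l a)"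
  define vs where "vs = map a [0..<n]"
  have p: "a permutes {..<n}" using a by (simp add: paths_def)
  have "vs \<in> hamiltonian_paths n"
    using permutes_image[OF p] permutes_inj[OF p]
    by (auto simp: hamiltonian_paths_def vs_def distinct_map lessThan_atLeast0 intro: inj_on_subset)
  moreover have "increasing_path r vs"
  proof -
    have pe: "path_edges vs = map (edge a) [0..<m]"
      using Suc_m by (auto simp: path_edges_def vs_def edge_def m_def)
    have "(edge a i, edge a j) \<in> r - Id" if "i < j" "j < m" for i j
      using inc that edge_in_K[OF a] by (intro l) (auto simp: inc_def lab_def)
    then show ?thesis unfolding increasing_path_def pe by (auto simp: sorted_wrt_iff_nth_less)
  qed
  ultimately have "{vs \<in> hamiltonian_paths n. increasing_path r vs} \<noteq> {}" by blast
  then show False using r(2) finite_hamiltonian_paths[of n] by (auto simp: num_increasing_paths_def)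
qed

text \<open>An ordering and a label set of the right size determine an injective labelling, which
  assigns the labels in the given order. The set is recovered as the image and the ordering from
  comparisons, and without an increasing path for the ordering there is none for the
  labelling.\<close>

lemma card_bad_orderings_le:
  "card {r\<in>edge_orderings n. num_increasing_paths n r = 0} * (Q choose card (K_edges n))
    \<le> card {l\<in>labels. \<forall>a\<in>paths. \<not> inc (lab l a)}"
proof -
  let ?K = "K_edges n" and ?M = "card (K_edges n)"
  let ?R = "{r\<in>edge_orderings n. num_increasing_paths n r = 0}"
  let ?S = "{A. A \<subseteq> {..<Q} \<and> card A = ?M}"
  define \<phi> where "\<phi> r A = restrict (\<lambda>e. sorted_list_of_set A ! rank r e) ?K" for r and A :: "nat set"
  have less: "\<phi> r A e < \<phi> r A f" if r: "r \<in> edge_orderings n" and A: "A \<in> ?S" and ef: "e \<in> ?K" "f \<in> ?K" "(e, f) \<in> r" "e \<noteq> f" for r A e f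
  proof -
    have "sorted_wrt (<) (sorted_list_of_set A)" by simp
    moreover have "length (sorted_list_of_set A) = ?M" using A by simp
    ultimately show ?thesis
      using rank_strict[OF r ef] rank_lt[OF ef(2), of r] ef by (simp add: \<phi>_def sorted_wrt_iff_nth_less)
  qed
  have iff: "\<phi> r A e < \<phi> r A f \<longleftrightarrow> (e, f) \<in> r - Id" if r: "r \<in> edge_orderings n" and A: "A \<in> ?S" and ef: "e \<in> ?K" "f \<in> ?K" for r A e f
  proof
    assume lt: "\<phi> r A e < \<phi> r A f"
    then have "e \<noteq> f" by auto
    moreover have "(e, f) \<in> r" using ordering_cases(1)[OF r ef] less[OF r A ef(2,1)] lt by fastforce
    ultimately show "(e, f) \<in> r - Id" by simp
  next
    assume "(e, f) \<in> r - Id" then show "\<phi> r A e < \<phi> r A f" using less[OF r A ef] by simp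
  qed
  have sub: "\<phi> r A ` ?K \<subseteq> A" if A: "A \<in> ?S" for r A
  proof
    fix y assume "y \<in> \<phi> r A ` ?K"
    then obtain e where e: "e \<in> ?K" "y = sorted_list_of_set A ! rank r e" by (auto simp: \<phi>_def)
    have "finite A" using A finite_subset by auto
    moreover have "length (sorted_list_of_set A) = ?M" using A by simp
    ultimately show "y \<in> A" using nth_mem[of "rank r e" "sorted_list_of_set A"] rank_lt[OF e(1), of r] e(2) by simp
  qed
  have im: "\<phi> r A ` ?K = A" if r: "r \<in> edge_orderings n" and A: "A \<in> ?S" for r A
  proof (rule card_subset_eq[OF _ sub[OF A]])
    show "finite A" using A finite_subset by auto
    have "inj_on (\<phi> r A) ?K"
    proof (rule inj_onI, rule ccontr)
      fix e f assume ef: "e \<in> ?K" "f \<in> ?K" "\<phi> r A e = \<phi> r A f" "e \<noteq> f"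
      then show False using ordering_cases(1)[OF r ef(1,2)] less[OF r A ef(1,2)] less[OF r A ef(2,1)] by auto
    qed
    then show "card (\<phi> r A ` ?K) = card A" using A by (simp add: card_image)
  qed
  have "card (?R \<times> ?S) \<le> card {l\<in>labels. \<forall>a\<in>paths. \<not> inc (lab l a)}"
  proof (rule card_inj_on_le[of "\<lambda>(r, A). \<phi> r A"])
    show "inj_on (\<lambda>(r, A). \<phi> r A) (?R \<times> ?S)"
    proof (rule inj_onI, clarsimp, intro conjI)
      fix r A r' A'
      assume r: "r \<in> edge_orderings n" and r': "r' \<in> edge_orderings n" and "A \<subseteq> {..<Q}" "card A = ?M" "A' \<subseteq> {..<Q}" "card A' = ?M"
        and eq: "\<phi> r A = \<phi> r' A'"
      then have A: "A \<in> ?S" and A': "A' \<in> ?S" by auto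
      show "A = A'" using im[OF r A] im[OF r' A'] eq by simp
      have "(e, f) \<in> r \<longleftrightarrow> (e, f) \<in> r'" for e f
      proof (cases "e \<in> ?K \<and> f \<in> ?K")
        case True
        then show ?thesis
          using iff[OF r A, of e f] iff[OF r' A', of e f] eq ordering_cases(2)[OF r, of e e] ordering_cases(2)[OF r', of e e]
          by (cases "e = f") auto
      next
        case False
        then show ?thesis using ordering_field[OF r] ordering_field[OF r'] by blast
      qed
      then show "r = r'" by auto
    qed
    show "(\<lambda>(r, A). \<phi> r A) ` (?R \<times> ?S) \<subseteq> {l\<in>labels. \<forall>a\<in>paths. \<not> inc (lab l a)}"
    proof
      fix l assume "l \<in> (\<lambda>(r, A). \<phi> r A) ` (?R \<times> ?S)"
      then obtain r A where l: "l = \<phi> r A" and r: "r \<in> edge_orderings n" "num_increasing_paths n r = 0" and A: "A \<in> ?S" by auto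
      have "l e < Q" if "e \<in> ?K" for e using sub[OF A, of r] A that by (auto simp: l)
      moreover have "l \<in> extensional ?K" by (simp add: l \<phi>_def)
      ultimately have "l \<in> labels" by (auto simp: labels_def PiE_iff)
      moreover have "\<not> inc (lab l a)" if "a \<in> paths" for a
        by (rule no_path_bridge[OF r _ that]) (use iff[OF r(1) A] in \<open>simp add: l\<close>)
      ultimately show "l \<in> {l\<in>labels. \<forall>a\<in>paths. \<not> inc (lab l a)}" by simp
    qed
    show "finite {l\<in>labels. \<forall>a\<in>paths. \<not> inc (lab l a)}" using finite_labels by simp
  qed
  moreover have "card ?S = Q choose ?M" using n_subsets[of "{..<Q}" ?M] by simp
  ultimately show ?thesis by (simp add: card_cartesian_product)
qed

abbreviation failure :: real where
  "failure \<equiv> measure_pmf.prob (random_edge_ordering n) {r. num_increasing_paths n r = 0}"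

text \<open>The correction is a lower bound for the probability that all edge labels are distinct,
  in which case they induce a uniform ordering.\<close>

lemma failure_le:
  assumes Q: "card (K_edges n) \<le> Q"
  shows "failure * (1 - real (card (K_edges n)) ^ 2 / real Q) \<le> ex (\<lambda>l. of_bool (\<forall>a\<in>paths. \<not> inc (lab l a)))"
proof -
  let ?M = "card (K_edges n)"
  let ?B = "card {r\<in>edge_orderings n. num_increasing_paths n r = 0}"
  have Qp: "0 < real Q" using Q1 by simp
  have f: "failure = real ?B / real (card (edge_orderings n))"
    unfolding random_edge_ordering_def
    by (simp add: measure_pmf_of_set finite_edge_orderings edge_orderings_nonempty Int_def)
  have "failure \<le> real ?B / fact ?M" unfolding f
  proof (rule divide_left_mono)
    show fo: "fact ?M \<le> real (card (edge_orderings n))" using card_orderings_ge by (metis of_nat_fact of_nat_le_iff)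
    show "0 < real (card (edge_orderings n)) * fact ?M"
      by (intro mult_pos_pos order.strict_trans2[OF fact_gt_zero fo] fact_gt_zero)
  qed simp
  have "failure * (1 - real ?M ^ 2 / real Q) \<le> failure * (fact ?M * real (Q choose ?M) / real Q ^ ?M)"
    by (intro mult_left_mono falling_ge Q Q1) simp
  also have "\<dots> \<le> (real ?B / fact ?M) * (fact ?M * real (Q choose ?M) / real Q ^ ?M)"
    by (intro mult_right_mono) (use \<open>failure \<le> real ?B / fact ?M\<close> in auto)
  also have "\<dots> = real (?B * (Q choose ?M)) / real Q ^ ?M" by simp
  also have "\<dots> \<le> real (card {l\<in>labels. \<forall>a\<in>paths. \<not> inc (lab l a)}) / real Q ^ ?M"
    by (intro divide_right_mono of_nat_mono card_bad_orderings_le) simp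
  also have "\<dots> = ex (\<lambda>l. of_bool (\<forall>a\<in>paths. \<not> inc (lab l a)))"
    unfolding ex_def using finite_labels by (simp add: of_bool_def sum.If_cases Int_def)
  finally show ?thesis .
qed

end

section \<open>The limit\<close>

context labelling begin

lemma perr_le:
  assumes K: "4 * K + 2 \<le> n" and hQ: "h \<le> Q"
  shows "perr h K \<le> 4 ^ K * (2 * (72 * (4 * real K + 1) ^ 2 * (1 / real n) + 8 * real K ^ 2 * exp (- (real h / real Q * (real n / 2))))
    + 32 * real K ^ 2 * (1 / real n) + (2 * real K + 5) * 2 * (1 / real n) + real n ^ 2 / real Q)"
proof -
  define M where "M = m - 2 * K"
  have np: "0 < real n" and Qp: "0 < real Q" using n2 Q1 by auto
  have "n \<le> 2 * M" using K Suc_m by (simp add: M_def)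
  then have M: "real n / 2 \<le> real M" by linarith
  have "(1 - real h / real Q) ^ M \<le> exp (- (real h / real Q)) ^ M"
    using hQ Qp exp_ge_add_one_self[of "- (real h / real Q)"] by (intro power_mono) auto
  also have "\<dots> = exp (- (real h / real Q * real M))" by (simp add: exp_of_nat_mult[symmetric] mult.commute)
  also have "\<dots> \<le> exp (- (real h / real Q * (real n / 2)))"
    unfolding exp_le_cancel_iff neg_le_iff_le using M by (intro mult_left_mono) auto
  finally have e: "(1 - real h / real Q) ^ M \<le> exp (- (real h / real Q * (real n / 2)))" .
  have "(2 * real K + 5) / real M \<le> (2 * real K + 5) / (real n / 2)" using M np by (intro divide_left_mono) auto
  then have g: "(2 * real K + 5) / real M \<le> (2 * real K + 5) * 2 * (1 / real n)" by simp
  have "8 * real K ^ 2 * (1 - real h / real Q) ^ M \<le> 8 * real K ^ 2 * exp (- (real h / real Q * (real n / 2)))"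
    using e by (rule mult_left_mono) simp
  then show ?thesis unfolding perr_def M_def[symmetric] using g by (intro mult_left_mono) auto
qed

text \<open>This is \<open>no_good_path_bound\<close> at \<open>d = \<delta> * n\<close>, divided by
  \<open>n\<close> and regrouped into quotients with known limits, so that the limit can be taken
  term by term.\<close>

lemma failure_bound:
  assumes K: "8 * K \<le> n" "16 * (2 * K + 1) ^ 2 \<le> n" "4 * (K + K2) \<le> n" "4 * K + 2 \<le> n"
    and hQ: "h \<le> Q" and Q: "2 * n ^ 2 \<le> Q" and d: "0 < \<delta>" and n3: "3 \<le> n" and G: "1 \<le> G"
    and pos: "0 \<le> 1 - defect h G"
  shows "failure * (1 - real n ^ 4 / real Q) * (1 - (real n ^ 2 / real Q + (8 * real h + 8) * real n ^ 2 / (real Q * real G ^ 2)))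
    \<le> 2 * \<delta> + overlap_tail n K / real n ^ 2 / \<delta> + (weight_bound K / \<delta>) ^ 2 *
      ((1 + 2 * crude (2 * K)) * (overlap_tail n K2 / real n ^ 2)
       + (4 ^ K * (2 * (72 * (4 * real K + 1) ^ 2 * (1 / real n) + 8 * real K ^ 2 * exp (- (real h / real Q * (real n / 2))))
           + 32 * real K ^ 2 * (1 / real n) + (2 * real K + 5) * 2 * (1 / real n) + real n ^ 2 / real Q) * pat_C0 K ^ 2
          + 2 * 4 ^ K * ((real G / real n + 10 * (1 / real n)) * pat_C1 K ^ 2 + 2 * real K2 * (1 / real n) * pat_C1 K * pat_C0 K
             + 2 * (real G / real n) * pat_C2 K * pat_C0 K)) * (1 + 2 * crude K2)
       + crude (K + K2) * (8 * real K) * (1 + 2 * crude K) * (1 / real n))"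
proof -
  have np: "0 < real n" and Qp: "0 < real Q" using n2 Q1 by auto
  let ?p = "ex (\<lambda>l. of_bool (\<forall>a\<in>paths. \<not> inc (lab l a)))"
  let ?M = "card (K_edges n)"
  have Mn: "?M \<le> n ^ 2"
    using n2 by (simp add: card_K_edges choose_two power2_eq_square le_div_geq) (meson diff_le_self div_le_dividend le_trans mult_le_mono2)
  have "?M \<le> Q" using Mn Q by linarith
  have "failure * (1 - real n ^ 4 / real Q) \<le> failure * (1 - real ?M ^ 2 / real Q)"
  proof (rule mult_left_mono)
    have "real ?M ^ 2 \<le> (real n ^ 2) ^ 2" using Mn by (intro power_mono) (metis of_nat_le_iff of_nat_power, simp)
    then have "real ?M ^ 2 / real Q \<le> real n ^ 4 / real Q" using Qp by (intro divide_right_mono) auto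
    then show "1 - real n ^ 4 / real Q \<le> 1 - real ?M ^ 2 / real Q" by linarith
  qed simp
  also have "\<dots> \<le> ?p" by (rule failure_le[OF \<open>?M \<le> Q\<close>])
  finally have fp: "failure * (1 - real n ^ 4 / real Q) \<le> ?p" .
  have pe: "perr h K \<ge> 0"
    using hQ Qp unfolding perr_def by (intro mult_nonneg_nonneg add_nonneg_nonneg divide_nonneg_nonneg zero_le_power) auto
  define pb where "pb = 4 ^ K * (2 * (72 * (4 * real K + 1) ^ 2 * (1 / real n) + 8 * real K ^ 2 * exp (- (real h / real Q * (real n / 2))))
    + 32 * real K ^ 2 * (1 / real n) + (2 * real K + 5) * 2 * (1 / real n) + real n ^ 2 / real Q)"
  define gb where "gb = 2 * 4 ^ K * ((real G / real n + 10 * (1 / real n)) * pat_C1 K ^ 2 + 2 * real K2 * (1 / real n) * pat_C1 K * pat_C0 K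
             + 2 * (real G / real n) * pat_C2 K * pat_C0 K)"
  have phi0: "0 \<le> phi_err h G K K2" unfolding phi_err_def using pe pat_C_nonneg[of K]
    by (intro add_nonneg_nonneg mult_nonneg_nonneg) auto
  have phi: "\<bar>phi_err h G K K2\<bar> / real n \<le> pb * pat_C0 K ^ 2 + gb"
  proof -
    have "phi_err h G K K2 / real n = perr h K * pat_C0 K ^ 2 + gb"
      unfolding phi_err_def gb_def using np by (simp add: field_simps)
    moreover have "perr h K * pat_C0 K ^ 2 \<le> pb * pat_C0 K ^ 2"
      unfolding pb_def by (intro mult_right_mono perr_le K(4) hQ) auto
    ultimately show ?thesis using phi0 by simp
  qed
  have V: "V_err h G K K2 / real n ^ 3 \<le> weight_bound K ^ 2 * ((1 + 2 * crude (2 * K)) * (overlap_tail n K2 / real n ^ 2)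
      + (pb * pat_C0 K ^ 2 + gb) * (1 + 2 * crude K2) + crude (K + K2) * (8 * real K) * (1 + 2 * crude K) * (1 / real n))"
  proof -
    have "V_err h G K K2 / real n ^ 3 = weight_bound K ^ 2 * ((1 + 2 * crude (2 * K)) * (overlap_tail n K2 / real n ^ 2)
      + (\<bar>phi_err h G K K2\<bar> / real n) * (1 + 2 * crude K2) + crude (K + K2) * (8 * real K) * (1 + 2 * crude K) * (1 / real n))"
      unfolding V_err_def using np by (simp add: divide_simps power2_eq_square power3_eq_cube) (simp add: algebra_simps)
    also have "\<dots> \<le> weight_bound K ^ 2 * ((1 + 2 * crude (2 * K)) * (overlap_tail n K2 / real n ^ 2)
      + (pb * pat_C0 K ^ 2 + gb) * (1 + 2 * crude K2) + crude (K + K2) * (8 * real K) * (1 + 2 * crude K) * (1 / real n))"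
      using crude_nonneg[of K2] by (intro mult_left_mono add_right_mono add_left_mono mult_right_mono phi) auto
    finally show ?thesis .
  qed
  have dn: "0 < \<delta> * real n" using d np by simp
  have "?p * (real n * (1 - defect h G)) \<le> 2 * (\<delta> * real n) + overlap_tail n K / (\<delta> * real n) + V_err h G K K2 / (\<delta> * real n) ^ 2"
    by (rule no_good_path_bound[OF K(1-3) hQ Q dn n3 G])
  then have "?p * (real n * (1 - defect h G)) / real n \<le> (2 * (\<delta> * real n) + overlap_tail n K / (\<delta> * real n) + V_err h G K K2 / (\<delta> * real n) ^ 2) / real n"
    using np by (intro divide_right_mono) auto
  moreover have "?p * (real n * (1 - defect h G)) / real n = ?p * (1 - defect h G)" using np by simp
  moreover have "(2 * (\<delta> * real n) + overlap_tail n K / (\<delta> * real n) + V_err h G K K2 / (\<delta> * real n) ^ 2) / real n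
    = 2 * \<delta> + overlap_tail n K / real n ^ 2 / \<delta> + (1 / \<delta>) ^ 2 * (V_err h G K K2 / real n ^ 3)"
    using np d by (simp add: add_divide_distrib power2_eq_square power3_eq_cube mult_ac)
  ultimately have "?p * (1 - defect h G) \<le> 2 * \<delta> + overlap_tail n K / real n ^ 2 / \<delta> + (1 / \<delta>) ^ 2 * (V_err h G K K2 / real n ^ 3)"
    by linarith
  also have "\<dots> \<le> 2 * \<delta> + overlap_tail n K / real n ^ 2 / \<delta> + (1 / \<delta>) ^ 2 * (weight_bound K ^ 2 * ((1 + 2 * crude (2 * K)) * (overlap_tail n K2 / real n ^ 2)
      + (pb * pat_C0 K ^ 2 + gb) * (1 + 2 * crude K2) + crude (K + K2) * (8 * real K) * (1 + 2 * crude K) * (1 / real n)))"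
    by (intro add_left_mono mult_left_mono V) auto
  finally have "?p * (1 - defect h G) \<le> 2 * \<delta> + overlap_tail n K / real n ^ 2 / \<delta> + (weight_bound K / \<delta>) ^ 2 * ((1 + 2 * crude (2 * K)) * (overlap_tail n K2 / real n ^ 2)
      + (pb * pat_C0 K ^ 2 + gb) * (1 + 2 * crude K2) + crude (K + K2) * (8 * real K) * (1 + 2 * crude K) * (1 / real n))"
    by (simp only: power_divide power_one mult.assoc[symmetric] times_divide_eq_left mult_1)
  moreover have "failure * (1 - real n ^ 4 / real Q) * (1 - defect h G) \<le> ?p * (1 - defect h G)"
    using fp pos by (rule mult_right_mono)
  ultimately show ?thesis unfolding defect_def[symmetric] pb_def gb_def by linarith
qed

end

lemma overlap_tail_lim: "(\<lambda>n. overlap_tail n K / real n ^ 2) \<longlonglongrightarrow> 606 * exp 404 * tail_rate ^ K"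
proof (rule Lim_transform_eventually)
  have "(\<lambda>n. 606 * exp 404 * tail_rate ^ K + 12 * exp 1 * exp 36 * (1 / real n)) \<longlonglongrightarrow> 606 * exp 404 * tail_rate ^ K + 12 * exp 1 * exp 36 * 0"
    by (intro tendsto_intros lim_const_over_n)
  then show "(\<lambda>n. 606 * exp 404 * tail_rate ^ K + 12 * exp 1 * exp 36 * (1 / real n)) \<longlonglongrightarrow> 606 * exp 404 * tail_rate ^ K" by simp
  show "\<forall>\<^sub>F n in sequentially. 606 * exp 404 * tail_rate ^ K + 12 * exp 1 * exp 36 * (1 / real n) = overlap_tail n K / real n ^ 2"
    using eventually_gt_at_top[of 0] by eventually_elim (simp add: overlap_tail_def field_simps power2_eq_square)
qed

lemma tail_rate_small: "0 < e \<Longrightarrow> \<exists>K. C * tail_rate ^ K \<le> (e :: real)"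
proof -
  assume e: "0 < e"
  have "(\<lambda>K. C * tail_rate ^ K) \<longlonglongrightarrow> C * 0" using tail_rate by (intro tendsto_intros LIMSEQ_power_zero) simp
  then have "\<forall>\<^sub>F K in sequentially. C * tail_rate ^ K < e" using e by (intro order_tendstoD(2)) auto
  then show ?thesis by (auto simp: eventually_sequentially intro: less_imp_le)
qed

lemma failure_tendsto_0: "(\<lambda>n. measure_pmf.prob (random_edge_ordering n) {r. num_increasing_paths n r = 0}) \<longlonglongrightarrow> 0"
    (is "?P \<longlonglongrightarrow> 0")
proof (rule tendstoI)
  fix e :: real assume e: "0 < e"
  \<comment> \<open>\<open>n ^ 4 / Q\<close> tends to 0, so edge labels rarely coincide.
    \<open>h * n / Q\<close> is about \<open>n powr (1 / 2)\<close>, so a window of length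
    \<open>h\<close> is rarely empty. \<open>h * n ^ 2 / (Q * G ^ 2)\<close> has order
    \<open>n powr (- 1 / 4)\<close>, so bunching is rare, and still \<open>G / n\<close> tends to 0:
    the exponent of \<open>G\<close> has to lie strictly between 3/4 and 1.\<close>
  define Q h G where "Q n = n ^ 6" and "h n = nat \<lfloor>real n powr (11/2)\<rfloor>" and "G n = nat \<lceil>real n powr (7/8)\<rceil>" for n :: nat
  define \<delta> where "\<delta> = e / 20"
  have d: "0 < \<delta>" using e by (simp add: \<delta>_def)
  \<comment> \<open>The order of choices is \<open>\<delta>\<close>, then \<open>K\<close>, then
    \<open>K2\<close>: the tail beyond \<open>K\<close> is divided by \<open>\<delta>\<close>, and
    the tail beyond \<open>K2\<close> must beat the constant \<open>B\<close>, which involves both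
    \<open>K\<close> and \<open>\<delta>\<close>.\<close>
  obtain K where K: "606 * exp 404 * tail_rate ^ K \<le> \<delta> * \<delta>" using tail_rate_small[of "\<delta> * \<delta>"] d by auto
  define B where "B = (labelling.weight_bound K / \<delta>) ^ 2 * (1 + 2 * labelling.crude (2 * K))"
  obtain K2 where K2: "B * (606 * exp 404) * tail_rate ^ K2 \<le> \<delta>" using tail_rate_small[of \<delta>] d by auto
  define A where "A n = (1 - real n ^ 4 / real (Q n)) * (1 - (real n ^ 2 / real (Q n) + (8 * real (h n) + 8) * real n ^ 2 / (real (Q n) * real (G n) ^ 2)))" for n
  define U where "U n = 2 * \<delta> + overlap_tail n K / real n ^ 2 / \<delta> + (labelling.weight_bound K / \<delta>) ^ 2 *
      ((1 + 2 * labelling.crude (2 * K)) * (overlap_tail n K2 / real n ^ 2)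
       + (4 ^ K * (2 * (72 * (4 * real K + 1) ^ 2 * (1 / real n) + 8 * real K ^ 2 * exp (- (real (h n) / real (Q n) * (real n / 2))))
           + 32 * real K ^ 2 * (1 / real n) + (2 * real K + 5) * 2 * (1 / real n) + real n ^ 2 / real (Q n)) * pat_C0 K ^ 2
          + 2 * 4 ^ K * ((real (G n) / real n + 10 * (1 / real n)) * pat_C1 K ^ 2 + 2 * real K2 * (1 / real n) * pat_C1 K * pat_C0 K
             + 2 * (real (G n) / real n) * pat_C2 K * pat_C0 K)) * (1 + 2 * labelling.crude K2)
       + labelling.crude (K + K2) * (8 * real K) * (1 + 2 * labelling.crude K) * (1 / real n))" for n
  have l1: "(\<lambda>n. real n ^ 2 / real (Q n)) \<longlonglongrightarrow> 0" "(\<lambda>n. real n ^ 4 / real (Q n)) \<longlonglongrightarrow> 0"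
    unfolding Q_def of_nat_power by real_asymp+
  have l2: "(\<lambda>n. exp (- (real (h n) / real (Q n) * (real n / 2)))) \<longlonglongrightarrow> 0"
    unfolding Q_def h_def of_nat_power by real_asymp
  have l3: "(\<lambda>n. real (G n) / real n) \<longlonglongrightarrow> 0" unfolding G_def by real_asymp
  have l4: "(\<lambda>n. (8 * real (h n) + 8) * real n ^ 2 / (real (Q n) * real (G n) ^ 2)) \<longlonglongrightarrow> 0"
    unfolding Q_def h_def G_def of_nat_power by real_asymp
  have l5: "(\<lambda>n. 1 / real n) \<longlonglongrightarrow> 0" by (rule lim_const_over_n)
  have "A \<longlonglongrightarrow> (1 - 0) * (1 - (0 + 0))"
    unfolding A_def[abs_def] by (intro l1 l4 tendsto_const tendsto_mult tendsto_diff tendsto_add)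
  then have A: "A \<longlonglongrightarrow> 1" by simp
  have UL: "U \<longlonglongrightarrow> 2 * \<delta> + (606 * exp 404 * tail_rate ^ K) / \<delta> + (labelling.weight_bound K / \<delta>) ^ 2 * ((1 + 2 * labelling.crude (2 * K)) * (606 * exp 404 * tail_rate ^ K2)
    + (4 ^ K * (2 * (72 * (4 * real K + 1) ^ 2 * 0 + 8 * real K ^ 2 * 0) + 32 * real K ^ 2 * 0 + (2 * real K + 5) * 2 * 0 + 0) * pat_C0 K ^ 2
          + 2 * 4 ^ K * ((0 + 10 * 0) * pat_C1 K ^ 2 + 2 * real K2 * 0 * pat_C1 K * pat_C0 K
             + 2 * 0 * pat_C2 K * pat_C0 K)) * (1 + 2 * labelling.crude K2)
       + labelling.crude (K + K2) * (8 * real K) * (1 + 2 * labelling.crude K) * 0)" (is "_ \<longlonglongrightarrow> ?L")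
    unfolding U_def[abs_def] using d by (intro tendsto_intros l1 l2 l3 l5 overlap_tail_lim) auto
  have "?L = 2 * \<delta> + (606 * exp 404 * tail_rate ^ K) / \<delta> + B * (606 * exp 404) * tail_rate ^ K2"
    unfolding B_def by (simp only: mult_zero_right mult_zero_left add_0_right mult.assoc)
  moreover have "(606 * exp 404 * tail_rate ^ K) / \<delta> \<le> \<delta>" using K d by (simp add: divide_le_eq)
  \<comment> \<open>The limit is at most \<open>2 * \<delta> + \<delta> + \<delta>\<close>. As
    \<open>A n\<close> eventually exceeds \<open>1 / 2\<close>, the probability of failure drops
    below \<open>10 * \<delta> = e / 2\<close>.\<close>
  ultimately have "?L < 5 * \<delta>" using K2 d by linarith
  then have ev: "\<forall>\<^sub>F n in sequentially. U n < 5 * \<delta>" using order_tendstoD(2)[OF UL] by blast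
  have "\<forall>\<^sub>F n in sequentially. ?P n * A n \<le> U n"
  proof -
    have "\<forall>\<^sub>F n in sequentially. real (h n) \<le> real (Q n)" unfolding Q_def h_def of_nat_power by real_asymp
    moreover have "\<forall>\<^sub>F n in sequentially. 2 * real n ^ 2 \<le> real (Q n)" unfolding Q_def of_nat_power by real_asymp
    moreover have "\<forall>\<^sub>F n in sequentially. 1 \<le> real (G n)" unfolding G_def by real_asymp
    moreover have "\<forall>\<^sub>F n in sequentially. real n ^ 2 / real (Q n) + (8 * real (h n) + 8) * real n ^ 2 / (real (Q n) * real (G n) ^ 2) < 1"
      using order_tendstoD(2)[OF tendsto_add[OF l1(1) l4]] by simp
    moreover have "\<forall>\<^sub>F n in sequentially. n \<ge> 16 * (2 * K + 1) ^ 2 + 8 * K + 4 * (K + K2) + 3" by (rule eventually_ge_at_top)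
    ultimately show ?thesis
    proof eventually_elim
      case (elim n)
      have n: "2 \<le> n" "3 \<le> n" "1 \<le> Q n" "8 * K \<le> n" "16 * (2 * K + 1) ^ 2 \<le> n" "4 * (K + K2) \<le> n" "4 * K + 2 \<le> n"
        using elim(5) by (simp_all add: Q_def)
      have N: "h n \<le> Q n" "1 \<le> G n" using elim(1,3) by simp_all
      have N2: "2 * n ^ 2 \<le> Q n" using elim(2) by (metis of_nat_le_iff of_nat_mult of_nat_numeral of_nat_power)
      interpret labelling n "Q n" using n by unfold_locales
      have "0 \<le> 1 - defect (h n) (G n)" using elim(4) by (simp add: defect_def)
      then show ?case
        using failure_bound[OF n(4-7) N(1) N2 d n(2) N(2)] unfolding A_def U_def by (simp only: mult.assoc)
    qed
  qed
  moreover have "\<forall>\<^sub>F n in sequentially. 1 / 2 < A n" using order_tendstoD(1)[OF A, of "1/2"] by simp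
  ultimately show "\<forall>\<^sub>F n in sequentially. dist (?P n) 0 < e"
    using ev
  proof eventually_elim
    case (elim n)
    have "?P n * (1 / 2) \<le> ?P n * A n" using elim(2) by (intro mult_left_mono) auto
    then have "?P n < e" using elim(1,3) d by (simp add: \<delta>_def)
    then show ?case by simp
  qed
qed

theorem theorem1p1:
  shows "(\<lambda>n. measure_pmf.prob (random_edge_ordering n) {r. num_increasing_paths n r > 0})
           \<longlonglongrightarrow> 1"
proof -
  have "measure_pmf.prob (random_edge_ordering n) {r. num_increasing_paths n r > 0}
    = 1 - measure_pmf.prob (random_edge_ordering n) {r. num_increasing_paths n r = 0}" for n
  proof -
    have "{r. num_increasing_paths n r > 0} = space (measure_pmf (random_edge_ordering n)) - {r. num_increasing_paths n r = 0}" by auto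
    then show ?thesis by (simp only: measure_pmf.prob_compl sets_measure_pmf UNIV_I)
  qed
  then show ?thesis using tendsto_diff[OF tendsto_const[of 1] failure_tendsto_0] by simp
qed

end
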